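(* Let $\mathcal{C}$ be a coalgebra with a group-like element $e$, and let $\mathcal{B}\subseteq\mathcal{A}$ and $\mathcal{B}'\subseteq\mathcal{A}'$ be $e$-coaugmented $\mathcal{C}$-Galois extensions with bijective canonical entwinings. Assume that $\mathcal{A}'$ is faithfully flat as a left and as a right $\mathcal{B}'$-module, and that the coalgebra $\mathcal{C}$ is cosemisimple. Then every $\mathcal{C}$-equivariant (right $\mathcal{C}$-colinear) algebra map $f\colon\mathcal{A}\to\mathcal{A}'$ restricts and corestricts to an algebra homomorphism $\mathcal{B}\to\mathcal{B}'$, and induces an isomorphism of $\mathcal{B}'$-bimodules $$\mathcal{B}'\otimes_{\mathcal{B}}(\mathcal{A}\,\Box^{\mathcal{C}}\mathcal{A})\otimes_{\mathcal{B}}\mathcal{B}'\cong\mathcal{A}'\,\Box^{\mathcal{C}}\mathcal{A}'.$$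
   Context: Algebras, coalgebras and vector spaces are over $\mathbb{C}$; algebras and algebra homomorphisms are unital; unadorned $\otimes$ is over $\mathbb{C}$. For a right $\mathcal{C}$-comodule $(M,\delta_M)$ and a left $\mathcal{C}$-comodule $(N,{}_N\delta)$, the cotensor product is $M\,\Box^{\mathcal{C}}N:=\ker(\delta_M\otimes\mathrm{id}-\mathrm{id}\otimes{}_N\delta)\subseteq M\otimes N$. $e$-coaugmented $\mathcal{C}$-Galois extension: let $e\in\mathcal{C}$ be group-like, and let $\mathcal{A}$ be an algebra and a right $\mathcal{C}$-comodule via $\delta_{\mathcal{A}}\colon\mathcal{A}\to\mathcal{A}\otimes\mathcal{C}$ (not assumed to be an algebra map) with $\delta_{\mathcal{A}}(1)=1\otimes e$. Put $\mathcal{B}:=\{b\in\mathcal{A}\mid\forall a\in\mathcal{A}:\ \delta_{\mathcal{A}}(ba)=b\,\delta_{\mathcal{A}}(a)\}$ (coaction-invariant subalgebra). The inclusion $\mathcal{B}\subseteq\mathcal{A}$ is an $e$-coaugmented $\mathcal{C}$-Galois extension if the canonical map $can\colon\mathcal{A}\otimes_{\mathcal{B}}\mathcal{A}\to\mathcal{A}\otimes\mathcal{C}$, $a\otimes a'\mapsto a\,\delta_{\mathcal{A}}(a')$, is bijective. Its canonical entwining is $\psi\colon\mathcal{C}\otimes\mathcal{A}\to\mathcal{A}\otimes\mathcal{C}$, $c\otimes a\mapsto can(can^{-1}(1\otimes c)a)$. When $\psi$ is bijective, $\mathcal{A}$ is also a left $\mathcal{C}$-comodule via ${}_{\mathcal{A}}\delta(a):=\psi^{-1}(a\otimes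 e)\in\mathcal{C}\otimes\mathcal{A}$. The right coaction $\delta_{\mathcal{A}}$ is left $\mathcal{B}$-linear and the left coaction ${}_{\mathcal{A}}\delta$ is right $\mathcal{B}$-linear, so that $\mathcal{A}\,\Box^{\mathcal{C}}\mathcal{A}$ (with the first $\mathcal{A}$ viewed as a right comodule via $\delta_{\mathcal{A}}$ and the second as a left comodule via ${}_{\mathcal{A}}\delta$) is a $\mathcal{B}$-bimodule by left multiplication on the first factor and right multiplication on the second; similarly for $\mathcal{A}'$. $\mathcal{B}'$ is viewed as a $(\mathcal{B}'-\mathcal{B})$-bimodule and as a $(\mathcal{B}-\mathcal{B}')$-bimodule through the restriction $f|_{\mathcal{B}}\colon\mathcal{B}\to\mathcal{B}'$. *)

theory Defs
  imports Complex_Main "HOL-Algebra.Algebra" "HOL-Algebra.Algebraic_Closure_Type"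
begin

section \<open>Bimodules\<close>

text \<open>
  The fields \<open>mult\<close> and \<open>one\<close> inherited from \<^typ>\<open>'m ring\<close> are never used for a bimodule (as for
  the library's record of modules); the acting rings are passed separately.  A one-sided module is
  a bimodule record whose other action is ignored.
\<close>

record ('l, 'm, 'r) bimodule = "'m ring" +
  lact :: "'l \<Rightarrow> 'm \<Rightarrow> 'm"
  ract :: "'m \<Rightarrow> 'r \<Rightarrow> 'm"

definition with_actions ::
  "('m, 'x) ring_scheme \<Rightarrow> ('l \<Rightarrow> 'm \<Rightarrow> 'm) \<Rightarrow> ('m \<Rightarrow> 'r \<Rightarrow> 'm) \<Rightarrow> ('l, 'm, 'r) bimodule" where
  "with_actions M l r =
     \<lparr>carrier = carrier M, monoid.mult = undefined, one = undefined, ring.zero = ring.zero M, add = add M,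
      lact = l, ract = r\<rparr>"

definition left_module :: "('l, 'x) ring_scheme \<Rightarrow> ('l, 'm, 'r) bimodule \<Rightarrow> bool" where
  "left_module R M \<longleftrightarrow> ring R \<and> abelian_group M \<and>
     (\<forall>r\<in>carrier R. \<forall>m\<in>carrier M. lact M r m \<in> carrier M) \<and>
     (\<forall>r\<in>carrier R. \<forall>m\<in>carrier M. \<forall>n\<in>carrier M.
        lact M r (m \<oplus>\<^bsub>M\<^esub> n) = lact M r m \<oplus>\<^bsub>M\<^esub> lact M r n) \<and>
     (\<forall>r\<in>carrier R. \<forall>s\<in>carrier R. \<forall>m\<in>carrier M.
        lact M (r \<oplus>\<^bsub>R\<^esub> s) m = lact M r m \<oplus>\<^bsub>M\<^esub> lact M s m) \<and>
     (\<forall>r\<in>carrier R. \<forall>s\<in>carrier R. \<forall>m\<in>carrier M.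
        lact M (r \<otimes>\<^bsub>R\<^esub> s) m = lact M r (lact M s m)) \<and>
     (\<forall>m\<in>carrier M. lact M \<one>\<^bsub>R\<^esub> m = m)"

definition right_module :: "('r, 'x) ring_scheme \<Rightarrow> ('l, 'm, 'r) bimodule \<Rightarrow> bool" where
  "right_module R M \<longleftrightarrow> ring R \<and> abelian_group M \<and>
     (\<forall>r\<in>carrier R. \<forall>m\<in>carrier M. ract M m r \<in> carrier M) \<and>
     (\<forall>r\<in>carrier R. \<forall>m\<in>carrier M. \<forall>n\<in>carrier M.
        ract M (m \<oplus>\<^bsub>M\<^esub> n) r = ract M m r \<oplus>\<^bsub>M\<^esub> ract M n r) \<and>
     (\<forall>r\<in>carrier R. \<forall>s\<in>carrier R. \<forall>m\<in>carrier M.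
        ract M m (r \<oplus>\<^bsub>R\<^esub> s) = ract M m r \<oplus>\<^bsub>M\<^esub> ract M m s) \<and>
     (\<forall>r\<in>carrier R. \<forall>s\<in>carrier R. \<forall>m\<in>carrier M.
        ract M m (r \<otimes>\<^bsub>R\<^esub> s) = ract M (ract M m r) s) \<and>
     (\<forall>m\<in>carrier M. ract M m \<one>\<^bsub>R\<^esub> = m)"

definition additive_maps :: "('m, 'x) ring_scheme \<Rightarrow> ('n, 'y) ring_scheme \<Rightarrow> ('m \<Rightarrow> 'n) set" where
  "additive_maps M N = hom (add_monoid M) (add_monoid N)"

definition left_linear ::
  "('l, 'x) ring_scheme \<Rightarrow> ('l, 'm, 'r) bimodule \<Rightarrow> ('l, 'n, 's) bimodule \<Rightarrow> ('m \<Rightarrow> 'n) set" where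
  "left_linear R M N =
     {h \<in> additive_maps M N. \<forall>r\<in>carrier R. \<forall>m\<in>carrier M. h (lact M r m) = lact N r (h m)}"

definition right_linear ::
  "('r, 'x) ring_scheme \<Rightarrow> ('l, 'm, 'r) bimodule \<Rightarrow> ('k, 'n, 'r) bimodule \<Rightarrow> ('m \<Rightarrow> 'n) set" where
  "right_linear R M N =
     {h \<in> additive_maps M N. \<forall>r\<in>carrier R. \<forall>m\<in>carrier M. h (ract M m r) = ract N (h m) r}"

definition bimodule_iso ::
  "('l, 'x) ring_scheme \<Rightarrow> ('r, 'y) ring_scheme \<Rightarrow> ('l, 'm, 'r) bimodule \<Rightarrow> ('l, 'n, 'r) bimodule
     \<Rightarrow> ('m \<Rightarrow> 'n) set" where
  "bimodule_iso R S M N =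
     {h \<in> left_linear R M N \<inter> right_linear S M N. bij_betw h (carrier M) (carrier N)}"


section \<open>Tensor products over a (noncommutative) ring\<close>

text \<open>
  \<open>M \<otimes>\<^sub>R N\<close> is the free abelian group on \<open>M \<times> N\<close> modulo the biadditivity relations and
  \<open>(m r, n) = (m, r n)\<close>.  It uses the right action on \<open>M\<close> and the left action on \<open>N\<close> only; the other
  two actions are passed on to the tensor product.
\<close>

type_synonym ('m, 'n) tens = "('m \<times> 'n \<Rightarrow>\<^sub>0 int) set"

definition tensor_relations ::
  "('r, 'x) ring_scheme \<Rightarrow> ('l, 'm, 'r) bimodule \<Rightarrow> ('r, 'n, 's) bimodule
     \<Rightarrow> ('m \<times> 'n \<Rightarrow>\<^sub>0 int) set" where
  "tensor_relations R M N =
     {frag_of (m \<oplus>\<^bsub>M\<^esub> m', n) - frag_of (m, n) - frag_of (m', n) | m m' n.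
        m \<in> carrier M \<and> m' \<in> carrier M \<and> n \<in> carrier N} \<union>
     {frag_of (m, n \<oplus>\<^bsub>N\<^esub> n') - frag_of (m, n) - frag_of (m, n') | m n n'.
        m \<in> carrier M \<and> n \<in> carrier N \<and> n' \<in> carrier N} \<union>
     {frag_of (ract M m r, n) - frag_of (m, lact N r n) | m r n.
        m \<in> carrier M \<and> r \<in> carrier R \<and> n \<in> carrier N}"

definition tensor_null ::
  "('r, 'x) ring_scheme \<Rightarrow> ('l, 'm, 'r) bimodule \<Rightarrow> ('r, 'n, 's) bimodule \<Rightarrow> ('m, 'n) tens" where
  "tensor_null R M N =
     generate (free_Abelian_group (carrier M \<times> carrier N)) (tensor_relations R M N)"

definition tensor_group ::
  "('r, 'x) ring_scheme \<Rightarrow> ('l, 'm, 'r) bimodule \<Rightarrow> ('r, 'n, 's) bimodule \<Rightarrow> ('m, 'n) tens ring" where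
  "tensor_group R M N =
     (let Q = free_Abelian_group (carrier M \<times> carrier N) Mod tensor_null R M N
      in \<lparr>carrier = carrier Q, monoid.mult = undefined, one = undefined,
          ring.zero = one Q, add = monoid.mult Q\<rparr>)"

definition pure_tensor ::
  "('r, 'x) ring_scheme \<Rightarrow> ('l, 'm, 'r) bimodule \<Rightarrow> ('r, 'n, 's) bimodule \<Rightarrow> 'm \<Rightarrow> 'n
     \<Rightarrow> ('m, 'n) tens" where
  "pure_tensor R M N m n =
     tensor_null R M N #>\<^bsub>free_Abelian_group (carrier M \<times> carrier N)\<^esub> frag_of (m, n)"

text \<open>
  \<open>tensor_lift G \<beta>\<close> is the additive map \<open>m \<otimes> n \<mapsto> \<beta> m n\<close> into \<open>G\<close> given by the universal property;
  for balanced biadditive \<open>\<beta>\<close> the value does not depend on the chosen representative.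
\<close>

definition tensor_lift ::
  "('g, 'x) ring_scheme \<Rightarrow> ('m \<Rightarrow> 'n \<Rightarrow> 'g) \<Rightarrow> ('m, 'n) tens \<Rightarrow> 'g" where
  "tensor_lift G \<beta> t =
     (let x = (SOME x. x \<in> t)
      in \<Oplus>\<^bsub>G\<^esub>p\<in>Poly_Mapping.keys x.
           [Poly_Mapping.lookup x p] \<cdot>\<^bsub>G\<^esub> \<beta> (fst p) (snd p))"

definition tensor ::
  "('r, 'x) ring_scheme \<Rightarrow> ('l, 'm, 'r) bimodule \<Rightarrow> ('r, 'n, 's) bimodule
     \<Rightarrow> ('l, ('m, 'n) tens, 's) bimodule" where
  "tensor R M N =
     with_actions (tensor_group R M N)
       (\<lambda>l. tensor_lift (tensor_group R M N) (\<lambda>m n. pure_tensor R M N (lact M l m) n))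
       (\<lambda>t s. tensor_lift (tensor_group R M N) (\<lambda>m n. pure_tensor R M N m (ract N n s)) t)"

text \<open>\<open>tensor_map R M N g h\<close> is \<open>g \<otimes> h\<close>, where \<open>M\<close> and \<open>N\<close> are the \<^emph>\<open>codomains\<close> of \<open>g\<close> and \<open>h\<close>.\<close>

definition tensor_map ::
  "('r, 'x) ring_scheme \<Rightarrow> ('l, 'm, 'r) bimodule \<Rightarrow> ('r, 'n, 's) bimodule
     \<Rightarrow> ('m0 \<Rightarrow> 'm) \<Rightarrow> ('n0 \<Rightarrow> 'n) \<Rightarrow> ('m0, 'n0) tens \<Rightarrow> ('m, 'n) tens" where
  "tensor_map R M N g h =
     tensor_lift (tensor R M N) (\<lambda>m n. pure_tensor R M N (g m) (h n))"

text \<open>The canonical map \<open>(M \<otimes>\<^sub>R N) \<otimes>\<^sub>S P \<rightarrow> M \<otimes>\<^sub>R (N \<otimes>\<^sub>S P)\<close>.\<close>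

definition tensor_assoc ::
  "('r, 'x) ring_scheme \<Rightarrow> ('s, 'y) ring_scheme \<Rightarrow> ('l, 'm, 'r) bimodule \<Rightarrow> ('r, 'n, 's) bimodule
     \<Rightarrow> ('s, 'p, 't) bimodule \<Rightarrow> (('m, 'n) tens, 'p) tens \<Rightarrow> ('m, ('n, 'p) tens) tens" where
  "tensor_assoc R S M N P =
     tensor_lift (tensor R M (tensor S N P))
       (\<lambda>t p. tensor_lift (tensor R M (tensor S N P))
          (\<lambda>m n. pure_tensor R M (tensor S N P) m (pure_tensor S N P n p)) t)"


section \<open>Faithful flatness\<close>

definition exact_at ::
  "('m1, 'x) ring_scheme \<Rightarrow> ('m1 \<Rightarrow> 'm2) \<Rightarrow> ('m2, 'y) ring_scheme \<Rightarrow> ('m2 \<Rightarrow> 'm3)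
     \<Rightarrow> ('m3, 'z) ring_scheme \<Rightarrow> bool" where
  "exact_at M1 u M2 v M3 \<longleftrightarrow> u ` carrier M1 = {m \<in> carrier M2. v m = \<zero>\<^bsub>M3\<^esub>}"

text \<open>
  A module is faithfully flat if a sequence \<open>N1 \<rightarrow> N2 \<rightarrow> N3\<close> is exact if and only if the tensored
  sequence is.  HOL cannot quantify over all modules of all types, so the test modules range over
  the modules whose carrier is a set of elements of a type \<open>'t\<close> given as an argument (with
  arbitrary operations; their unused other action has the type \<^typ>\<open>unit\<close>).  Flatness is detected
  by the inclusions of finitely generated one-sided ideals into the ring, and faithfulness by cyclic
  modules.  Hence, if \<open>'t\<close> is infinite and at least as large as the ring, the notion does not depend
  on \<open>'t\<close> and is the usual one; for a too small \<open>'t\<close> it would be too weak.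
\<close>

definition faithfully_flat_left ::
  "'t itself \<Rightarrow> ('r, 'x) ring_scheme \<Rightarrow> ('r, 'm, 's) bimodule \<Rightarrow> bool" where
  "faithfully_flat_left T R M \<longleftrightarrow> left_module R M \<and>
     (\<forall>(N1 :: (unit, 't, 'r) bimodule) (N2 :: (unit, 't, 'r) bimodule)
        (N3 :: (unit, 't, 'r) bimodule). \<forall>u v.
        right_module R N1 \<and> right_module R N2 \<and> right_module R N3 \<and>
        u \<in> right_linear R N1 N2 \<and> v \<in> right_linear R N2 N3 \<longrightarrow>
        (exact_at N1 u N2 v N3 \<longleftrightarrow>
         exact_at (tensor R N1 M) (tensor_map R N2 M u (\<lambda>m. m))
           (tensor R N2 M) (tensor_map R N3 M v (\<lambda>m. m)) (tensor R N3 M)))"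

definition faithfully_flat_right ::
  "'t itself \<Rightarrow> ('r, 'x) ring_scheme \<Rightarrow> ('l, 'm, 'r) bimodule \<Rightarrow> bool" where
  "faithfully_flat_right T R M \<longleftrightarrow> right_module R M \<and>
     (\<forall>(N1 :: ('r, 't, unit) bimodule) (N2 :: ('r, 't, unit) bimodule)
        (N3 :: ('r, 't, unit) bimodule). \<forall>u v.
        left_module R N1 \<and> left_module R N2 \<and> left_module R N3 \<and>
        u \<in> left_linear R N1 N2 \<and> v \<in> left_linear R N2 N3 \<longrightarrow>
        (exact_at N1 u N2 v N3 \<longleftrightarrow>
         exact_at (tensor R M N1) (tensor_map R M N2 (\<lambda>m. m) u)
           (tensor R M N2) (tensor_map R M N3 (\<lambda>m. m) v) (tensor R M N3)))"


section \<open>Algebras\<close>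

abbreviation cplx :: "complex ring" where
  "cplx \<equiv> ring_of_type_algebra"

text \<open>The library's locale of algebras is restricted to commutative ones.\<close>

locale assoc_algebra = module cplx A + ring A for A (structure) +
  assumes smult_mult_left: "\<lbrakk>a \<in> carrier A; b \<in> carrier A\<rbrakk> \<Longrightarrow> (k \<odot> a) \<otimes> b = k \<odot> (a \<otimes> b)"
    and smult_mult_right: "\<lbrakk>a \<in> carrier A; b \<in> carrier A\<rbrakk> \<Longrightarrow> a \<otimes> (k \<odot> b) = k \<odot> (a \<otimes> b)"

definition algebra_hom ::
  "(complex, 'a, 'x) module_scheme \<Rightarrow> (complex, 'b, 'y) module_scheme \<Rightarrow> ('a \<Rightarrow> 'b) set" where
  "algebra_hom A A' =
     {f \<in> ring_hom A A'. \<forall>k. \<forall>a\<in>carrier A. f (k \<odot>\<^bsub>A\<^esub> a) = k \<odot>\<^bsub>A'\<^esub> f a}"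

text \<open>
  The bimodule structures used: a vector space as a \<open>(\<complex>,\<complex>)\<close>-bimodule, and a ring or algebra as
  an \<open>(A,A)\<close>-, \<open>(A,\<complex>)\<close>- or \<open>(\<complex>,A)\<close>-bimodule.  As the acting ring is a separate argument,
  \<open>regular A\<close> is also the bimodule over any subrings of \<open>A\<close>.
\<close>

definition vect :: "(complex, 'v, 'x) module_scheme \<Rightarrow> (complex, 'v, complex) bimodule" where
  "vect V = with_actions V (\<lambda>k v. k \<odot>\<^bsub>V\<^esub> v) (\<lambda>v k. k \<odot>\<^bsub>V\<^esub> v)"

definition regular :: "('a, 'x) ring_scheme \<Rightarrow> ('a, 'a, 'a) bimodule" where
  "regular A = with_actions A (monoid.mult A) (monoid.mult A)"

definition left_regular :: "(complex, 'a, 'x) module_scheme \<Rightarrow> ('a, 'a, complex) bimodule" where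
  "left_regular A = with_actions A (monoid.mult A) (\<lambda>a k. k \<odot>\<^bsub>A\<^esub> a)"

definition right_regular :: "(complex, 'a, 'x) module_scheme \<Rightarrow> (complex, 'a, 'a) bimodule" where
  "right_regular A = with_actions A (\<lambda>k a. k \<odot>\<^bsub>A\<^esub> a) (monoid.mult A)"

abbreviation ctensor (infixl \<open>\<otimes>\<^sub>\<complex>\<close> 70) where
  "M \<otimes>\<^sub>\<complex> N \<equiv> tensor cplx M N"


section \<open>Coalgebras and comodules\<close>

record 'c coalgebra = "(complex, 'c) module" +
  comult :: "'c \<Rightarrow> ('c, 'c) tens"
  counit :: "'c \<Rightarrow> complex"

definition is_coalgebra :: "'c coalgebra \<Rightarrow> bool" where
  "is_coalgebra C \<longleftrightarrow> module cplx C \<and>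
     comult C \<in> left_linear cplx (vect C) (vect C \<otimes>\<^sub>\<complex> vect C) \<and>
     counit C \<in> left_linear cplx (vect C) (regular cplx) \<and>
     (\<forall>c\<in>carrier C.
        tensor_assoc cplx cplx (vect C) (vect C) (vect C)
          (tensor_map cplx (vect C \<otimes>\<^sub>\<complex> vect C) (vect C) (comult C) (\<lambda>x. x) (comult C c)) =
        tensor_map cplx (vect C) (vect C \<otimes>\<^sub>\<complex> vect C) (\<lambda>x. x) (comult C) (comult C c)) \<and>
     (\<forall>c\<in>carrier C. tensor_lift C (\<lambda>x y. counit C x \<odot>\<^bsub>C\<^esub> y) (comult C c) = c) \<and>
     (\<forall>c\<in>carrier C. tensor_lift C (\<lambda>x y. counit C y \<odot>\<^bsub>C\<^esub> x) (comult C c) = c)"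

definition group_like :: "'c coalgebra \<Rightarrow> 'c \<Rightarrow> bool" where
  "group_like C e \<longleftrightarrow> e \<in> carrier C \<and>
     comult C e = pure_tensor cplx (vect C) (vect C) e e \<and> counit C e = 1"

text \<open>
  For a subspace \<open>D\<close>, the space \<open>D \<otimes> D\<close> is identified with its image in \<open>C \<otimes> C\<close>.
\<close>

definition subcoalgebra :: "'c set \<Rightarrow> 'c coalgebra \<Rightarrow> bool" where
  "subcoalgebra D C \<longleftrightarrow> submodule D cplx C \<and>
     comult C ` D \<subseteq>
       tensor_map cplx (vect C) (vect C) (\<lambda>x. x) (\<lambda>x. x) `
         carrier (vect (C\<lparr>carrier := D\<rparr>) \<otimes>\<^sub>\<complex> vect (C\<lparr>carrier := D\<rparr>))"

definition simple_subcoalgebra :: "'c set \<Rightarrow> 'c coalgebra \<Rightarrow> bool" where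
  "simple_subcoalgebra D C \<longleftrightarrow> subcoalgebra D C \<and> D \<noteq> {\<zero>\<^bsub>C\<^esub>} \<and>
     (\<forall>E. subcoalgebra E C \<and> E \<subseteq> D \<longrightarrow> E = {\<zero>\<^bsub>C\<^esub>} \<or> E = D)"

text \<open>
  A coalgebra is cosemisimple if it is a direct sum of simple subcoalgebras.  A family of
  components is an extensional function on the set of summands, so that it can be unique.
\<close>

definition cosemisimple :: "'c coalgebra \<Rightarrow> bool" where
  "cosemisimple C \<longleftrightarrow>
     (\<exists>\<D>. (\<forall>D\<in>\<D>. simple_subcoalgebra D C) \<and>
        (\<forall>c\<in>carrier C. \<exists>!x. x \<in> (\<Pi>\<^sub>E D\<in>\<D>. D) \<and> finite {D \<in> \<D>. x D \<noteq> \<zero>\<^bsub>C\<^esub>} \<and>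
           c = (\<Oplus>\<^bsub>C\<^esub>D\<in>{D \<in> \<D>. x D \<noteq> \<zero>\<^bsub>C\<^esub>}. x D)))"

text \<open>A \<open>\<complex>\<close>-module (possibly with a multiplication) together with a right coaction.\<close>

record ('a, 'c) comodule = "(complex, 'a) module" +
  coact :: "'a \<Rightarrow> ('a, 'c) tens"

definition right_comodule :: "'c coalgebra \<Rightarrow> ('a, 'c) comodule \<Rightarrow> bool" where
  "right_comodule C M \<longleftrightarrow> module cplx M \<and>
     coact M \<in> left_linear cplx (vect M) (vect M \<otimes>\<^sub>\<complex> vect C) \<and>
     (\<forall>m\<in>carrier M.
        tensor_assoc cplx cplx (vect M) (vect C) (vect C)
          (tensor_map cplx (vect M \<otimes>\<^sub>\<complex> vect C) (vect C) (coact M) (\<lambda>x. x) (coact M m)) =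
        tensor_map cplx (vect M) (vect C \<otimes>\<^sub>\<complex> vect C) (\<lambda>x. x) (comult C) (coact M m)) \<and>
     (\<forall>m\<in>carrier M. tensor_lift M (\<lambda>x c. counit C c \<odot>\<^bsub>M\<^esub> x) (coact M m) = m)"

definition colinear ::
  "'c coalgebra \<Rightarrow> ('a, 'c) comodule \<Rightarrow> ('b, 'c) comodule \<Rightarrow> ('a \<Rightarrow> 'b) \<Rightarrow> bool" where
  "colinear C M N f \<longleftrightarrow>
     (\<forall>m\<in>carrier M. coact N (f m) = tensor_map cplx (vect N) (vect C) f (\<lambda>c. c) (coact M m))"


section \<open>Coaugmented coalgebra-Galois extensions\<close>

text \<open>The coaction-invariant subalgebra \<open>\<B>\<close>; here \<open>left_regular A \<otimes>\<^sub>\<complex> vect C\<close> is \<open>\<A> \<otimes> \<C>\<close>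
  with left multiplication on \<open>\<A>\<close>.\<close>

definition coinvariants :: "'c coalgebra \<Rightarrow> ('a, 'c) comodule \<Rightarrow> 'a set" where
  "coinvariants C A =
     {b \<in> carrier A. \<forall>a\<in>carrier A.
        coact A (b \<otimes>\<^bsub>A\<^esub> a) = lact (left_regular A \<otimes>\<^sub>\<complex> vect C) b (coact A a)}"

abbreviation coinv_algebra :: "'c coalgebra \<Rightarrow> ('a, 'c) comodule \<Rightarrow> ('a, 'c) comodule" where
  "coinv_algebra C A \<equiv> A\<lparr>carrier := coinvariants C A\<rparr>"

abbreviation tensor_coinv ::
  "'c coalgebra \<Rightarrow> ('a, 'c) comodule \<Rightarrow> ('a, ('a, 'a) tens, 'a) bimodule" where
  "tensor_coinv C A \<equiv> tensor (coinv_algebra C A) (regular A) (regular A)"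

definition can :: "'c coalgebra \<Rightarrow> ('a, 'c) comodule \<Rightarrow> ('a, 'a) tens \<Rightarrow> ('a, 'c) tens" where
  "can C A =
     tensor_lift (left_regular A \<otimes>\<^sub>\<complex> vect C)
       (\<lambda>a a'. lact (left_regular A \<otimes>\<^sub>\<complex> vect C) a (coact A a'))"

definition coaugmented_Galois_extension ::
  "'c coalgebra \<Rightarrow> 'c \<Rightarrow> ('a, 'c) comodule \<Rightarrow> bool" where
  "coaugmented_Galois_extension C e A \<longleftrightarrow>
     assoc_algebra A \<and> right_comodule C A \<and>
     coact A \<one>\<^bsub>A\<^esub> = pure_tensor cplx (vect A) (vect C) \<one>\<^bsub>A\<^esub> e \<and>
     bij_betw (can C A) (carrier (tensor_coinv C A)) (carrier (vect A \<otimes>\<^sub>\<complex> vect C))"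

definition canonical_entwining ::
  "'c coalgebra \<Rightarrow> ('a, 'c) comodule \<Rightarrow> ('c, 'a) tens \<Rightarrow> ('a, 'c) tens" where
  "canonical_entwining C A =
     tensor_lift (vect A \<otimes>\<^sub>\<complex> vect C)
       (\<lambda>c a. can C A
          (ract (tensor_coinv C A)
             (inv_into (carrier (tensor_coinv C A)) (can C A)
                (pure_tensor cplx (vect A) (vect C) \<one>\<^bsub>A\<^esub> c)) a))"

definition bijective_entwining :: "'c coalgebra \<Rightarrow> ('a, 'c) comodule \<Rightarrow> bool" where
  "bijective_entwining C A \<longleftrightarrow>
     bij_betw (canonical_entwining C A)
       (carrier (vect C \<otimes>\<^sub>\<complex> vect A)) (carrier (vect A \<otimes>\<^sub>\<complex> vect C))"

definition left_coact ::
  "'c coalgebra \<Rightarrow> 'c \<Rightarrow> ('a, 'c) comodule \<Rightarrow> 'a \<Rightarrow> ('c, 'a) tens" where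
  "left_coact C e A a =
     inv_into (carrier (vect C \<otimes>\<^sub>\<complex> vect A)) (canonical_entwining C A)
       (pure_tensor cplx (vect A) (vect C) a e)"

definition cotensor ::
  "'c coalgebra \<Rightarrow> (complex, 'm, 'x) module_scheme \<Rightarrow> ('m \<Rightarrow> ('m, 'c) tens)
     \<Rightarrow> (complex, 'n, 'y) module_scheme \<Rightarrow> ('n \<Rightarrow> ('c, 'n) tens) \<Rightarrow> ('m, 'n) tens set" where
  "cotensor C M \<delta> N \<delta>' =
     {t \<in> carrier (vect M \<otimes>\<^sub>\<complex> vect N).
        tensor_assoc cplx cplx (vect M) (vect C) (vect N)
          (tensor_map cplx (vect M \<otimes>\<^sub>\<complex> vect C) (vect N) \<delta> (\<lambda>n. n) t) =
        tensor_map cplx (vect M) (vect C \<otimes>\<^sub>\<complex> vect N) (\<lambda>m. m) \<delta>' t}"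

text \<open>
  \<open>\<A> \<box>\<^bsup>\<C>\<^esup> \<A>\<close>, with the actions of the \<open>(A,A)\<close>-bimodule \<open>\<A> \<otimes> \<A>\<close>.  Only \<open>\<B>\<close> preserves the carrier.
\<close>

definition cotensor_square ::
  "'c coalgebra \<Rightarrow> 'c \<Rightarrow> ('a, 'c) comodule \<Rightarrow> ('a, ('a, 'a) tens, 'a) bimodule" where
  "cotensor_square C e A =
     (left_regular A \<otimes>\<^sub>\<complex> right_regular A)
       \<lparr>carrier := cotensor C A (coact A) A (left_coact C e A)\<rparr>"

text \<open>For a ring map \<open>f : B \<rightarrow> R\<close>, the ring \<open>R\<close> as an \<open>(R,B)\<close>- and as a \<open>(B,R)\<close>-bimodule.\<close>

definition restrict_right ::
  "('b \<Rightarrow> 'r) \<Rightarrow> ('r, 'x) ring_scheme \<Rightarrow> ('r, 'r, 'b) bimodule" where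
  "restrict_right f R = with_actions R (monoid.mult R) (\<lambda>x b. x \<otimes>\<^bsub>R\<^esub> f b)"

definition restrict_left ::
  "('b \<Rightarrow> 'r) \<Rightarrow> ('r, 'x) ring_scheme \<Rightarrow> ('b, 'r, 'r) bimodule" where
  "restrict_left f R = with_actions R (\<lambda>b x. f b \<otimes>\<^bsub>R\<^esub> x) (monoid.mult R)"

text \<open>\<open>(\<B>' \<otimes>\<^sub>\<B> (\<A> \<box>\<^bsup>\<C>\<^esup> \<A>)) \<otimes>\<^sub>\<B> \<B>'\<close>, and its generators \<open>x \<otimes> t \<otimes> y\<close>\<close>

definition base_change_left ::
  "'c coalgebra \<Rightarrow> 'c \<Rightarrow> ('a, 'c) comodule \<Rightarrow> ('b, 'c) comodule \<Rightarrow> ('a \<Rightarrow> 'b)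
     \<Rightarrow> ('b, ('b, ('a, 'a) tens) tens, 'a) bimodule" where
  "base_change_left C e A A' f =
     tensor (coinv_algebra C A) (restrict_right f (coinv_algebra C A')) (cotensor_square C e A)"

definition base_change ::
  "'c coalgebra \<Rightarrow> 'c \<Rightarrow> ('a, 'c) comodule \<Rightarrow> ('b, 'c) comodule \<Rightarrow> ('a \<Rightarrow> 'b)
     \<Rightarrow> ('b, (('b, ('a, 'a) tens) tens, 'b) tens, 'b) bimodule" where
  "base_change C e A A' f =
     tensor (coinv_algebra C A) (base_change_left C e A A' f)
       (restrict_left f (coinv_algebra C A'))"

definition base_change_pure ::
  "'c coalgebra \<Rightarrow> 'c \<Rightarrow> ('a, 'c) comodule \<Rightarrow> ('b, 'c) comodule \<Rightarrow> ('a \<Rightarrow> 'b)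
     \<Rightarrow> 'b \<Rightarrow> ('a, 'a) tens \<Rightarrow> 'b \<Rightarrow> (('b, ('a, 'a) tens) tens, 'b) tens" where
  "base_change_pure C e A A' f x t y =
     pure_tensor (coinv_algebra C A) (base_change_left C e A A' f)
       (restrict_left f (coinv_algebra C A'))
       (pure_tensor (coinv_algebra C A) (restrict_right f (coinv_algebra C A'))
          (cotensor_square C e A) x t) y"

end

theory Submission
  imports Defs
begin

text \<open>
  The isomorphism sends \<open>x \<otimes> t \<otimes> y\<close> to \<open>x (f \<otimes> f)(t) y\<close>.  With \<open>\<A> \<otimes> \<A>\<close> in place of the cotensor
  square, its bijectivity would follow from the two isomorphisms \<open>\<B>' \<otimes>\<^sub>\<B> \<A> \<cong> \<A>'\<close> and \<open>\<A> \<otimes>\<^sub>\<B> \<B>' \<cong> \<A>'\<close>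
  alone.  The theorem is thus the combination of these isomorphisms with the fact that the cotensor
  square is a direct summand of \<open>\<A> \<otimes> \<A>\<close>, as a \<open>\<B>\<close>-bimodule and naturally in \<open>\<A>\<close>.

  The summand is where cosemisimplicity enters.  A cosemisimple coalgebra has a cointegral: a
  bilinear form \<open>\<gamma>\<close> with \<open>\<Sum> \<gamma>(c\<^sub>1, c\<^sub>2) = \<epsilon>(c)\<close> and \<open>\<Sum> c\<^sub>1 \<gamma>(c\<^sub>2, d) = \<Sum> \<gamma>(c, d\<^sub>1) d\<^sub>2\<close>
  (\<open>cointegral_exists\<close>).  On a simple subcoalgebra \<open>D\<close>, which has finite dimension, \<open>\<gamma>\<close> comes from
  the trace: the element \<open>t\<close> of \<open>D\<close> that represents the trace form of the action of the dual algebra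
  on \<open>D\<close> is cocommutative, so its slices form a subcoalgebra of \<open>D\<close>.  This subcoalgebra is not zero,
  since \<open>\<epsilon>(t) = dim D \<noteq> 0\<close>.  By simplicity every \<open>d \<in> D\<close> is a slice of \<open>t\<close> by some linear form
  \<open>y\<^sub>d\<close>, and \<open>\<gamma>(c, d) = y\<^sub>d(c)\<close> is a cointegral on \<open>D\<close> (\<open>simple_cointegral\<close>).  Then
  \<open>p(a \<otimes> a') = \<Sum> a\<^sub>0 \<gamma>(a\<^sub>1, a'\<^sub>(\<^sub>-\<^sub>1\<^sub>)) a'\<^sub>0\<close> is a \<open>\<B>\<close>-bilinear map of \<open>\<A> \<otimes> \<A>\<close> that fixes the cotensor
  square (\<open>proj_id\<close>) and takes its values there (\<open>proj_in\<close>).  The second property needs the left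
  coaction to be coassociative, which follows from the compatibility of the entwining with the
  comultiplication (\<open>left_coact_coassoc\<close>).  The canonical map, hence the entwining and the left
  coaction, are natural for colinear algebra maps, so \<open>f \<otimes> f\<close> commutes with \<open>p\<close> (\<open>proj_ff\<close>).

  The two isomorphisms are where faithful flatness enters: it suffices to prove that the map
  \<open>\<B>' \<otimes>\<^sub>\<B> \<A> \<rightarrow> \<A>'\<close> becomes bijective after \<open>\<A>' \<otimes>\<^bsub>\<B>'\<^esub> -\<close> is applied.  The target becomes
  \<open>\<A>' \<otimes>\<^bsub>\<B>'\<^esub> \<A>'\<close>, which is \<open>\<A>' \<otimes> \<C>\<close> by the canonical map of \<open>\<A>'\<close>; the source becomes \<open>\<A>' \<otimes>\<^sub>\<B> \<A>\<close>,
  which is \<open>\<A>' \<otimes> \<C>\<close> by the canonical map of \<open>\<A>\<close> (\<open>\<phi>L_bij\<close>).  On the other side, the bijective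
  entwining provides the left version \<open>\<A> \<otimes>\<^sub>\<B> \<A> \<rightarrow> \<C> \<otimes> \<A>\<close> of the canonical map, and the argument is
  the mirror image (\<open>\<phi>R_bij\<close>).

  Finally \<open>b f(a) \<otimes> f(a') b' \<mapsto> b \<otimes> p(a \<otimes> a') \<otimes> b'\<close> is well defined on \<open>\<A>' \<otimes> \<A>'\<close> by the two isomorphisms,
  and its restriction to the cotensor square is the inverse (\<open>h_iso\<close>).
\<close>

section \<open>Additive maps and modules\<close>

lemma additive_mapsI:
  assumes "\<And>x. x \<in> carrier M \<Longrightarrow> h x \<in> carrier N"
    and "\<And>x y. x \<in> carrier M \<Longrightarrow> y \<in> carrier M \<Longrightarrow> h (x \<oplus>\<^bsub>M\<^esub> y) = h x \<oplus>\<^bsub>N\<^esub> h y"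
  shows "h \<in> additive_maps M N"
  using assms by (auto simp: additive_maps_def hom_def)

lemma additive_closed: "h \<in> additive_maps M N \<Longrightarrow> x \<in> carrier M \<Longrightarrow> h x \<in> carrier N"
  by (auto simp: additive_maps_def hom_def)

lemma additive_add:
  "h \<in> additive_maps M N \<Longrightarrow> x \<in> carrier M \<Longrightarrow> y \<in> carrier M \<Longrightarrow> h (x \<oplus>\<^bsub>M\<^esub> y) = h x \<oplus>\<^bsub>N\<^esub> h y"
  by (auto simp: additive_maps_def hom_def)

lemma additive_zero:
  assumes "h \<in> additive_maps M N" "abelian_group M" "abelian_group N"
  shows "h \<zero>\<^bsub>M\<^esub> = \<zero>\<^bsub>N\<^esub>"
proof -
  interpret group_hom "add_monoid M" "add_monoid N" h
    using assms by (simp add: group_hom_def group_hom_axioms_def additive_maps_def abelian_group.a_group)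
  show ?thesis using hom_one by simp
qed

lemma additive_minus:
  assumes "h \<in> additive_maps M N" "abelian_group M" "abelian_group N" "x \<in> carrier M"
  shows "h (\<ominus>\<^bsub>M\<^esub> x) = \<ominus>\<^bsub>N\<^esub> h x"
proof -
  interpret group_hom "add_monoid M" "add_monoid N" h
    using assms by (simp add: group_hom_def group_hom_axioms_def additive_maps_def abelian_group.a_group)
  show ?thesis using hom_inv[of x] assms by (simp add: a_inv_def)
qed

lemma additive_finsum:
  assumes h: "h \<in> additive_maps M N" and M: "abelian_group M" and N: "abelian_group N"
    and "finite I" "g \<in> I \<rightarrow> carrier M"
  shows "h (\<Oplus>\<^bsub>M\<^esub>i\<in>I. g i) = (\<Oplus>\<^bsub>N\<^esub>i\<in>I. h (g i))"
  using \<open>finite I\<close> \<open>g \<in> I \<rightarrow> carrier M\<close>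
proof (induction I)
  case empty
  interpret M: abelian_group M by fact
  interpret N: abelian_group N by fact
  show ?case using additive_zero[OF h M N] by simp
next
  case (insert i I)
  interpret M: abelian_group M by fact
  interpret N: abelian_group N by fact
  have "h (\<Oplus>\<^bsub>M\<^esub>i\<in>insert i I. g i) = h (g i) \<oplus>\<^bsub>N\<^esub> h (\<Oplus>\<^bsub>M\<^esub>i\<in>I. g i)"
    using insert by (simp add: Pi_iff additive_add[OF h])
  also have "\<dots> = (\<Oplus>\<^bsub>N\<^esub>i\<in>insert i I. h (g i))"
    using insert by (simp add: Pi_iff additive_closed[OF h])
  finally show ?case .
qed

lemma additive_inj_on:
  assumes h: "h \<in> additive_maps M N" and M: "abelian_group M" and N: "abelian_group N"
    and "\<And>x. x \<in> carrier M \<Longrightarrow> h x = \<zero>\<^bsub>N\<^esub> \<Longrightarrow> x = \<zero>\<^bsub>M\<^esub>"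
  shows "inj_on h (carrier M)"
proof -
  interpret group_hom "add_monoid M" "add_monoid N" h
    using assms by (simp add: group_hom_def group_hom_axioms_def additive_maps_def abelian_group.a_group)
  show ?thesis using assms(4) inj_on_one_iff by auto
qed

lemma left_moduleD:
  assumes "left_module R M"
  shows "ring R" "abelian_group M"
    "\<And>r m. r \<in> carrier R \<Longrightarrow> m \<in> carrier M \<Longrightarrow> lact M r m \<in> carrier M"
    "\<And>r m n. r \<in> carrier R \<Longrightarrow> m \<in> carrier M \<Longrightarrow> n \<in> carrier M \<Longrightarrow>
        lact M r (m \<oplus>\<^bsub>M\<^esub> n) = lact M r m \<oplus>\<^bsub>M\<^esub> lact M r n"
    "\<And>r s m. r \<in> carrier R \<Longrightarrow> s \<in> carrier R \<Longrightarrow> m \<in> carrier M \<Longrightarrow>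
        lact M (r \<oplus>\<^bsub>R\<^esub> s) m = lact M r m \<oplus>\<^bsub>M\<^esub> lact M s m"
    "\<And>r s m. r \<in> carrier R \<Longrightarrow> s \<in> carrier R \<Longrightarrow> m \<in> carrier M \<Longrightarrow>
        lact M (r \<otimes>\<^bsub>R\<^esub> s) m = lact M r (lact M s m)"
    "\<And>m. m \<in> carrier M \<Longrightarrow> lact M \<one>\<^bsub>R\<^esub> m = m"
  using assms by (simp_all add: left_module_def)

lemma right_moduleD:
  assumes "right_module R M"
  shows "ring R" "abelian_group M"
    "\<And>r m. r \<in> carrier R \<Longrightarrow> m \<in> carrier M \<Longrightarrow> ract M m r \<in> carrier M"
    "\<And>r m n. r \<in> carrier R \<Longrightarrow> m \<in> carrier M \<Longrightarrow> n \<in> carrier M \<Longrightarrow>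
        ract M (m \<oplus>\<^bsub>M\<^esub> n) r = ract M m r \<oplus>\<^bsub>M\<^esub> ract M n r"
    "\<And>r s m. r \<in> carrier R \<Longrightarrow> s \<in> carrier R \<Longrightarrow> m \<in> carrier M \<Longrightarrow>
        ract M m (r \<oplus>\<^bsub>R\<^esub> s) = ract M m r \<oplus>\<^bsub>M\<^esub> ract M m s"
    "\<And>r s m. r \<in> carrier R \<Longrightarrow> s \<in> carrier R \<Longrightarrow> m \<in> carrier M \<Longrightarrow>
        ract M m (r \<otimes>\<^bsub>R\<^esub> s) = ract M (ract M m r) s"
    "\<And>m. m \<in> carrier M \<Longrightarrow> ract M m \<one>\<^bsub>R\<^esub> = m"
  using assms by (simp_all add: right_module_def)

lemma with_actions_sel [simp]:
  "carrier (with_actions M l r) = carrier M" "\<zero>\<^bsub>with_actions M l r\<^esub> = \<zero>\<^bsub>M\<^esub>"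
  "add (with_actions M l r) = add M" "lact (with_actions M l r) = l" "ract (with_actions M l r) = r"
  by (simp_all add: with_actions_def)

lemma abelian_group_cong:
  assumes "carrier M = carrier M'" "add M = add M'" "\<zero>\<^bsub>M\<^esub> = \<zero>\<^bsub>M'\<^esub>" "abelian_group M'"
  shows "abelian_group M"
proof -
  interpret abelian_group M' by fact
  show ?thesis
    by (rule abelian_groupI) (auto simp: assms(1-3) a_ac intro!: bexI[of _ "\<ominus>\<^bsub>M'\<^esub> _"] l_neg)
qed

section \<open>Tensor products over a ring\<close>

definition balanced ::
  "('r, 'x) ring_scheme \<Rightarrow> ('l, 'm, 'r) bimodule \<Rightarrow> ('r, 'n, 's) bimodule \<Rightarrow> ('g, 'y) ring_scheme
     \<Rightarrow> ('m \<Rightarrow> 'n \<Rightarrow> 'g) \<Rightarrow> bool" where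
  "balanced R M N G \<beta> \<longleftrightarrow>
     (\<forall>m\<in>carrier M. \<beta> m \<in> additive_maps N G) \<and>
     (\<forall>n\<in>carrier N. (\<lambda>m. \<beta> m n) \<in> additive_maps M G) \<and>
     (\<forall>m\<in>carrier M. \<forall>r\<in>carrier R. \<forall>n\<in>carrier N. \<beta> (ract M m r) n = \<beta> m (lact N r n))"

locale tensor_product =
  fixes R :: "('r, 'x) ring_scheme" and M :: "('l, 'm, 'r) bimodule" and N :: "('r, 'n, 's) bimodule"
  assumes rmod: "right_module R M" and lmod: "left_module R N"
begin

abbreviation "F \<equiv> free_Abelian_group (carrier M \<times> carrier N)"
abbreviation "Z \<equiv> tensor_null R M N"

lemma Mab: "abelian_group M" and Nab: "abelian_group N"
  using rmod lmod by (simp_all add: right_moduleD left_moduleD)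

sublocale M: abelian_group M by (rule Mab)
sublocale N: abelian_group N by (rule Nab)

lemma comm_F: "comm_group F" by (rule abelian_free_Abelian_group)

lemma relations_F: "tensor_relations R M N \<subseteq> carrier F"
  using right_moduleD(3)[OF rmod] left_moduleD(3)[OF lmod]
  by (auto simp: tensor_relations_def dest!: subsetD[OF keys_diff] split: if_splits)

lemma normal_Z: "Z \<lhd> F"
proof -
  interpret comm_group F by (rule comm_F)
  have "subgroup Z F" unfolding tensor_null_def by (rule generate_is_subgroup[OF relations_F])
  thus ?thesis by (rule subgroup_imp_normal)
qed

sublocale Z: normal Z F by (rule normal_Z)

lemma comm_Q: "comm_group (F Mod Z)"
  using comm_group.abelian_FactGroup[OF comm_F Z.subgroup_axioms] .

lemma tensor_group_sel:
  "carrier (tensor_group R M N) = carrier (F Mod Z)"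
  "\<zero>\<^bsub>tensor_group R M N\<^esub> = Z"
  "add (tensor_group R M N) = monoid.mult (F Mod Z)"
  by (simp_all add: tensor_group_def Let_def)

lemma add_monoid_tensor_group:
  "add_monoid (tensor_group R M N) = F Mod Z"
  by (simp add: tensor_group_def Let_def FactGroup_def)

lemma abelian_group_tensor_group: "abelian_group (tensor_group R M N)"
proof (intro abelian_group.intro abelian_monoid.intro abelian_group_axioms.intro)
  show "comm_group (add_monoid (tensor_group R M N))"
    unfolding add_monoid_tensor_group by (rule comm_Q)
  thus "Group.comm_monoid (add_monoid (tensor_group R M N))" by (rule comm_group.axioms)
qed

lemma cls_add: "x \<in> carrier F \<Longrightarrow> y \<in> carrier F \<Longrightarrow>
   (Z #>\<^bsub>F\<^esub> x) \<oplus>\<^bsub>tensor_group R M N\<^esub> (Z #>\<^bsub>F\<^esub> y) = Z #>\<^bsub>F\<^esub> (x + y)"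
  by (simp add: tensor_group_sel FactGroup_def Z.rcos_sum)

lemma cls_closed: "x \<in> carrier F \<Longrightarrow> Z #>\<^bsub>F\<^esub> x \<in> carrier (tensor_group R M N)"
  unfolding tensor_group_sel FactGroup_def by (auto simp: RCOSETS_def)

lemma cls_eqI: "x \<in> carrier F \<Longrightarrow> y \<in> carrier F \<Longrightarrow> x - y \<in> Z \<Longrightarrow> Z #>\<^bsub>F\<^esub> x = Z #>\<^bsub>F\<^esub> y"
  by (rule Z.repr_independence[OF _ _ Z.subgroup_axioms, symmetric])
     (auto simp: r_coset_def intro!: bexI[of _ "x - y"])

lemma rel_in_Z: "z \<in> tensor_relations R M N \<Longrightarrow> z \<in> Z"
  unfolding tensor_null_def by (rule generate.incl)

abbreviation "pt \<equiv> pure_tensor R M N"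
abbreviation "TG \<equiv> tensor_group R M N"

lemma pure_closed [simp]: "m \<in> carrier M \<Longrightarrow> n \<in> carrier N \<Longrightarrow> pt m n \<in> carrier TG"
  unfolding pure_tensor_def by (rule cls_closed) simp

lemma pure_add_left: "m \<in> carrier M \<Longrightarrow> m' \<in> carrier M \<Longrightarrow> n \<in> carrier N \<Longrightarrow>
    pt (m \<oplus>\<^bsub>M\<^esub> m') n = pt m n \<oplus>\<^bsub>TG\<^esub> pt m' n"
  unfolding pure_tensor_def
  by (subst cls_add, simp, simp, rule cls_eqI)
     (auto intro!: rel_in_Z simp: tensor_relations_def diff_diff_eq dest!: subsetD[OF keys_add] split: if_splits)

lemma pure_add_right: "m \<in> carrier M \<Longrightarrow> n \<in> carrier N \<Longrightarrow> n' \<in> carrier N \<Longrightarrow>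
    pt m (n \<oplus>\<^bsub>N\<^esub> n') = pt m n \<oplus>\<^bsub>TG\<^esub> pt m n'"
proof -
  assume a: "m \<in> carrier M" "n \<in> carrier N" "n' \<in> carrier N"
  hence "frag_of (m, n \<oplus>\<^bsub>N\<^esub> n') - frag_of (m, n) - frag_of (m, n') \<in> tensor_relations R M N"
    unfolding tensor_relations_def by blast
  with a show ?thesis
    unfolding pure_tensor_def
    by (subst cls_add, simp, simp, intro cls_eqI)
       (auto intro!: rel_in_Z simp: diff_diff_eq dest!: subsetD[OF keys_add] split: if_splits)
qed

lemma pure_balanced: "m \<in> carrier M \<Longrightarrow> r \<in> carrier R \<Longrightarrow> n \<in> carrier N \<Longrightarrow>
    pt (ract M m r) n = pt m (lact N r n)"
  using right_moduleD(3)[OF rmod] left_moduleD(3)[OF lmod]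
  unfolding pure_tensor_def
  by (intro cls_eqI) (auto intro!: rel_in_Z simp: tensor_relations_def)

lemma balanced_pure: "balanced R M N TG pt"
  by (auto simp: balanced_def pure_add_left pure_add_right pure_balanced intro!: additive_mapsI)

lemma pure_zero_left: "n \<in> carrier N \<Longrightarrow> pt \<zero>\<^bsub>M\<^esub> n = \<zero>\<^bsub>TG\<^esub>"
  using balanced_pure additive_zero[OF _ Mab abelian_group_tensor_group]
  unfolding balanced_def by blast

lemma pure_zero_right: "m \<in> carrier M \<Longrightarrow> pt m \<zero>\<^bsub>N\<^esub> = \<zero>\<^bsub>TG\<^esub>"
  using balanced_pure additive_zero[OF _ Nab abelian_group_tensor_group]
  unfolding balanced_def by blast

lemma pure_minus_left: "m \<in> carrier M \<Longrightarrow> n \<in> carrier N \<Longrightarrow> pt (\<ominus>\<^bsub>M\<^esub> m) n = \<ominus>\<^bsub>TG\<^esub> pt m n"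
  using balanced_pure additive_minus[OF _ Mab abelian_group_tensor_group]
  unfolding balanced_def by blast

text \<open>
  Pure tensors span under addition alone, as \<open>- (m \<otimes> n) = (- m) \<otimes> n\<close>.  Most identities between
  additive maps on a tensor product are proved by this induction.
\<close>

lemma tensor_group_induct [consumes 1, case_names pure add]:
  assumes t: "t \<in> carrier TG"
    and pure: "\<And>m n. m \<in> carrier M \<Longrightarrow> n \<in> carrier N \<Longrightarrow> P (pt m n)"
    and add: "\<And>s t. s \<in> carrier TG \<Longrightarrow> t \<in> carrier TG \<Longrightarrow> P s \<Longrightarrow> P t \<Longrightarrow> P (s \<oplus>\<^bsub>TG\<^esub> t)"
  shows "P t"
proof -
  interpret TG: abelian_group TG by (rule abelian_group_tensor_group)
  have zero: "P \<zero>\<^bsub>TG\<^esub>" using pure[of "\<zero>\<^bsub>M\<^esub>" "\<zero>\<^bsub>N\<^esub>"] by (simp add: pure_zero_left)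
  obtain x where x: "x \<in> carrier F" "t = Z #>\<^bsub>F\<^esub> x"
    using t by (auto simp: tensor_group_sel FactGroup_def RCOSETS_def)
  \<comment> \<open>The property is proved together with its analogue for the negative, as the free abelian group is generated by its basis under subtraction.\<close>
  have "P (Z #>\<^bsub>F\<^esub> x) \<and> P (Z #>\<^bsub>F\<^esub> (- x))"
    using x(1) unfolding carrier_free_Abelian_group_iff
  proof (induction x rule: free_Abelian_group_induct[consumes 1])
    case 1
    have "Z #>\<^bsub>F\<^esub> 0 = \<zero>\<^bsub>TG\<^esub>"
      using Z.coset_mult_one[of Z] Z.subset by (simp add: tensor_group_sel)
    thus ?case using zero by simp
  next
    case (2 x y)
    have "P ((Z #>\<^bsub>F\<^esub> x) \<oplus>\<^bsub>TG\<^esub> (Z #>\<^bsub>F\<^esub> (- y)))" "P ((Z #>\<^bsub>F\<^esub> y) \<oplus>\<^bsub>TG\<^esub> (Z #>\<^bsub>F\<^esub> (- x)))"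
      using 2 by (auto intro!: add cls_closed)
    thus ?case using 2 by (simp add: cls_add)
  next
    case (3 a)
    obtain m n where mn: "a = (m, n)" "m \<in> carrier M" "n \<in> carrier N" using 3 by auto
    have "(Z #>\<^bsub>F\<^esub> (- frag_of a)) = pt (\<ominus>\<^bsub>M\<^esub> m) n"
    proof -
      have "(Z #>\<^bsub>F\<^esub> (- frag_of a)) \<oplus>\<^bsub>TG\<^esub> pt m n = \<zero>\<^bsub>TG\<^esub>"
        unfolding pure_tensor_def mn(1)[symmetric] using 3 Z.coset_mult_one[of Z] Z.subset
        by (subst cls_add) (auto simp: tensor_group_sel)
      hence "(Z #>\<^bsub>F\<^esub> (- frag_of a)) = \<ominus>\<^bsub>TG\<^esub> pt m n"
        using mn 3 by (intro TG.minus_equality[symmetric]) (auto intro!: cls_closed)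
      thus ?thesis using mn by (simp add: pure_minus_left)
    qed
    moreover have "(Z #>\<^bsub>F\<^esub> frag_of a) = pt m n" by (simp add: mn(1) pure_tensor_def)
    ultimately show ?case using mn pure by simp
  qed
  thus ?thesis using x by simp
qed

end

text \<open>
  The universal property of the free abelian group, with the homomorphism given by the very sum
  that occurs in \<open>tensor_lift\<close>.
\<close>

lemma finsum_frag_hom:
  assumes G: "abelian_group G" and \<beta>: "\<beta> ` S \<subseteq> carrier G"
  defines "h \<equiv> \<lambda>x. \<Oplus>\<^bsub>G\<^esub>p\<in>Poly_Mapping.keys x. [Poly_Mapping.lookup x p] \<cdot>\<^bsub>G\<^esub> \<beta> p"
  shows "h \<in> hom (free_Abelian_group S) (add_monoid G)" "p \<in> S \<Longrightarrow> h (frag_of p) = \<beta> p"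
proof -
  interpret abelian_group G by fact
  have zero_mult: "add_pow G (0 :: int) x = \<zero>\<^bsub>G\<^esub>" for x by (simp add: add_pow_def)
  have wide: "h x = (\<Oplus>\<^bsub>G\<^esub>p\<in>K. [Poly_Mapping.lookup x p] \<cdot>\<^bsub>G\<^esub> \<beta> p)"
    if "Poly_Mapping.keys x \<subseteq> K" "finite K" "K \<subseteq> S" for x K
    unfolding h_def using that \<beta>
    by (intro add.finprod_mono_neutral_cong_left)
       (auto simp: in_keys_iff Pi_iff image_subset_iff zero_mult intro!: add.int_pow_closed)
  show "h \<in> hom (free_Abelian_group S) (add_monoid G)"
  proof (rule homI)
    fix x y assume "x \<in> carrier (free_Abelian_group S)" "y \<in> carrier (free_Abelian_group S)"
    hence xy: "Poly_Mapping.keys x \<subseteq> S" "Poly_Mapping.keys y \<subseteq> S" by simp_all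
    let ?K = "Poly_Mapping.keys x \<union> Poly_Mapping.keys y"
    have "h (x + y) = (\<Oplus>\<^bsub>G\<^esub>p\<in>?K. [Poly_Mapping.lookup (x + y) p] \<cdot>\<^bsub>G\<^esub> \<beta> p)"
      using xy by (intro wide) (auto dest: subsetD[OF keys_add])
    also have "\<dots> = (\<Oplus>\<^bsub>G\<^esub>p\<in>?K. [Poly_Mapping.lookup x p] \<cdot>\<^bsub>G\<^esub> \<beta> p \<oplus>\<^bsub>G\<^esub> [Poly_Mapping.lookup y p] \<cdot>\<^bsub>G\<^esub> \<beta> p)"
      using xy \<beta> by (intro finsum_cong')
        (auto simp: lookup_add image_subset_iff Pi_iff add.int_pow_mult)
    also have "\<dots> = (\<Oplus>\<^bsub>G\<^esub>p\<in>?K. [Poly_Mapping.lookup x p] \<cdot>\<^bsub>G\<^esub> \<beta> p) \<oplus>\<^bsub>G\<^esub> (\<Oplus>\<^bsub>G\<^esub>p\<in>?K. [Poly_Mapping.lookup y p] \<cdot>\<^bsub>G\<^esub> \<beta> p)"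
      using xy \<beta> by (intro finsum_addf) (auto simp: image_subset_iff Pi_iff)
    also have "\<dots> = h x \<oplus>\<^bsub>G\<^esub> h y" using xy by (simp add: wide[of x ?K] wide[of y ?K])
    finally show "h (x \<otimes>\<^bsub>free_Abelian_group S\<^esub> y) = h x \<otimes>\<^bsub>add_monoid G\<^esub> h y" by simp
  qed (use \<beta> in \<open>auto simp: h_def image_subset_iff Pi_iff intro!: finsum_closed\<close>)
  show "h (frag_of p) = \<beta> p" if "p \<in> S"
    using that \<beta> by (auto simp: h_def image_subset_iff)
qed

context tensor_product
begin

text \<open>
  The universal property of the tensor product.  The homomorphism on the free abelian group kills
  the relations, so it has the same value on every representative, in particular on the chosen
  one that \<open>tensor_lift\<close> evaluates.
\<close>

lemma lift_group:
  assumes G: "abelian_group G" and \<beta>: "balanced R M N G \<beta>"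
  shows "tensor_lift G \<beta> \<in> additive_maps TG G"
    and "\<And>m n. m \<in> carrier M \<Longrightarrow> n \<in> carrier N \<Longrightarrow> tensor_lift G \<beta> (pt m n) = \<beta> m n"
proof -
  interpret G: abelian_group G by fact
  define h where "h = (\<lambda>x :: 'm \<times> 'n \<Rightarrow>\<^sub>0 int. \<Oplus>\<^bsub>G\<^esub>p\<in>Poly_Mapping.keys x. [Poly_Mapping.lookup x p] \<cdot>\<^bsub>G\<^esub> (case_prod \<beta> p))"
  have cl: "case_prod \<beta> ` (carrier M \<times> carrier N) \<subseteq> carrier G"
    using \<beta> by (auto simp: balanced_def dest: additive_closed)
  have hh: "h \<in> hom F (add_monoid G)"
    "\<And>p. p \<in> carrier M \<times> carrier N \<Longrightarrow> h (frag_of p) = case_prod \<beta> p"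
    unfolding h_def by (rule finsum_frag_hom[OF G cl]; assumption)+
  have h_of: "h (frag_of (m, n)) = \<beta> m n" if "m \<in> carrier M" "n \<in> carrier N" for m n
    using hh(2)[of "(m, n)"] that by simp
  interpret h: group_hom F "add_monoid G" h
    using hh(1) by (simp add: group_hom_def group_hom_axioms_def G.a_group)
  have h_diff: "h (x - y) = h x \<ominus>\<^bsub>G\<^esub> h y" if "x \<in> carrier F" "y \<in> carrier F" for x y
    using h.hom_mult[of x "- y"] h.hom_inv[of y] that
    by (simp add: a_minus_def a_inv_def)
  have "Z \<subseteq> kernel F (add_monoid G) h"
    unfolding tensor_null_def
  proof (rule group.generate_subgroup_incl[OF group_free_Abelian_group _ h.subgroup_kernel], rule subsetI)
    fix z assume z: "z \<in> tensor_relations R M N"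
    have zF: "z \<in> carrier F" using z relations_F by blast
    have cc: "\<beta> m n \<in> carrier G" if "m \<in> carrier M" "n \<in> carrier N" for m n
      using \<beta> that by (auto simp: balanced_def dest: additive_closed)
    have "h z = \<zero>\<^bsub>G\<^esub>"
      using z unfolding tensor_relations_def
    proof (elim UnE CollectE exE conjE)
      fix m m' n assume 1: "z = frag_of (m \<oplus>\<^bsub>M\<^esub> m', n) - frag_of (m, n) - frag_of (m', n)"
        and 2: "m \<in> carrier M" "m' \<in> carrier M" "n \<in> carrier N"
      have "\<beta> (m \<oplus>\<^bsub>M\<^esub> m') n = \<beta> m n \<oplus>\<^bsub>G\<^esub> \<beta> m' n"
        using \<beta> 2 additive_add[of "\<lambda>m. \<beta> m n" M G] by (auto simp: balanced_def)
      moreover have "h z = \<beta> (m \<oplus>\<^bsub>M\<^esub> m') n \<ominus>\<^bsub>G\<^esub> \<beta> m n \<ominus>\<^bsub>G\<^esub> \<beta> m' n"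
        unfolding 1 using 2 by (subst h_diff, force dest!: subsetD[OF keys_diff] split: if_splits, simp)+
          (simp add: h_of M.a_closed N.a_closed)
      ultimately show ?thesis using cc 2 by (simp add: a_minus_def G.minus_add G.a_ac G.r_neg1 G.r_neg)
    next
      fix m n n' assume 1: "z = frag_of (m, n \<oplus>\<^bsub>N\<^esub> n') - frag_of (m, n) - frag_of (m, n')"
        and 2: "m \<in> carrier M" "n \<in> carrier N" "n' \<in> carrier N"
      have "\<beta> m (n \<oplus>\<^bsub>N\<^esub> n') = \<beta> m n \<oplus>\<^bsub>G\<^esub> \<beta> m n'"
        using \<beta> 2 additive_add[of "\<beta> m" N G] by (auto simp: balanced_def)
      moreover have "h z = \<beta> m (n \<oplus>\<^bsub>N\<^esub> n') \<ominus>\<^bsub>G\<^esub> \<beta> m n \<ominus>\<^bsub>G\<^esub> \<beta> m n'"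
        unfolding 1 using 2 by (subst h_diff, force dest!: subsetD[OF keys_diff] split: if_splits, simp)+
          (simp add: h_of M.a_closed N.a_closed)
      ultimately show ?thesis using cc 2 by (simp add: a_minus_def G.minus_add G.a_ac G.r_neg1 G.r_neg)
    next
      fix m r n assume 1: "z = frag_of (ract M m r, n) - frag_of (m, lact N r n)"
        and 2: "m \<in> carrier M" "r \<in> carrier R" "n \<in> carrier N"
      have 3: "ract M m r \<in> carrier M" "lact N r n \<in> carrier N"
        using 2 right_moduleD(3)[OF rmod] left_moduleD(3)[OF lmod] by auto
      have "\<beta> (ract M m r) n = \<beta> m (lact N r n)" using \<beta> 2 by (auto simp: balanced_def)
      moreover have "h z = \<beta> (ract M m r) n \<ominus>\<^bsub>G\<^esub> \<beta> m (lact N r n)"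
        unfolding 1 using 2 3 by (subst h_diff) (simp_all add: h_of)
      ultimately show ?thesis using cc 2 3 by (simp add: a_minus_def G.r_neg)
    qed
    thus "z \<in> kernel F (add_monoid G) h" using zF by (simp add: kernel_def)
  qed
  hence Zker: "z \<in> Z \<Longrightarrow> z \<in> carrier F \<and> h z = \<zero>\<^bsub>G\<^esub>" for z
    by (auto simp: kernel_def)
  have lift_cls: "tensor_lift G \<beta> (Z #>\<^bsub>F\<^esub> x) = h x" if x: "x \<in> carrier F" for x
  proof -
    define y where "y = (SOME y. y \<in> Z #>\<^bsub>F\<^esub> x)"
    have "x \<in> Z #>\<^bsub>F\<^esub> x" using Z.rcos_self[OF x Z.subgroup_axioms] .
    hence "y \<in> Z #>\<^bsub>F\<^esub> x" unfolding y_def by (rule someI)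
    then obtain z where z: "z \<in> Z" "y = z + x" by (auto simp: r_coset_def)
    have "h y = h z \<oplus>\<^bsub>G\<^esub> h x"
      using h.hom_mult[of z x] z x Zker by simp
    also have "\<dots> = h x" using Zker[OF z(1)] h.hom_closed[OF x] by simp
    finally show ?thesis by (simp add: tensor_lift_def y_def h_def case_prod_unfold)
  qed
  show "tensor_lift G \<beta> (pt m n) = \<beta> m n" if "m \<in> carrier M" "n \<in> carrier N" for m n
    unfolding pure_tensor_def using that by (subst lift_cls) (simp_all add: h_of)
  show "tensor_lift G \<beta> \<in> additive_maps TG G"
  proof (rule additive_mapsI)
    fix s assume "s \<in> carrier TG"
    then obtain x where x: "x \<in> carrier F" "s = Z #>\<^bsub>F\<^esub> x"
      by (auto simp: tensor_group_sel FactGroup_def RCOSETS_def)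
    thus "tensor_lift G \<beta> s \<in> carrier G" using lift_cls h.hom_closed by simp
    fix t assume "t \<in> carrier TG"
    then obtain y where y: "y \<in> carrier F" "t = Z #>\<^bsub>F\<^esub> y"
      by (auto simp: tensor_group_sel FactGroup_def RCOSETS_def)
    have xy: "x + y \<in> carrier F" using x y by (auto dest: subsetD[OF keys_add])
    show "tensor_lift G \<beta> (s \<oplus>\<^bsub>TG\<^esub> t) = tensor_lift G \<beta> s \<oplus>\<^bsub>G\<^esub> tensor_lift G \<beta> t"
      using x y xy h.hom_mult[of x y] by (simp only: cls_add lift_cls) simp
  qed
qed

end

definition bimod ::
  "('l, 'x) ring_scheme \<Rightarrow> ('r, 'y) ring_scheme \<Rightarrow> ('l, 'm, 'r) bimodule \<Rightarrow> bool" where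
  "bimod L R M \<longleftrightarrow> left_module L M \<and> right_module R M \<and>
     (\<forall>l\<in>carrier L. \<forall>m\<in>carrier M. \<forall>r\<in>carrier R. ract M (lact M l m) r = lact M l (ract M m r))"

lemma bimodD:
  assumes "bimod L R M"
  shows "left_module L M" "right_module R M"
    "\<And>l m r. l \<in> carrier L \<Longrightarrow> m \<in> carrier M \<Longrightarrow> r \<in> carrier R \<Longrightarrow>
       ract M (lact M l m) r = lact M l (ract M m r)"
  using assms by (simp_all add: bimod_def)

lemma balancedI:
  assumes "\<And>m n. m \<in> carrier M \<Longrightarrow> n \<in> carrier N \<Longrightarrow> \<beta> m n \<in> carrier G"
    and "\<And>m m' n. m \<in> carrier M \<Longrightarrow> m' \<in> carrier M \<Longrightarrow> n \<in> carrier N \<Longrightarrow>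
       \<beta> (m \<oplus>\<^bsub>M\<^esub> m') n = \<beta> m n \<oplus>\<^bsub>G\<^esub> \<beta> m' n"
    and "\<And>m n n'. m \<in> carrier M \<Longrightarrow> n \<in> carrier N \<Longrightarrow> n' \<in> carrier N \<Longrightarrow>
       \<beta> m (n \<oplus>\<^bsub>N\<^esub> n') = \<beta> m n \<oplus>\<^bsub>G\<^esub> \<beta> m n'"
    and "\<And>m r n. m \<in> carrier M \<Longrightarrow> r \<in> carrier R \<Longrightarrow> n \<in> carrier N \<Longrightarrow>
       \<beta> (ract M m r) n = \<beta> m (lact N r n)"
  shows "balanced R M N G \<beta>"
  using assms by (auto simp: balanced_def intro!: additive_mapsI)

lemma balancedD:
  assumes "balanced R M N G \<beta>"
  shows "m \<in> carrier M \<Longrightarrow> n \<in> carrier N \<Longrightarrow> \<beta> m n \<in> carrier G"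
    and "m \<in> carrier M \<Longrightarrow> m' \<in> carrier M \<Longrightarrow> n \<in> carrier N \<Longrightarrow>
       \<beta> (m \<oplus>\<^bsub>M\<^esub> m') n = \<beta> m n \<oplus>\<^bsub>G\<^esub> \<beta> m' n"
    and "m \<in> carrier M \<Longrightarrow> n \<in> carrier N \<Longrightarrow> n' \<in> carrier N \<Longrightarrow>
       \<beta> m (n \<oplus>\<^bsub>N\<^esub> n') = \<beta> m n \<oplus>\<^bsub>G\<^esub> \<beta> m n'"
    and "m \<in> carrier M \<Longrightarrow> r \<in> carrier R \<Longrightarrow> n \<in> carrier N \<Longrightarrow>
       \<beta> (ract M m r) n = \<beta> m (lact N r n)"
  using assms by (auto simp: balanced_def additive_maps_def hom_def)

lemma tensor_group_sel2:
  "carrier (tensor R M N) = carrier (tensor_group R M N)"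
  "\<zero>\<^bsub>tensor R M N\<^esub> = \<zero>\<^bsub>tensor_group R M N\<^esub>"
  "add (tensor R M N) = add (tensor_group R M N)"
  by (simp_all add: tensor_def)

lemma additive_maps_cong:
  "carrier M = carrier M' \<Longrightarrow> add M = add M' \<Longrightarrow> carrier N = carrier N' \<Longrightarrow> add N = add N' \<Longrightarrow>
     additive_maps M N = additive_maps M' N'"
  by (simp add: additive_maps_def hom_def)

context tensor_product
begin

lemma tensor_abelian_group: "abelian_group (tensor R M N)"
  by (rule abelian_group_cong[OF _ _ _ abelian_group_tensor_group]) (simp_all add: tensor_group_sel2)

lemma pure_in: "m \<in> carrier M \<Longrightarrow> n \<in> carrier N \<Longrightarrow> pt m n \<in> carrier (tensor R M N)"
  by (simp add: tensor_group_sel2)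

lemma pure_add1: "m \<in> carrier M \<Longrightarrow> m' \<in> carrier M \<Longrightarrow> n \<in> carrier N \<Longrightarrow>
    pt (m \<oplus>\<^bsub>M\<^esub> m') n = pt m n \<oplus>\<^bsub>tensor R M N\<^esub> pt m' n"
  by (simp add: tensor_group_sel2 pure_add_left)

lemma pure_add2: "m \<in> carrier M \<Longrightarrow> n \<in> carrier N \<Longrightarrow> n' \<in> carrier N \<Longrightarrow>
    pt m (n \<oplus>\<^bsub>N\<^esub> n') = pt m n \<oplus>\<^bsub>tensor R M N\<^esub> pt m n'"
  by (simp add: tensor_group_sel2 pure_add_right)

lemma pure_zero1: "n \<in> carrier N \<Longrightarrow> pt \<zero>\<^bsub>M\<^esub> n = \<zero>\<^bsub>tensor R M N\<^esub>"
  by (simp add: tensor_group_sel2 pure_zero_left)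

lemma pure_zero2: "m \<in> carrier M \<Longrightarrow> pt m \<zero>\<^bsub>N\<^esub> = \<zero>\<^bsub>tensor R M N\<^esub>"
  by (simp add: tensor_group_sel2 pure_zero_right)

lemma induct [consumes 1, case_names pure add]:
  assumes "t \<in> carrier (tensor R M N)"
    and "\<And>m n. m \<in> carrier M \<Longrightarrow> n \<in> carrier N \<Longrightarrow> P (pt m n)"
    and "\<And>s t. s \<in> carrier (tensor R M N) \<Longrightarrow> t \<in> carrier (tensor R M N) \<Longrightarrow> P s \<Longrightarrow> P t \<Longrightarrow>
       P (s \<oplus>\<^bsub>tensor R M N\<^esub> t)"
  shows "P t"
  using assms unfolding tensor_group_sel2 by (rule tensor_group_induct)

lemma lift_additive:
  "abelian_group G \<Longrightarrow> balanced R M N G \<beta> \<Longrightarrow> tensor_lift G \<beta> \<in> additive_maps (tensor R M N) G"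
  using lift_group(1)[of G \<beta>] additive_maps_cong[of TG "tensor R M N" G G] by (simp add: tensor_group_sel2)

lemma lift_pure:
  "abelian_group G \<Longrightarrow> balanced R M N G \<beta> \<Longrightarrow> m \<in> carrier M \<Longrightarrow> n \<in> carrier N \<Longrightarrow>
     tensor_lift G \<beta> (pt m n) = \<beta> m n"
  using lift_group(2)[of G \<beta>] by simp

lemma additive_eqI:
  assumes "g \<in> additive_maps (tensor R M N) G" "h \<in> additive_maps (tensor R M N) G"
    and "\<And>m n. m \<in> carrier M \<Longrightarrow> n \<in> carrier N \<Longrightarrow> g (pt m n) = h (pt m n)"
    and "t \<in> carrier (tensor R M N)"
  shows "g t = h t"
  using assms(4) by (induction rule: induct) (simp_all add: assms(3) additive_add[OF assms(1)] additive_add[OF assms(2)])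

text \<open>
  The value on a fixed tensor \<open>t\<close> of a map with a further argument \<open>q\<close> is additive in \<open>q\<close>.  Through
  this lemma a tensor is inserted into a multiadditive expression one factor at a time.
\<close>

lemma lift_param:
  assumes G: "abelian_group G"
    and 1: "\<And>q. q \<in> carrier Q \<Longrightarrow> balanced R M N G (\<lambda>m n. \<beta> m n q)"
    and 2: "\<And>m n. m \<in> carrier M \<Longrightarrow> n \<in> carrier N \<Longrightarrow> \<beta> m n \<in> additive_maps Q G"
    and Q: "abelian_group Q"
    and t: "t \<in> carrier (tensor R M N)"
  shows "(\<lambda>q. tensor_lift G (\<lambda>m n. \<beta> m n q) t) \<in> additive_maps Q G"
proof (rule additive_mapsI)
  interpret G: abelian_group G by fact
  interpret Q: abelian_group Q by fact
  note la = lift_additive[OF G 1]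
  show "tensor_lift G (\<lambda>m n. \<beta> m n q) t \<in> carrier G" if "q \<in> carrier Q" for q
    using additive_closed[OF la[OF that] t] .
  fix q q' assume q: "q \<in> carrier Q" "q' \<in> carrier Q"
  hence qq: "q \<oplus>\<^bsub>Q\<^esub> q' \<in> carrier Q" by simp
  show "tensor_lift G (\<lambda>m n. \<beta> m n (q \<oplus>\<^bsub>Q\<^esub> q')) t =
     tensor_lift G (\<lambda>m n. \<beta> m n q) t \<oplus>\<^bsub>G\<^esub> tensor_lift G (\<lambda>m n. \<beta> m n q') t"
    using t
  proof (induction rule: induct)
    case (pure m n)
    thus ?case using q qq by (simp add: lift_pure[OF G 1] additive_add[OF 2])
  next
    case (add s t)
    thus ?case
      using additive_closed[OF la[OF q(1)]] additive_closed[OF la[OF q(2)]]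
      by (simp add: additive_add[OF la] q qq G.a_ac)
  qed
qed

end

lemma tensor_productI: "right_module R M \<Longrightarrow> left_module R N \<Longrightarrow> tensor_product R M N"
  by (rule tensor_product.intro)

lemma additive_comp:
  "g \<in> additive_maps M N \<Longrightarrow> h \<in> additive_maps N P \<Longrightarrow> (\<lambda>x. h (g x)) \<in> additive_maps M P"
  by (rule additive_mapsI) (simp_all add: additive_closed additive_add)

lemma additive_id [simp]: "(\<lambda>x. x) \<in> additive_maps M M"
  by (auto simp: additive_maps_def hom_def)

lemma left_linear_additive: "h \<in> left_linear R M N \<Longrightarrow> h \<in> additive_maps M N"
  by (simp add: left_linear_def)

lemma right_linear_additive: "h \<in> right_linear R M N \<Longrightarrow> h \<in> additive_maps M N"
  by (simp add: right_linear_def)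

lemma left_linear_act: "h \<in> left_linear R M N \<Longrightarrow> r \<in> carrier R \<Longrightarrow> m \<in> carrier M \<Longrightarrow>
    h (lact M r m) = lact N r (h m)"
  by (simp add: left_linear_def)

lemma right_linear_act: "h \<in> right_linear R M N \<Longrightarrow> r \<in> carrier R \<Longrightarrow> m \<in> carrier M \<Longrightarrow>
    h (ract M m r) = ract N (h m) r"
  by (simp add: right_linear_def)

lemma left_linear_id [simp]: "(\<lambda>x. x) \<in> left_linear R M M"
  by (simp add: left_linear_def)

lemma right_linear_id [simp]: "(\<lambda>x. x) \<in> right_linear R M M"
  by (simp add: right_linear_def)

context tensor_product
begin

lemma map_additive_pure:
  assumes "tensor_product R M' N'" "g \<in> right_linear R M M'" "h \<in> left_linear R N N'"
  shows "tensor_map R M' N' g h \<in> additive_maps (tensor R M N) (tensor R M' N')"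
    and "m \<in> carrier M \<Longrightarrow> n \<in> carrier N \<Longrightarrow>
      tensor_map R M' N' g h (pt m n) = pure_tensor R M' N' (g m) (h n)"
proof -
  interpret T': tensor_product R M' N' by fact
  note [simp] = T'.pure_in T'.pure_add1 T'.pure_add2 T'.pure_balanced
    additive_closed[OF right_linear_additive[OF assms(2)]] additive_closed[OF left_linear_additive[OF assms(3)]]
    additive_add[OF right_linear_additive[OF assms(2)]] additive_add[OF left_linear_additive[OF assms(3)]]
    left_linear_act[OF assms(3)] right_linear_act[OF assms(2)]
  have b: "balanced R M N (tensor R M' N') (\<lambda>m n. pure_tensor R M' N' (g m) (h n))"
    by (rule balancedI) simp_all
  show "tensor_map R M' N' g h \<in> additive_maps (tensor R M N) (tensor R M' N')"
    unfolding tensor_map_def by (rule lift_additive[OF T'.tensor_abelian_group b])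
  show "m \<in> carrier M \<Longrightarrow> n \<in> carrier N \<Longrightarrow>
      tensor_map R M' N' g h (pt m n) = pure_tensor R M' N' (g m) (h n)"
    unfolding tensor_map_def using lift_pure[OF T'.tensor_abelian_group b] by simp
qed

lemma additive_maps_TG: "additive_maps Y (tensor_group R M N) = additive_maps Y (tensor R M N)"
  by (rule additive_maps_cong) (simp_all add: tensor_group_sel2)

lemma lact_tensor:
  assumes "bimod L R M" "l \<in> carrier L"
  shows "lact (tensor R M N) l \<in> additive_maps (tensor R M N) (tensor R M N)"
    and "m \<in> carrier M \<Longrightarrow> n \<in> carrier N \<Longrightarrow> lact (tensor R M N) l (pt m n) = pt (lact M l m) n"
proof -
  have eq: "lact (tensor R M N) l = tensor_lift TG (\<lambda>m n. pt (lact M l m) n)"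
    by (simp add: tensor_def)
  note D = left_moduleD[OF bimodD(1)[OF assms(1)]] right_moduleD[OF bimodD(2)[OF assms(1)]]
  have b: "balanced R M N TG (\<lambda>m n. pt (lact M l m) n)"
    by (rule balancedI)
       (use assms in \<open>simp_all add: D pure_add_left pure_add_right pure_balanced[symmetric] bimodD(3)[OF assms(1)]\<close>)
  show "lact (tensor R M N) l \<in> additive_maps (tensor R M N) (tensor R M N)"
    unfolding eq using lift_additive[OF abelian_group_tensor_group b]
    by (simp only: additive_maps_TG)
  show "lact (tensor R M N) l (pt m n) = pt (lact M l m) n" if "m \<in> carrier M" "n \<in> carrier N"
    using lift_pure[OF abelian_group_tensor_group b] that by (simp add: eq)
qed

lemma ract_tensor:
  assumes "bimod R S N" "s \<in> carrier S"
  shows "(\<lambda>t. ract (tensor R M N) t s) \<in> additive_maps (tensor R M N) (tensor R M N)"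
    and "m \<in> carrier M \<Longrightarrow> n \<in> carrier N \<Longrightarrow> ract (tensor R M N) (pt m n) s = pt m (ract N n s)"
proof -
  have eq: "(\<lambda>t. ract (tensor R M N) t s) = tensor_lift TG (\<lambda>m n. pt m (ract N n s))"
    by (simp add: tensor_def fun_eq_iff)
  note D = left_moduleD[OF bimodD(1)[OF assms(1)]] right_moduleD[OF bimodD(2)[OF assms(1)]]
  have b: "balanced R M N TG (\<lambda>m n. pt m (ract N n s))"
    by (rule balancedI)
       (use assms in \<open>simp_all add: D pure_add_left pure_add_right pure_balanced bimodD(3)[OF assms(1)]\<close>)
  show "(\<lambda>t. ract (tensor R M N) t s) \<in> additive_maps (tensor R M N) (tensor R M N)"
    unfolding eq using lift_additive[OF abelian_group_tensor_group b]
    by (simp only: additive_maps_TG)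
  show "ract (tensor R M N) (pt m n) s = pt m (ract N n s)" if "m \<in> carrier M" "n \<in> carrier N"
    using lift_pure[OF abelian_group_tensor_group b] that fun_cong[OF eq] by simp
qed

lemma left_module_tensor:
  assumes "bimod L R M" shows "left_module L (tensor R M N)"
proof -
  interpret T: abelian_group "tensor R M N" by (rule tensor_abelian_group)
  note D = left_moduleD[OF bimodD(1)[OF assms(1)]]
  interpret L: ring L by (rule D(1))
  note la = additive_add[OF lact_tensor(1)[OF assms]] additive_closed[OF lact_tensor(1)[OF assms]]
  show ?thesis
    unfolding left_module_def
  proof (intro conjI ballI)
    fix r s t assume r: "r \<in> carrier L" "s \<in> carrier L" and t: "t \<in> carrier (tensor R M N)"
    show "lact (tensor R M N) (r \<oplus>\<^bsub>L\<^esub> s) t = lact (tensor R M N) r t \<oplus>\<^bsub>tensor R M N\<^esub> lact (tensor R M N) s t"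
      using t r by (induction rule: induct)
        (simp_all add: lact_tensor(2)[OF assms] D la pure_add1 T.a_ac)
    show "lact (tensor R M N) (r \<otimes>\<^bsub>L\<^esub> s) t = lact (tensor R M N) r (lact (tensor R M N) s t)"
      using t r by (induction rule: induct)
        (simp_all add: lact_tensor(2)[OF assms] D la)
  next
    fix t assume "t \<in> carrier (tensor R M N)"
    thus "lact (tensor R M N) \<one>\<^bsub>L\<^esub> t = t"
      by (induction rule: induct) (simp_all add: lact_tensor(2)[OF assms] D la)
  qed (auto simp: la D tensor_abelian_group)
qed

lemma right_module_tensor:
  assumes "bimod R S N" shows "right_module S (tensor R M N)"
proof -
  interpret T: abelian_group "tensor R M N" by (rule tensor_abelian_group)
  note D = right_moduleD[OF bimodD(2)[OF assms(1)]]
  interpret S: ring S by (rule D(1))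
  note la = additive_add[OF ract_tensor(1)[OF assms]] additive_closed[OF ract_tensor(1)[OF assms]]
  show ?thesis
    unfolding right_module_def
  proof (intro conjI ballI)
    fix r s t assume r: "r \<in> carrier S" "s \<in> carrier S" and t: "t \<in> carrier (tensor R M N)"
    show "ract (tensor R M N) t (r \<oplus>\<^bsub>S\<^esub> s) = ract (tensor R M N) t r \<oplus>\<^bsub>tensor R M N\<^esub> ract (tensor R M N) t s"
      using t r by (induction rule: induct)
        (simp_all add: ract_tensor(2)[OF assms] D la pure_add2 T.a_ac)
    show "ract (tensor R M N) t (r \<otimes>\<^bsub>S\<^esub> s) = ract (tensor R M N) (ract (tensor R M N) t r) s"
      using t r by (induction rule: induct)
        (simp_all add: ract_tensor(2)[OF assms] D la)
  next
    fix t assume "t \<in> carrier (tensor R M N)"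
    thus "ract (tensor R M N) t \<one>\<^bsub>S\<^esub> = t"
      by (induction rule: induct) (simp_all add: ract_tensor(2)[OF assms] D la)
  qed (auto simp: la D tensor_abelian_group)
qed

lemma bimod_tensor:
  assumes "bimod L R M" "bimod R S N" shows "bimod L S (tensor R M N)"
  unfolding bimod_def
proof (intro conjI ballI left_module_tensor[OF assms(1)] right_module_tensor[OF assms(2)])
  fix l t s assume "l \<in> carrier L" "t \<in> carrier (tensor R M N)" "s \<in> carrier S"
  from this(2,1,3)
  show "ract (tensor R M N) (lact (tensor R M N) l t) s = lact (tensor R M N) l (ract (tensor R M N) t s)"
    by (induction rule: induct)
       (simp_all add: lact_tensor(2)[OF assms(1)] ract_tensor(2)[OF assms(2)]
          additive_add[OF lact_tensor(1)[OF assms(1)]] additive_closed[OF lact_tensor(1)[OF assms(1)]]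
          additive_add[OF ract_tensor(1)[OF assms(2)]] additive_closed[OF ract_tensor(1)[OF assms(2)]]
          left_moduleD[OF bimodD(1)[OF assms(1)]] right_moduleD[OF bimodD(2)[OF assms(2)]])
qed

end

lemma assoc_additive_pure:
  assumes M: "right_module R M" and N: "bimod R S N" and P: "left_module S P"
  shows "tensor_assoc R S M N P \<in> additive_maps (tensor S (tensor R M N) P) (tensor R M (tensor S N P))"
    and "m \<in> carrier M \<Longrightarrow> n \<in> carrier N \<Longrightarrow> p \<in> carrier P \<Longrightarrow>
      tensor_assoc R S M N P (pure_tensor S (tensor R M N) P (pure_tensor R M N m n) p) =
      pure_tensor R M (tensor S N P) m (pure_tensor S N P n p)"
proof -
  interpret MN: tensor_product R M N using M bimodD(1)[OF N] by (rule tensor_productI)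
  interpret NP: tensor_product S N P using bimodD(2)[OF N] P by (rule tensor_productI)
  interpret M_NP: tensor_product R M "tensor S N P"
    using M NP.left_module_tensor[OF N] by (rule tensor_productI)
  interpret MN_P: tensor_product S "tensor R M N" P
    using P MN.right_module_tensor[OF N] by (intro tensor_productI)
  note G = M_NP.tensor_abelian_group
  let ?G = "tensor R M (tensor S N P)"
  let ?b = "\<lambda>m n p. pure_tensor R M (tensor S N P) m (pure_tensor S N P n p)"
  note DN = left_moduleD[OF bimodD(1)[OF N]] right_moduleD[OF bimodD(2)[OF N]]
  note DP = left_moduleD[OF P]
  have b1: "balanced R M N ?G (\<lambda>m n. ?b m n p)" if "p \<in> carrier P" for p
    by (rule balancedI) (use that in \<open>simp_all add: M_NP.pure_in NP.pure_in M_NP.pure_add1 M_NP.pure_add2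
        NP.pure_add1 M_NP.pure_balanced NP.lact_tensor(2)[OF N]\<close>)
  have b2: "?b m n \<in> additive_maps P ?G" if "m \<in> carrier M" "n \<in> carrier N" for m n
    by (rule additive_mapsI) (use that in \<open>simp_all add: M_NP.pure_in NP.pure_in NP.pure_add2 M_NP.pure_add2\<close>)
  have ab: "abelian_group P" by (rule DP)
  note p1 = MN.lift_additive[OF G b1]
  have bal: "tensor_lift ?G (\<lambda>m n. ?b m n p) (ract (tensor R M N) t s) =
      tensor_lift ?G (\<lambda>m n. ?b m n (lact P s p)) t"
    if t: "t \<in> carrier (tensor R M N)" and s: "s \<in> carrier S" and p: "p \<in> carrier P" for t s p
    using t s p
    by (induction rule: MN.induct)
       (simp_all add: MN.ract_tensor(2)[OF N] MN.lift_pure[OF G b1] DN DP NP.pure_balanced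
         additive_add[OF MN.ract_tensor(1)[OF N]] additive_closed[OF MN.ract_tensor(1)[OF N]]
         additive_add[OF p1])
  have B: "balanced S (tensor R M N) P ?G (\<lambda>t p. tensor_lift ?G (\<lambda>m n. ?b m n p) t)"
    unfolding balanced_def
    by (intro conjI ballI MN.lift_param[OF G b1 b2 ab] p1) (simp_all add: bal)
  show "tensor_assoc R S M N P \<in> additive_maps (tensor S (tensor R M N) P) (tensor R M (tensor S N P))"
    unfolding tensor_assoc_def by (rule MN_P.lift_additive[OF G B])
  show "m \<in> carrier M \<Longrightarrow> n \<in> carrier N \<Longrightarrow> p \<in> carrier P \<Longrightarrow>
      tensor_assoc R S M N P (pure_tensor S (tensor R M N) P (pure_tensor R M N m n) p) =
      pure_tensor R M (tensor S N P) m (pure_tensor S N P n p)"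
    unfolding tensor_assoc_def using MN_P.lift_pure[OF G B] MN.lift_pure[OF G b1] by (simp add: MN.pure_in)
qed

text \<open>
  The underlying group depends on one action of each factor only.  Hence \<open>\<A> \<otimes> \<C>\<close> is the same group
  whether \<open>\<A>\<close> is taken as a vector space or with its left multiplication.
\<close>

lemma tensor_cong_left:
  assumes "carrier M = carrier M'" "add M = add M'" "ract M = ract M'"
  shows "tensor_group R M N = tensor_group R M' N" "pure_tensor R M N = pure_tensor R M' N"
proof -
  have "tensor_null R M N = tensor_null R M' N"
    using assms by (simp add: tensor_null_def tensor_relations_def)
  thus "tensor_group R M N = tensor_group R M' N" "pure_tensor R M N = pure_tensor R M' N"
    using assms by (simp_all add: tensor_group_def pure_tensor_def fun_eq_iff)
qed

lemma tensor_cong_right: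
  assumes "carrier N = carrier N'" "add N = add N'" "lact N = lact N'"
  shows "tensor_group R M N = tensor_group R M N'" "pure_tensor R M N = pure_tensor R M N'"
proof -
  have "tensor_null R M N = tensor_null R M N'"
    using assms by (simp add: tensor_null_def tensor_relations_def)
  thus "tensor_group R M N = tensor_group R M N'" "pure_tensor R M N = pure_tensor R M N'"
    using assms by (simp_all add: tensor_group_def pure_tensor_def fun_eq_iff)
qed

lemma cplx_sel [simp]:
  "carrier cplx = UNIV" "\<one>\<^bsub>cplx\<^esub> = 1" "\<zero>\<^bsub>cplx\<^esub> = 0"
  "x \<otimes>\<^bsub>cplx\<^esub> y = x * y" "x \<oplus>\<^bsub>cplx\<^esub> y = x + y"
  by (simp_all add: ring_of_type_algebra_def)

lemma ring_cplx: "ring cplx"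
  by (rule ring_from_type_algebra)

lemma abelian_group_cplx: "abelian_group cplx"
  using ring_cplx by (rule ring.is_abelian_group)

lemma finsum_cplx: "finite I \<Longrightarrow> finsum cplx g I = sum g I"
proof (induction I rule: finite_induct)
  case (insert i I)
  interpret abelian_group cplx by (rule abelian_group_cplx)
  show ?case using insert by (simp add: Pi_iff)
next
  case empty
  interpret abelian_group cplx by (rule abelian_group_cplx)
  show ?case by simp
qed

text \<open>
  A complex vector space as a bimodule record: both actions are the scalar multiplication.  Then
  the two actions on a tensor product coincide too, and one-sided linearity is two-sided.
\<close>

definition cspace :: "(complex, 'm, complex) bimodule \<Rightarrow> bool" where
  "cspace M \<longleftrightarrow> bimod cplx cplx M \<and> (\<forall>k. \<forall>m\<in>carrier M. ract M m k = lact M k m)"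

lemma cspaceD:
  assumes "cspace M"
  shows "bimod cplx cplx M" "left_module cplx M" "right_module cplx M" "abelian_group M"
    "m \<in> carrier M \<Longrightarrow> ract M m k = lact M k m"
    "m \<in> carrier M \<Longrightarrow> lact M k m \<in> carrier M"
    "m \<in> carrier M \<Longrightarrow> n \<in> carrier M \<Longrightarrow> lact M k (m \<oplus>\<^bsub>M\<^esub> n) = lact M k m \<oplus>\<^bsub>M\<^esub> lact M k n"
    "m \<in> carrier M \<Longrightarrow> lact M (k + l) m = lact M k m \<oplus>\<^bsub>M\<^esub> lact M l m"
    "m \<in> carrier M \<Longrightarrow> lact M (k * l) m = lact M k (lact M l m)"
    "m \<in> carrier M \<Longrightarrow> lact M 1 m = m"
proof -
  have b: "bimod cplx cplx M" using assms by (simp add: cspace_def)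
  note D = left_moduleD[OF bimodD(1)[OF b]]
  show "bimod cplx cplx M" "left_module cplx M" "right_module cplx M" "abelian_group M"
    using b bimodD[OF b] D(2) by blast+
  show "m \<in> carrier M \<Longrightarrow> ract M m k = lact M k m" using assms by (simp add: cspace_def)
  show "m \<in> carrier M \<Longrightarrow> lact M k m \<in> carrier M"
    "m \<in> carrier M \<Longrightarrow> n \<in> carrier M \<Longrightarrow> lact M k (m \<oplus>\<^bsub>M\<^esub> n) = lact M k m \<oplus>\<^bsub>M\<^esub> lact M k n"
    "m \<in> carrier M \<Longrightarrow> lact M (k + l) m = lact M k m \<oplus>\<^bsub>M\<^esub> lact M l m"
    "m \<in> carrier M \<Longrightarrow> lact M (k * l) m = lact M k (lact M l m)"
    "m \<in> carrier M \<Longrightarrow> lact M 1 m = m"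
    using D(3)[of k m] D(4)[of k m n] D(5)[of k l m] D(6)[of k l m] D(7)[of m] by simp_all
qed

lemma cspace_tensor_product: "cspace M \<Longrightarrow> cspace N \<Longrightarrow> tensor_product cplx M N"
  by (rule tensor_productI) (auto dest: cspaceD)

lemma vect_sel [simp]:
  "carrier (vect V) = carrier V" "\<zero>\<^bsub>vect V\<^esub> = \<zero>\<^bsub>V\<^esub>" "add (vect V) = add V"
  "lact (vect V) = (\<lambda>k v. k \<odot>\<^bsub>V\<^esub> v)" "ract (vect V) = (\<lambda>v k. k \<odot>\<^bsub>V\<^esub> v)"
  by (simp_all add: vect_def fun_eq_iff)

lemma cspace_vect:
  assumes "module cplx V" shows "cspace (vect V)"
proof -
  interpret module cplx V by fact
  have "abelian_group (vect V)"
    by (rule abelian_group_cong[OF _ _ _ M.abelian_group_axioms]) simp_all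
  moreover have "k \<odot>\<^bsub>V\<^esub> v \<in> carrier V" if "v \<in> carrier V" for k v
    using that by (intro smult_closed) auto
  moreover have "k \<odot>\<^bsub>V\<^esub> (u \<oplus>\<^bsub>V\<^esub> v) = k \<odot>\<^bsub>V\<^esub> u \<oplus>\<^bsub>V\<^esub> k \<odot>\<^bsub>V\<^esub> v" if "u \<in> carrier V" "v \<in> carrier V" for k u v
    using that by (intro smult_r_distr) auto
  moreover have "(k + l) \<odot>\<^bsub>V\<^esub> v = k \<odot>\<^bsub>V\<^esub> v \<oplus>\<^bsub>V\<^esub> l \<odot>\<^bsub>V\<^esub> v" if "v \<in> carrier V" for k l v
    using that smult_l_distr[of k l v] by simp
  moreover have "(k * l) \<odot>\<^bsub>V\<^esub> v = k \<odot>\<^bsub>V\<^esub> (l \<odot>\<^bsub>V\<^esub> v)" "(k * l) \<odot>\<^bsub>V\<^esub> v = l \<odot>\<^bsub>V\<^esub> (k \<odot>\<^bsub>V\<^esub> v)"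
    if "v \<in> carrier V" for k l v
    using that smult_assoc1[of k l v] smult_assoc1[of l k v] by (simp_all add: mult.commute)
  moreover have "1 \<odot>\<^bsub>V\<^esub> v = v" if "v \<in> carrier V" for v
    using that smult_one[of v] by simp
  ultimately show ?thesis
    unfolding cspace_def bimod_def left_module_def right_module_def
    by (intro conjI ballI allI ring_cplx) simp_all
qed

lemma cspace_tensor:
  assumes M: "cspace M" and N: "cspace N" shows "cspace (M \<otimes>\<^sub>\<complex> N)"
proof -
  interpret tensor_product cplx M N using M N by (rule cspace_tensor_product)
  note b = cspaceD(1)[OF M] cspaceD(1)[OF N]
  have "ract (M \<otimes>\<^sub>\<complex> N) t k = lact (M \<otimes>\<^sub>\<complex> N) k t" if "t \<in> carrier (M \<otimes>\<^sub>\<complex> N)" for t k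
    using that
  proof (induction rule: induct)
    case (pure m n)
    thus ?case
      by (simp add: lact_tensor(2)[OF b(1)] ract_tensor(2)[OF b(2)] cspaceD(5)[OF N]
          pure_balanced[symmetric] cspaceD(5)[OF M])
  next
    case (add s t)
    thus ?case
      by (simp add: additive_add[OF lact_tensor(1)[OF b(1)]] additive_add[OF ract_tensor(1)[OF b(2)]])
  qed
  thus ?thesis using bimod_tensor[OF b] by (simp add: cspace_def)
qed

lemma clinear_right:
  "h \<in> left_linear cplx M N \<Longrightarrow> cspace M \<Longrightarrow> cspace N \<Longrightarrow> h \<in> right_linear cplx M N"
  using cspaceD(5)[of M] cspaceD(5)[of N] additive_closed[OF left_linear_additive, of h cplx M N]
  by (auto simp: left_linear_def right_linear_def)

lemma (in tensor_product) lift_left_linear: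
  assumes b: "bimod L R M" and G: "left_module L G" and \<beta>: "balanced R M N G \<beta>"
    and lin: "\<And>l m n. l \<in> carrier L \<Longrightarrow> m \<in> carrier M \<Longrightarrow> n \<in> carrier N \<Longrightarrow> \<beta> (lact M l m) n = lact G l (\<beta> m n)"
  shows "tensor_lift G \<beta> \<in> left_linear L (tensor R M N) G"
proof -
  note Gab = left_moduleD(2)[OF G]
  note la = lift_additive[OF Gab \<beta>]
  have "tensor_lift G \<beta> (lact (tensor R M N) l t) = lact G l (tensor_lift G \<beta> t)"
    if "t \<in> carrier (tensor R M N)" "l \<in> carrier L" for t l
    using that
    by (induction rule: induct)
       (simp_all add: lact_tensor(2)[OF b] left_moduleD(3)[OF bimodD(1)[OF b]] lift_pure[OF Gab \<beta>] lin
         additive_add[OF lact_tensor(1)[OF b]] additive_closed[OF lact_tensor(1)[OF b]]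
         additive_add[OF la] additive_closed[OF la] left_moduleD(4)[OF G])
  thus ?thesis using la by (simp add: left_linear_def)
qed

lemma (in tensor_product) lift_right_linear:
  assumes b: "bimod R S N" and G: "right_module S G" and \<beta>: "balanced R M N G \<beta>"
    and lin: "\<And>s m n. s \<in> carrier S \<Longrightarrow> m \<in> carrier M \<Longrightarrow> n \<in> carrier N \<Longrightarrow> \<beta> m (ract N n s) = ract G (\<beta> m n) s"
  shows "tensor_lift G \<beta> \<in> right_linear S (tensor R M N) G"
proof -
  note Gab = right_moduleD(2)[OF G]
  note la = lift_additive[OF Gab \<beta>]
  have "tensor_lift G \<beta> (ract (tensor R M N) t s) = ract G (tensor_lift G \<beta> t) s"
    if "t \<in> carrier (tensor R M N)" "s \<in> carrier S" for t s
    using that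
    by (induction rule: induct)
       (simp_all add: ract_tensor(2)[OF b] right_moduleD(3)[OF bimodD(2)[OF b]] lift_pure[OF Gab \<beta>] lin
         additive_add[OF ract_tensor(1)[OF b]] additive_closed[OF ract_tensor(1)[OF b]]
         additive_add[OF la] additive_closed[OF la] right_moduleD(4)[OF G])
  thus ?thesis using la by (simp add: right_linear_def)
qed

section \<open>Vector spaces\<close>

locale complex_space = module cplx V for V :: "(complex, 'v, 'x) module_scheme" (structure)
begin

lemma smult_in [simp]: "x \<in> carrier V \<Longrightarrow> k \<odot> x \<in> carrier V"
  by (rule smult_closed) auto

lemma zero_smult [simp]: "v \<in> carrier V \<Longrightarrow> 0 \<odot> v = \<zero>"
  using smult_l_null[of v] by simp

lemma one_smult [simp]: "v \<in> carrier V \<Longrightarrow> 1 \<odot> v = v"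
  using smult_one[of v] by simp

lemma smult_zero [simp]: "k \<odot> \<zero> = \<zero>"
  by (rule smult_r_null) simp

lemma cspace: "cspace (vect V)" by (rule cspace_vect) unfold_locales

definition linear_form :: "('v \<Rightarrow> complex) \<Rightarrow> bool" where
  "linear_form x \<longleftrightarrow> (\<forall>u\<in>carrier V. \<forall>v\<in>carrier V. x (u \<oplus> v) = x u + x v) \<and>
     (\<forall>k. \<forall>v\<in>carrier V. x (k \<odot> v) = k * x v)"

lemma linear_form_add: "linear_form x \<Longrightarrow> u \<in> carrier V \<Longrightarrow> v \<in> carrier V \<Longrightarrow> x (u \<oplus> v) = x u + x v"
  and linear_form_smult: "linear_form x \<Longrightarrow> v \<in> carrier V \<Longrightarrow> x (k \<odot> v) = k * x v"
  by (simp_all add: linear_form_def)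

lemma linear_form_additive: "linear_form x \<Longrightarrow> x \<in> additive_maps V cplx"
  by (rule additive_mapsI) (simp_all add: linear_form_add)

lemma linear_form_zero: "linear_form x \<Longrightarrow> x \<zero> = 0"
  using additive_zero[OF linear_form_additive M.abelian_group_axioms abelian_group_cplx] by simp

lemma linear_form_sum:
  "linear_form x \<Longrightarrow> finite I \<Longrightarrow> g \<in> I \<rightarrow> carrier V \<Longrightarrow> x (\<Oplus>i\<in>I. g i) = (\<Sum>i\<in>I. x (g i))"
  using additive_finsum[OF linear_form_additive M.abelian_group_axioms abelian_group_cplx, of x I g]
  by (simp add: finsum_cplx)

lemma minus_smult: "v \<in> carrier V \<Longrightarrow> \<ominus> v = (- 1) \<odot> v"
proof (rule M.minus_equality)
  assume v: "v \<in> carrier V"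
  have "(- 1) \<odot> v \<oplus> 1 \<odot> v = (- 1 + 1) \<odot> v"
    using smult_l_distr[of "- 1" 1 v] v by simp
  thus "(- 1) \<odot> v \<oplus> v = \<zero>"
    using v smult_one[of v] smult_l_null[of v] by simp
qed simp_all

lemma submoduleI':
  assumes "H \<subseteq> carrier V" "\<zero> \<in> H" "\<And>a b. a \<in> H \<Longrightarrow> b \<in> H \<Longrightarrow> a \<oplus> b \<in> H"
    "\<And>k a. a \<in> H \<Longrightarrow> k \<odot> a \<in> H"
  shows "submodule H cplx V"
  using assms minus_smult by (intro submoduleI) (auto simp: subset_iff)

lemma submoduleD:
  assumes "submodule E cplx V"
  shows "E \<subseteq> carrier V" "\<zero> \<in> E" "\<And>a b. a \<in> E \<Longrightarrow> b \<in> E \<Longrightarrow> a \<oplus> b \<in> E"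
    "\<And>k a. a \<in> E \<Longrightarrow> k \<odot> a \<in> E"
  using submoduleE[OF assms] subgroup.one_closed[OF submodule.axioms(1)[OF assms]] by auto

lemma submodule_finsum:
  assumes "submodule E cplx V" "finite I" "\<And>i. i \<in> I \<Longrightarrow> g i \<in> E"
  shows "(\<Oplus>i\<in>I. g i) \<in> E"
  using assms(2,3)
proof (induction I)
  case (insert i I)
  thus ?case using submoduleD[OF assms(1)] by (subst M.finsum_insert) auto
qed (use submoduleD[OF assms(1)] in simp)

lemma eq_by_minus: "a \<in> carrier V \<Longrightarrow> b \<in> carrier V \<Longrightarrow> a \<oplus> (- 1) \<odot> b = \<zero> \<Longrightarrow> a = b"
  using M.minus_equality[of a "\<ominus> b"] M.minus_minus[of b] by (simp flip: minus_smult)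

text \<open>
  A linear form separating a vector from a subspace comes from a subspace that is maximal among
  those that avoid the vector: it has codimension one, and the form is the coordinate along \<open>c\<close>.
\<close>

lemma separating_linear_form:
  assumes E: "submodule E cplx V" and c: "c \<in> carrier V" "c \<notin> E"
  obtains x where "linear_form x" "x c = 1" "\<And>v. v \<in> E \<Longrightarrow> x v = 0"
proof -
  let ?A = "{F. submodule F cplx V \<and> E \<subseteq> F \<and> c \<notin> F}"
  have "\<exists>M\<in>?A. \<forall>Y\<in>?A. M \<subseteq> Y \<longrightarrow> Y = M"
  proof (rule subset_Zorn_nonempty)
    show "?A \<noteq> {}" using assms by blast
    fix \<C> assume ne: "\<C> \<noteq> {}" and ch: "subset.chain ?A \<C>"
    hence sub: "submodule F cplx V" "E \<subseteq> F" "c \<notin> F" if "F \<in> \<C>" for F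
      using that by (auto simp: subset.chain_def)
    obtain F\<^sub>0 where F\<^sub>0: "F\<^sub>0 \<in> \<C>" using ne by blast
    have "submodule (\<Union>\<C>) cplx V"
    proof (rule submoduleI')
      show "\<Union>\<C> \<subseteq> carrier V" using submoduleD(1)[OF sub(1)] by (rule Union_least)
      show "\<zero> \<in> \<Union>\<C>" using submoduleD(2)[OF sub(1)[OF F\<^sub>0]] F\<^sub>0 by (rule UnionI[rotated])
      show "k \<odot> a \<in> \<Union>\<C>" if a: "a \<in> \<Union>\<C>" for k a
      proof -
        obtain F where F: "F \<in> \<C>" "a \<in> F" using a by (rule UnionE)
        show ?thesis using F(1) submoduleD(4)[OF sub(1)[OF F(1)] F(2)] by (rule UnionI)
      qed
      fix a b assume "a \<in> \<Union>\<C>" "b \<in> \<Union>\<C>"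
      then obtain F F' where F: "F \<in> \<C>" "F' \<in> \<C>" "a \<in> F" "b \<in> F'" by (elim UnionE)
      have "F \<subseteq> F' \<or> F' \<subseteq> F" using ch F(1,2) unfolding subset_chain_def by blast
      hence "\<exists>G\<in>\<C>. a \<in> G \<and> b \<in> G" using F by (elim disjE) (rule bexI[OF _ F(2)] bexI[OF _ F(1)]; simp add: subset_iff)+
      then obtain G where G: "G \<in> \<C>" "a \<in> G" "b \<in> G" by (elim bexE conjE)
      show "a \<oplus> b \<in> \<Union>\<C>" using G(1) submoduleD(3)[OF sub(1)[OF G(1)] G(2,3)] by (rule UnionI)
    qed
    moreover have "E \<subseteq> \<Union>\<C>" using sub(2)[OF F\<^sub>0] F\<^sub>0 by (auto simp: subset_iff)
    moreover have "c \<notin> \<Union>\<C>" using sub(3) by auto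
    ultimately show "\<Union>\<C> \<in> ?A" by simp
  qed
  then obtain M where MA: "M \<in> ?A" and maxA: "\<forall>Y\<in>?A. M \<subseteq> Y \<longrightarrow> Y = M" by (rule bexE)
  have M: "submodule M cplx V" "E \<subseteq> M" "c \<notin> M" using MA by simp_all
  have max: "Y = M" if "submodule Y cplx V" "M \<subseteq> Y" "c \<notin> Y" for Y
  proof -
    have "Y \<in> ?A" using that M(2) by simp
    thus ?thesis using maxA that(2) by simp
  qed
  note MD = submoduleD[OF M(1)]
  have MC: "m \<in> M \<Longrightarrow> m \<in> carrier V" for m using MD(1) by (rule subsetD)
  have ex: "\<exists>k. v \<oplus> (- k) \<odot> c \<in> M" if v: "v \<in> carrier V" for v
  proof (cases "v \<in> M")
    case True
    thus ?thesis using c v by (intro exI[of _ 0]) simp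
  next
    case False
    let ?Y = "{m \<oplus> k \<odot> v | m k. m \<in> M}"
    have "submodule ?Y cplx V"
    proof (rule submoduleI')
      show "?Y \<subseteq> carrier V" using MC v by auto
      show "\<zero> \<in> ?Y" using MD(2) v by (auto intro!: exI[of _ \<zero>] exI[of _ "0 :: complex"])
      fix a b assume "a \<in> ?Y" "b \<in> ?Y"
      then obtain m k m' k' where *: "a = m \<oplus> k \<odot> v" "b = m' \<oplus> k' \<odot> v" "m \<in> M" "m' \<in> M" by blast
      have "a \<oplus> b = (m \<oplus> m') \<oplus> (k + k') \<odot> v"
        using * v MC smult_l_distr[of k k' v] by (simp add: M.a_ac)
      thus "a \<oplus> b \<in> ?Y" using MD(3)[OF *(3,4)] by (intro CollectI exI conjI)
    next
      fix l a assume "a \<in> ?Y"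
      then obtain m k where *: "a = m \<oplus> k \<odot> v" "m \<in> M" by blast
      have "l \<odot> a = l \<odot> m \<oplus> (l * k) \<odot> v"
        using * v MC smult_r_distr[of l m "k \<odot> v"] smult_assoc1[of l k v] by simp
      thus "l \<odot> a \<in> ?Y" using MD(4)[OF *(2)] by (intro CollectI exI conjI)
    qed
    moreover have "M \<subseteq> ?Y"
    proof
      fix m assume "m \<in> M"
      thus "m \<in> ?Y" using MC v by (auto intro!: exI[of _ m] exI[of _ "0 :: complex"])
    qed
    moreover have "v \<in> ?Y" using v MD(2) by (auto intro!: exI[of _ \<zero>] exI[of _ "1 :: complex"])
    ultimately have "c \<in> ?Y" using max[of ?Y] False by blast
    then obtain m k where mk: "c = m \<oplus> k \<odot> v" "m \<in> M" by blast
    hence k: "k \<noteq> 0" using M(3) MC v by auto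
    have "(1 / k) \<odot> c = (1 / k) \<odot> m \<oplus> v"
      using mk v MC smult_r_distr[of "1 / k" m "k \<odot> v"] smult_assoc1[of "1 / k" k v] k by simp
    hence "(- (1 / k)) \<odot> c = (- (1 / k)) \<odot> m \<oplus> \<ominus> v"
      using mk v MC c smult_assoc1[of "- 1" "1 / k" c] smult_assoc1[of "- 1" "1 / k" m]
        smult_r_distr[of "- 1" "(1 / k) \<odot> m" v] by (simp add: minus_smult)
    hence "v \<oplus> (- (1 / k)) \<odot> c = (- (1 / k)) \<odot> m"
      using MC[OF mk(2)] v by (simp add: M.a_lcomm[of v] M.r_neg)
    thus ?thesis using MD(4)[OF mk(2), of "- (1 / k)"] by (intro exI[of _ "1 / k"]) simp
  qed
  have uniq: "k = l" if kl: "v \<oplus> (- k) \<odot> c \<in> M" "v \<oplus> (- l) \<odot> c \<in> M" and v: "v \<in> carrier V" for v k l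
  proof (rule ccontr)
    assume ne: "k \<noteq> l"
    have "(v \<oplus> (- k) \<odot> c) \<oplus> (- 1) \<odot> (v \<oplus> (- l) \<odot> c) \<in> M"
      by (rule MD(3)[OF kl(1) MD(4)[OF kl(2)]])
    also have "(v \<oplus> (- k) \<odot> c) \<oplus> (- 1) \<odot> (v \<oplus> (- l) \<odot> c) = (l - k) \<odot> c"
    proof -
      have "(- 1) \<odot> (v \<oplus> (- l) \<odot> c) = \<ominus> v \<oplus> l \<odot> c"
        using v c smult_r_distr[of "- 1" v "(- l) \<odot> c"] smult_assoc1[of "- 1" "- l" c]
        by (simp add: minus_smult)
      moreover have "(- k) \<odot> c \<oplus> l \<odot> c = (l - k) \<odot> c"
        using c smult_l_distr[of "- k" l c] by simp
      moreover have "(v \<oplus> (- k) \<odot> c) \<oplus> (\<ominus> v \<oplus> l \<odot> c) = (v \<oplus> \<ominus> v) \<oplus> ((- k) \<odot> c \<oplus> l \<odot> c)"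
        using v c by (simp add: M.a_ac)
      ultimately show ?thesis using v c by (simp add: M.r_neg)
    qed
    finally have "(1 / (l - k)) \<odot> ((l - k) \<odot> c) \<in> M" by (rule MD(4))
    thus False using M(3) c ne smult_assoc1[of "1 / (l - k)" "l - k" c] by simp
  qed
  define x where "x v = (SOME k. v \<oplus> (- k) \<odot> c \<in> M)" for v
  have xM: "v \<oplus> (- x v) \<odot> c \<in> M" if "v \<in> carrier V" for v
    unfolding x_def using someI_ex[OF ex[OF that]] .
  have xI: "x v = k" if "v \<in> carrier V" "v \<oplus> (- k) \<odot> c \<in> M" for v k
    using uniq[OF xM that(2)] that by blast
  show ?thesis
  proof
    show "x c = 1" using c MD(2) minus_smult[of c] by (intro xI) (simp_all add: M.r_neg flip: minus_smult)
    show "x v = 0" if "v \<in> E" for v using that M(2) MC c by (intro xI) auto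
    show "linear_form x"
      unfolding linear_form_def
    proof (intro conjI ballI allI)
      fix u v assume uv: "u \<in> carrier V" "v \<in> carrier V"
      have "(u \<oplus> (- x u) \<odot> c) \<oplus> (v \<oplus> (- x v) \<odot> c) \<in> M" by (rule MD(3)[OF xM[OF uv(1)] xM[OF uv(2)]])
      also have "(u \<oplus> (- x u) \<odot> c) \<oplus> (v \<oplus> (- x v) \<odot> c) = (u \<oplus> v) \<oplus> (- (x u + x v)) \<odot> c"
        using uv c smult_l_distr[of "- x u" "- x v" c] by (simp add: M.a_ac)
      finally show "x (u \<oplus> v) = x u + x v" using uv by (intro xI) auto
    next
      fix k v assume v: "v \<in> carrier V"
      have "k \<odot> (v \<oplus> (- x v) \<odot> c) \<in> M" by (rule MD(4)[OF xM[OF v]])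
      also have "k \<odot> (v \<oplus> (- x v) \<odot> c) = k \<odot> v \<oplus> (- (k * x v)) \<odot> c"
        using v c smult_r_distr[of k v "(- x v) \<odot> c"] smult_assoc1[of k "- x v" c] by simp
      finally show "x (k \<odot> v) = k * x v" using v by (intro xI) auto
    qed
  qed
qed

lemma zero_submodule: "submodule {\<zero>} cplx V"
  by (rule submoduleI') auto

lemma linear_forms_separate:
  assumes "u \<in> carrier V" "v \<in> carrier V" "\<And>x. linear_form x \<Longrightarrow> x u = x v"
  shows "u = v"
proof (rule ccontr)
  assume "u \<noteq> v"
  hence "u \<oplus> (- 1) \<odot> v \<notin> {\<zero>}" using assms eq_by_minus by blast
  then obtain x where x: "linear_form x" "x (u \<oplus> (- 1) \<odot> v) = 1"
    using separating_linear_form[OF zero_submodule, of "u \<oplus> (- 1) \<odot> v"] assms by auto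
  thus False using assms(1,2) assms(3)[OF x(1)] by (simp add: linear_form_add linear_form_smult)
qed

lemma linear_form_diff: "linear_form x \<Longrightarrow> linear_form y \<Longrightarrow> linear_form (\<lambda>v. x v - k * y v)"
  and linear_form_plus: "linear_form x \<Longrightarrow> linear_form y \<Longrightarrow> linear_form (\<lambda>v. x v + y v)"
  and linear_form_scale: "linear_form x \<Longrightarrow> linear_form (\<lambda>v. k * x v)"
  by (simp_all add: linear_form_def algebra_simps)

text \<open>
  A finite set \<open>H\<close> together with linear forms dual to it: a basis of a finite dimensional subspace
  and coordinate functions that are defined on the whole space.
\<close>

definition biorthogonal :: "'v set \<Rightarrow> ('v \<Rightarrow> 'v \<Rightarrow> complex) \<Rightarrow> bool" where
  "biorthogonal H \<chi> \<longleftrightarrow> finite H \<and> H \<subseteq> carrier V \<and> (\<forall>h\<in>H. linear_form (\<chi> h)) \<and>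
     (\<forall>h\<in>H. \<forall>k\<in>H. \<chi> h k = (if h = k then 1 else 0))"

text \<open>Membership of \<open>v\<close> in the span of \<open>H\<close>, expressed by the coordinates that the dual forms assign to \<open>v\<close>.\<close>

definition expands :: "'v set \<Rightarrow> ('v \<Rightarrow> 'v \<Rightarrow> complex) \<Rightarrow> 'v \<Rightarrow> bool" where
  "expands H \<chi> v \<longleftrightarrow> v \<in> carrier V \<and> v = (\<Oplus>h\<in>H. \<chi> h v \<odot> h)"

lemma biorthogonalD:
  assumes "biorthogonal H \<chi>"
  shows "finite H" "H \<subseteq> carrier V" "h \<in> H \<Longrightarrow> h \<in> carrier V" "h \<in> H \<Longrightarrow> linear_form (\<chi> h)"
    "h \<in> H \<Longrightarrow> k \<in> H \<Longrightarrow> \<chi> h k = (if h = k then 1 else 0)"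
  using assms by (auto simp: biorthogonal_def)

lemma smult_sum: "finite I \<Longrightarrow> g \<in> I \<rightarrow> carrier V \<Longrightarrow> k \<odot> (\<Oplus>i\<in>I. g i) = (\<Oplus>i\<in>I. k \<odot> g i)"
  by (rule finsum_smult_ldistr) auto

lemma expands_submodule:
  assumes b: "biorthogonal H \<chi>" shows "submodule {v. expands H \<chi> v} cplx V"
proof (rule submoduleI')
  note D = biorthogonalD[OF b]
  show "{v. expands H \<chi> v} \<subseteq> carrier V" by (auto simp: expands_def)
  have "(\<Oplus>h\<in>H. \<chi> h \<zero> \<odot> h) = (\<Oplus>h\<in>H. \<zero>)"
    using D(3,4) by (intro M.finsum_cong') (auto simp: linear_form_zero)
  thus "\<zero> \<in> {v. expands H \<chi> v}" by (simp add: expands_def)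
  fix a v assume "a \<in> {v. expands H \<chi> v}"
  hence a: "a \<in> carrier V" "(\<Oplus>h\<in>H. \<chi> h a \<odot> h) = a" by (simp_all add: expands_def)
  {
    assume "v \<in> {v. expands H \<chi> v}"
    hence v: "v \<in> carrier V" "(\<Oplus>h\<in>H. \<chi> h v \<odot> h) = v" by (simp_all add: expands_def)
    have "(\<Oplus>h\<in>H. \<chi> h (a \<oplus> v) \<odot> h) = (\<Oplus>h\<in>H. \<chi> h a \<odot> h \<oplus> \<chi> h v \<odot> h)"
      using D(3,4) a(1) v(1) smult_l_distr by (intro M.finsum_cong') (auto simp: linear_form_add)
    also have "\<dots> = a \<oplus> v"
      using D(3) a v by (subst M.finsum_addf) (auto simp: Pi_iff)
    finally show "a \<oplus> v \<in> {v. expands H \<chi> v}" using a v by (simp add: expands_def)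
  }
  fix k
  have "(\<Oplus>h\<in>H. \<chi> h (k \<odot> a) \<odot> h) = (\<Oplus>h\<in>H. k \<odot> (\<chi> h a \<odot> h))"
    using D(3,4) a(1) smult_assoc1 by (intro M.finsum_cong') (auto simp: linear_form_smult)
  also have "\<dots> = k \<odot> (\<Oplus>h\<in>H. \<chi> h a \<odot> h)"
    using D(1,3) by (intro smult_sum[symmetric]) auto
  finally show "k \<odot> a \<in> {v. expands H \<chi> v}" using a by (simp add: expands_def)
qed

lemma expands_base:
  assumes b: "biorthogonal H \<chi>" and h: "h \<in> H" shows "expands H \<chi> h"
proof -
  note D = biorthogonalD[OF b]
  have "(\<Oplus>k\<in>H. \<chi> k h \<odot> k) = (\<Oplus>k\<in>H. if h = k then k else \<zero>)"
    using D h by (intro M.finsum_cong') auto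
  also have "\<dots> = h" using D h by (intro M.finsum_singleton) auto
  finally show ?thesis using D h by (simp add: expands_def)
qed

text \<open>
  A Gram-Schmidt step extends the system by a vector \<open>w\<close> outside its span: a linear form that
  vanishes on the span and is 1 at \<open>w\<close> serves as the new dual form and corrects the old ones.
\<close>

lemma biorthogonal_exists:
  assumes "finite W" "W \<subseteq> carrier V"
  shows "\<exists>H \<chi>. biorthogonal H \<chi> \<and> H \<subseteq> W \<and> (\<forall>w\<in>W. expands H \<chi> w)"
  using assms
proof (induction W)
  case empty
  have "biorthogonal {} (\<lambda>_ _. 0)" by (simp add: biorthogonal_def)
  thus ?case by blast
next
  case (insert w W)
  then obtain H \<chi> where b: "biorthogonal H \<chi>" and HW: "H \<subseteq> W" and ex: "\<forall>w\<in>W. expands H \<chi> w"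
    by auto
  have w: "w \<in> carrier V" using insert by simp
  note D = biorthogonalD[OF b]
  show ?case
  proof (cases "expands H \<chi> w")
    case True
    thus ?thesis using b HW ex by (intro exI[of _ H] exI[of _ \<chi>]) auto
  next
    case False
    then obtain x where x: "linear_form x" "x w = 1" "\<And>v. v \<in> {v. expands H \<chi> v} \<Longrightarrow> x v = 0"
      using separating_linear_form[OF expands_submodule[OF b] w] by auto
    have wH: "w \<notin> H" using expands_base[OF b] False by auto
    have xH: "x h = 0" if "h \<in> H" for h using x(3) expands_base[OF b that] by simp
    define \<chi>' where "\<chi>' h = (if h = w then x else (\<lambda>v. \<chi> h v - \<chi> h w * x v))" for h
    have b': "biorthogonal (insert w H) \<chi>'"
      unfolding biorthogonal_def
    proof (intro conjI ballI)
      show "finite (insert w H)" "insert w H \<subseteq> carrier V" using D w by auto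
      fix h assume h: "h \<in> insert w H"
      show "linear_form (\<chi>' h)"
        using D(4)[of h] x(1) h linear_form_diff[of "\<chi> h" x "\<chi> h w"] by (auto simp: \<chi>'_def)
      fix k assume k: "k \<in> insert w H"
      show "\<chi>' h k = (if h = k then 1 else 0)"
        using h k wH D(5)[of h k] by (auto simp: \<chi>'_def x(2) xH)
    qed
    have "expands (insert w H) \<chi>' v" if v: "expands H \<chi> v" for v
    proof -
      have vc: "v \<in> carrier V" "x v = 0" using v x(3) by (simp_all add: expands_def)
      have "(\<Oplus>h\<in>insert w H. \<chi>' h v \<odot> h) = \<chi>' w v \<odot> w \<oplus> (\<Oplus>h\<in>H. \<chi>' h v \<odot> h)"
        using D(1,3) wH w by (intro M.finsum_insert) auto
      also have "(\<Oplus>h\<in>H. \<chi>' h v \<odot> h) = (\<Oplus>h\<in>H. \<chi> h v \<odot> h)"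
        using D(3) wH vc by (intro M.finsum_cong') (auto simp: \<chi>'_def)
      also have "\<dots> = v" using v by (simp add: expands_def)
      finally show ?thesis using vc w by (simp add: expands_def \<chi>'_def)
    qed
    hence "\<forall>v\<in>insert w W. expands (insert w H) \<chi>' v"
      using ex expands_base[OF b', of w] by simp
    thus ?thesis using b' HW by (intro exI[of _ "insert w H"] exI[of _ \<chi>']) auto
  qed
qed

subsection \<open>Slices of tensors\<close>

abbreviation VV where "VV \<equiv> vect V \<otimes>\<^sub>\<complex> vect V"
abbreviation pv where "pv \<equiv> pure_tensor cplx (vect V) (vect V)"

text \<open>
  The slices \<open>(x \<otimes> id) t\<close> and \<open>(id \<otimes> y) t\<close> of a tensor by linear forms.  They turn statements on
  tensors into statements on vectors.
\<close>

definition slice_left :: "('v \<Rightarrow> complex) \<Rightarrow> ('v, 'v) tens \<Rightarrow> 'v" where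
  "slice_left x = tensor_lift V (\<lambda>u v. x u \<odot> v)"

definition slice_right :: "('v \<Rightarrow> complex) \<Rightarrow> ('v, 'v) tens \<Rightarrow> 'v" where
  "slice_right y = tensor_lift V (\<lambda>u v. y v \<odot> u)"

sublocale VV: tensor_product cplx "vect V" "vect V"
  using cspace cspace by (rule cspace_tensor_product)

lemma balanced_slices:
  assumes "linear_form x"
  shows "balanced cplx (vect V) (vect V) V (\<lambda>u v. x u \<odot> v)"
    and "balanced cplx (vect V) (vect V) V (\<lambda>u v. x v \<odot> u)"
  using assms smult_l_distr smult_r_distr
  by (auto intro!: balancedI simp: linear_form_add linear_form_smult mult.commute simp flip: smult_assoc1)

lemma slices_additive:
  assumes "linear_form x"
  shows "slice_left x \<in> additive_maps VV V" "slice_right x \<in> additive_maps VV V"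
  unfolding slice_left_def slice_right_def
  using balanced_slices[OF assms] by (auto intro: VV.lift_additive[OF M.abelian_group_axioms])

lemma slices_pure [simp]:
  assumes "linear_form x" "u \<in> carrier V" "v \<in> carrier V"
  shows "slice_left x (pv u v) = x u \<odot> v" "slice_right x (pv u v) = x v \<odot> u"
  unfolding slice_left_def slice_right_def
  using balanced_slices[OF assms(1)] assms(2,3)
  by (simp_all add: VV.lift_pure[OF M.abelian_group_axioms])

lemma slices_add:
  assumes "linear_form x" "s \<in> carrier VV" "t \<in> carrier VV"
  shows "slice_left x (s \<oplus>\<^bsub>VV\<^esub> t) = slice_left x s \<oplus> slice_left x t"
    "slice_right x (s \<oplus>\<^bsub>VV\<^esub> t) = slice_right x s \<oplus> slice_right x t"
  using slices_additive[OF assms(1)] assms(2,3) by (simp_all add: additive_add)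

lemma slices_in [simp]:
  assumes "linear_form x" "t \<in> carrier VV"
  shows "slice_left x t \<in> carrier V" "slice_right x t \<in> carrier V"
  using slices_additive[OF assms(1)] assms(2) by (simp_all add: additive_closed)

lemma slices_linear_left:
  assumes x: "linear_form x" "linear_form y" and t: "t \<in> carrier VV"
  shows "slice_left (\<lambda>v. x v + y v) t = slice_left x t \<oplus> slice_left y t"
    and "slice_left (\<lambda>v. k * x v) t = k \<odot> slice_left x t"
proof -
  note L = linear_form_plus[OF x] linear_form_scale[OF x(1)]
  show "slice_left (\<lambda>v. x v + y v) t = slice_left x t \<oplus> slice_left y t"
    using t
  proof (induction rule: VV.induct)
    case (pure u v)
    thus ?case using L x smult_l_distr[of "x u" "y u" v] by simp
  next
    case (add s t)
    thus ?case using L x by (simp add: slices_add M.a_ac)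
  qed
  show "slice_left (\<lambda>v. k * x v) t = k \<odot> slice_left x t"
    using t
  proof (induction rule: VV.induct)
    case (pure u v)
    thus ?case using L x smult_assoc1[of k "x u" v] by simp
  next
    case (add s t)
    thus ?case using L x smult_r_distr by (simp add: slices_add)
  qed
qed

lemma slices_commute:
  assumes x: "linear_form x" "linear_form y" and t: "t \<in> carrier VV"
  shows "y (slice_left x t) = x (slice_right y t)"
  using t
  by (induction rule: VV.induct) (simp_all add: x slices_add linear_form_add linear_form_smult mult.commute)

lemma slices_smult:
  assumes x: "linear_form x" and t: "t \<in> carrier VV"
  shows "slice_left x (lact VV k t) = k \<odot> slice_left x t" "slice_right x (lact VV k t) = k \<odot> slice_right x t"
proof -
  note b = cspaceD(1)[OF cspace]
  note l = VV.lact_tensor(1)[OF b] VV.lact_tensor(2)[OF b]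
  have "slice_left x (lact VV k t) = k \<odot> slice_left x t \<and> slice_right x (lact VV k t) = k \<odot> slice_right x t"
    using t
  proof (induction rule: VV.induct)
    case (pure u v)
    thus ?case using x smult_assoc1[of k "x u" v] smult_assoc1[of k "x v" u] smult_assoc1[of "x v" k u]
      by (simp add: l(2) linear_form_smult mult.commute)
  next
    case (add s t)
    thus ?case using x smult_r_distr additive_closed[OF l(1)] by (simp add: slices_add additive_add[OF l(1)])
  qed
  thus "slice_left x (lact VV k t) = k \<odot> slice_left x t" "slice_right x (lact VV k t) = k \<odot> slice_right x t"
    by simp_all
qed

lemma VV_abelian: "abelian_group VV" by (rule VV.tensor_abelian_group)

text \<open>
  The finite set \<open>W\<close> collects the left factors of some representation of the tensor; a biorthogonal
  system expands the tensor as soon as it expands these.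
\<close>

lemma tensor_expansion_support:
  assumes "t \<in> carrier VV"
  shows "\<exists>W. finite W \<and> W \<subseteq> carrier V \<and> (\<forall>H \<chi>. biorthogonal H \<chi> \<longrightarrow> (\<forall>w\<in>W. expands H \<chi> w) \<longrightarrow>
     t = (\<Oplus>\<^bsub>VV\<^esub>h\<in>H. pv h (slice_left (\<chi> h) t)))"
  using assms
proof (induction rule: VV.induct)
  case (pure u v)
  hence uv: "u \<in> carrier V" "v \<in> carrier V" by simp_all
  have "pv u v = (\<Oplus>\<^bsub>VV\<^esub>h\<in>H. pv h (slice_left (\<chi> h) (pv u v)))"
    if b: "biorthogonal H \<chi>" and ex: "expands H \<chi> u" for H \<chi>
  proof -
    note D = biorthogonalD[OF b]
    have add: "(\<lambda>u. pv u v) \<in> additive_maps V VV"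
      using uv by (intro additive_mapsI) (simp_all add: VV.pure_in VV.pure_add1[simplified])
    have "pv u v = pv (\<Oplus>h\<in>H. \<chi> h u \<odot> h) v" using ex by (simp add: expands_def)
    also have "\<dots> = (\<Oplus>\<^bsub>VV\<^esub>h\<in>H. pv (\<chi> h u \<odot> h) v)"
      using D by (intro additive_finsum[OF add M.abelian_group_axioms VV_abelian]) auto
    also have "\<dots> = (\<Oplus>\<^bsub>VV\<^esub>h\<in>H. pv h (slice_left (\<chi> h) (pv u v)))"
    proof (rule abelian_monoid.finsum_cong'[OF abelian_group.axioms(1)[OF VV_abelian] refl])
      show "(\<lambda>h. pv h (slice_left (\<chi> h) (pv u v))) \<in> H \<rightarrow> carrier VV"
        using D uv by (auto intro!: VV.pure_in)
      fix h assume "h \<in> H"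
      thus "pv (\<chi> h u \<odot> h) v = pv h (slice_left (\<chi> h) (pv u v))"
        using D uv VV.pure_balanced[of h "\<chi> h u" v] by simp
    qed
    finally show ?thesis .
  qed
  thus ?case using uv by (intro exI[of _ "{u}"]) auto
next
  case (add s t)
  obtain W W' where W: "finite W" "W \<subseteq> carrier V" "finite W'" "W' \<subseteq> carrier V"
    and e: "\<forall>H \<chi>. biorthogonal H \<chi> \<longrightarrow> (\<forall>w\<in>W. expands H \<chi> w) \<longrightarrow> s = (\<Oplus>\<^bsub>VV\<^esub>h\<in>H. pv h (slice_left (\<chi> h) s))"
     "\<forall>H \<chi>. biorthogonal H \<chi> \<longrightarrow> (\<forall>w\<in>W'. expands H \<chi> w) \<longrightarrow> t = (\<Oplus>\<^bsub>VV\<^esub>h\<in>H. pv h (slice_left (\<chi> h) t))"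
    using add by auto
  interpret A: abelian_group VV by (rule VV_abelian)
  have "s \<oplus>\<^bsub>VV\<^esub> t = (\<Oplus>\<^bsub>VV\<^esub>h\<in>H. pv h (slice_left (\<chi> h) (s \<oplus>\<^bsub>VV\<^esub> t)))"
    if b: "biorthogonal H \<chi>" and ex: "\<forall>w\<in>W \<union> W'. expands H \<chi> w" for H \<chi>
  proof -
    note D = biorthogonalD[OF b]
    have "(\<Oplus>\<^bsub>VV\<^esub>h\<in>H. pv h (slice_left (\<chi> h) (s \<oplus>\<^bsub>VV\<^esub> t))) =
        (\<Oplus>\<^bsub>VV\<^esub>h\<in>H. pv h (slice_left (\<chi> h) s) \<oplus>\<^bsub>VV\<^esub> pv h (slice_left (\<chi> h) t))"
      using D add(1,2) by (intro A.finsum_cong')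
        (auto intro!: A.a_closed VV.pure_in simp: slices_add VV.pure_add2[simplified])
    also have "\<dots> = (\<Oplus>\<^bsub>VV\<^esub>h\<in>H. pv h (slice_left (\<chi> h) s)) \<oplus>\<^bsub>VV\<^esub> (\<Oplus>\<^bsub>VV\<^esub>h\<in>H. pv h (slice_left (\<chi> h) t))"
      using D add(1,2) by (intro A.finsum_addf) (auto intro!: VV.pure_in)
    also have "\<dots> = s \<oplus>\<^bsub>VV\<^esub> t"
    proof -
      have ex': "\<forall>w\<in>W. expands H \<chi> w" "\<forall>w\<in>W'. expands H \<chi> w" using ex by auto
      show ?thesis
        by (rule arg_cong2[where f = "add VV", OF sym sym])
           (rule e(1)[THEN spec, THEN spec, THEN mp, THEN mp, OF b ex'(1)]
              e(2)[THEN spec, THEN spec, THEN mp, THEN mp, OF b ex'(2)])+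
    qed
    finally show ?thesis by (rule sym)
  qed
  thus ?case using W by (intro exI[of _ "W \<union> W'"]) auto
qed

lemma tensor_expansion:
  assumes t: "t \<in> carrier VV"
  obtains H \<chi> where "biorthogonal H \<chi>" "t = (\<Oplus>\<^bsub>VV\<^esub>h\<in>H. pv h (slice_left (\<chi> h) t))"
proof -
  obtain W where W: "finite W" "W \<subseteq> carrier V" and
    e: "\<forall>H \<chi>. biorthogonal H \<chi> \<longrightarrow> (\<forall>w\<in>W. expands H \<chi> w) \<longrightarrow> t = (\<Oplus>\<^bsub>VV\<^esub>h\<in>H. pv h (slice_left (\<chi> h) t))"
    using tensor_expansion_support[OF t] by auto
  obtain H \<chi> where "biorthogonal H \<chi>" "\<forall>w\<in>W. expands H \<chi> w"
    using biorthogonal_exists[OF W] by auto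
  thus ?thesis using that e by simp
qed

text \<open>A tensor whose left slices lie in the span of \<open>K\<close> has a representation with right factors in \<open>K\<close>.\<close>

lemma tensor_expansion_right:
  assumes t: "t \<in> carrier VV" and b: "biorthogonal K \<kappa>"
    and ex: "\<And>x. linear_form x \<Longrightarrow> expands K \<kappa> (slice_left x t)"
  shows "t = (\<Oplus>\<^bsub>VV\<^esub>k\<in>K. pv (slice_right (\<kappa> k) t) k)"
proof -
  interpret A: abelian_group VV by (rule VV_abelian)
  note D = biorthogonalD[OF b]
  let ?Q = "\<lambda>s. \<Oplus>\<^bsub>VV\<^esub>k\<in>K. pv (slice_right (\<kappa> k) s) k"
  have Q: "?Q \<in> additive_maps VV VV"
  proof (rule additive_mapsI)
    fix s assume s: "s \<in> carrier VV"
    show "?Q s \<in> carrier VV" using D s by (auto intro!: A.finsum_closed VV.pure_in)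
    fix s' assume s': "s' \<in> carrier VV"
    have "?Q (s \<oplus>\<^bsub>VV\<^esub> s') = (\<Oplus>\<^bsub>VV\<^esub>k\<in>K. pv (slice_right (\<kappa> k) s) k \<oplus>\<^bsub>VV\<^esub> pv (slice_right (\<kappa> k) s') k)"
      using D s s' by (intro A.finsum_cong')
        (auto intro!: A.a_closed VV.pure_in simp: slices_add VV.pure_add1[simplified])
    also have "\<dots> = ?Q s \<oplus>\<^bsub>VV\<^esub> ?Q s'"
      using D s s' by (intro A.finsum_addf) (auto intro!: VV.pure_in)
    finally show "?Q (s \<oplus>\<^bsub>VV\<^esub> s') = ?Q s \<oplus>\<^bsub>VV\<^esub> ?Q s'" .
  qed
  have Qp: "?Q (pv u v) = pv u v" if u: "u \<in> carrier V" and v: "expands K \<kappa> v" for u v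
  proof -
    have vc: "v \<in> carrier V" "(\<Oplus>k\<in>K. \<kappa> k v \<odot> k) = v" using v by (simp_all add: expands_def)
    have add: "pv u \<in> additive_maps V VV"
      using u by (intro additive_mapsI) (simp_all add: VV.pure_in VV.pure_add2[simplified])
    have "?Q (pv u v) = (\<Oplus>\<^bsub>VV\<^esub>k\<in>K. pv u (\<kappa> k v \<odot> k))"
    proof (rule A.finsum_cong'[OF refl])
      show "(\<lambda>k. pv u (\<kappa> k v \<odot> k)) \<in> K \<rightarrow> carrier VV" using D u by (auto intro!: VV.pure_in)
      fix k assume "k \<in> K"
      thus "pv (slice_right (\<kappa> k) (pv u v)) k = pv u (\<kappa> k v \<odot> k)"
        using D u vc VV.pure_balanced[of u "\<kappa> k v" k] by simp
    qed
    also have "\<dots> = pv u (\<Oplus>k\<in>K. \<kappa> k v \<odot> k)"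
      using D by (intro additive_finsum[OF add M.abelian_group_axioms VV_abelian, symmetric]) auto
    finally show ?thesis using vc by simp
  qed
  obtain H \<chi> where bH: "biorthogonal H \<chi>" and tH: "t = (\<Oplus>\<^bsub>VV\<^esub>h\<in>H. pv h (slice_left (\<chi> h) t))"
    using tensor_expansion[OF t] by auto
  note DH = biorthogonalD[OF bH]
  have "?Q t = ?Q (\<Oplus>\<^bsub>VV\<^esub>h\<in>H. pv h (slice_left (\<chi> h) t))" using tH by simp
  also have "\<dots> = (\<Oplus>\<^bsub>VV\<^esub>h\<in>H. ?Q (pv h (slice_left (\<chi> h) t)))"
    using DH t by (intro additive_finsum[OF Q VV_abelian VV_abelian]) (auto intro!: VV.pure_in)
  also have "\<dots> = (\<Oplus>\<^bsub>VV\<^esub>h\<in>H. pv h (slice_left (\<chi> h) t))"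
    using DH t ex by (intro A.finsum_cong'[OF refl]) (auto intro!: VV.pure_in simp: Qp)
  also have "\<dots> = t" using tH by (rule sym)
  finally show ?thesis by (rule sym)
qed

lemma slice_left_expansion:
  assumes t: "t \<in> carrier VV" and b: "biorthogonal H \<chi>"
    and e: "t = (\<Oplus>\<^bsub>VV\<^esub>h\<in>H. pv h (slice_left (\<chi> h) t))" and x: "linear_form x"
  shows "slice_left x t = (\<Oplus>h\<in>H. x h \<odot> slice_left (\<chi> h) t)"
proof -
  note D = biorthogonalD[OF b]
  have g: "(\<lambda>h. pv h (slice_left (\<chi> h) t)) \<in> H \<rightarrow> carrier VV"
    using D t by (auto intro!: VV.pure_in)
  have "slice_left x t = slice_left x (\<Oplus>\<^bsub>VV\<^esub>h\<in>H. pv h (slice_left (\<chi> h) t))" using e by simp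
  also have "\<dots> = (\<Oplus>h\<in>H. slice_left x (pv h (slice_left (\<chi> h) t)))"
    by (rule additive_finsum[OF slices_additive(1)[OF x] VV_abelian M.abelian_group_axioms D(1) g])
  also have "\<dots> = (\<Oplus>h\<in>H. x h \<odot> slice_left (\<chi> h) t)"
    using D x t by (intro M.finsum_cong'[OF refl]) auto
  finally show ?thesis .
qed

lemma slice_right_expansion:
  assumes t: "t \<in> carrier VV" and b: "biorthogonal K \<kappa>"
    and e: "t = (\<Oplus>\<^bsub>VV\<^esub>k\<in>K. pv (slice_right (\<kappa> k) t) k)" and y: "linear_form y"
  shows "slice_right y t = (\<Oplus>k\<in>K. y k \<odot> slice_right (\<kappa> k) t)"
proof -
  note D = biorthogonalD[OF b]
  have g: "(\<lambda>k. pv (slice_right (\<kappa> k) t) k) \<in> K \<rightarrow> carrier VV"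
    using D t by (auto intro!: VV.pure_in)
  have "slice_right y t = slice_right y (\<Oplus>\<^bsub>VV\<^esub>k\<in>K. pv (slice_right (\<kappa> k) t) k)" using e by simp
  also have "\<dots> = (\<Oplus>k\<in>K. slice_right y (pv (slice_right (\<kappa> k) t) k))"
    by (rule additive_finsum[OF slices_additive(2)[OF y] VV_abelian M.abelian_group_axioms D(1) g])
  also have "\<dots> = (\<Oplus>k\<in>K. y k \<odot> slice_right (\<kappa> k) t)"
    using D y t by (intro M.finsum_cong'[OF refl]) auto
  finally show ?thesis .
qed

end

section \<open>Coalgebras\<close>

locale complex_coalgebra =
  fixes C :: "'c coalgebra" (structure)
  assumes coalgebra: "is_coalgebra C"
begin

sublocale complex_space C
  using coalgebra by (simp add: complex_space_def is_coalgebra_def)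

abbreviation "\<Delta> \<equiv> comult C"
abbreviation "\<epsilon> \<equiv> counit C"
text \<open>
  The actions of linear forms on the coalgebra, \<open>L x c = \<Sum> x(c\<^sub>1) c\<^sub>2\<close> and \<open>R y c = \<Sum> c\<^sub>1 y(c\<^sub>2)\<close>.  The
  space of linear forms is an algebra under convolution; \<open>L\<close> is a right and \<open>R\<close> a left action of it.
\<close>

abbreviation L where "L x c \<equiv> slice_left x (\<Delta> c)"
abbreviation R where "R y c \<equiv> slice_right y (\<Delta> c)"

lemma comult_linear: "\<Delta> \<in> left_linear cplx (vect C) VV"
  using coalgebra by (simp add: is_coalgebra_def)

lemma comult_in [simp]: "c \<in> carrier C \<Longrightarrow> \<Delta> c \<in> carrier VV"
  using additive_closed[OF left_linear_additive[OF comult_linear]] by simp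

lemma comult_add: "c \<in> carrier C \<Longrightarrow> d \<in> carrier C \<Longrightarrow> \<Delta> (c \<oplus> d) = \<Delta> c \<oplus>\<^bsub>VV\<^esub> \<Delta> d"
  using additive_add[OF left_linear_additive[OF comult_linear], of c d] by simp

lemma comult_smult: "c \<in> carrier C \<Longrightarrow> \<Delta> (k \<odot> c) = lact VV k (\<Delta> c)"
  using left_linear_act[OF comult_linear, of k c] by simp

lemma L_add: "linear_form x \<Longrightarrow> c \<in> carrier C \<Longrightarrow> d \<in> carrier C \<Longrightarrow> L x (c \<oplus> d) = L x c \<oplus> L x d"
  and R_add: "linear_form x \<Longrightarrow> c \<in> carrier C \<Longrightarrow> d \<in> carrier C \<Longrightarrow> R x (c \<oplus> d) = R x c \<oplus> R x d"
  and L_smult: "linear_form x \<Longrightarrow> c \<in> carrier C \<Longrightarrow> L x (k \<odot> c) = k \<odot> L x c"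
  and R_smult: "linear_form x \<Longrightarrow> c \<in> carrier C \<Longrightarrow> R x (k \<odot> c) = k \<odot> R x c"
  by (simp_all add: comult_add comult_smult slices_add slices_smult)

lemma L_additive: "linear_form x \<Longrightarrow> L x \<in> additive_maps C C"
  and R_additive: "linear_form x \<Longrightarrow> R x \<in> additive_maps C C"
  by (auto intro!: additive_mapsI simp: L_add R_add)

lemma linear_form_L: "linear_form z \<Longrightarrow> linear_form x \<Longrightarrow> linear_form (\<lambda>v. z (L x v))"
  and linear_form_R: "linear_form z \<Longrightarrow> linear_form x \<Longrightarrow> linear_form (\<lambda>v. z (R x v))"
  by (simp_all add: linear_form_def L_add R_add L_smult R_smult)

lemma L_R_adjoint: "linear_form x \<Longrightarrow> linear_form y \<Longrightarrow> c \<in> carrier C \<Longrightarrow> y (L x c) = x (R y c)"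
  by (simp add: slices_commute)

lemma linear_form_counit: "linear_form \<epsilon>"
proof -
  have "\<epsilon> \<in> left_linear cplx (vect C) (regular cplx)" using coalgebra by (simp add: is_coalgebra_def)
  thus ?thesis
    by (auto simp: linear_form_def left_linear_def additive_maps_def hom_def regular_def)
qed

lemma L_counit: "c \<in> carrier C \<Longrightarrow> L \<epsilon> c = c"
  and R_counit: "c \<in> carrier C \<Longrightarrow> R \<epsilon> c = c"
  using coalgebra by (simp_all add: is_coalgebra_def slice_left_def slice_right_def)

text \<open>This is coassociativity: both sides are \<open>\<Sum> x(c\<^sub>1) c\<^sub>2 y(c\<^sub>3)\<close>.\<close>

lemma L_R_commute:
  assumes x: "linear_form x" and y: "linear_form y" and c: "c \<in> carrier C"
  shows "R y (L x c) = L x (R y c)"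
proof -
  let ?C = "vect C"
  note cs = cspace cspace_tensor[OF cspace cspace]
  interpret C_CC: tensor_product cplx ?C VV using cs by (rule cspace_tensor_product)
  interpret CC_C: tensor_product cplx VV ?C using cs(2,1) by (rule cspace_tensor_product)
  define \<Phi> where "\<Phi> = tensor_lift C (\<lambda>u s. x u \<odot> slice_right y s)"
  have bal: "balanced cplx ?C VV C (\<lambda>u s. x u \<odot> slice_right y s)"
    using x y smult_l_distr smult_r_distr smult_assoc1[of "_" "_"]
    by (intro balancedI) (auto simp: slices_add slices_smult linear_form_add linear_form_smult mult.commute simp flip: smult_assoc1)
  have \<Phi>: "\<Phi> \<in> additive_maps (?C \<otimes>\<^sub>\<complex> VV) C"
    unfolding \<Phi>_def by (rule C_CC.lift_additive[OF M.abelian_group_axioms bal])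
  have \<Phi>p: "\<Phi> (pure_tensor cplx ?C VV u s) = x u \<odot> slice_right y s" if "u \<in> carrier C" "s \<in> carrier VV" for u s
    unfolding \<Phi>_def using that by (simp add: C_CC.lift_pure[OF M.abelian_group_axioms bal])
  note as = assoc_additive_pure[OF cspaceD(3)[OF cspace] cspaceD(1)[OF cspace] cspaceD(2)[OF cspace]]
  note \<Delta>r = clinear_right[OF comult_linear cs]
  note m1 = CC_C.tensor_product_axioms
  note ml = VV.map_additive_pure[OF CC_C.tensor_product_axioms \<Delta>r left_linear_id]
  note mr = VV.map_additive_pure[OF C_CC.tensor_product_axioms right_linear_id comult_linear]
  have left: "\<Phi> (tensor_assoc cplx cplx ?C ?C ?C (tensor_map cplx VV ?C \<Delta> (\<lambda>x. x) t)) = L x (slice_right y t)"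
    if "t \<in> carrier VV" for t
    using that
  proof (induction rule: VV.induct)
    case (pure u v)
    hence uv: "u \<in> carrier C" "v \<in> carrier C" by simp_all
    have "\<Phi> (tensor_assoc cplx cplx ?C ?C ?C (pure_tensor cplx VV ?C s v)) = y v \<odot> slice_left x s"
      if "s \<in> carrier VV" for s
      using that
    proof (induction rule: VV.induct)
      case (pure a b)
      thus ?case using uv x y smult_assoc1[of "x a" "y v" b] smult_assoc1[of "y v" "x a" b]
        by (simp add: as(2) \<Phi>p VV.pure_in mult.commute)
    next
      case (add s s')
      thus ?case using uv x y smult_r_distr
        by (simp add: CC_C.pure_add1[simplified] additive_add[OF as(1)] additive_closed[OF as(1)]
            additive_add[OF \<Phi>] CC_C.pure_in slices_add)
    qed
    thus ?case using uv x y by (simp add: ml(2) L_smult)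
  next
    case (add s t)
    thus ?case using x y
      by (simp add: additive_add[OF ml(1)] additive_closed[OF ml(1)] additive_add[OF as(1)]
          additive_closed[OF as(1)] additive_add[OF \<Phi>] slices_add comult_add)
  qed
  have right: "\<Phi> (tensor_map cplx ?C VV (\<lambda>x. x) \<Delta> t) = R y (slice_left x t)"
    if "t \<in> carrier VV" for t
    using that
  proof (induction rule: VV.induct)
    case (pure u v)
    thus ?case using x y by (simp add: mr(2) \<Phi>p R_smult)
  next
    case (add s t)
    thus ?case using x y
      by (simp add: additive_add[OF mr(1)] additive_closed[OF mr(1)] additive_add[OF \<Phi>] slices_add comult_add)
  qed
  have "tensor_assoc cplx cplx ?C ?C ?C (tensor_map cplx VV ?C \<Delta> (\<lambda>x. x) (\<Delta> c)) =
      tensor_map cplx ?C VV (\<lambda>x. x) \<Delta> (\<Delta> c)"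
    using coalgebra c by (simp add: is_coalgebra_def)
  thus ?thesis using left[of "\<Delta> c"] right[of "\<Delta> c"] c by simp
qed

text \<open>
  The form \<open>v \<mapsto> z (L x v)\<close> is the convolution product of \<open>x\<close> and \<open>z\<close>.  Since linear forms separate
  vectors, this and \<open>R_comp\<close> follow from \<open>L_R_commute\<close> by moving forms across with \<open>L_R_adjoint\<close>.
\<close>

lemma L_comp:
  assumes "linear_form z" "linear_form x" "c \<in> carrier C"
  shows "L z (L x c) = L (\<lambda>v. z (L x v)) c"
proof (rule linear_forms_separate)
  fix y assume y: "linear_form y"
  have "y (L z (L x c)) = z (R y (L x c))" using assms y by (simp add: L_R_adjoint)
  also have "\<dots> = z (L x (R y c))" using assms y by (simp add: L_R_commute)
  also have "\<dots> = y (L (\<lambda>v. z (L x v)) c)"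
    using assms y linear_form_L[OF assms(1,2)] by (simp add: L_R_adjoint[of "\<lambda>v. z (L x v)"])
  finally show "y (L z (L x c)) = y (L (\<lambda>v. z (L x v)) c)" .
qed (use assms linear_form_L[OF assms(1,2)] in simp_all)

lemma R_comp:
  assumes "linear_form z" "linear_form x" "c \<in> carrier C"
  shows "R z (R x c) = R (\<lambda>v. z (R x v)) c"
proof (rule linear_forms_separate)
  fix y assume y: "linear_form y"
  have "y (R z (R x c)) = z (L y (R x c))" using assms y by (simp add: L_R_adjoint)
  also have "\<dots> = z (R x (L y c))" using assms y by (simp add: L_R_commute)
  also have "\<dots> = y (R (\<lambda>v. z (R x v)) c)"
    using assms y linear_form_R[OF assms(1,2)] by (simp add: L_R_adjoint[of y "\<lambda>v. z (R x v)", symmetric])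
  finally show "y (R z (R x c)) = y (R (\<lambda>v. z (R x v)) c)" .
qed (use assms linear_form_R[OF assms(1,2)] in simp_all)

subsection \<open>Subcoalgebras\<close>

lemma submodule_space: "submodule D cplx C \<Longrightarrow> complex_space (C\<lparr>carrier := D\<rparr>)"
  using submodule.submodule_is_module[of D cplx C] by (simp add: complex_space_def module_axioms)

text \<open>
  By this lemma and its converse \<open>subcoalgebraI\<close>, subcoalgebras are exactly the subspaces that are
  stable under the two actions.
\<close>

lemma subcoalgebra_slices:
  assumes D: "subcoalgebra D C" and c: "c \<in> D" and x: "linear_form x"
  shows "L x c \<in> D" "R x c \<in> D"
proof -
  let ?D = "C\<lparr>carrier := D\<rparr>"
  have sub: "submodule D cplx C" using D by (simp add: subcoalgebra_def)
  note SD = submoduleD[OF sub]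
  interpret D: complex_space ?D by (rule submodule_space[OF sub])
  have id: "(\<lambda>x. x) \<in> left_linear cplx (vect ?D) (vect C)" "(\<lambda>x. x) \<in> right_linear cplx (vect ?D) (vect C)"
    using SD(1) by (auto simp: left_linear_def right_linear_def additive_maps_def hom_def)
  note m = D.VV.map_additive_pure[OF VV.tensor_product_axioms id(2,1)]
  have "slice_left x (tensor_map cplx (vect C) (vect C) (\<lambda>x. x) (\<lambda>x. x) s) \<in> D \<and>
      slice_right x (tensor_map cplx (vect C) (vect C) (\<lambda>x. x) (\<lambda>x. x) s) \<in> D"
    if "s \<in> carrier D.VV" for s
    using that
  proof (induction rule: D.VV.induct)
    case (pure u v)
    hence "u \<in> D" "v \<in> D" "u \<in> carrier C" "v \<in> carrier C" using SD(1) by auto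
    thus ?case using x SD(4) by (simp add: m(2))
  next
    case (add s t)
    thus ?case using x SD(3) by (simp add: additive_add[OF m(1)] slices_add additive_closed[OF m(1)])
  qed
  moreover have "\<Delta> c \<in> tensor_map cplx (vect C) (vect C) (\<lambda>x. x) (\<lambda>x. x) ` carrier D.VV"
    using D c by (auto simp: subcoalgebra_def)
  ultimately show "L x c \<in> D" "R x c \<in> D" by auto
qed

text \<open>
  The left slices of \<open>\<Delta> c\<close> lie in the span of a finite subset \<open>K\<close> of \<open>E\<close>, so \<open>\<Delta> c\<close> is a sum of
  tensors \<open>R (\<kappa> k) c \<otimes> k\<close> with both factors in \<open>E\<close>.
\<close>

lemma subcoalgebraI:
  assumes sub: "submodule E cplx C"
    and st: "\<And>c x. c \<in> E \<Longrightarrow> linear_form x \<Longrightarrow> L x c \<in> E \<and> R x c \<in> E"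
  shows "subcoalgebra E C"
  unfolding subcoalgebra_def
proof (intro conjI sub image_subsetI)
  let ?D = "C\<lparr>carrier := E\<rparr>"
  note SD = submoduleD[OF sub]
  interpret D: complex_space ?D by (rule submodule_space[OF sub])
  have id: "(\<lambda>x. x) \<in> left_linear cplx (vect ?D) (vect C)" "(\<lambda>x. x) \<in> right_linear cplx (vect ?D) (vect C)"
    using SD(1) by (auto simp: left_linear_def right_linear_def additive_maps_def hom_def)
  note m = D.VV.map_additive_pure[OF VV.tensor_product_axioms id(2,1)]
  fix c assume c: "c \<in> E"
  hence cC: "c \<in> carrier C" using SD(1) by auto
  obtain H \<chi> where H: "biorthogonal H \<chi>" "\<Delta> c = (\<Oplus>\<^bsub>VV\<^esub>h\<in>H. pv h (L (\<chi> h) c))"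
    using tensor_expansion[OF comult_in[OF cC]] by auto
  note DH = biorthogonalD[OF H(1)]
  let ?W = "(\<lambda>h. L (\<chi> h) c) ` H"
  have "finite ?W" "?W \<subseteq> carrier C" using DH cC by auto
  then obtain K \<kappa> where K: "biorthogonal K \<kappa>" "K \<subseteq> ?W" "\<forall>w\<in>?W. expands K \<kappa> w"
    using biorthogonal_exists by meson
  note DK = biorthogonalD[OF K(1)]
  have KE: "k \<in> E" if "k \<in> K" for k
    using that K(2) st[OF c] DH(4) by auto
  have "expands K \<kappa> (L x c)" if x: "linear_form x" for x
  proof -
    have "L x c = (\<Oplus>h\<in>H. x h \<odot> L (\<chi> h) c)"
      by (rule slice_left_expansion[OF comult_in[OF cC] H x])
    also have "\<dots> \<in> {v. expands K \<kappa> v}"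
      using K(3) submoduleD(4)[OF expands_submodule[OF K(1)]]
      by (intro submodule_finsum[OF expands_submodule[OF K(1)] DH(1)]) auto
    finally show ?thesis by simp
  qed
  hence e: "\<Delta> c = (\<Oplus>\<^bsub>VV\<^esub>k\<in>K. pv (R (\<kappa> k) c) k)"
    using cC by (intro tensor_expansion_right K(1)) auto
  let ?g = "\<lambda>k. D.pv (R (\<kappa> k) c) k"
  have g: "?g \<in> K \<rightarrow> carrier D.VV" using KE st[OF c] DK(4) by (auto intro!: D.VV.pure_in)
  have "tensor_map cplx (vect C) (vect C) (\<lambda>x. x) (\<lambda>x. x) (\<Oplus>\<^bsub>D.VV\<^esub>k\<in>K. ?g k) =
     (\<Oplus>\<^bsub>VV\<^esub>k\<in>K. tensor_map cplx (vect C) (vect C) (\<lambda>x. x) (\<lambda>x. x) (?g k))"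
    by (rule additive_finsum[OF m(1) D.VV_abelian VV_abelian DK(1) g])
  also have "\<dots> = (\<Oplus>\<^bsub>VV\<^esub>k\<in>K. pv (R (\<kappa> k) c) k)"
    using KE st[OF c] DK SD(1) cC
    by (intro abelian_monoid.finsum_cong'[OF abelian_group.axioms(1)[OF VV_abelian] refl])
       (auto intro!: VV.pure_in simp: m(2))
  finally have "\<Delta> c = tensor_map cplx (vect C) (vect C) (\<lambda>x. x) (\<lambda>x. x) (\<Oplus>\<^bsub>D.VV\<^esub>k\<in>K. ?g k)"
    using e by simp
  moreover have "(\<Oplus>\<^bsub>D.VV\<^esub>k\<in>K. ?g k) \<in> carrier D.VV"
    using g by (rule abelian_monoid.finsum_closed[OF abelian_group.axioms(1)[OF D.VV_abelian]])
  ultimately show "\<Delta> c \<in> tensor_map cplx (vect C) (vect C) (\<lambda>x. x) (\<lambda>x. x) ` carrier D.VV"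
    by (rule image_eqI)
qed

text \<open>The slices \<open>L x c\<close> of one element span a space of finite dimension; the finite set \<open>W\<close> generates it.\<close>

lemma L_support:
  assumes c: "c \<in> carrier C"
  obtains W where "finite W" "W \<subseteq> {L x c | x. linear_form x}"
    "\<And>E x. submodule E cplx C \<Longrightarrow> W \<subseteq> E \<Longrightarrow> linear_form x \<Longrightarrow> L x c \<in> E"
proof -
  obtain H \<chi> where H: "biorthogonal H \<chi>" "\<Delta> c = (\<Oplus>\<^bsub>VV\<^esub>h\<in>H. pv h (L (\<chi> h) c))"
    using tensor_expansion[OF comult_in[OF c]] by auto
  note D = biorthogonalD[OF H(1)]
  show ?thesis
  proof (rule that[of "(\<lambda>h. L (\<chi> h) c) ` H"])
    show "finite ((\<lambda>h. L (\<chi> h) c) ` H)" using D by simp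
    show "(\<lambda>h. L (\<chi> h) c) ` H \<subseteq> {L x c | x. linear_form x}" using D(4) by auto
    fix E x assume E: "submodule E cplx C" and W: "(\<lambda>h. L (\<chi> h) c) ` H \<subseteq> E" and x: "linear_form x"
    have "L x c = (\<Oplus>h\<in>H. x h \<odot> L (\<chi> h) c)"
      by (rule slice_left_expansion[OF comult_in[OF c] H x])
    also have "\<dots> \<in> E"
      using W by (intro submodule_finsum[OF E D(1)] submoduleD(4)[OF E]) auto
    finally show "L x c \<in> E" .
  qed
qed

lemma right_expansion:
  assumes c: "c \<in> carrier C"
  obtains K \<kappa> where "biorthogonal K \<kappa>" "\<Delta> c = (\<Oplus>\<^bsub>VV\<^esub>k\<in>K. pv (R (\<kappa> k) c) k)"
proof -
  obtain W where W: "finite W" "W \<subseteq> {L x c | x. linear_form x}"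
    "\<And>E x. submodule E cplx C \<Longrightarrow> W \<subseteq> E \<Longrightarrow> linear_form x \<Longrightarrow> L x c \<in> E"
    by (rule L_support[OF c]) blast
  have "W \<subseteq> carrier C" using W(2) c by auto
  then obtain K \<kappa> where K: "biorthogonal K \<kappa>" "\<forall>w\<in>W. expands K \<kappa> w"
    using biorthogonal_exists[OF W(1)] by auto
  have "expands K \<kappa> (L x c)" if "linear_form x" for x
    using W(3)[OF expands_submodule[OF K(1)] _ that] K(2) by auto
  thus ?thesis using K(1) tensor_expansion_right[OF comult_in[OF c] K(1)] that by simp
qed

lemma R_support:
  assumes c: "c \<in> carrier C"
  obtains W where "finite W" "W \<subseteq> {R x c | x. linear_form x}"
    "\<And>E x. submodule E cplx C \<Longrightarrow> W \<subseteq> E \<Longrightarrow> linear_form x \<Longrightarrow> R x c \<in> E"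
proof -
  obtain K \<kappa> where K: "biorthogonal K \<kappa>" "\<Delta> c = (\<Oplus>\<^bsub>VV\<^esub>k\<in>K. pv (R (\<kappa> k) c) k)"
    using right_expansion[OF c] .
  note D = biorthogonalD[OF K(1)]
  show ?thesis
  proof (rule that[of "(\<lambda>k. R (\<kappa> k) c) ` K"])
    show "finite ((\<lambda>k. R (\<kappa> k) c) ` K)" using D by simp
    show "(\<lambda>k. R (\<kappa> k) c) ` K \<subseteq> {R x c | x. linear_form x}" using D(4) by auto
    fix E x assume E: "submodule E cplx C" and W: "(\<lambda>k. R (\<kappa> k) c) ` K \<subseteq> E" and x: "linear_form x"
    have "R x c = (\<Oplus>k\<in>K. x k \<odot> R (\<kappa> k) c)"
      by (rule slice_right_expansion[OF comult_in[OF c] K x])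
    also have "\<dots> \<in> E"
      using W by (intro submodule_finsum[OF E D(1)] submoduleD(4)[OF E]) auto
    finally show "R x c \<in> E" .
  qed
qed

lemma preimage_submodule:
  assumes E: "submodule E cplx C" and x: "linear_form x"
  shows "submodule {v \<in> carrier C. L x v \<in> E} cplx C" "submodule {v \<in> carrier C. R x v \<in> E} cplx C"
proof -
  note S = submoduleD[OF E]
  have "L x \<zero> = \<zero>" "R x \<zero> = \<zero>"
    using additive_zero[OF L_additive[OF x] M.abelian_group_axioms M.abelian_group_axioms]
      additive_zero[OF R_additive[OF x] M.abelian_group_axioms M.abelian_group_axioms] by auto
  thus "submodule {v \<in> carrier C. L x v \<in> E} cplx C" "submodule {v \<in> carrier C. R x v \<in> E} cplx C"
    using S x by (auto intro!: submoduleI' simp: L_add R_add L_smult R_smult)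
qed

text \<open>
  The subcoalgebra generated by one element \<open>c\<close> is spanned by its two-sided slices \<open>R y (L x c)\<close>, so it
  has finite dimension.  A simple subcoalgebra is generated by any of its nonzero elements.
\<close>

lemma simple_finite_dimensional:
  assumes D: "simple_subcoalgebra D C"
  obtains G \<chi> where "biorthogonal G \<chi>" "G \<subseteq> D" "\<And>d. d \<in> D \<Longrightarrow> expands G \<chi> d" "G \<noteq> {}"
proof -
  have sc: "subcoalgebra D C" and nz: "D \<noteq> {\<zero>}"
    and simple: "\<And>E. subcoalgebra E C \<Longrightarrow> E \<subseteq> D \<Longrightarrow> E = {\<zero>} \<or> E = D"
    using D by (simp_all add: simple_subcoalgebra_def)
  have sub: "submodule D cplx C" using sc by (simp add: subcoalgebra_def)
  note SD = submoduleD[OF sub]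
  obtain c where c: "c \<in> D" "c \<noteq> \<zero>" using nz SD(2) by auto
  have cC: "c \<in> carrier C" using c SD(1) by auto
  \<comment> \<open>The span of the two-sided slices, as the intersection \<open>E\<close> of all subspaces that contain them.\<close>
  define \<F> where "\<F> = {F. submodule F cplx C \<and> (\<forall>x y. linear_form x \<longrightarrow> linear_form y \<longrightarrow> R y (L x c) \<in> F)}"
  define E where "E = \<Inter>\<F>"
  have carF: "carrier C \<in> \<F>"
    unfolding \<F>_def using cC carrier_is_submodule by auto
  have FD: "submodule F cplx C" "\<And>x y. linear_form x \<Longrightarrow> linear_form y \<Longrightarrow> R y (L x c) \<in> F" if "F \<in> \<F>" for F
    using that by (simp_all add: \<F>_def)
  have subE: "submodule E cplx C"
  proof (rule submoduleI')
    show "E \<subseteq> carrier C" unfolding E_def using carF by (rule Inter_lower)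
    show "\<zero> \<in> E" unfolding E_def using submoduleD(2)[OF FD(1)] by (rule InterI)
    fix a assume a: "a \<in> E"
    show "k \<odot> a \<in> E" for k
      unfolding E_def by (rule InterI) (use a in \<open>auto simp: E_def intro!: submoduleD(4)[OF FD(1)]\<close>)
    fix b assume b: "b \<in> E"
    show "a \<oplus> b \<in> E"
      unfolding E_def by (rule InterI) (use a b in \<open>auto simp: E_def intro!: submoduleD(3)[OF FD(1)]\<close>)
  qed
  have gen: "R y (L x c) \<in> E" if "linear_form x" "linear_form y" for x y
    unfolding E_def using FD(2) that by (intro InterI) auto
  have min: "E \<subseteq> F" if "submodule F cplx C" "\<And>x y. linear_form x \<Longrightarrow> linear_form y \<Longrightarrow> R y (L x c) \<in> F" for F
    unfolding E_def using that by (intro Inter_lower) (simp add: \<F>_def)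
  have "subcoalgebra E C"
  proof (rule subcoalgebraI[OF subE])
    fix v z assume v: "v \<in> E" and z: "linear_form z"
    have "E \<subseteq> {v \<in> carrier C. L z v \<in> E}"
    proof (rule min[OF preimage_submodule(1)[OF subE z]])
      fix x y assume xy: "linear_form x" "linear_form y"
      have "L z (R y (L x c)) = R y (L (\<lambda>v. z (L x v)) c)"
        using xy z cC by (simp add: L_R_commute[symmetric] L_comp)
      thus "R y (L x c) \<in> {v \<in> carrier C. L z v \<in> E}" using gen xy z linear_form_L[OF z xy(1)] cC by simp
    qed
    moreover have "E \<subseteq> {v \<in> carrier C. R z v \<in> E}"
    proof (rule min[OF preimage_submodule(2)[OF subE z]])
      fix x y assume xy: "linear_form x" "linear_form y"
      have "R z (R y (L x c)) = R (\<lambda>v. z (R y v)) (L x c)"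
        using xy z cC by (simp add: R_comp)
      thus "R y (L x c) \<in> {v \<in> carrier C. R z v \<in> E}" using gen xy z linear_form_R[OF z xy(2)] cC by simp
    qed
    ultimately show "L z v \<in> E \<and> R z v \<in> E" using v by auto
  qed
  moreover have "E \<subseteq> D"
    using min[OF sub] subcoalgebra_slices[OF sc] c by simp
  moreover have "c \<in> E"
    using gen[OF linear_form_counit linear_form_counit] cC by (simp add: L_counit R_counit)
  ultimately have ED: "E = D" using simple[of E] c by auto
  obtain W where W: "finite W" "W \<subseteq> {L x c | x. linear_form x}"
    "\<And>F x. submodule F cplx C \<Longrightarrow> W \<subseteq> F \<Longrightarrow> linear_form x \<Longrightarrow> L x c \<in> F"
    by (rule L_support[OF cC]) blast
  have WD: "W \<subseteq> D" using W(2) subcoalgebra_slices[OF sc c(1)] by auto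
  have "\<forall>w\<in>W. \<exists>U. finite U \<and> U \<subseteq> {R x w | x. linear_form x} \<and>
     (\<forall>F x. submodule F cplx C \<longrightarrow> U \<subseteq> F \<longrightarrow> linear_form x \<longrightarrow> R x w \<in> F)"
  proof
    fix w assume "w \<in> W"
    hence "w \<in> carrier C" using WD SD(1) by auto
    then obtain U where "finite U" "U \<subseteq> {R x w | x. linear_form x}"
      "\<And>F x. submodule F cplx C \<Longrightarrow> U \<subseteq> F \<Longrightarrow> linear_form x \<Longrightarrow> R x w \<in> F"
      by (rule R_support) blast
    thus "\<exists>U. finite U \<and> U \<subseteq> {R x w | x. linear_form x} \<and>
      (\<forall>F x. submodule F cplx C \<longrightarrow> U \<subseteq> F \<longrightarrow> linear_form x \<longrightarrow> R x w \<in> F)"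
      by (intro exI[of _ U]) simp
  qed
  then obtain U where U0: "\<forall>w\<in>W. finite (U w) \<and> U w \<subseteq> {R x w | x. linear_form x} \<and>
     (\<forall>F x. submodule F cplx C \<longrightarrow> U w \<subseteq> F \<longrightarrow> linear_form x \<longrightarrow> R x w \<in> F)"
    by (rule bchoice[THEN exE])
  have U: "finite (U w)" "U w \<subseteq> {R x w | x. linear_form x}"
     "submodule F cplx C \<Longrightarrow> U w \<subseteq> F \<Longrightarrow> linear_form x \<Longrightarrow> R x w \<in> F" if "w \<in> W" for w F x
    using bspec[OF U0 that] by simp_all
  let ?W = "\<Union>w\<in>W. U w"
  have fin: "finite ?W" using U(1) W(1) by simp
  have WD': "?W \<subseteq> D"
  proof (rule UN_least)
    fix w assume "w \<in> W"
    thus "U w \<subseteq> D" using U(2)[of w] WD subcoalgebra_slices(2)[OF sc, of w] by auto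
  qed
  obtain G \<chi> where G: "biorthogonal G \<chi>" "G \<subseteq> ?W" "\<forall>w\<in>?W. expands G \<chi> w"
    using biorthogonal_exists[OF fin subset_trans[OF WD' SD(1)]] by auto
  let ?F = "{v. expands G \<chi> v}"
  note subF = expands_submodule[OF G(1)]
  have "D \<subseteq> ?F"
    unfolding ED[symmetric]
  proof (rule min[OF subF])
    fix x y assume xy: "linear_form x" "linear_form y"
    have "W \<subseteq> {v \<in> carrier C. R y v \<in> ?F}"
    proof
      fix w assume w: "w \<in> W"
      have "U w \<subseteq> ?F" using G(3) w by auto
      hence "R y w \<in> ?F" by (rule U(3)[OF w subF _ xy(2)])
      thus "w \<in> {v \<in> carrier C. R y v \<in> ?F}" using w WD SD(1) by auto
    qed
    hence "L x c \<in> {v \<in> carrier C. R y v \<in> ?F}"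
      by (rule W(3)[OF preimage_submodule(2)[OF subF xy(2)] _ xy(1)])
    thus "R y (L x c) \<in> ?F" by simp
  qed
  hence "expands G \<chi> d" if "d \<in> D" for d using that by auto
  moreover have "G \<subseteq> D" using G(2) WD' by (rule subset_trans)
  moreover have "G \<noteq> {}"
  proof
    assume "G = {}"
    hence "c = \<zero>" using \<open>D \<subseteq> ?F\<close> c by (auto simp: expands_def)
    thus False using c by simp
  qed
  ultimately show ?thesis using G(1) that by blast
qed

section \<open>The cointegral of a cosemisimple coalgebra\<close>

text \<open>
  The form \<open>\<gamma>(u, v) = y v u\<close> is only determined on \<open>D\<close>, while \<open>\<Delta> c\<close> lies in \<open>\<C> \<otimes> \<C>\<close>.  The normalisation
  \<open>\<Sum> \<gamma>(c\<^sub>1, c\<^sub>2) = \<epsilon>(c)\<close> is therefore demanded for every bilinear form on \<open>\<C>\<close> that extends it.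
\<close>

definition local_cointegral :: "'c set \<Rightarrow> ('c \<Rightarrow> 'c \<Rightarrow> complex) \<Rightarrow> bool" where
  "local_cointegral D y \<longleftrightarrow> (\<forall>d\<in>D. linear_form (y d)) \<and> (\<forall>c\<in>D. \<forall>d\<in>D. y d c = y c d) \<and>
     (\<forall>c\<in>D. \<forall>d\<in>D. R (y d) c = L (y c) d) \<and>
     (\<forall>c\<in>D. \<forall>\<gamma>. balanced cplx (vect C) (vect C) cplx \<gamma> \<longrightarrow> (\<forall>u\<in>D. \<forall>v\<in>D. \<gamma> u v = y v u) \<longrightarrow>
        tensor_lift cplx \<gamma> (\<Delta> c) = \<epsilon> c)"

text \<open>
  The trace on a matrix algebra is a nondegenerate symmetric form; the same argument works on a
  simple subcoalgebra without identifying it with a matrix coalgebra.  Let \<open>t\<close> represent the trace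
  form, \<open>z(t) = tr (R z on D)\<close>.  From \<open>tr (R x R y) = tr (R y R x)\<close> the element \<open>t\<close> is cocommutative, so its
  slices form a subcoalgebra, which is all of \<open>D\<close> as \<open>\<epsilon>(t) = dim D \<noteq> 0\<close>.  The form \<open>y d\<close> is chosen such
  that \<open>d\<close> is the slice of \<open>t\<close> by it.  Invariance is the commutation of \<open>L\<close> and \<open>R\<close> applied to \<open>t\<close>, and
  the normalisation reads \<open>\<Sum> \<gamma>(c\<^sub>1, c\<^sub>2) = y\<^sub>c(t) = \<epsilon>(c)\<close>.
\<close>

lemma simple_cointegral:
  assumes D: "simple_subcoalgebra D C"
  shows "\<exists>y. local_cointegral D y"
proof -
  have sc: "subcoalgebra D C"
    and simple: "\<And>E. subcoalgebra E C \<Longrightarrow> E \<subseteq> D \<Longrightarrow> E = {\<zero>} \<or> E = D"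
    using D by (simp_all add: simple_subcoalgebra_def)
  have sub: "submodule D cplx C" using sc by (simp add: subcoalgebra_def)
  note SD = submoduleD[OF sub]
  have DC: "d \<in> D \<Longrightarrow> d \<in> carrier C" for d using SD(1) by auto
  note sl = subcoalgebra_slices[OF sc]
  obtain G \<chi> where G: "biorthogonal G \<chi>" "G \<subseteq> D" "\<And>d. d \<in> D \<Longrightarrow> expands G \<chi> d" "G \<noteq> {}"
    by (rule simple_finite_dimensional[OF D]) blast
  note B = biorthogonalD[OF G(1)]
  have GD: "g \<in> G \<Longrightarrow> g \<in> D" for g using G(2) by auto
  have expand: "z v = (\<Sum>g\<in>G. \<chi> g v * z g)" if "v \<in> D" "linear_form z" for v z
  proof -
    have "z v = z (\<Oplus>g\<in>G. \<chi> g v \<odot> g)" using G(3)[OF that(1)] by (simp add: expands_def)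
    also have "\<dots> = (\<Sum>g\<in>G. z (\<chi> g v \<odot> g))"
      using B that by (intro linear_form_sum) auto
    finally show ?thesis using B that by (simp add: linear_form_smult)
  qed
  \<comment> \<open>A linear form \<open>z\<close> takes the trace of \<open>R z\<close> on \<open>D\<close> as its value at this element.\<close>
  define t where "t = (\<Oplus>i\<in>G. L (\<chi> i) i)"
  have tD: "t \<in> D" unfolding t_def using GD B sl by (intro submodule_finsum[OF sub]) auto
  have tC: "t \<in> carrier C" using tD DC by simp
  have trace: "z t = (\<Sum>i\<in>G. \<chi> i (R z i))" if z: "linear_form z" for z
  proof -
    have "z t = (\<Sum>i\<in>G. z (L (\<chi> i) i))"
      unfolding t_def using B z by (intro linear_form_sum) auto
    thus ?thesis using B z by (simp add: L_R_adjoint)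
  qed
  have trace2: "x (R y t) = (\<Sum>i\<in>G. \<Sum>j\<in>G. \<chi> j (R y i) * \<chi> i (R x j))"
    if x: "linear_form x" and y: "linear_form y" for x y
  proof -
    have "x (R y t) = (\<Sum>i\<in>G. \<chi> i (R (\<lambda>v. x (R y v)) i))"
      by (rule trace[OF linear_form_R[OF x y]])
    also have "\<dots> = (\<Sum>i\<in>G. \<chi> i (R x (R y i)))"
      using B x y by (simp add: R_comp)
    also have "\<dots> = (\<Sum>i\<in>G. \<Sum>j\<in>G. \<chi> j (R y i) * \<chi> i (R x j))"
    proof (rule sum.cong[OF refl])
      fix i assume i: "i \<in> G"
      show "\<chi> i (R x (R y i)) = (\<Sum>j\<in>G. \<chi> j (R y i) * \<chi> i (R x j))"
        using expand[of "R y i" "\<lambda>v. \<chi> i (R x v)"] i sl(2)[OF GD[OF i] y] linear_form_R[OF B(4)[OF i] x]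
        by simp
    qed
    finally show ?thesis .
  qed
  have cocomm: "R y t = L y t" if y: "linear_form y" for y
  proof (rule linear_forms_separate)
    fix x assume x: "linear_form x"
    have "x (R y t) = y (R x t)"
      unfolding trace2[OF x y] trace2[OF y x] by (subst sum.swap) (simp add: mult.commute)
    thus "x (R y t) = x (L y t)" using x y tC by (simp add: L_R_adjoint)
  qed (use y tC in simp_all)
  let ?E = "{L y t | y. linear_form y}"
  have "subcoalgebra ?E C"
  proof (rule subcoalgebraI)
    show "submodule ?E cplx C"
    proof (rule submoduleI')
      show "?E \<subseteq> carrier C" using tC by auto
      have "linear_form (\<lambda>_. 0)" by (simp add: linear_form_def)
      moreover have "L (\<lambda>_. 0) t = \<zero>"
        using slices_linear_left(2)[OF linear_form_counit linear_form_counit comult_in[OF tC], of 0]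
          tC linear_form_counit by simp
      ultimately show "\<zero> \<in> ?E" by (intro CollectI exI[of _ "\<lambda>_. 0"]) simp
      fix a assume "a \<in> ?E"
      then obtain x where x: "a = L x t" "linear_form x" by auto
      show "k \<odot> a \<in> ?E" for k
        using slices_linear_left(2)[OF x(2) x(2) comult_in[OF tC], of k] linear_form_scale[OF x(2), of k] x(1)
        by (intro CollectI exI[of _ "\<lambda>v. k * x v"]) simp
      fix b assume "b \<in> ?E"
      then obtain y where y: "b = L y t" "linear_form y" by auto
      show "a \<oplus> b \<in> ?E"
        using slices_linear_left(1)[OF x(2) y(2) comult_in[OF tC]] linear_form_plus[OF x(2) y(2)] x(1) y(1)
        by (intro CollectI exI[of _ "\<lambda>v. x v + y v"]) simp
    qed
    fix v z assume "v \<in> ?E" and z: "linear_form z"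
    then obtain y where y: "v = L y t" "linear_form y" by auto
    have "L z v = L (\<lambda>v. z (L y v)) t" using y z tC by (simp add: L_comp)
    moreover have "R z v = L (\<lambda>v. z (R y v)) t"
      using y z tC linear_form_R[OF z y(2)] by (simp add: cocomm[symmetric] R_comp)
    ultimately show "L z v \<in> ?E \<and> R z v \<in> ?E"
      using linear_form_L[OF z y(2)] linear_form_R[OF z y(2)] by auto
  qed
  moreover have "?E \<subseteq> D" using sl(1)[OF tD] by auto
  \<comment> \<open>Here \<open>\<epsilon> t\<close> is the number of elements of the basis \<open>G\<close>, which is not zero in the complex numbers.\<close>
  moreover have "?E \<noteq> {\<zero>}"
  proof
    assume "?E = {\<zero>}"
    moreover have "t \<in> ?E" using L_counit[OF tC] linear_form_counit by (intro CollectI exI[of _ \<epsilon>]) simp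
    ultimately have "t = \<zero>" by simp
    moreover have "\<epsilon> t = (\<Sum>i\<in>G. 1)"
      using trace[OF linear_form_counit] B by (simp add: R_counit)
    ultimately show False using linear_form_zero[OF linear_form_counit] B(1) G(4) by simp
  qed
  ultimately have ED: "?E = D" using simple[of ?E] by blast
  have ex: "\<exists>y. linear_form y \<and> L y t = d" if "d \<in> D" for d
  proof -
    have "d \<in> ?E" using that ED by simp
    thus ?thesis by auto
  qed
  define y where "y d = (SOME y. linear_form y \<and> L y t = d)" for d
  have y: "linear_form (y d)" "L (y d) t = d" "R (y d) t = d" if "d \<in> D" for d
  proof -
    show l: "linear_form (y d)" "L (y d) t = d"
      unfolding y_def using someI_ex[OF ex[OF that]] by auto
    show "R (y d) t = d" using cocomm[OF l(1)] l(2) by simp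
  qed
  have sym: "y d c = y c d" if "c \<in> D" "d \<in> D" for c d
  proof -
    have "y d c = y d (R (y c) t)" using y that by simp
    also have "\<dots> = y c (L (y d) t)" by (rule L_R_adjoint[OF y(1)[OF that(2)] y(1)[OF that(1)] tC, symmetric])
    finally show ?thesis using y that by simp
  qed
  have inv: "R (y d) c = L (y c) d" if "c \<in> D" "d \<in> D" for c d
  proof -
    have "R (y d) (L (y c) t) = L (y c) (R (y d) t)"
      by (rule L_R_commute[OF y(1)[OF that(1)] y(1)[OF that(2)] tC])
    thus ?thesis using y that by simp
  qed
  have norm: "tensor_lift cplx \<gamma> (\<Delta> c) = \<epsilon> c"
    if c: "c \<in> D" and bal: "balanced cplx (vect C) (vect C) cplx \<gamma>"
      and \<gamma>: "\<And>u v. u \<in> D \<Longrightarrow> v \<in> D \<Longrightarrow> \<gamma> u v = y v u" for c \<gamma>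
  proof -
    have "\<Delta> c = (\<Oplus>\<^bsub>VV\<^esub>g\<in>G. pv (R (\<chi> g) c) g)"
      using sl[OF c] G DC[OF c] by (intro tensor_expansion_right) auto
    hence "tensor_lift cplx \<gamma> (\<Delta> c) = tensor_lift cplx \<gamma> (\<Oplus>\<^bsub>VV\<^esub>g\<in>G. pv (R (\<chi> g) c) g)" by simp
    also have "\<dots> = (\<Oplus>\<^bsub>cplx\<^esub>g\<in>G. tensor_lift cplx \<gamma> (pv (R (\<chi> g) c) g))"
      using B DC[OF c] by (intro additive_finsum[OF VV.lift_additive[OF abelian_group_cplx bal] VV_abelian abelian_group_cplx])
        (auto intro!: VV.pure_in)
    also have "\<dots> = (\<Sum>g\<in>G. tensor_lift cplx \<gamma> (pv (R (\<chi> g) c) g))" using B by (simp add: finsum_cplx)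
    also have "\<dots> = (\<Sum>g\<in>G. \<gamma> (R (\<chi> g) c) g)"
      using B DC[OF c] by (intro sum.cong[OF refl]) (simp add: VV.lift_pure[OF abelian_group_cplx bal])
    also have "\<dots> = (\<Sum>g\<in>G. y g (R (\<chi> g) c))"
      using GD sl[OF c] B by (intro sum.cong[OF refl] \<gamma>) auto
    also have "\<dots> = (\<Sum>g\<in>G. \<chi> g (R (y c) g))"
    proof (rule sum.cong[OF refl])
      fix g assume g: "g \<in> G"
      have "y g (R (\<chi> g) c) = \<chi> g (L (y g) c)"
        using y(1)[OF GD[OF g]] B(4)[OF g] DC[OF c] by (simp add: L_R_adjoint)
      thus "y g (R (\<chi> g) c) = \<chi> g (R (y c) g)" using inv[OF GD[OF g] c] by simp
    qed
    also have "\<dots> = y c t" by (rule trace[OF y(1)[OF c], symmetric])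
    also have "\<dots> = y c (R \<epsilon> t)" using tC by (simp add: R_counit)
    also have "\<dots> = \<epsilon> (L (y c) t)" using y(1)[OF c] linear_form_counit tC by (simp add: L_R_adjoint)
    also have "\<dots> = \<epsilon> c" using y(2)[OF c] by simp
    finally show ?thesis .
  qed
  show ?thesis
    unfolding local_cointegral_def
    by (intro exI[of _ y] conjI ballI allI impI) (simp_all add: y(1) sym inv norm)
qed

text \<open>The projections \<open>\<pi> D\<close> onto the summands of a decomposition into simple subcoalgebras.\<close>

definition component_family :: "'c set set \<Rightarrow> ('c set \<Rightarrow> 'c \<Rightarrow> 'c) \<Rightarrow> bool" where
  "component_family \<D> \<pi> \<longleftrightarrow> (\<forall>D\<in>\<D>. simple_subcoalgebra D C) \<and>
     (\<forall>c\<in>carrier C. \<forall>D\<in>\<D>. \<pi> D c \<in> D) \<and>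
     (\<forall>c\<in>carrier C. finite {D \<in> \<D>. \<pi> D c \<noteq> \<zero>} \<and> c = (\<Oplus>D\<in>{D \<in> \<D>. \<pi> D c \<noteq> \<zero>}. \<pi> D c)) \<and>
     (\<forall>c\<in>carrier C. \<forall>d\<in>carrier C. \<forall>D\<in>\<D>. \<pi> D (c \<oplus> d) = \<pi> D c \<oplus> \<pi> D d) \<and>
     (\<forall>k. \<forall>c\<in>carrier C. \<forall>D\<in>\<D>. \<pi> D (k \<odot> c) = k \<odot> \<pi> D c) \<and>
     (\<forall>D\<in>\<D>. \<forall>E\<in>\<D>. \<forall>c\<in>D. \<pi> E c = (if E = D then c else \<zero>))"

text \<open>
  By uniqueness, the components of a sum or of a multiple are the sums or multiples of the
  components.  So they depend linearly on the element.
\<close>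

lemma simple_components:
  assumes "cosemisimple C" shows "\<exists>\<D> \<pi>. component_family \<D> \<pi>"
proof -
  obtain \<D> where \<D>: "\<forall>D\<in>\<D>. simple_subcoalgebra D C"
    "\<forall>c\<in>carrier C. \<exists>!x. x \<in> (\<Pi>\<^sub>E D\<in>\<D>. D) \<and> finite {D \<in> \<D>. x D \<noteq> \<zero>} \<and>
           c = (\<Oplus>D\<in>{D \<in> \<D>. x D \<noteq> \<zero>}. x D)"
    using assms unfolding cosemisimple_def by (elim exE conjE)
  note simple = bspec[OF \<D>(1)] and ex1 = bspec[OF \<D>(2)]
  have sub: "submodule D cplx C" if "D \<in> \<D>" for D
    using simple[OF that] by (simp add: simple_subcoalgebra_def subcoalgebra_def)
  note SD = submoduleD[OF sub]
  have DC: "v \<in> carrier C" if "D \<in> \<D>" "v \<in> D" for D v using SD(1)[OF that(1)] that(2) by auto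
  define P where "P c x \<longleftrightarrow> x \<in> (\<Pi>\<^sub>E D\<in>\<D>. D) \<and> finite {D \<in> \<D>. x D \<noteq> \<zero>} \<and>
           c = (\<Oplus>D\<in>{D \<in> \<D>. x D \<noteq> \<zero>}. x D)" for c x
  define q where "q c = (THE x. P c x)" for c
  have qP: "P c (q c)" if "c \<in> carrier C" for c
    unfolding q_def by (rule theI'[where P = "P c"]) (use ex1[OF that] in \<open>simp only: P_def\<close>)
  have qI: "q c = x" if "c \<in> carrier C" "P c x" for c x
    unfolding q_def by (rule the1_equality[where P = "P c", OF _ that(2)]) (use ex1[OF that(1)] in \<open>simp only: P_def\<close>)
  have PI: "P (\<Oplus>D\<in>F. x D) (\<lambda>D\<in>\<D>. x D)"
    if F: "finite F" "F \<subseteq> \<D>" and x: "\<And>D. D \<in> \<D> \<Longrightarrow> x D \<in> D" "\<And>D. D \<in> \<D> - F \<Longrightarrow> x D = \<zero>" for F x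
  proof -
    have eq: "{D \<in> \<D>. (\<lambda>D\<in>\<D>. x D) D \<noteq> \<zero>} = {D \<in> \<D>. x D \<noteq> \<zero>}" by auto
    have s: "{D \<in> \<D>. x D \<noteq> \<zero>} \<subseteq> F" using x(2) by auto
    have "(\<Oplus>D\<in>F. x D) = finsum C (\<lambda>D\<in>\<D>. x D) {D \<in> \<D>. x D \<noteq> \<zero>}"
      by (rule M.add.finprod_mono_neutral_cong_right[OF F(1) s])
         (use F(2) x DC in \<open>auto simp: subset_iff\<close>)
    moreover have "(\<lambda>D\<in>\<D>. x D) \<in> (\<Pi>\<^sub>E D\<in>\<D>. D)" using x(1) by (rule restrict_PiE_iff[THEN iffD2, OF ballI])
    ultimately show ?thesis using finite_subset[OF s F(1)] unfolding P_def eq by (intro conjI)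
  qed
  have PD: "q c D \<in> D" if "c \<in> carrier C" "D \<in> \<D>" for c D
    using qP[OF that(1)] that(2) unfolding P_def by (auto simp: PiE_iff)
  have fin: "finite {D \<in> \<D>. q c D \<noteq> \<zero>}" if "c \<in> carrier C" for c
    using qP[OF that] unfolding P_def by simp
  have exp: "c = (\<Oplus>D\<in>{D \<in> \<D>. q c D \<noteq> \<zero>}. q c D)" if "c \<in> carrier C" for c
    using qP[OF that] unfolding P_def by simp
  have expF: "(\<Oplus>D\<in>F. q c D) = c"
    if c: "c \<in> carrier C" and F: "finite F" "F \<subseteq> \<D>" "{D \<in> \<D>. q c D \<noteq> \<zero>} \<subseteq> F" for c F
  proof -
    have "(\<Oplus>D\<in>F. q c D) = (\<Oplus>D\<in>{D \<in> \<D>. q c D \<noteq> \<zero>}. q c D)"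
      by (rule M.add.finprod_mono_neutral_cong_right[OF F(1,3)])
         (use F(2) PD[OF c] DC in \<open>auto simp: subset_iff\<close>)
    thus ?thesis using exp[OF c] by simp
  qed
  show ?thesis
    unfolding component_family_def
  proof (intro exI[of _ \<D>] exI[of _ "\<lambda>D c. q c D"] conjI ballI allI simple PD fin exp)
    fix c d D assume c: "c \<in> carrier C" and d: "d \<in> carrier C" and D: "D \<in> \<D>"
    let ?F = "{D \<in> \<D>. q c D \<noteq> \<zero>} \<union> {D \<in> \<D>. q d D \<noteq> \<zero>}"
    have F: "finite ?F" "?F \<subseteq> \<D>" using fin c d by auto
    have qin: "q c D \<in> carrier C" "q d D \<in> carrier C" if "D \<in> \<D>" for D
      using PD c d that DC by auto
    have "P (\<Oplus>D\<in>?F. q c D \<oplus> q d D) (\<lambda>D\<in>\<D>. q c D \<oplus> q d D)"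
      by (rule PI[OF F]) (use SD(3) PD c d in auto)
    also have "(\<Oplus>D\<in>?F. q c D \<oplus> q d D) = (\<Oplus>D\<in>?F. q c D) \<oplus> (\<Oplus>D\<in>?F. q d D)"
      using qin by (intro M.finsum_addf) auto
    also have "\<dots> = c \<oplus> d"
      using expF[OF c F] expF[OF d F] by (simp del: Un_iff)
    finally show "q (c \<oplus> d) D = q c D \<oplus> q d D" using qI[of "c \<oplus> d"] c d D by simp
  next
    fix k c D assume c: "c \<in> carrier C" and D: "D \<in> \<D>"
    let ?F = "{D \<in> \<D>. q c D \<noteq> \<zero>}"
    have F: "finite ?F" "?F \<subseteq> \<D>" using fin c by auto
    have qin: "q c D \<in> carrier C" if "D \<in> \<D>" for D
      using PD c that DC by auto
    have "P (\<Oplus>D\<in>?F. k \<odot> q c D) (\<lambda>D\<in>\<D>. k \<odot> q c D)"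
      by (rule PI[OF F]) (use SD(4) PD c in auto)
    also have "(\<Oplus>D\<in>?F. k \<odot> q c D) = k \<odot> (\<Oplus>D\<in>?F. q c D)"
      using qin F by (intro smult_sum[symmetric]) auto
    also have "\<dots> = k \<odot> c"
      using expF[OF c F] by simp
    finally show "q (k \<odot> c) D = k \<odot> q c D" using qI[of "k \<odot> c"] c D by simp
  next
    fix c D E assume D: "D \<in> \<D>" and E: "E \<in> \<D>" and c: "c \<in> D"
    have "P (\<Oplus>D'\<in>{D}. if D' = D then c else \<zero>) (\<lambda>D'\<in>\<D>. if D' = D then c else \<zero>)"
      by (rule PI) (use D c SD(2) in auto)
    hence "P c (\<lambda>D'\<in>\<D>. if D' = D then c else \<zero>)"
      using DC[OF D c] by simp
    thus "q c E = (if E = D then c else \<zero>)" using qI[OF DC[OF D c]] E by simp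
  qed
qed

definition cointegral :: "('c \<Rightarrow> 'c \<Rightarrow> complex) \<Rightarrow> bool" where
  "cointegral \<gamma> \<longleftrightarrow> (\<forall>c\<in>carrier C. linear_form (\<gamma> c)) \<and> (\<forall>d\<in>carrier C. linear_form (\<lambda>c. \<gamma> c d)) \<and>
     (\<forall>c\<in>carrier C. tensor_lift cplx \<gamma> (\<Delta> c) = \<epsilon> c) \<and>
     (\<forall>c\<in>carrier C. \<forall>d\<in>carrier C. R (\<lambda>u. \<gamma> u d) c = L (\<gamma> c) d)"

text \<open>
  Let \<open>\<gamma>\<close> be the local cointegral on each simple summand and zero between different summands.
  Invariance survives since the actions \<open>L\<close> and \<open>R\<close> preserve the summands.
\<close>

lemma cointegral_exists:
  assumes "cosemisimple C" shows "\<exists>\<gamma>. cointegral \<gamma>"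
proof -
  obtain \<D> \<pi> where cf: "component_family \<D> \<pi>" using simple_components[OF assms] by auto
  have simple: "D \<in> \<D> \<Longrightarrow> simple_subcoalgebra D C"
    and \<pi>D: "c \<in> carrier C \<Longrightarrow> D \<in> \<D> \<Longrightarrow> \<pi> D c \<in> D"
    and fin: "c \<in> carrier C \<Longrightarrow> finite {D \<in> \<D>. \<pi> D c \<noteq> \<zero>}"
    and exp: "c \<in> carrier C \<Longrightarrow> c = (\<Oplus>D\<in>{D \<in> \<D>. \<pi> D c \<noteq> \<zero>}. \<pi> D c)"
    and \<pi>add: "c \<in> carrier C \<Longrightarrow> d \<in> carrier C \<Longrightarrow> D \<in> \<D> \<Longrightarrow> \<pi> D (c \<oplus> d) = \<pi> D c \<oplus> \<pi> D d"
    and \<pi>smult: "c \<in> carrier C \<Longrightarrow> D \<in> \<D> \<Longrightarrow> \<pi> D (k \<odot> c) = k \<odot> \<pi> D c"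
    and \<pi>id: "D \<in> \<D> \<Longrightarrow> E \<in> \<D> \<Longrightarrow> c \<in> D \<Longrightarrow> \<pi> E c = (if E = D then c else \<zero>)" for c d D E k
    using cf unfolding component_family_def by simp_all
  have sc: "subcoalgebra D C" if "D \<in> \<D>" for D
    using simple[OF that] by (simp add: simple_subcoalgebra_def)
  have sub: "submodule D cplx C" if "D \<in> \<D>" for D
    using sc[OF that] by (simp add: subcoalgebra_def)
  note SD = submoduleD[OF sub]
  have DC: "v \<in> carrier C" if "D \<in> \<D>" "v \<in> D" for D v using SD(1)[OF that(1)] that(2) by auto
  have \<pi>C: "\<pi> D c \<in> carrier C" if "c \<in> carrier C" "D \<in> \<D>" for c D using \<pi>D DC that by simp
  have "\<forall>D\<in>\<D>. \<exists>y. local_cointegral D y" using simple simple_cointegral by auto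
  then obtain Y where Y0: "\<forall>D\<in>\<D>. local_cointegral D (Y D)" by (rule bchoice[THEN exE])
  have Y: "d \<in> D \<Longrightarrow> linear_form (Y D d)" "c \<in> D \<Longrightarrow> d \<in> D \<Longrightarrow> Y D d c = Y D c d"
     "c \<in> D \<Longrightarrow> d \<in> D \<Longrightarrow> R (Y D d) c = L (Y D c) d"
     "c \<in> D \<Longrightarrow> balanced cplx (vect C) (vect C) cplx \<gamma> \<Longrightarrow> (\<forall>u\<in>D. \<forall>v\<in>D. \<gamma> u v = Y D v u) \<Longrightarrow>
        tensor_lift cplx \<gamma> (\<Delta> c) = \<epsilon> c" if "D \<in> \<D>" for D c d \<gamma>
    using bspec[OF Y0 that] unfolding local_cointegral_def by simp_all
  have Yz: "Y D \<zero> c = 0" if "D \<in> \<D>" "c \<in> D" for D c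
    using Y(2)[OF that SD(2)[OF that(1)]] linear_form_zero[OF Y(1)[OF that]] by simp
  define \<gamma> where "\<gamma> c d = (\<Sum>D\<in>{D \<in> \<D>. \<pi> D d \<noteq> \<zero>}. Y D (\<pi> D d) (\<pi> D c))" for c d
  have \<gamma>F: "\<gamma> c d = (\<Sum>D\<in>F. Y D (\<pi> D d) (\<pi> D c))"
    if "c \<in> carrier C" "finite F" "F \<subseteq> \<D>" "{D \<in> \<D>. \<pi> D d \<noteq> \<zero>} \<subseteq> F" for c d F
    unfolding \<gamma>_def by (rule sum.mono_neutral_left[OF that(2,4)]) (use that Yz \<pi>D in \<open>auto simp: subset_iff\<close>)
  have lin1: "linear_form (\<lambda>c. \<gamma> c d)" if d: "d \<in> carrier C" for d
    unfolding linear_form_def \<gamma>_def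
    using Y(1) \<pi>D[OF d] \<pi>C \<pi>add \<pi>smult
    by (auto simp: linear_form_add linear_form_smult sum_distrib_left simp flip: sum.distrib)
  have Yadd: "Y D (a \<oplus> b) u = Y D a u + Y D b u" if "D \<in> \<D>" "a \<in> D" "b \<in> D" "u \<in> D" for D a b u
    using Y(2)[OF that(1) that(4) SD(3)[OF that(1-3)]] Y(2)[OF that(1,4,2)] Y(2)[OF that(1,4,3)]
      linear_form_add[OF Y(1)[OF that(1,4)]] DC that by simp
  have Ysmult: "Y D (k \<odot> a) u = k * Y D a u" if "D \<in> \<D>" "a \<in> D" "u \<in> D" for D a k u
    using Y(2)[OF that(1) that(3) SD(4)[OF that(1,2)]] Y(2)[OF that(1,3,2)]
      linear_form_smult[OF Y(1)[OF that(1,3)]] DC that by simp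
  have lin2: "linear_form (\<gamma> c)" if c: "c \<in> carrier C" for c
    unfolding linear_form_def
  proof (intro conjI ballI allI)
    fix u v assume u: "u \<in> carrier C" and v: "v \<in> carrier C"
    let ?F = "{D \<in> \<D>. \<pi> D u \<noteq> \<zero>} \<union> {D \<in> \<D>. \<pi> D v \<noteq> \<zero>}"
    have F: "finite ?F" "?F \<subseteq> \<D>" using fin u v by auto
    have s: "{D \<in> \<D>. \<pi> D (u \<oplus> v) \<noteq> \<zero>} \<subseteq> ?F"
    proof
      fix D assume "D \<in> {D \<in> \<D>. \<pi> D (u \<oplus> v) \<noteq> \<zero>}"
      hence D: "D \<in> \<D>" "\<pi> D (u \<oplus> v) \<noteq> \<zero>" by simp_all
      thus "D \<in> ?F" using \<pi>add[OF u v D(1)] by (cases "\<pi> D u = \<zero>") auto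
    qed
    have "\<gamma> c (u \<oplus> v) = (\<Sum>D\<in>?F. Y D (\<pi> D (u \<oplus> v)) (\<pi> D c))" by (rule \<gamma>F[OF c F s])
    also have "\<dots> = (\<Sum>D\<in>?F. Y D (\<pi> D u) (\<pi> D c) + Y D (\<pi> D v) (\<pi> D c))"
      using Yadd \<pi>D u v c \<pi>add by (intro sum.cong[OF refl]) auto
    also have "\<dots> = \<gamma> c u + \<gamma> c v"
      using \<gamma>F[OF c F, of u] \<gamma>F[OF c F, of v] by (simp add: sum.distrib)
    finally show "\<gamma> c (u \<oplus> v) = \<gamma> c u + \<gamma> c v" .
  next
    fix k v assume v: "v \<in> carrier C"
    let ?F = "{D \<in> \<D>. \<pi> D v \<noteq> \<zero>}"
    have F: "finite ?F" "?F \<subseteq> \<D>" using fin v by auto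
    have s: "{D \<in> \<D>. \<pi> D (k \<odot> v) \<noteq> \<zero>} \<subseteq> ?F"
      using \<pi>smult[OF v] by auto
    have "\<gamma> c (k \<odot> v) = (\<Sum>D\<in>?F. Y D (\<pi> D (k \<odot> v)) (\<pi> D c))" by (rule \<gamma>F[OF c F s])
    also have "\<dots> = (\<Sum>D\<in>?F. k * Y D (\<pi> D v) (\<pi> D c))"
      using Ysmult \<pi>D v c \<pi>smult by (intro sum.cong[OF refl]) auto
    finally show "\<gamma> c (k \<odot> v) = k * \<gamma> c v"
      by (simp add: \<gamma>_def sum_distrib_left)
  qed
  have \<gamma>D: "\<gamma> c d = (if D = E then Y D d c else 0)"
    if "D \<in> \<D>" "E \<in> \<D>" "c \<in> D" "d \<in> E" for c d D E
  proof -
    have s: "{D \<in> \<D>. \<pi> D d \<noteq> \<zero>} \<subseteq> {E}"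
    proof (rule subsetI, rule ccontr)
      fix D assume "D \<in> {D \<in> \<D>. \<pi> D d \<noteq> \<zero>}" "D \<notin> {E}"
      thus False using \<pi>id[OF that(2) _ that(4), of D] by simp
    qed
    have "\<gamma> c d = (\<Sum>D\<in>{E}. Y D (\<pi> D d) (\<pi> D c))"
      using that DC[OF that(1,3)] by (intro \<gamma>F[OF _ _ _ s]) auto
    also have "\<dots> = Y E d (\<pi> E c)" using \<pi>id[OF that(2,2,4)] by simp
    also have "\<dots> = (if D = E then Y D d c else 0)"
      using \<pi>id[OF that(1,2,3)] linear_form_zero[OF Y(1)[OF that(2,4)]] by auto
    finally show ?thesis .
  qed
  have bal: "balanced cplx (vect C) (vect C) cplx \<gamma>"
    using lin1 lin2 by (intro balancedI) (simp_all add: linear_form_add linear_form_smult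
        linear_form_add[OF lin1] linear_form_smult[OF lin1])
  note lift = VV.lift_additive[OF abelian_group_cplx bal] VV.lift_pure[OF abelian_group_cplx bal]
  have norm: "tensor_lift cplx \<gamma> (\<Delta> c) = \<epsilon> c" if c: "c \<in> carrier C" for c
  proof -
    let ?F = "{D \<in> \<D>. \<pi> D c \<noteq> \<zero>}"
    have add: "(\<lambda>c. tensor_lift cplx \<gamma> (\<Delta> c)) \<in> additive_maps C cplx"
      by (rule additive_mapsI) (simp_all add: comult_add additive_add[OF lift(1)])
    have g: "(\<lambda>D. \<pi> D c) \<in> ?F \<rightarrow> carrier C" using \<pi>C[OF c] by auto
    have "tensor_lift cplx \<gamma> (\<Delta> c) = tensor_lift cplx \<gamma> (\<Delta> (\<Oplus>D\<in>?F. \<pi> D c))"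
      using exp[OF c] by simp
    also have "\<dots> = (\<Sum>D\<in>?F. tensor_lift cplx \<gamma> (\<Delta> (\<pi> D c)))"
      using additive_finsum[OF add M.abelian_group_axioms abelian_group_cplx fin[OF c] g] fin[OF c]
      by (simp add: finsum_cplx)
    also have "\<dots> = (\<Sum>D\<in>?F. \<epsilon> (\<pi> D c))"
      using \<gamma>D \<pi>D[OF c] by (intro sum.cong[OF refl] Y(4)[OF _ _ bal]) auto
    also have "\<dots> = \<epsilon> (\<Oplus>D\<in>?F. \<pi> D c)"
      by (rule linear_form_sum[OF linear_form_counit fin[OF c] g, symmetric])
    finally show ?thesis using exp[OF c] by simp
  qed
  \<comment> \<open>The invariance, tested against a linear form \<open>z\<close>; in this shape it is additive in \<open>c\<close> and \<open>d\<close>.\<close>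
  have inv: "\<gamma> (L z c) d = \<gamma> c (R z d)"
    if z: "linear_form z" and c: "c \<in> carrier C" and d: "d \<in> carrier C" for z c d
  proof -
    have 1: "\<gamma> (L z u) v = \<gamma> u (R z v)" if "D \<in> \<D>" "E \<in> \<D>" "u \<in> D" "v \<in> E" for D E u v
    proof -
      have in': "L z u \<in> D" "R z v \<in> E"
        using subcoalgebra_slices(1)[OF sc[OF that(1)] that(3) z] subcoalgebra_slices(2)[OF sc[OF that(2)] that(4) z] .
      show ?thesis
      proof (cases "D = E")
        case True
        hence vD: "v \<in> D" "R z v \<in> D" using that in' by simp_all
        note uC = DC[OF that(1,3)] and vC = DC[OF that(1) vD(1)]
        have "\<gamma> (L z u) v = Y D v (L z u)" using \<gamma>D[OF that(1,1) in'(1) vD(1)] by simp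
        also have "\<dots> = z (R (Y D v) u)" using L_R_adjoint[OF z Y(1)[OF that(1) vD(1)] uC] .
        also have "\<dots> = z (L (Y D u) v)" using Y(3)[OF that(1,3) vD(1)] by simp
        also have "\<dots> = Y D u (R z v)" using L_R_adjoint[OF Y(1)[OF that(1,3)] z vC] .
        also have "\<dots> = Y D (R z v) u" using Y(2)[OF that(1) vD(2) that(3)] .
        also have "\<dots> = \<gamma> u (R z v)" using \<gamma>D[OF that(1,1,3) vD(2)] by simp
        finally show ?thesis .
      next
        case False
        thus ?thesis using \<gamma>D[OF that(1,2) in'(1) that(4)] \<gamma>D[OF that(1,2,3) in'(2)] by simp
      qed
    qed
    let ?F = "{D \<in> \<D>. \<pi> D c \<noteq> \<zero>}" and ?G = "{D \<in> \<D>. \<pi> D d \<noteq> \<zero>}"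
    have g: "(\<lambda>D. \<pi> D c) \<in> ?F \<rightarrow> carrier C" "(\<lambda>D. \<pi> D d) \<in> ?G \<rightarrow> carrier C" using \<pi>C[OF c] \<pi>C[OF d] by auto
    have 2: "\<gamma> (L z u) d = \<gamma> u (R z d)" if "D \<in> \<D>" "u \<in> D" for D u
    proof -
      note uC = DC[OF that]
      have "\<gamma> (L z u) d = \<gamma> (L z u) (\<Oplus>E\<in>?G. \<pi> E d)" using exp[OF d] by simp
      also have "\<dots> = (\<Sum>E\<in>?G. \<gamma> (L z u) (\<pi> E d))"
        using uC z by (intro linear_form_sum[OF lin2 fin[OF d] g(2)]) simp
      also have "\<dots> = (\<Sum>E\<in>?G. \<gamma> u (R z (\<pi> E d)))"
        using 1[OF that(1) _ that(2)] \<pi>D[OF d] by (intro sum.cong[OF refl]) auto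
      also have "\<dots> = \<gamma> u (R z (\<Oplus>E\<in>?G. \<pi> E d))"
        by (rule linear_form_sum[OF linear_form_R[OF lin2[OF uC] z] fin[OF d] g(2), symmetric])
      finally show ?thesis using exp[OF d] by simp
    qed
    have Rd: "R z d \<in> carrier C" using z d by simp
    have "\<gamma> (L z c) d = \<gamma> (L z (\<Oplus>D\<in>?F. \<pi> D c)) d" using exp[OF c] by simp
    also have "\<dots> = (\<Sum>D\<in>?F. \<gamma> (L z (\<pi> D c)) d)"
      by (rule linear_form_sum[OF linear_form_L[OF lin1[OF d] z] fin[OF c] g(1)])
    also have "\<dots> = (\<Sum>D\<in>?F. \<gamma> (\<pi> D c) (R z d))"
      using 2 \<pi>D[OF c] by (intro sum.cong[OF refl]) auto
    also have "\<dots> = \<gamma> (\<Oplus>D\<in>?F. \<pi> D c) (R z d)"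
      by (rule linear_form_sum[OF lin1[OF Rd] fin[OF c] g(1), symmetric])
    finally show ?thesis using exp[OF c] by simp
  qed
  have "R (\<lambda>u. \<gamma> u d) c = L (\<gamma> c) d" if c: "c \<in> carrier C" and d: "d \<in> carrier C" for c d
  proof (rule linear_forms_separate)
    fix z assume z: "linear_form z"
    have "z (R (\<lambda>u. \<gamma> u d) c) = \<gamma> (L z c) d" using L_R_adjoint[OF z lin1[OF d] c] by simp
    also have "\<dots> = \<gamma> c (R z d)" by (rule inv[OF z c d])
    also have "\<dots> = z (L (\<gamma> c) d)" using L_R_adjoint[OF lin2[OF c] z d] by simp
    finally show "z (R (\<lambda>u. \<gamma> u d) c) = z (L (\<gamma> c) d)" .
  qed (use lin1 lin2 c d in simp_all)
  thus ?thesis unfolding cointegral_def using lin1 lin2 norm by (intro exI[of _ \<gamma>] conjI ballI)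
qed

end

section \<open>Coaugmented Galois extensions\<close>

lemma regular_sel [simp]:
  "carrier (regular A) = carrier A" "\<zero>\<^bsub>regular A\<^esub> = \<zero>\<^bsub>A\<^esub>" "add (regular A) = add A"
  "lact (regular A) = monoid.mult A" "ract (regular A) = monoid.mult A"
  "carrier (left_regular A') = carrier A'" "\<zero>\<^bsub>left_regular A'\<^esub> = \<zero>\<^bsub>A'\<^esub>" "add (left_regular A') = add A'"
  "lact (left_regular A') = monoid.mult A'" "ract (left_regular A') = (\<lambda>a k. k \<odot>\<^bsub>A'\<^esub> a)"
  "carrier (right_regular A') = carrier A'" "\<zero>\<^bsub>right_regular A'\<^esub> = \<zero>\<^bsub>A'\<^esub>" "add (right_regular A') = add A'"
  "lact (right_regular A') = (\<lambda>k a. k \<odot>\<^bsub>A'\<^esub> a)" "ract (right_regular A') = monoid.mult A'"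
  by (simp_all add: regular_def left_regular_def right_regular_def)

text \<open>Here \<open>K\<close> and \<open>L\<close> are subrings of \<open>A\<close>, given as rings of their own with the operations of \<open>A\<close>.\<close>

lemma bimod_regular:
  assumes A: "ring A"
    and K: "ring K" "carrier K \<subseteq> carrier A" "monoid.mult K = monoid.mult A" "\<one>\<^bsub>K\<^esub> = \<one>\<^bsub>A\<^esub>" "add K = add A"
    and L: "ring L" "carrier L \<subseteq> carrier A" "monoid.mult L = monoid.mult A" "\<one>\<^bsub>L\<^esub> = \<one>\<^bsub>A\<^esub>" "add L = add A"
  shows "bimod K L (regular A)"
proof -
  interpret A: ring A by fact
  have "abelian_group (regular A)"
    by (rule abelian_group_cong[OF _ _ _ A.is_abelian_group]) simp_all
  moreover have "k \<in> carrier A" if "k \<in> carrier K" for k using that K by auto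
  moreover have "l \<in> carrier A" if "l \<in> carrier L" for l using that L by auto
  ultimately show ?thesis
    using K L unfolding bimod_def left_module_def right_module_def
    by (simp add: A.l_distr A.r_distr A.m_assoc)
qed

lemma tensor_left_regular [simp]:
  fixes A :: "(complex, 'a, 'x) module_scheme"
  shows "carrier (left_regular A \<otimes>\<^sub>\<complex> N) = carrier (vect A \<otimes>\<^sub>\<complex> N)"
    "add (left_regular A \<otimes>\<^sub>\<complex> N) = add (vect A \<otimes>\<^sub>\<complex> N)"
    "\<zero>\<^bsub>left_regular A \<otimes>\<^sub>\<complex> N\<^esub> = \<zero>\<^bsub>vect A \<otimes>\<^sub>\<complex> N\<^esub>"
    "pure_tensor cplx (left_regular A) N = pure_tensor cplx (vect A) N"
  using tensor_cong_left[of "left_regular A" "vect A" cplx N] by (simp_all add: tensor_group_sel2)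

lemma tensor_right_regular [simp]:
  fixes A :: "(complex, 'a, 'x) module_scheme"
  shows "carrier (M \<otimes>\<^sub>\<complex> right_regular A) = carrier (M \<otimes>\<^sub>\<complex> vect A)"
    "add (M \<otimes>\<^sub>\<complex> right_regular A) = add (M \<otimes>\<^sub>\<complex> vect A)"
    "\<zero>\<^bsub>M \<otimes>\<^sub>\<complex> right_regular A\<^esub> = \<zero>\<^bsub>M \<otimes>\<^sub>\<complex> vect A\<^esub>"
    "pure_tensor cplx M (right_regular A) = pure_tensor cplx M (vect A)"
  using tensor_cong_right[of "right_regular A" "vect A" cplx M] by (simp_all add: tensor_group_sel2)

lemma additive_maps_left_regular [simp]:
  "additive_maps (left_regular A \<otimes>\<^sub>\<complex> N) G = additive_maps (vect A \<otimes>\<^sub>\<complex> N) G"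
  "additive_maps G (left_regular A \<otimes>\<^sub>\<complex> N) = additive_maps G (vect A \<otimes>\<^sub>\<complex> N)"
  "additive_maps (M \<otimes>\<^sub>\<complex> right_regular A) G = additive_maps (M \<otimes>\<^sub>\<complex> vect A) G"
  "additive_maps G (M \<otimes>\<^sub>\<complex> right_regular A) = additive_maps G (M \<otimes>\<^sub>\<complex> vect A)"
  by (rule additive_maps_cong; simp)+

lemma inv_into_additive:
  assumes h: "h \<in> additive_maps M N" and b: "bij_betw h (carrier M) (carrier N)" and M: "abelian_group M"
  shows "inv_into (carrier M) h \<in> additive_maps N M"
proof (rule additive_mapsI)
  interpret abelian_group M by fact
  let ?g = "inv_into (carrier M) h"
  note r = bij_betw_inv_into_right[OF b] and l = bij_betw_inv_into_left[OF b]
  have c: "?g x \<in> carrier M" if "x \<in> carrier N" for x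
    using bij_betwE[OF bij_betw_inv_into[OF b]] that by simp
  thus "x \<in> carrier N \<Longrightarrow> ?g x \<in> carrier M" for x .
  fix x y assume xy: "x \<in> carrier N" "y \<in> carrier N"
  have "h (?g x \<oplus>\<^bsub>M\<^esub> ?g y) = x \<oplus>\<^bsub>N\<^esub> y" using c xy by (simp add: additive_add[OF h] r)
  thus "?g (x \<oplus>\<^bsub>N\<^esub> y) = ?g x \<oplus>\<^bsub>M\<^esub> ?g y" using l[of "?g x \<oplus>\<^bsub>M\<^esub> ?g y"] c xy by simp
qed

locale galois_extension = complex_coalgebra C for C :: "'c coalgebra" +
  fixes e :: 'c and A :: "('a, 'c) comodule"
  assumes gl: "group_like C e"
    and gal: "coaugmented_Galois_extension C e A"
    and bij: "bijective_entwining C A"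
begin

abbreviation "vA \<equiv> vect A"
abbreviation "vC \<equiv> vect C"
abbreviation "B \<equiv> coinvariants C A"
abbreviation "BA \<equiv> coinv_algebra C A"
abbreviation "\<delta> \<equiv> coact A"
abbreviation "pAC \<equiv> pure_tensor cplx vA vC"
abbreviation "pCA \<equiv> pure_tensor cplx vC vA"
abbreviation "tAC \<equiv> vA \<otimes>\<^sub>\<complex> vC"
abbreviation "tCA \<equiv> vC \<otimes>\<^sub>\<complex> vA"
abbreviation "lmul \<equiv> lact (left_regular A \<otimes>\<^sub>\<complex> vC)"
abbreviation "rmul \<equiv> ract (vC \<otimes>\<^sub>\<complex> right_regular A)"

lemma e_in [simp]: "e \<in> carrier C" and comult_e: "\<Delta> e = pv e e"
  using gl by (simp_all add: group_like_def)

lemma A_alg: "assoc_algebra A" and A_comod: "right_comodule C A"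
  and coact_one: "\<delta> \<one>\<^bsub>A\<^esub> = pAC \<one>\<^bsub>A\<^esub> e"
  and can_bij: "bij_betw (can C A) (carrier (tensor_coinv C A)) (carrier tAC)"
  using gal by (simp_all add: coaugmented_Galois_extension_def)

sublocale A: assoc_algebra A by (rule A_alg)
sublocale Av: complex_space A
  unfolding complex_space_def by (rule A.module_axioms)

lemma cA: "cspace vA" and cC: "cspace vC"
  by (rule Av.cspace, rule cspace)

sublocale AC: tensor_product cplx vA vC using cA cC by (rule cspace_tensor_product)
sublocale CA: tensor_product cplx vC vA using cC cA by (rule cspace_tensor_product)

lemma cAC: "cspace tAC" and cCA: "cspace tCA" and cCC: "cspace (vC \<otimes>\<^sub>\<complex> vC)"
  using cA cC by (auto intro: cspace_tensor)

lemma abelian_group_left_regular: "abelian_group (left_regular A)" "abelian_group (right_regular A)"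
  by (rule abelian_group_cong[OF _ _ _ A.is_abelian_group]; simp)+

lemma bimod_left_regular: "bimod A cplx (left_regular A)"
  using abelian_group_left_regular A.ring_axioms ring_cplx A.smult_l_distr A.smult_r_distr A.smult_assoc1
  unfolding bimod_def left_module_def right_module_def
  by (simp add: A.l_distr A.r_distr A.m_assoc A.smult_mult_right flip: A.smult_assoc1) (simp add: mult.commute)

lemma bimod_right_regular: "bimod cplx A (right_regular A)"
  using abelian_group_left_regular A.ring_axioms ring_cplx A.smult_l_distr A.smult_r_distr A.smult_assoc1
  unfolding bimod_def left_module_def right_module_def
  by (simp add: A.l_distr A.r_distr A.m_assoc A.smult_mult_left)

sublocale LAC: tensor_product cplx "left_regular A" vC
  using bimodD(2)[OF bimod_left_regular] cspaceD(2)[OF cC] by (rule tensor_productI)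
sublocale RCA: tensor_product cplx vC "right_regular A"
  using cspaceD(3)[OF cC] bimodD(1)[OF bimod_right_regular] by (rule tensor_productI)

lemma lmul_additive: "a \<in> carrier A \<Longrightarrow> lmul a \<in> additive_maps tAC tAC"
  and lmul_pure [simp]: "a \<in> carrier A \<Longrightarrow> x \<in> carrier A \<Longrightarrow> c \<in> carrier C \<Longrightarrow>
      lmul a (pAC x c) = pAC (a \<otimes>\<^bsub>A\<^esub> x) c"
  using LAC.lact_tensor[OF bimod_left_regular, of a] by simp_all

lemma rmul_additive: "a \<in> carrier A \<Longrightarrow> (\<lambda>s. rmul s a) \<in> additive_maps tCA tCA"
  and rmul_pure [simp]: "a \<in> carrier A \<Longrightarrow> x \<in> carrier A \<Longrightarrow> c \<in> carrier C \<Longrightarrow>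
      rmul (pCA c x) a = pCA c (x \<otimes>\<^bsub>A\<^esub> a)"
  using RCA.ract_tensor[OF bimod_right_regular, of a] by simp_all

lemmas lmul_module = left_moduleD(3-7)[OF LAC.left_module_tensor[OF bimod_left_regular], simplified]
lemmas rmul_module = right_moduleD(3-7)[OF RCA.right_module_tensor[OF bimod_right_regular], simplified]
lemmas AC_pure [simp] = AC.pure_in[simplified] and CA_pure [simp] = CA.pure_in[simplified]

lemma coact_linear: "\<delta> \<in> left_linear cplx vA tAC"
  using A_comod by (simp add: right_comodule_def)

lemma coact_in [simp]: "a \<in> carrier A \<Longrightarrow> \<delta> a \<in> carrier tAC"
  using additive_closed[OF left_linear_additive[OF coact_linear]] by simp

lemma coact_add: "a \<in> carrier A \<Longrightarrow> b \<in> carrier A \<Longrightarrow> \<delta> (a \<oplus>\<^bsub>A\<^esub> b) = \<delta> a \<oplus>\<^bsub>tAC\<^esub> \<delta> b"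
  using additive_add[OF left_linear_additive[OF coact_linear], of a b] by simp

lemma coact_smult: "a \<in> carrier A \<Longrightarrow> \<delta> (k \<odot>\<^bsub>A\<^esub> a) = lact tAC k (\<delta> a)"
  using left_linear_act[OF coact_linear, of k a] by simp

lemma lact_AC_additive: "lact tAC k \<in> additive_maps tAC tAC"
  and lact_AC_pure [simp]: "x \<in> carrier A \<Longrightarrow> c \<in> carrier C \<Longrightarrow> lact tAC k (pAC x c) = pAC (k \<odot>\<^bsub>A\<^esub> x) c"
  using AC.lact_tensor[OF cspaceD(1)[OF cA], of k] by simp_all

text \<open>
  Scalars act as elements of the algebra.  As they lie in \<open>\<B>\<close> (\<open>scalar_B\<close>), linearity over the complex
  numbers is an instance of \<open>\<B>\<close>-linearity or of balancedness over \<open>\<B>\<close>.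
\<close>

lemma scalar_mult: "t \<in> carrier tAC \<Longrightarrow> lact tAC k t = lmul (k \<odot>\<^bsub>A\<^esub> \<one>\<^bsub>A\<^esub>) t"
  by (erule AC.additive_eqI[OF lact_AC_additive lmul_additive, rotated 2])
     (simp_all add: A.smult_mult_left)

subsection \<open>The coinvariant subalgebra\<close>

lemma B_in: "b \<in> B \<Longrightarrow> b \<in> carrier A" and B_coact: "b \<in> B \<Longrightarrow> a \<in> carrier A \<Longrightarrow> \<delta> (b \<otimes>\<^bsub>A\<^esub> a) = lmul b (\<delta> a)"
  by (simp_all add: coinvariants_def)

lemma B_coact_one: "b \<in> B \<Longrightarrow> \<delta> b = pAC b e"
  using B_coact[of b "\<one>\<^bsub>A\<^esub>"] B_in[of b] by (simp add: coact_one)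

lemma scalar_B: "k \<odot>\<^bsub>A\<^esub> \<one>\<^bsub>A\<^esub> \<in> B"
  by (simp add: coinvariants_def A.smult_mult_left coact_smult scalar_mult)

lemma one_B: "\<one>\<^bsub>A\<^esub> \<in> B"
  by (simp add: coinvariants_def lmul_module(5))

lemma add_B: "b \<in> B \<Longrightarrow> b' \<in> B \<Longrightarrow> b \<oplus>\<^bsub>A\<^esub> b' \<in> B"
  by (simp add: coinvariants_def A.l_distr coact_add lmul_module)

lemma mult_B: "b \<in> B \<Longrightarrow> b' \<in> B \<Longrightarrow> b \<otimes>\<^bsub>A\<^esub> b' \<in> B"
  by (simp add: coinvariants_def A.m_assoc lmul_module)

lemma smult_B: "b \<in> B \<Longrightarrow> k \<odot>\<^bsub>A\<^esub> b \<in> B"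
  using mult_B[OF scalar_B, of b k] B_in[of b] by (simp add: A.smult_mult_left)

lemma minus_B: "b \<in> B \<Longrightarrow> \<ominus>\<^bsub>A\<^esub> b \<in> B"
  using smult_B[of b "- 1"] B_in[of b] by (simp add: Av.minus_smult)

lemma subring_B: "subring B A"
  by (rule A.subringI) (auto simp: B_in one_B minus_B mult_B add_B)

lemma ring_B: "ring BA"
  by (rule A.subring_is_ring[OF subring_B])

lemma bimod_AB: "bimod A BA (regular A)" and bimod_BA: "bimod BA A (regular A)" and bimod_BB: "bimod BA BA (regular A)"
  by (rule bimod_regular; use A.ring_axioms ring_B B_in in auto)+

sublocale TB: tensor_product BA "regular A" "regular A"
  using bimodD(2)[OF bimod_AB] bimodD(1)[OF bimod_BA] by (rule tensor_productI)

abbreviation "tB \<equiv> pure_tensor BA (regular A) (regular A)"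
abbreviation "AtA \<equiv> tensor_coinv C A"

lemmas TB_pure [simp] = TB.pure_in[simplified]

lemma lact_TB: "a \<in> carrier A \<Longrightarrow> lact AtA a \<in> additive_maps AtA AtA"
  and lact_TB_pure [simp]: "a \<in> carrier A \<Longrightarrow> x \<in> carrier A \<Longrightarrow> y \<in> carrier A \<Longrightarrow>
      lact AtA a (tB x y) = tB (a \<otimes>\<^bsub>A\<^esub> x) y"
  using TB.lact_tensor[OF bimod_AB, of a] by simp_all

lemma ract_TB: "a \<in> carrier A \<Longrightarrow> (\<lambda>t. ract AtA t a) \<in> additive_maps AtA AtA"
  and ract_TB_pure [simp]: "a \<in> carrier A \<Longrightarrow> x \<in> carrier A \<Longrightarrow> y \<in> carrier A \<Longrightarrow>
      ract AtA (tB x y) a = tB x (y \<otimes>\<^bsub>A\<^esub> a)"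
  using TB.ract_tensor[OF bimod_BA, of a] by simp_all

lemmas TB_module = TB.bimod_tensor[OF bimod_AB bimod_BA]
lemmas TB_left = left_moduleD(3-7)[OF bimodD(1)[OF TB_module]]
lemmas TB_right = right_moduleD(3-7)[OF bimodD(2)[OF TB_module]]

subsection \<open>The canonical map\<close>

abbreviation "cn \<equiv> can C A"

lemma can_balanced: "balanced BA (regular A) (regular A) (left_regular A \<otimes>\<^sub>\<complex> vC) (\<lambda>a a'. lmul a (\<delta> a'))"
  by (rule balancedI) (simp_all add: lmul_module coact_add B_coact B_in)

lemma can_additive: "cn \<in> additive_maps AtA tAC"
  and can_pure [simp]: "a \<in> carrier A \<Longrightarrow> a' \<in> carrier A \<Longrightarrow> cn (tB a a') = lmul a (\<delta> a')"
  using TB.lift_additive[OF LAC.tensor_abelian_group can_balanced] TB.lift_pure[OF LAC.tensor_abelian_group can_balanced]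
  by (simp_all add: can_def)

lemma can_lact: "s \<in> carrier AtA \<Longrightarrow> a \<in> carrier A \<Longrightarrow> cn (lact AtA a s) = lmul a (cn s)"
proof (induction rule: TB.induct)
  case (add s t)
  thus ?case
    by (simp add: additive_add[OF lact_TB] additive_closed[OF lact_TB] additive_add[OF can_additive]
        additive_closed[OF can_additive] lmul_module)
qed (simp add: lmul_module)

definition can_inv where "can_inv = inv_into (carrier AtA) cn"

lemma can_inv_additive: "can_inv \<in> additive_maps tAC AtA"
  unfolding can_inv_def by (rule inv_into_additive[OF can_additive can_bij TB.tensor_abelian_group])

lemma can_inv_in [simp]: "t \<in> carrier tAC \<Longrightarrow> can_inv t \<in> carrier AtA"
  using additive_closed[OF can_inv_additive] .

lemma can_in [simp]: "s \<in> carrier AtA \<Longrightarrow> cn s \<in> carrier tAC"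
  using additive_closed[OF can_additive] .

lemma can_can_inv [simp]: "t \<in> carrier tAC \<Longrightarrow> cn (can_inv t) = t"
  unfolding can_inv_def by (rule bij_betw_inv_into_right[OF can_bij])

lemma can_inv_can [simp]: "s \<in> carrier AtA \<Longrightarrow> can_inv (cn s) = s"
  unfolding can_inv_def by (rule bij_betw_inv_into_left[OF can_bij])

lemma can_inv_lmul: "t \<in> carrier tAC \<Longrightarrow> a \<in> carrier A \<Longrightarrow> can_inv (lmul a t) = lact AtA a (can_inv t)"
  using can_lact[of "can_inv t" a] can_inv_can[of "lact AtA a (can_inv t)"] TB_left(1) by simp

text \<open>
  As the canonical map is onto, \<open>\<A> \<otimes> \<C>\<close> is generated by the elements \<open>x \<delta>(y)\<close>.  On them the action of \<open>\<A>\<close>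
  below is explicit.
\<close>

lemma AC_can_induct [consumes 1, case_names can add]:
  assumes "t \<in> carrier tAC"
    and "\<And>x y. x \<in> carrier A \<Longrightarrow> y \<in> carrier A \<Longrightarrow> P (lmul x (\<delta> y))"
    and "\<And>s t. s \<in> carrier tAC \<Longrightarrow> t \<in> carrier tAC \<Longrightarrow> P s \<Longrightarrow> P t \<Longrightarrow>
       P (s \<oplus>\<^bsub>tAC\<^esub> t)"
  shows "P t"
proof -
  have "P (cn s)" if "s \<in> carrier AtA" for s
    using that
    by (induction rule: TB.induct) (simp_all add: additive_add[OF can_additive] assms(2,3))
  from this[of "can_inv t"] show ?thesis using assms(1) by simp
qed

text \<open>
  The right multiplication of \<open>\<A>\<close> on \<open>\<A> \<otimes>\<^sub>\<B> \<A>\<close>, transported to \<open>\<A> \<otimes> \<C>\<close> along the canonical map.  The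
  canonical entwining is \<open>\<psi>(c \<otimes> a) = (1 \<otimes> c) a\<close> for this action, and the coaction is right linear
  for it (\<open>ract_AC_coact\<close>).
\<close>

definition ract_AC where "ract_AC a t = cn (ract AtA (can_inv t) a)"

lemma ract_AC_can [simp]: "s \<in> carrier AtA \<Longrightarrow> ract_AC a (cn s) = cn (ract AtA s a)"
  by (simp add: ract_AC_def)

lemma ract_AC_additive: "a \<in> carrier A \<Longrightarrow> ract_AC a \<in> additive_maps tAC tAC"
  unfolding ract_AC_def[abs_def]
  by (rule additive_comp[OF additive_comp[OF can_inv_additive ract_TB] can_additive])

lemma ract_AC_in [simp]: "a \<in> carrier A \<Longrightarrow> t \<in> carrier tAC \<Longrightarrow> ract_AC a t \<in> carrier tAC"
  using additive_closed[OF ract_AC_additive] .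

lemma ract_AC_add: "a \<in> carrier A \<Longrightarrow> s \<in> carrier tAC \<Longrightarrow> t \<in> carrier tAC \<Longrightarrow>
    ract_AC a (s \<oplus>\<^bsub>tAC\<^esub> t) = ract_AC a s \<oplus>\<^bsub>tAC\<^esub> ract_AC a t"
  using additive_add[OF ract_AC_additive] .

lemma ract_AC_add_left: "a \<in> carrier A \<Longrightarrow> a' \<in> carrier A \<Longrightarrow> t \<in> carrier tAC \<Longrightarrow>
    ract_AC (a \<oplus>\<^bsub>A\<^esub> a') t = ract_AC a t \<oplus>\<^bsub>tAC\<^esub> ract_AC a' t"
  by (simp add: ract_AC_def TB_right additive_add[OF can_additive])

lemma ract_AC_mult: "a \<in> carrier A \<Longrightarrow> a' \<in> carrier A \<Longrightarrow> t \<in> carrier tAC \<Longrightarrow>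
    ract_AC (a \<otimes>\<^bsub>A\<^esub> a') t = ract_AC a' (ract_AC a t)"
  by (simp add: ract_AC_def TB_right)

lemma ract_AC_lmul: "a \<in> carrier A \<Longrightarrow> x \<in> carrier A \<Longrightarrow> t \<in> carrier tAC \<Longrightarrow>
    ract_AC a (lmul x t) = lmul x (ract_AC a t)"
  by (simp add: ract_AC_def can_inv_lmul bimodD(3)[OF TB_module] can_lact TB_right)

lemma ract_AC_coact: "a \<in> carrier A \<Longrightarrow> x \<in> carrier A \<Longrightarrow> ract_AC a (\<delta> x) = \<delta> (x \<otimes>\<^bsub>A\<^esub> a)"
  using ract_AC_can[of "tB \<one>\<^bsub>A\<^esub> x" a] by (simp add: lmul_module del: ract_AC_can)

lemma ract_AC_grouplike: "a \<in> carrier A \<Longrightarrow> x \<in> carrier A \<Longrightarrow> ract_AC a (pAC x e) = lmul x (\<delta> a)"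
  using ract_AC_lmul[of a x "\<delta> \<one>\<^bsub>A\<^esub>"] ract_AC_coact[of a "\<one>\<^bsub>A\<^esub>"] by (simp add: coact_one)

text \<open>As \<open>\<delta>(b a) = \<delta>(b) a\<close> for the right action of \<open>\<A>\<close>, invariance need only be tested at \<open>a = 1\<close>.\<close>

lemma B_I: "b \<in> carrier A \<Longrightarrow> \<delta> b = pAC b e \<Longrightarrow> b \<in> B"
  using ract_AC_coact[of _ b] ract_AC_grouplike[of _ b] by (simp add: coinvariants_def)

lemma ract_AC_smult:
  assumes "a \<in> carrier A" "t \<in> carrier tAC"
  shows "ract_AC (k \<odot>\<^bsub>A\<^esub> a) t = lmul (k \<odot>\<^bsub>A\<^esub> \<one>\<^bsub>A\<^esub>) (ract_AC a t)"
proof -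
  have "ract AtA s (k \<odot>\<^bsub>A\<^esub> a) = lact AtA (k \<odot>\<^bsub>A\<^esub> \<one>\<^bsub>A\<^esub>) (ract AtA s a)" if "s \<in> carrier AtA" for s
    using that
  proof (induction rule: TB.induct)
    case (pure x y)
    have "tB x (y \<otimes>\<^bsub>A\<^esub> (k \<odot>\<^bsub>A\<^esub> a)) = tB x ((k \<odot>\<^bsub>A\<^esub> \<one>\<^bsub>A\<^esub>) \<otimes>\<^bsub>A\<^esub> (y \<otimes>\<^bsub>A\<^esub> a))"
      using pure assms by (simp add: A.smult_mult_left A.smult_mult_right)
    also have "\<dots> = tB (x \<otimes>\<^bsub>A\<^esub> (k \<odot>\<^bsub>A\<^esub> \<one>\<^bsub>A\<^esub>)) (y \<otimes>\<^bsub>A\<^esub> a)"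
      using pure assms TB.pure_balanced[of x "k \<odot>\<^bsub>A\<^esub> \<one>\<^bsub>A\<^esub>" "y \<otimes>\<^bsub>A\<^esub> a"] by (simp add: scalar_B)
    finally show ?case using pure assms by (simp add: A.smult_mult_left A.smult_mult_right)
  next
    case (add s t)
    thus ?case using assms by (simp add: additive_add[OF ract_TB] TB_left TB_right)
  qed
  thus ?thesis using assms by (simp add: ract_AC_def can_lact TB_right)
qed

subsection \<open>The canonical entwining\<close>

abbreviation "\<psi> \<equiv> canonical_entwining C A"

lemma entwining_alt: "\<psi> = tensor_lift tAC (\<lambda>c a. ract_AC a (pAC \<one>\<^bsub>A\<^esub> c))"
  by (simp add: canonical_entwining_def ract_AC_def can_inv_def)

lemma pAC_scalar: "c \<in> carrier C \<Longrightarrow> pAC \<one>\<^bsub>A\<^esub> (k \<odot>\<^bsub>C\<^esub> c) = lmul (k \<odot>\<^bsub>A\<^esub> \<one>\<^bsub>A\<^esub>) (pAC \<one>\<^bsub>A\<^esub> c)"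
  using AC.pure_balanced[of "\<one>\<^bsub>A\<^esub>" k c] by simp

lemma ract_AC_scalar: "c \<in> carrier C \<Longrightarrow> a \<in> carrier A \<Longrightarrow>
    ract_AC a (pAC (k \<odot>\<^bsub>A\<^esub> \<one>\<^bsub>A\<^esub>) c) = lmul (k \<odot>\<^bsub>A\<^esub> \<one>\<^bsub>A\<^esub>) (ract_AC a (pAC \<one>\<^bsub>A\<^esub> c))"
  using ract_AC_lmul[of a "k \<odot>\<^bsub>A\<^esub> \<one>\<^bsub>A\<^esub>" "pAC \<one>\<^bsub>A\<^esub> c"] by simp

lemma entwining_balanced: "balanced cplx vC vA tAC (\<lambda>c a. ract_AC a (pAC \<one>\<^bsub>A\<^esub> c))"
  by (rule balancedI) (simp_all add: AC.pure_add2[simplified] ract_AC_add ract_AC_add_left pAC_scalar ract_AC_scalar ract_AC_smult)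

lemma entwining_additive: "\<psi> \<in> additive_maps tCA tAC"
  and entwining_pure [simp]: "c \<in> carrier C \<Longrightarrow> a \<in> carrier A \<Longrightarrow> \<psi> (pCA c a) = ract_AC a (pAC \<one>\<^bsub>A\<^esub> c)"
  unfolding entwining_alt
  using CA.lift_additive[OF AC.tensor_abelian_group entwining_balanced] CA.lift_pure[OF AC.tensor_abelian_group entwining_balanced]
  by simp_all

lemma entwining_linear: "\<psi> \<in> left_linear cplx tCA tAC"
  unfolding entwining_alt
  by (rule CA.lift_left_linear[OF cspaceD(1)[OF cC] cspaceD(2)[OF cAC] entwining_balanced])
     (simp add: pAC_scalar ract_AC_scalar scalar_mult)

text \<open>
  The action satisfies \<open>(w a) a' = w (a a')\<close>, so right \<open>\<A>\<close>-linearity of \<open>\<psi>\<close> holds on the generators; it is the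
  compatibility of the entwining with the multiplication.
\<close>

lemma entwining_rmul: "s \<in> carrier tCA \<Longrightarrow> a \<in> carrier A \<Longrightarrow> \<psi> (rmul s a) = ract_AC a (\<psi> s)"
proof (induction rule: CA.induct)
  case (add s t)
  thus ?case
    by (simp add: additive_add[OF rmul_additive] additive_closed[OF rmul_additive]
        additive_add[OF entwining_additive] additive_closed[OF entwining_additive] ract_AC_add)
qed (simp add: ract_AC_mult)

lemma entwining_bij: "bij_betw \<psi> (carrier tCA) (carrier tAC)"
  using bij by (simp add: bijective_entwining_def)

definition psi_inv where "psi_inv = inv_into (carrier tCA) \<psi>"

lemma psi_inv_additive: "psi_inv \<in> additive_maps tAC tCA"
  unfolding psi_inv_def by (rule inv_into_additive[OF entwining_additive entwining_bij CA.tensor_abelian_group])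

lemma entwining_in [simp]: "s \<in> carrier tCA \<Longrightarrow> \<psi> s \<in> carrier tAC"
  using additive_closed[OF entwining_additive] .

lemma psi_inv_in [simp]: "t \<in> carrier tAC \<Longrightarrow> psi_inv t \<in> carrier tCA"
  using additive_closed[OF psi_inv_additive] .

lemma entwining_psi_inv [simp]: "t \<in> carrier tAC \<Longrightarrow> \<psi> (psi_inv t) = t"
  unfolding psi_inv_def by (rule bij_betw_inv_into_right[OF entwining_bij])

lemma psi_inv_entwining [simp]: "s \<in> carrier tCA \<Longrightarrow> psi_inv (\<psi> s) = s"
  unfolding psi_inv_def by (rule bij_betw_inv_into_left[OF entwining_bij])

lemma psi_inv_linear: "psi_inv \<in> left_linear cplx tAC tCA"
  unfolding left_linear_def
proof (intro CollectI conjI ballI psi_inv_additive)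
  fix k t assume t: "t \<in> carrier tAC"
  have "\<psi> (lact tCA k (psi_inv t)) = lact tAC k t"
    using left_linear_act[OF entwining_linear, of k "psi_inv t"] t by simp
  thus "psi_inv (lact tAC k t) = lact tCA k (psi_inv t)"
    using psi_inv_entwining[of "lact tCA k (psi_inv t)"] cspaceD(6)[OF cCA, of "psi_inv t" k] t by simp
qed

abbreviation "lcoact \<equiv> left_coact C e A"

lemma left_coact_alt: "lcoact a = psi_inv (pAC a e)"
  by (simp add: left_coact_def psi_inv_def)

lemma left_coact_in [simp]: "a \<in> carrier A \<Longrightarrow> lcoact a \<in> carrier tCA"
  by (simp add: left_coact_alt)

lemma entwining_left_coact [simp]: "a \<in> carrier A \<Longrightarrow> \<psi> (lcoact a) = pAC a e"
  by (simp add: left_coact_alt)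

lemma left_coact_linear: "lcoact \<in> left_linear cplx vA tCA"
proof -
  have "left_coact C e A = (\<lambda>a. psi_inv (pAC a e))" by (simp add: left_coact_alt fun_eq_iff)
  moreover have "(\<lambda>a. pAC a e) \<in> additive_maps vA tAC"
    by (rule additive_mapsI) (simp_all add: AC.pure_add1[simplified])
  ultimately show ?thesis
    unfolding left_linear_def
    using additive_comp[OF _ psi_inv_additive] left_linear_act[OF psi_inv_linear, symmetric]
    by auto
qed

text \<open>Both sides are mapped by \<open>\<psi>\<close> to \<open>a b \<otimes> e\<close>, since \<open>(a \<otimes> e) b = a \<delta>(b)\<close> and \<open>\<delta>(b) = b \<otimes> e\<close>.\<close>

lemma left_coact_B: "a \<in> carrier A \<Longrightarrow> b \<in> B \<Longrightarrow> lcoact (a \<otimes>\<^bsub>A\<^esub> b) = rmul (lcoact a) b"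
proof -
  assume a: "a \<in> carrier A" and b: "b \<in> B"
  have "\<psi> (rmul (lcoact a) b) = pAC (a \<otimes>\<^bsub>A\<^esub> b) e"
    using a b by (simp add: entwining_rmul B_in ract_AC_grouplike B_coact_one)
  thus ?thesis
    using psi_inv_entwining[of "rmul (lcoact a) b"] a b by (simp add: left_coact_alt rmul_module B_in)
qed

text \<open>The map \<open>\<psi>\<^sup>-\<^sup>1 \<circ> can\<close> is the left version \<open>\<A> \<otimes>\<^sub>\<B> \<A> \<rightarrow> \<C> \<otimes> \<A>\<close> of the canonical map, built from the left coaction.\<close>

lemma psi_inv_can: "a \<in> carrier A \<Longrightarrow> a' \<in> carrier A \<Longrightarrow> psi_inv (cn (tB a a')) = rmul (lcoact a) a'"
proof -
  assume a: "a \<in> carrier A" "a' \<in> carrier A"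
  have "\<psi> (rmul (lcoact a) a') = cn (tB a a')"
    using a by (simp add: entwining_rmul ract_AC_grouplike)
  thus ?thesis
    using psi_inv_entwining[of "rmul (lcoact a) a'"] a by (simp add: rmul_module)
qed

end

subsection \<open>Inverse of the associativity map\<close>

definition tensor_unassoc ::
  "('r, 'x) ring_scheme \<Rightarrow> ('s, 'y) ring_scheme \<Rightarrow> ('l, 'm, 'r) bimodule \<Rightarrow> ('r, 'n, 's) bimodule
     \<Rightarrow> ('s, 'p, 't) bimodule \<Rightarrow> ('m, ('n, 'p) tens) tens \<Rightarrow> (('m, 'n) tens, 'p) tens" where
  "tensor_unassoc R S M N P =
     tensor_lift (tensor S (tensor R M N) P)
       (\<lambda>m. tensor_lift (tensor S (tensor R M N) P)
          (\<lambda>n p. pure_tensor S (tensor R M N) P (pure_tensor R M N m n) p))"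

lemma unassoc_additive_pure:
  assumes M: "right_module R M" and N: "bimod R S N" and P: "left_module S P"
  shows "tensor_unassoc R S M N P \<in> additive_maps (tensor R M (tensor S N P)) (tensor S (tensor R M N) P)"
    and "m \<in> carrier M \<Longrightarrow> n \<in> carrier N \<Longrightarrow> p \<in> carrier P \<Longrightarrow>
      tensor_unassoc R S M N P (pure_tensor R M (tensor S N P) m (pure_tensor S N P n p)) =
      pure_tensor S (tensor R M N) P (pure_tensor R M N m n) p"
proof -
  interpret MN: tensor_product R M N using M bimodD(1)[OF N] by (rule tensor_productI)
  interpret NP: tensor_product S N P using bimodD(2)[OF N] P by (rule tensor_productI)
  interpret M_NP: tensor_product R M "tensor S N P"
    using M NP.left_module_tensor[OF N] by (rule tensor_productI)
  interpret MN_P: tensor_product S "tensor R M N" P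
    using P MN.right_module_tensor[OF N] by (intro tensor_productI)
  note G = MN_P.tensor_abelian_group
  let ?G = "tensor S (tensor R M N) P"
  let ?b = "\<lambda>m n p. pure_tensor S (tensor R M N) P (pure_tensor R M N m n) p"
  note DN = left_moduleD[OF bimodD(1)[OF N]] right_moduleD[OF bimodD(2)[OF N]]
  note DM = right_moduleD[OF M]
  have b1: "balanced S N P ?G (?b m)" if "m \<in> carrier M" for m
    by (rule balancedI) (use that in \<open>simp_all add: MN_P.pure_in MN.pure_in MN_P.pure_add1 MN_P.pure_add2
        MN.pure_add2 MN_P.pure_balanced[symmetric] MN.ract_tensor(2)[OF N]\<close>)
  note p1 = NP.lift_additive[OF G b1]
  have B: "balanced R M (tensor S N P) ?G (\<lambda>m. tensor_lift ?G (?b m))"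
    unfolding balanced_def
  proof (intro conjI ballI p1)
    interpret Gr: abelian_group ?G by (rule G)
    fix t assume t: "t \<in> carrier (tensor S N P)"
    show "(\<lambda>m. tensor_lift ?G (?b m) t) \<in> additive_maps M ?G"
    proof (rule additive_mapsI)
      show "tensor_lift ?G (?b m) t \<in> carrier ?G" if "m \<in> carrier M" for m
        using additive_closed[OF p1[OF that] t] .
      fix m m' assume m: "m \<in> carrier M" "m' \<in> carrier M"
      hence mm: "m \<oplus>\<^bsub>M\<^esub> m' \<in> carrier M" using MN.M.a_closed by simp
      show "tensor_lift ?G (?b (m \<oplus>\<^bsub>M\<^esub> m')) t = tensor_lift ?G (?b m) t \<oplus>\<^bsub>?G\<^esub> tensor_lift ?G (?b m') t"
        using t
      proof (induction rule: NP.induct)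
        case (pure n p)
        thus ?case using m mm by (simp add: NP.lift_pure[OF G b1] MN.pure_add1 MN_P.pure_add1 MN.pure_in)
      next
        case (add s t)
        thus ?case using m mm
          by (simp add: additive_add[OF p1] additive_closed[OF p1] Gr.a_ac)
      qed
    qed
  next
    fix m r t assume m: "m \<in> carrier M" and r: "r \<in> carrier R" and t: "t \<in> carrier (tensor S N P)"
    show "tensor_lift ?G (?b (ract M m r)) t = tensor_lift ?G (?b m) (lact (tensor S N P) r t)"
      using t
    proof (induction rule: NP.induct)
      case (pure n p)
      thus ?case using m r by (simp add: NP.lact_tensor(2)[OF N] NP.lift_pure[OF G b1] DN DM MN.pure_balanced)
    next
      case (add s t)
      thus ?case using m r
        by (simp add: additive_add[OF p1] additive_closed[OF p1] DM additive_add[OF NP.lact_tensor(1)[OF N]]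
            additive_closed[OF NP.lact_tensor(1)[OF N]])
    qed
  qed
  show "tensor_unassoc R S M N P \<in> additive_maps (tensor R M (tensor S N P)) (tensor S (tensor R M N) P)"
    unfolding tensor_unassoc_def by (rule M_NP.lift_additive[OF G B])
  show "m \<in> carrier M \<Longrightarrow> n \<in> carrier N \<Longrightarrow> p \<in> carrier P \<Longrightarrow>
      tensor_unassoc R S M N P (pure_tensor R M (tensor S N P) m (pure_tensor S N P n p)) =
      pure_tensor S (tensor R M N) P (pure_tensor R M N m n) p"
    unfolding tensor_unassoc_def using M_NP.lift_pure[OF G B] NP.lift_pure[OF G b1] by (simp add: NP.pure_in)
qed

lemma assoc_inverse:
  assumes M: "right_module R M" and N: "bimod R S N" and P: "left_module S P"
  shows "t \<in> carrier (tensor S (tensor R M N) P) \<Longrightarrow> tensor_unassoc R S M N P (tensor_assoc R S M N P t) = t"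
    and "u \<in> carrier (tensor R M (tensor S N P)) \<Longrightarrow> tensor_assoc R S M N P (tensor_unassoc R S M N P u) = u"
proof -
  interpret MN: tensor_product R M N using M bimodD(1)[OF N] by (rule tensor_productI)
  interpret NP: tensor_product S N P using bimodD(2)[OF N] P by (rule tensor_productI)
  interpret M_NP: tensor_product R M "tensor S N P"
    using M NP.left_module_tensor[OF N] by (rule tensor_productI)
  interpret MN_P: tensor_product S "tensor R M N" P
    using P MN.right_module_tensor[OF N] by (intro tensor_productI)
  note a = assoc_additive_pure[OF assms] and u = unassoc_additive_pure[OF assms]
  note ua = additive_comp[OF a(1) u(1)] and au = additive_comp[OF u(1) a(1)]
  have 1: "tensor_unassoc R S M N P (tensor_assoc R S M N P (pure_tensor S (tensor R M N) P s p)) =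
      pure_tensor S (tensor R M N) P s p" if "s \<in> carrier (tensor R M N)" "p \<in> carrier P" for s p
    using that
    by (induction rule: MN.induct) (simp_all add: a(2) u(2) MN_P.pure_add1 additive_add[OF ua] MN_P.pure_in)
  show "tensor_unassoc R S M N P (tensor_assoc R S M N P t) = t" if "t \<in> carrier (tensor S (tensor R M N) P)"
    using that by (induction rule: MN_P.induct) (simp_all add: 1 additive_add[OF ua])
  have 2: "tensor_assoc R S M N P (tensor_unassoc R S M N P (pure_tensor R M (tensor S N P) m s)) =
      pure_tensor R M (tensor S N P) m s" if "s \<in> carrier (tensor S N P)" "m \<in> carrier M" for s m
    using that
    by (induction rule: NP.induct) (simp_all add: a(2) u(2) M_NP.pure_add2 additive_add[OF au] M_NP.pure_in)
  show "tensor_assoc R S M N P (tensor_unassoc R S M N P u) = u" if "u \<in> carrier (tensor R M (tensor S N P))"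
    using that by (induction rule: M_NP.induct) (simp_all add: 2 additive_add[OF au])
qed

lemma ract_left_regular: "ract (left_regular A \<otimes>\<^sub>\<complex> N) = ract (vect A \<otimes>\<^sub>\<complex> N)"
  using tensor_cong_left[of "left_regular A" "vect A" cplx N] by (simp add: tensor_def)

lemma tensor_left_regular_twice [simp]:
  fixes A :: "(complex, 'a, 'x) module_scheme"
  shows "carrier ((left_regular A \<otimes>\<^sub>\<complex> M) \<otimes>\<^sub>\<complex> N) = carrier ((vect A \<otimes>\<^sub>\<complex> M) \<otimes>\<^sub>\<complex> N)"
    "add ((left_regular A \<otimes>\<^sub>\<complex> M) \<otimes>\<^sub>\<complex> N) = add ((vect A \<otimes>\<^sub>\<complex> M) \<otimes>\<^sub>\<complex> N)"
    "pure_tensor cplx (left_regular A \<otimes>\<^sub>\<complex> M) N = pure_tensor cplx (vect A \<otimes>\<^sub>\<complex> M) N"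
proof -
  have "tensor_group cplx (left_regular A \<otimes>\<^sub>\<complex> M) N = tensor_group cplx (vect A \<otimes>\<^sub>\<complex> M) N"
    by (rule tensor_cong_left) (simp_all add: ract_left_regular)
  thus "carrier ((left_regular A \<otimes>\<^sub>\<complex> M) \<otimes>\<^sub>\<complex> N) = carrier ((vect A \<otimes>\<^sub>\<complex> M) \<otimes>\<^sub>\<complex> N)"
    "add ((left_regular A \<otimes>\<^sub>\<complex> M) \<otimes>\<^sub>\<complex> N) = add ((vect A \<otimes>\<^sub>\<complex> M) \<otimes>\<^sub>\<complex> N)"
    by (simp_all only: tensor_group_sel2)
  show "pure_tensor cplx (left_regular A \<otimes>\<^sub>\<complex> M) N = pure_tensor cplx (vect A \<otimes>\<^sub>\<complex> M) N"
    by (rule tensor_cong_left) (simp_all add: ract_left_regular)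
qed

lemma additive_maps_left_regular_twice [simp]:
  "additive_maps ((left_regular A \<otimes>\<^sub>\<complex> M) \<otimes>\<^sub>\<complex> N) G = additive_maps ((vect A \<otimes>\<^sub>\<complex> M) \<otimes>\<^sub>\<complex> N) G"
  "additive_maps G ((left_regular A \<otimes>\<^sub>\<complex> M) \<otimes>\<^sub>\<complex> N) = additive_maps G ((vect A \<otimes>\<^sub>\<complex> M) \<otimes>\<^sub>\<complex> N)"
  by (rule additive_maps_cong; simp)+

context galois_extension
begin

subsection \<open>The entwining and the comultiplication\<close>

abbreviation "pACC \<equiv> pure_tensor cplx tAC vC"
abbreviation "TACC \<equiv> tAC \<otimes>\<^sub>\<complex> vC"
abbreviation "TCCA \<equiv> vC \<otimes>\<^sub>\<complex> tCA"

sublocale ACC: tensor_product cplx tAC vC using cAC cC by (rule cspace_tensor_product)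
sublocale A_CC: tensor_product cplx vA "vC \<otimes>\<^sub>\<complex> vC" using cA cCC by (rule cspace_tensor_product)
sublocale C_CA: tensor_product cplx vC tCA using cC cCA by (rule cspace_tensor_product)
sublocale CC_A: tensor_product cplx "vC \<otimes>\<^sub>\<complex> vC" vA using cCC cA by (rule cspace_tensor_product)
sublocale C_AC: tensor_product cplx vC tAC using cC cAC by (rule cspace_tensor_product)
sublocale CA_C: tensor_product cplx tCA vC using cCA cC by (rule cspace_tensor_product)
sublocale LACC: tensor_product cplx "left_regular A \<otimes>\<^sub>\<complex> vC" vC
  using LAC.right_module_tensor[OF cspaceD(1)[OF cC]] cspaceD(2)[OF cC] by (rule tensor_productI)

lemma bimod_LAC: "bimod A cplx (left_regular A \<otimes>\<^sub>\<complex> vC)"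
  by (rule LAC.bimod_tensor[OF bimod_left_regular cspaceD(1)[OF cC]])

abbreviation "lmul2 \<equiv> lact ((left_regular A \<otimes>\<^sub>\<complex> vC) \<otimes>\<^sub>\<complex> vC)"

lemma lmul2_additive: "a \<in> carrier A \<Longrightarrow> lmul2 a \<in> additive_maps TACC TACC"
  and lmul2_pure [simp]: "a \<in> carrier A \<Longrightarrow> r \<in> carrier tAC \<Longrightarrow> c \<in> carrier C \<Longrightarrow>
      lmul2 a (pACC r c) = pACC (lmul a r) c"
  using LACC.lact_tensor[OF bimod_LAC, of a] by simp_all

lemmas ACC_pure [simp] = ACC.pure_in[simplified] and A_CC_pure [simp] = A_CC.pure_in[simplified]
  and C_CA_pure [simp] = C_CA.pure_in[simplified] and CC_A_pure [simp] = CC_A.pure_in[simplified]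
  and C_AC_pure [simp] = C_AC.pure_in[simplified] and CA_C_pure [simp] = CA_C.pure_in[simplified]
  and CC_pure [simp] = VV.pure_in[simplified]

lemmas unassoc_ACC = unassoc_additive_pure[OF cspaceD(3)[OF cA] cspaceD(1)[OF cC] cspaceD(2)[OF cC], simplified]
lemmas unassoc_CAC = unassoc_additive_pure[OF cspaceD(3)[OF cC] cspaceD(1)[OF cA] cspaceD(2)[OF cC], simplified]
lemmas assoc_CCA = assoc_additive_pure[OF cspaceD(3)[OF cC] cspaceD(1)[OF cC] cspaceD(2)[OF cA], simplified]
lemmas assoc_ACC_inverse = assoc_inverse[OF cspaceD(3)[OF cA] cspaceD(1)[OF cC] cspaceD(2)[OF cC], simplified]
lemmas assoc_CAC_inverse = assoc_inverse[OF cspaceD(3)[OF cC] cspaceD(1)[OF cA] cspaceD(2)[OF cC], simplified]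

text \<open>
  The maps \<open>\<delta> \<otimes> id\<close> and \<open>id \<otimes> \<Delta>\<close> on \<open>\<A> \<otimes> \<C>\<close>; \<open>comult_right\<close> is the latter with target \<open>(\<A> \<otimes> \<C>) \<otimes> \<C>\<close>.
  Coassociativity of the coaction says that they agree on the image of \<open>\<delta>\<close>.
\<close>

definition coact_left where "coact_left = tensor_map cplx tAC vC \<delta> (\<lambda>c. c)"
definition id_comult where "id_comult = tensor_map cplx vA (vC \<otimes>\<^sub>\<complex> vC) (\<lambda>a. a) \<Delta>"
definition comult_right where "comult_right t = tensor_unassoc cplx cplx vA vC vC (id_comult t)"

lemma coact_left_additive: "coact_left \<in> additive_maps tAC TACC"
  and coact_left_pure [simp]: "a \<in> carrier A \<Longrightarrow> c \<in> carrier C \<Longrightarrow> coact_left (pAC a c) = pACC (\<delta> a) c"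
  using AC.map_additive_pure[OF ACC.tensor_product_axioms clinear_right[OF coact_linear cA cAC] left_linear_id]
  by (simp_all add: coact_left_def)

lemma id_comult_additive: "id_comult \<in> additive_maps tAC (vA \<otimes>\<^sub>\<complex> (vC \<otimes>\<^sub>\<complex> vC))"
  and id_comult_pure [simp]: "a \<in> carrier A \<Longrightarrow> c \<in> carrier C \<Longrightarrow>
    id_comult (pAC a c) = pure_tensor cplx vA (vC \<otimes>\<^sub>\<complex> vC) a (\<Delta> c)"
  using AC.map_additive_pure[OF A_CC.tensor_product_axioms right_linear_id comult_linear]
  by (simp_all add: id_comult_def)

lemma comult_right_additive: "comult_right \<in> additive_maps tAC TACC"
  unfolding comult_right_def[abs_def] by (rule additive_comp[OF id_comult_additive unassoc_ACC(1)])

lemma comult_right_coact: "a \<in> carrier A \<Longrightarrow> comult_right (\<delta> a) = coact_left (\<delta> a)"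
proof -
  assume a: "a \<in> carrier A"
  have "id_comult (\<delta> a) = tensor_assoc cplx cplx vA vC vC (coact_left (\<delta> a))"
    using A_comod a by (simp add: right_comodule_def id_comult_def coact_left_def)
  thus ?thesis using assoc_ACC_inverse(1)[of "coact_left (\<delta> a)"] additive_closed[OF coact_left_additive coact_in[OF a]]
    by (simp add: comult_right_def)
qed

lemma comult_right_lmul: "t \<in> carrier tAC \<Longrightarrow> x \<in> carrier A \<Longrightarrow> comult_right (lmul x t) = lmul2 x (comult_right t)"
proof (induction rule: AC.induct)
  case (pure a c)
  hence ac: "a \<in> carrier A" "c \<in> carrier C" "x \<in> carrier A" by simp_all
  have "tensor_unassoc cplx cplx vA vC vC (pure_tensor cplx vA (vC \<otimes>\<^sub>\<complex> vC) (x \<otimes>\<^bsub>A\<^esub> a) s) =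
     lmul2 x (tensor_unassoc cplx cplx vA vC vC (pure_tensor cplx vA (vC \<otimes>\<^sub>\<complex> vC) a s))"
    if "s \<in> carrier (vC \<otimes>\<^sub>\<complex> vC)" for s
    using that
    by (induction rule: VV.induct)
       (use ac in \<open>simp_all add: unassoc_ACC(2) A_CC.pure_add2[simplified] additive_add[OF unassoc_ACC(1)]
          additive_add[OF lmul2_additive] additive_closed[OF unassoc_ACC(1)]\<close>)
  thus ?case using ac by (simp add: comult_right_def)
next
  case (add s t)
  thus ?case
    by (simp add: lmul_module additive_add[OF comult_right_additive] additive_closed[OF comult_right_additive] additive_add[OF lmul2_additive])
qed

text \<open>For \<open>r \<in> \<A> \<otimes> \<C>\<close> this is the map \<open>a \<otimes> c \<mapsto> r a \<otimes> c\<close> into \<open>(\<A> \<otimes> \<C>) \<otimes> \<C>\<close>.\<close>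

definition act_by where "act_by r = tensor_lift TACC (\<lambda>a c. pACC (ract_AC a r) c)"

lemma act_by_balanced: "r \<in> carrier tAC \<Longrightarrow> balanced cplx vA vC TACC (\<lambda>a c. pACC (ract_AC a r) c)"
  by (rule balancedI)
     (simp_all add: ract_AC_add_left ACC.pure_add1[simplified] ACC.pure_add2[simplified] ract_AC_smult
        scalar_mult[symmetric] ACC.pure_balanced[simplified, symmetric] cspaceD(5)[OF cAC])

lemma act_by_additive: "r \<in> carrier tAC \<Longrightarrow> act_by r \<in> additive_maps tAC TACC"
  and act_by_pure [simp]: "r \<in> carrier tAC \<Longrightarrow> a \<in> carrier A \<Longrightarrow> c \<in> carrier C \<Longrightarrow> act_by r (pAC a c) = pACC (ract_AC a r) c"
  unfolding act_by_def
  using AC.lift_additive[OF ACC.tensor_abelian_group act_by_balanced] AC.lift_pure[OF ACC.tensor_abelian_group act_by_balanced]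
  by simp_all

lemma act_by_in [simp]: "r \<in> carrier tAC \<Longrightarrow> s \<in> carrier tAC \<Longrightarrow> act_by r s \<in> carrier TACC"
  using additive_closed[OF act_by_additive] .

lemma ACC_abelian: "abelian_group TACC" by (rule ACC.tensor_abelian_group)

lemma act_by_add_left:
  assumes "s \<in> carrier tAC" "r \<in> carrier tAC" "r' \<in> carrier tAC"
  shows "act_by (r \<oplus>\<^bsub>tAC\<^esub> r') s = act_by r s \<oplus>\<^bsub>TACC\<^esub> act_by r' s"
proof -
  interpret G: abelian_group TACC by (rule ACC_abelian)
  interpret H: abelian_group tAC by (rule AC.tensor_abelian_group)
  show ?thesis
    using assms
  proof (induction rule: AC.induct)
    case (add s t)
    thus ?case by (simp add: additive_add[OF act_by_additive] G.a_ac)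
  qed (simp add: ract_AC_add ACC.pure_add1[simplified])
qed

lemma act_by_lmul:
  assumes "s \<in> carrier tAC" "r \<in> carrier tAC" "x \<in> carrier A"
  shows "act_by (lmul x r) s = lmul2 x (act_by r s)"
  using assms
proof (induction rule: AC.induct)
  case (add s t)
  thus ?case by (simp add: additive_add[OF act_by_additive] lmul_module additive_add[OF lmul2_additive])
qed (simp add: ract_AC_lmul lmul_module)

lemma act_by_scalar:
  assumes "s \<in> carrier tAC" "r \<in> carrier tAC"
  shows "act_by (lact tAC k r) s = act_by r (lact tAC k s)"
  using assms
proof (induction rule: AC.induct)
  case (add s t)
  thus ?case using cspaceD(6)[OF cAC] by (simp add: additive_add[OF act_by_additive] cspaceD(7)[OF cAC])
qed (simp add: scalar_mult lmul_module ract_AC_lmul ract_AC_smult A.smult_mult_left)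

lemma act_by_scalar':
  assumes "s \<in> carrier tAC" "r \<in> carrier tAC"
  shows "act_by (lmul (k \<odot>\<^bsub>A\<^esub> \<one>\<^bsub>A\<^esub>) r) s = act_by r (lmul (k \<odot>\<^bsub>A\<^esub> \<one>\<^bsub>A\<^esub>) s)"
  using act_by_scalar[OF assms, of k] assms by (simp add: scalar_mult)

text \<open>
  The right action of \<open>\<A>\<close> on \<open>\<A> \<otimes> \<C> \<otimes> \<C>\<close>, where the algebra element is first moved past the last
  factor by the entwining and then acts on the other two.
\<close>

definition ract_ACC where "ract_ACC a = tensor_lift TACC (\<lambda>r c. act_by r (ract_AC a (pAC \<one>\<^bsub>A\<^esub> c)))"

lemma ract_ACC_balanced: "a \<in> carrier A \<Longrightarrow> balanced cplx tAC vC TACC (\<lambda>r c. act_by r (ract_AC a (pAC \<one>\<^bsub>A\<^esub> c)))"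
  by (rule balancedI)
     (simp_all add: act_by_add_left AC.pure_add2[simplified] ract_AC_add additive_add[OF act_by_additive] act_by_scalar'
        cspaceD(5)[OF cAC] pAC_scalar ract_AC_scalar scalar_mult)

lemma ract_ACC_additive: "a \<in> carrier A \<Longrightarrow> ract_ACC a \<in> additive_maps TACC TACC"
  and ract_ACC_pure [simp]: "a \<in> carrier A \<Longrightarrow> r \<in> carrier tAC \<Longrightarrow> c \<in> carrier C \<Longrightarrow>
    ract_ACC a (pACC r c) = act_by r (ract_AC a (pAC \<one>\<^bsub>A\<^esub> c))"
  unfolding ract_ACC_def
  using ACC.lift_additive[OF ACC_abelian ract_ACC_balanced] ACC.lift_pure[OF ACC_abelian ract_ACC_balanced] by simp_all

lemma coact_left_lmul: "s \<in> carrier tAC \<Longrightarrow> y \<in> carrier A \<Longrightarrow> coact_left (lmul y s) = act_by (\<delta> y) s"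
proof (induction rule: AC.induct)
  case (add s t)
  thus ?case by (simp add: additive_add[OF act_by_additive] lmul_module additive_add[OF coact_left_additive])
qed (simp add: ract_AC_coact)

text \<open>The map \<open>\<delta> \<otimes> id\<close> is right \<open>\<A>\<close>-linear, because \<open>\<delta>\<close> is.\<close>

lemma coact_left_ract_AC: "t \<in> carrier tAC \<Longrightarrow> a \<in> carrier A \<Longrightarrow> coact_left (ract_AC a t) = ract_ACC a (coact_left t)"
proof (induction rule: AC.induct)
  case (pure y c)
  have "ract_AC a (pAC y c) = lmul y (ract_AC a (pAC \<one>\<^bsub>A\<^esub> c))"
    using pure ract_AC_lmul[of a y "pAC \<one>\<^bsub>A\<^esub> c"] by simp
  thus ?case using pure by (simp add: coact_left_lmul)
next
  case (add s t)
  thus ?case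
    by (simp add: ract_AC_add additive_add[OF coact_left_additive] additive_closed[OF coact_left_additive] additive_add[OF ract_ACC_additive])
qed

lemma ract_ACC_lmul2: "w \<in> carrier TACC \<Longrightarrow> a \<in> carrier A \<Longrightarrow> x \<in> carrier A \<Longrightarrow> ract_ACC a (lmul2 x w) = lmul2 x (ract_ACC a w)"
proof (induction rule: ACC.induct)
  case (add s t)
  thus ?case
    by (simp add: additive_add[OF lmul2_additive] additive_closed[OF lmul2_additive] additive_add[OF ract_ACC_additive]
        additive_closed[OF ract_ACC_additive])
qed (simp add: act_by_lmul lmul_module)

text \<open>
  The compatibility of the entwining with the comultiplication: \<open>id \<otimes> \<Delta>\<close> is right \<open>\<A>\<close>-linear.  On the
  generators \<open>x \<delta>(y)\<close> the map agrees with \<open>\<delta> \<otimes> id\<close>, up to left multiplication by \<open>x\<close>, by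
  coassociativity, and \<open>\<delta> \<otimes> id\<close> is linear.
\<close>

lemma comult_right_ract_AC: "t \<in> carrier tAC \<Longrightarrow> a \<in> carrier A \<Longrightarrow> comult_right (ract_AC a t) = ract_ACC a (comult_right t)"
proof (induction rule: AC_can_induct)
  case (can x y)
  have "comult_right (ract_AC a (lmul x (\<delta> y))) = lmul2 x (coact_left (ract_AC a (\<delta> y)))"
    using can by (simp add: ract_AC_lmul comult_right_lmul ract_AC_coact comult_right_coact)
  also have "\<dots> = ract_ACC a (lmul2 x (coact_left (\<delta> y)))"
    using can by (simp add: coact_left_ract_AC ract_ACC_lmul2 additive_closed[OF coact_left_additive])
  also have "\<dots> = ract_ACC a (comult_right (lmul x (\<delta> y)))" using can by (simp add: comult_right_lmul comult_right_coact)
  finally show ?case .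
next
  case (add s t)
  thus ?case
    by (simp add: ract_AC_add additive_add[OF comult_right_additive] additive_closed[OF comult_right_additive] additive_add[OF ract_ACC_additive])
qed

subsection \<open>Coassociativity of the left coaction\<close>

text \<open>The composite \<open>psi2 = (\<psi> \<otimes> id) \<circ> (id \<otimes> \<psi>)\<close> moves an element of \<open>\<A>\<close> past two factors \<open>\<C>\<close>.\<close>

definition id_psi where "id_psi = tensor_map cplx vC tAC (\<lambda>c. c) \<psi>"
definition psi_id where "psi_id = tensor_map cplx tAC vC \<psi> (\<lambda>c. c)"
definition psi2 where "psi2 w = psi_id (tensor_unassoc cplx cplx vC vA vC (id_psi w))"

lemma id_psi: "id_psi \<in> additive_maps TCCA (vC \<otimes>\<^sub>\<complex> tAC)"
  "c \<in> carrier C \<Longrightarrow> s \<in> carrier tCA \<Longrightarrow>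
     id_psi (pure_tensor cplx vC tCA c s) = pure_tensor cplx vC tAC c (\<psi> s)"
  using C_CA.map_additive_pure[OF C_AC.tensor_product_axioms right_linear_id entwining_linear] by (simp_all add: id_psi_def)

lemma psi_id: "psi_id \<in> additive_maps (tCA \<otimes>\<^sub>\<complex> vC) TACC"
  "s \<in> carrier tCA \<Longrightarrow> c \<in> carrier C \<Longrightarrow>
     psi_id (pure_tensor cplx tCA vC s c) = pACC (\<psi> s) c"
  using CA_C.map_additive_pure[OF ACC.tensor_product_axioms clinear_right[OF entwining_linear cCA cAC] left_linear_id]
  by (simp_all add: psi_id_def)

lemma psi2_additive: "psi2 \<in> additive_maps TCCA TACC"
  unfolding psi2_def[abs_def] by (rule additive_comp[OF additive_comp[OF id_psi(1) unassoc_CAC(1)] psi_id(1)])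

lemma psi2_inj: "inj_on psi2 (carrier TCCA)"
proof -
  let ?i1 = "tensor_map cplx vC tCA (\<lambda>c. c) psi_inv"
  let ?i2 = "tensor_map cplx tCA vC psi_inv (\<lambda>c. c)"
  note i1 = C_AC.map_additive_pure[OF C_CA.tensor_product_axioms right_linear_id psi_inv_linear]
  note i2 = ACC.map_additive_pure[OF CA_C.tensor_product_axioms clinear_right[OF psi_inv_linear cAC cCA] left_linear_id]
  have 1: "?i1 (id_psi w) = w" if "w \<in> carrier TCCA" for w
    using that
    by (induction rule: C_CA.induct) (simp_all add: id_psi i1 additive_add[OF id_psi(1)] additive_add[OF i1(1)] additive_closed[OF id_psi(1)])
  have 2: "?i2 (psi_id w) = w" if "w \<in> carrier (tCA \<otimes>\<^sub>\<complex> vC)" for w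
    using that
    by (induction rule: CA_C.induct) (simp_all add: psi_id i2 additive_add[OF psi_id(1)] additive_add[OF i2(1)] additive_closed[OF psi_id(1)])
  have "?i1 (tensor_assoc cplx cplx vC vA vC (?i2 (psi2 w))) = w" if "w \<in> carrier TCCA" for w
    using that additive_closed[OF id_psi(1)] additive_closed[OF unassoc_CAC(1)]
    by (simp add: psi2_def 2 assoc_CAC_inverse(2) 1)
  thus ?thesis by (rule inj_on_inverseI)
qed

definition comult_id where "comult_id = tensor_map cplx (vC \<otimes>\<^sub>\<complex> vC) vA \<Delta> (\<lambda>a. a)"
definition id_lcoact where "id_lcoact = tensor_map cplx vC tCA (\<lambda>c. c) lcoact"

lemma comult_id: "comult_id \<in> additive_maps tCA ((vC \<otimes>\<^sub>\<complex> vC) \<otimes>\<^sub>\<complex> vA)"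
  "c \<in> carrier C \<Longrightarrow> a \<in> carrier A \<Longrightarrow> comult_id (pCA c a) = pure_tensor cplx (vC \<otimes>\<^sub>\<complex> vC) vA (\<Delta> c) a"
  using CA.map_additive_pure[OF CC_A.tensor_product_axioms clinear_right[OF comult_linear cC cCC] left_linear_id]
  by (simp_all add: comult_id_def)

lemma id_lcoact: "id_lcoact \<in> additive_maps tCA TCCA"
  "c \<in> carrier C \<Longrightarrow> a \<in> carrier A \<Longrightarrow> id_lcoact (pCA c a) = pure_tensor cplx vC tCA c (lcoact a)"
  using CA.map_additive_pure[OF C_CA.tensor_product_axioms right_linear_id left_coact_linear]
  by (simp_all add: id_lcoact_def)

lemma psi2_pure:
  assumes "s \<in> carrier tAC" "c \<in> carrier C"
  shows "psi_id (tensor_unassoc cplx cplx vC vA vC (pure_tensor cplx vC tAC c s)) = act_by (pAC \<one>\<^bsub>A\<^esub> c) s"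
  using assms
  by (induction rule: AC.induct)
     (simp_all add: unassoc_CAC(2) psi_id C_AC.pure_add2[simplified] additive_add[OF unassoc_CAC(1)]
       additive_add[OF psi_id(1)] additive_closed[OF unassoc_CAC(1)] additive_add[OF act_by_additive])

text \<open>
  The compatibility of \<open>\<psi>\<close> with \<open>\<Delta>\<close>: to move \<open>a\<close> past both parts of \<open>\<Delta>(c)\<close> is to move it past \<open>c\<close> and
  then comultiply.
\<close>

lemma psi2_comult:
  assumes "s \<in> carrier tCA"
  shows "psi2 (tensor_assoc cplx cplx vC vC vA (comult_id s)) = comult_right (\<psi> s)"
  using assms
proof (induction rule: CA.induct)
  case (pure c a)
  hence ca: "c \<in> carrier C" "a \<in> carrier A" by simp_all
  have "psi2 (tensor_assoc cplx cplx vC vC vA (pure_tensor cplx (vC \<otimes>\<^sub>\<complex> vC) vA s a)) =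
      ract_ACC a (tensor_unassoc cplx cplx vA vC vC (pure_tensor cplx vA (vC \<otimes>\<^sub>\<complex> vC) \<one>\<^bsub>A\<^esub> s))"
    if "s \<in> carrier (vC \<otimes>\<^sub>\<complex> vC)" for s
    using that
  proof (induction rule: VV.induct)
    case (pure c c')
    thus ?case using ca by (simp add: assoc_CCA(2) psi2_def id_psi psi2_pure unassoc_ACC(2))
  next
    case (add s t)
    thus ?case using ca
      by (simp add: CC_A.pure_add1[simplified] A_CC.pure_add2[simplified] additive_add[OF assoc_CCA(1)]
         additive_closed[OF assoc_CCA(1)] additive_add[OF psi2_additive] additive_add[OF unassoc_ACC(1)]
         additive_closed[OF unassoc_ACC(1)] additive_add[OF ract_ACC_additive])
  qed
  hence "psi2 (tensor_assoc cplx cplx vC vC vA (comult_id (pCA c a))) = ract_ACC a (comult_right (pAC \<one>\<^bsub>A\<^esub> c))"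
    using ca by (simp add: comult_id comult_right_def)
  thus ?case using ca by (simp add: comult_right_ract_AC)
next
  case (add s t)
  thus ?case
    by (simp add: additive_add[OF comult_id(1)] additive_closed[OF comult_id(1)] additive_add[OF assoc_CCA(1)]
        additive_closed[OF assoc_CCA(1)] additive_add[OF psi2_additive] additive_add[OF entwining_additive]
        additive_add[OF comult_right_additive])
qed

lemma psi2_left_coact:
  assumes "s \<in> carrier tCA"
  shows "psi2 (id_lcoact s) = pACC (\<psi> s) e"
  using assms
proof (induction rule: CA.induct)
  case (add s t)
  thus ?case
    by (simp add: additive_add[OF id_lcoact(1)] additive_closed[OF id_lcoact(1)] additive_add[OF psi2_additive]
        additive_add[OF entwining_additive] ACC.pure_add1[simplified])
qed (simp add: id_lcoact psi2_def id_psi unassoc_CAC(2) psi_id)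

text \<open>The injective map \<open>psi2\<close> sends both sides to \<open>a \<otimes> e \<otimes> e\<close>, because \<open>e\<close> is group-like.\<close>

lemma left_coact_coassoc:
  assumes a: "a \<in> carrier A"
  shows "tensor_assoc cplx cplx vC vC vA (comult_id (lcoact a)) = id_lcoact (lcoact a)"
proof (rule inj_onD[OF psi2_inj])
  have "psi2 (tensor_assoc cplx cplx vC vC vA (comult_id (lcoact a))) = comult_right (pAC a e)"
    using a by (simp add: psi2_comult)
  also have "\<dots> = pACC (pAC a e) e" using a by (simp add: comult_right_def comult_e unassoc_ACC(2))
  also have "\<dots> = psi2 (id_lcoact (lcoact a))" using a by (simp add: psi2_left_coact)
  finally show "psi2 (tensor_assoc cplx cplx vC vC vA (comult_id (lcoact a))) = psi2 (id_lcoact (lcoact a))" .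
qed (use a in \<open>auto intro!: additive_closed[OF assoc_CCA(1)] additive_closed[OF comult_id(1)] additive_closed[OF id_lcoact(1)]\<close>)

end

section \<open>Projection onto the cotensor square\<close>

text \<open>The universal property of a pair of tensor products: the extension of a map in four arguments.\<close>

definition bilift ::
  "('g, 'x) ring_scheme \<Rightarrow> ('m \<Rightarrow> 'n \<Rightarrow> 'p \<Rightarrow> 'q \<Rightarrow> 'g) \<Rightarrow> ('m, 'n) tens \<Rightarrow> ('p, 'q) tens \<Rightarrow> 'g" where
  "bilift G \<beta> s u = tensor_lift G (\<lambda>m n. tensor_lift G (\<beta> m n) u) s"

lemma bilift:
  assumes T1: "tensor_product R M N" and T2: "tensor_product S P Q" and G: "abelian_group G"
    and b1: "\<And>p q. p \<in> carrier P \<Longrightarrow> q \<in> carrier Q \<Longrightarrow> balanced R M N G (\<lambda>m n. \<beta> m n p q)"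
    and b2: "\<And>m n. m \<in> carrier M \<Longrightarrow> n \<in> carrier N \<Longrightarrow> balanced S P Q G (\<beta> m n)"
  shows "u \<in> carrier (tensor S P Q) \<Longrightarrow> (\<lambda>s. bilift G \<beta> s u) \<in> additive_maps (tensor R M N) G"
    and "s \<in> carrier (tensor R M N) \<Longrightarrow> bilift G \<beta> s \<in> additive_maps (tensor S P Q) G"
    and "m \<in> carrier M \<Longrightarrow> n \<in> carrier N \<Longrightarrow> p \<in> carrier P \<Longrightarrow> q \<in> carrier Q \<Longrightarrow>
      bilift G \<beta> (pure_tensor R M N m n) (pure_tensor S P Q p q) = \<beta> m n p q"
proof -
  interpret T1: tensor_product R M N by fact
  interpret T2: tensor_product S P Q by fact
  interpret G: abelian_group G by fact
  note l2 = T2.lift_additive[OF G b2]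
  note D = right_moduleD[OF T1.rmod] left_moduleD[OF T1.lmod]
  have B: "balanced R M N G (\<lambda>m n. tensor_lift G (\<beta> m n) u)" if u: "u \<in> carrier (tensor S P Q)" for u
  proof (rule balancedI)
    show "m \<in> carrier M \<Longrightarrow> n \<in> carrier N \<Longrightarrow> tensor_lift G (\<beta> m n) u \<in> carrier G" for m n
      using additive_closed[OF l2 u] .
    fix m m' n assume m: "m \<in> carrier M" "m' \<in> carrier M" "n \<in> carrier N"
    show "tensor_lift G (\<beta> (m \<oplus>\<^bsub>M\<^esub> m') n) u = tensor_lift G (\<beta> m n) u \<oplus>\<^bsub>G\<^esub> tensor_lift G (\<beta> m' n) u"
      using u
    proof (induction rule: T2.induct)
      case (pure p q)
      thus ?case using m balancedD(2)[OF b1[OF pure] m] by (simp add: T2.lift_pure[OF G b2] T1.M.a_closed)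
    next
      case (add s t)
      thus ?case using m by (simp add: additive_add[OF l2] additive_closed[OF l2] T1.M.a_closed G.a_ac)
    qed
  next
    fix m n n' assume m: "m \<in> carrier M" "n \<in> carrier N" "n' \<in> carrier N"
    show "tensor_lift G (\<beta> m (n \<oplus>\<^bsub>N\<^esub> n')) u = tensor_lift G (\<beta> m n) u \<oplus>\<^bsub>G\<^esub> tensor_lift G (\<beta> m n') u"
      using u
    proof (induction rule: T2.induct)
      case (pure p q)
      thus ?case using m balancedD(3)[OF b1[OF pure] m] by (simp add: T2.lift_pure[OF G b2] T1.N.a_closed)
    next
      case (add s t)
      thus ?case using m by (simp add: additive_add[OF l2] additive_closed[OF l2] T1.N.a_closed G.a_ac)
    qed
  next
    fix m r n assume m: "m \<in> carrier M" "r \<in> carrier R" "n \<in> carrier N"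
    show "tensor_lift G (\<beta> (ract M m r) n) u = tensor_lift G (\<beta> m (lact N r n)) u"
      using u
    proof (induction rule: T2.induct)
      case (pure p q)
      thus ?case using m balancedD(4)[OF b1[OF pure] m] by (simp add: T2.lift_pure[OF G b2] D)
    next
      case (add s t)
      thus ?case using m by (simp add: additive_add[OF l2] D)
    qed
  qed
  show "u \<in> carrier (tensor S P Q) \<Longrightarrow> (\<lambda>s. bilift G \<beta> s u) \<in> additive_maps (tensor R M N) G"
    unfolding bilift_def by (rule T1.lift_additive[OF G B])
  show "s \<in> carrier (tensor R M N) \<Longrightarrow> bilift G \<beta> s \<in> additive_maps (tensor S P Q) G"
    unfolding bilift_def[abs_def] by (rule T1.lift_param[OF G B l2 T2.tensor_abelian_group])
  show "m \<in> carrier M \<Longrightarrow> n \<in> carrier N \<Longrightarrow> p \<in> carrier P \<Longrightarrow> q \<in> carrier Q \<Longrightarrow>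
      bilift G \<beta> (pure_tensor R M N m n) (pure_tensor S P Q p q) = \<beta> m n p q"
    unfolding bilift_def using T1.lift_pure[OF G B[OF T2.pure_in]] T2.lift_pure[OF G b2] by simp
qed

context galois_extension
begin

abbreviation "AA \<equiv> vA \<otimes>\<^sub>\<complex> vA"
abbreviation "pAA \<equiv> pure_tensor cplx vA vA"
abbreviation "LR \<equiv> left_regular A \<otimes>\<^sub>\<complex> right_regular A"

sublocale LR: tensor_product cplx "left_regular A" "right_regular A"
  using bimodD(2)[OF bimod_left_regular] bimodD(1)[OF bimod_right_regular] by (rule tensor_productI)

lemma cAA: "cspace AA" using cA cA by (rule cspace_tensor)
lemma AA_abelian: "abelian_group AA" by (rule Av.VV.tensor_abelian_group)

lemmas AA_pure [simp] = Av.VV.pure_in[simplified]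

lemma LR_bimod: "bimod A A LR"
  by (rule LR.bimod_tensor[OF bimod_left_regular bimod_right_regular])

lemma lact_LR: "a \<in> carrier A \<Longrightarrow> lact LR a \<in> additive_maps AA AA"
  and lact_LR_pure [simp]: "a \<in> carrier A \<Longrightarrow> x \<in> carrier A \<Longrightarrow> y \<in> carrier A \<Longrightarrow>
      lact LR a (pAA x y) = pAA (a \<otimes>\<^bsub>A\<^esub> x) y"
  using LR.lact_tensor[OF bimod_left_regular, of a] by simp_all

lemma ract_LR: "a \<in> carrier A \<Longrightarrow> (\<lambda>t. ract LR t a) \<in> additive_maps AA AA"
  and ract_LR_pure [simp]: "a \<in> carrier A \<Longrightarrow> x \<in> carrier A \<Longrightarrow> y \<in> carrier A \<Longrightarrow>
      ract LR (pAA x y) a = pAA x (y \<otimes>\<^bsub>A\<^esub> a)"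
  using LR.ract_tensor[OF bimod_right_regular, of a] by simp_all

lemmas LR_left = left_moduleD(3-7)[OF bimodD(1)[OF LR_bimod], simplified]
lemmas LR_right = right_moduleD(3-7)[OF bimodD(2)[OF LR_bimod], simplified]
lemmas LR_comm = bimodD(3)[OF LR_bimod, simplified]

sublocale A_CA: tensor_product cplx vA tCA using cA cCA by (rule cspace_tensor_product)
sublocale AC_A: tensor_product cplx tAC vA using cAC cA by (rule cspace_tensor_product)

abbreviation "TACA \<equiv> vA \<otimes>\<^sub>\<complex> tCA"
abbreviation "pA_CA \<equiv> pure_tensor cplx vA tCA"

lemma ACA_abelian: "abelian_group TACA" by (rule A_CA.tensor_abelian_group)

lemmas A_CA_pure [simp] = A_CA.pure_in[simplified] and AC_A_pure [simp] = AC_A.pure_in[simplified]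

lemmas assoc_ACA = assoc_additive_pure[OF cspaceD(3)[OF cA] cspaceD(1)[OF cC] cspaceD(2)[OF cA], simplified]

text \<open>
  The cotensor square is the equaliser of these two maps \<open>\<A> \<otimes> \<A> \<rightarrow> \<A> \<otimes> \<C> \<otimes> \<A>\<close>, which apply the right
  coaction to the left factor and the left coaction to the right factor.
\<close>

definition cotensor_l where "cotensor_l t = tensor_assoc cplx cplx vA vC vA (tensor_map cplx tAC vA \<delta> (\<lambda>n. n) t)"
definition cotensor_r where "cotensor_r = tensor_map cplx vA tCA (\<lambda>m. m) lcoact"

lemma cotensor_l: "cotensor_l \<in> additive_maps AA TACA"
  "x \<in> carrier A \<Longrightarrow> y \<in> carrier A \<Longrightarrow>
    cotensor_l (pAA x y) = tensor_assoc cplx cplx vA vC vA (pure_tensor cplx tAC vA (\<delta> x) y)"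
proof -
  note m = Av.VV.map_additive_pure[OF AC_A.tensor_product_axioms clinear_right[OF coact_linear cA cAC] left_linear_id]
  show "cotensor_l \<in> additive_maps AA TACA"
    unfolding cotensor_l_def[abs_def] by (rule additive_comp[OF m(1) assoc_ACA(1)])
  show "x \<in> carrier A \<Longrightarrow> y \<in> carrier A \<Longrightarrow>
    cotensor_l (pAA x y) = tensor_assoc cplx cplx vA vC vA (pure_tensor cplx tAC vA (\<delta> x) y)"
    by (simp add: cotensor_l_def m(2))
qed

lemma cotensor_r: "cotensor_r \<in> additive_maps AA TACA"
  "x \<in> carrier A \<Longrightarrow> y \<in> carrier A \<Longrightarrow> cotensor_r (pAA x y) = pA_CA x (lcoact y)"
  using Av.VV.map_additive_pure[OF A_CA.tensor_product_axioms right_linear_id left_coact_linear] by (simp_all add: cotensor_r_def)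

abbreviation "cotens \<equiv> cotensor C A \<delta> A lcoact"

lemma cotens_iff: "t \<in> cotens \<longleftrightarrow> t \<in> carrier AA \<and> cotensor_l t = cotensor_r t"
  by (simp add: cotensor_def cotensor_l_def cotensor_r_def)

lemma lcoact_add: "x \<in> carrier A \<Longrightarrow> y \<in> carrier A \<Longrightarrow> lcoact (x \<oplus>\<^bsub>A\<^esub> y) = lcoact x \<oplus>\<^bsub>tCA\<^esub> lcoact y"
  using additive_add[OF left_linear_additive[OF left_coact_linear], of x y] by simp

lemma lcoact_smult: "x \<in> carrier A \<Longrightarrow> lcoact (k \<odot>\<^bsub>A\<^esub> x) = lact tCA k (lcoact x)"
  using left_linear_act[OF left_coact_linear, of k x] by simp

end

locale galois_cointegral = galois_extension C e A
  for C :: "'c coalgebra" and e :: 'c and A :: "('a, 'c) comodule" +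
  fixes \<gamma> :: "'c \<Rightarrow> 'c \<Rightarrow> complex"
  assumes cointegral: "cointegral \<gamma>"
begin

lemma \<gamma>_form: "c \<in> carrier C \<Longrightarrow> linear_form (\<gamma> c)" "d \<in> carrier C \<Longrightarrow> linear_form (\<lambda>c. \<gamma> c d)"
  and \<gamma>_counit: "c \<in> carrier C \<Longrightarrow> tensor_lift cplx \<gamma> (\<Delta> c) = \<epsilon> c"
  and \<gamma>_invariant: "c \<in> carrier C \<Longrightarrow> d \<in> carrier C \<Longrightarrow> R (\<lambda>u. \<gamma> u d) c = L (\<gamma> c) d"
  using cointegral by (simp_all add: cointegral_def)

lemma \<gamma>_add: "c \<in> carrier C \<Longrightarrow> d \<in> carrier C \<Longrightarrow> d' \<in> carrier C \<Longrightarrow> \<gamma> c (d \<oplus>\<^bsub>C\<^esub> d') = \<gamma> c d + \<gamma> c d'"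
  "c \<in> carrier C \<Longrightarrow> c' \<in> carrier C \<Longrightarrow> d \<in> carrier C \<Longrightarrow> \<gamma> (c \<oplus>\<^bsub>C\<^esub> c') d = \<gamma> c d + \<gamma> c' d"
  "c \<in> carrier C \<Longrightarrow> d \<in> carrier C \<Longrightarrow> \<gamma> c (k \<odot>\<^bsub>C\<^esub> d) = k * \<gamma> c d"
  "c \<in> carrier C \<Longrightarrow> d \<in> carrier C \<Longrightarrow> \<gamma> (k \<odot>\<^bsub>C\<^esub> c) d = k * \<gamma> c d"
  using linear_form_add[OF \<gamma>_form(1)] linear_form_add[OF \<gamma>_form(2)]
    linear_form_smult[OF \<gamma>_form(1)] linear_form_smult[OF \<gamma>_form(2)] by simp_all

lemma \<gamma>_balanced: "balanced cplx vC vC cplx \<gamma>"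
  by (rule balancedI) (simp_all add: \<gamma>_add)

lemma smult_rules: "x \<in> carrier A \<Longrightarrow> (k + l) \<odot>\<^bsub>A\<^esub> x = k \<odot>\<^bsub>A\<^esub> x \<oplus>\<^bsub>A\<^esub> l \<odot>\<^bsub>A\<^esub> x"
  "x \<in> carrier A \<Longrightarrow> y \<in> carrier A \<Longrightarrow> k \<odot>\<^bsub>A\<^esub> (x \<oplus>\<^bsub>A\<^esub> y) = k \<odot>\<^bsub>A\<^esub> x \<oplus>\<^bsub>A\<^esub> k \<odot>\<^bsub>A\<^esub> y"
  "x \<in> carrier A \<Longrightarrow> k \<odot>\<^bsub>A\<^esub> (l \<odot>\<^bsub>A\<^esub> x) = (k * l) \<odot>\<^bsub>A\<^esub> x"
  using A.smult_l_distr[of k l x] A.smult_r_distr[of k x y] A.smult_assoc1[of k l x] by simp_all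

text \<open>Contraction of the two inner factors of a pair in \<open>\<A> \<otimes> \<C>\<close> and \<open>\<C> \<otimes> \<A>\<close>.\<close>

definition contract where
  "contract = bilift AA (\<lambda>x c c' y. pAA (\<gamma> c c' \<odot>\<^bsub>A\<^esub> x) y)"

lemma contract_balanced:
  "c' \<in> carrier C \<Longrightarrow> y \<in> carrier A \<Longrightarrow> balanced cplx vA vC AA (\<lambda>x c. pAA (\<gamma> c c' \<odot>\<^bsub>A\<^esub> x) y)"
  "x \<in> carrier A \<Longrightarrow> c \<in> carrier C \<Longrightarrow> balanced cplx vC vA AA (\<lambda>c' y. pAA (\<gamma> c c' \<odot>\<^bsub>A\<^esub> x) y)"
  by (intro balancedI; simp add: \<gamma>_add smult_rules Av.VV.pure_add1[simplified] Av.VV.pure_add2[simplified]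
        Av.VV.pure_balanced[simplified, symmetric] mult.commute)+

lemma contract1: "u \<in> carrier tCA \<Longrightarrow> (\<lambda>s. contract s u) \<in> additive_maps tAC AA"
  and contract2: "s \<in> carrier tAC \<Longrightarrow> contract s \<in> additive_maps tCA AA"
  and contract_pure [simp]: "x \<in> carrier A \<Longrightarrow> c \<in> carrier C \<Longrightarrow> c' \<in> carrier C \<Longrightarrow> y \<in> carrier A \<Longrightarrow>
     contract (pAC x c) (pCA c' y) = pAA (\<gamma> c c' \<odot>\<^bsub>A\<^esub> x) y"
  unfolding contract_def
  using bilift[OF AC.tensor_product_axioms CA.tensor_product_axioms AA_abelian, of "\<lambda>x c c' y. pAA (\<gamma> c c' \<odot>\<^bsub>A\<^esub> x) y"]
    contract_balanced by simp_all

lemma contract_in [simp]: "s \<in> carrier tAC \<Longrightarrow> u \<in> carrier tCA \<Longrightarrow> contract s u \<in> carrier AA"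
  using additive_closed[OF contract2] .

lemma contract_induct:
  assumes g: "\<And>u. u \<in> carrier tCA \<Longrightarrow> (\<lambda>s. g s u) \<in> additive_maps tAC G"
     "\<And>s. s \<in> carrier tAC \<Longrightarrow> g s \<in> additive_maps tCA G"
    and h: "\<And>u. u \<in> carrier tCA \<Longrightarrow> (\<lambda>s. h s u) \<in> additive_maps tAC G"
     "\<And>s. s \<in> carrier tAC \<Longrightarrow> h s \<in> additive_maps tCA G"
    and p: "\<And>x c c' y. x \<in> carrier A \<Longrightarrow> c \<in> carrier C \<Longrightarrow> c' \<in> carrier C \<Longrightarrow> y \<in> carrier A \<Longrightarrow>
       g (pAC x c) (pCA c' y) = h (pAC x c) (pCA c' y)"
    and s: "s \<in> carrier tAC" and u: "u \<in> carrier tCA"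
  shows "g s u = h s u"
proof (rule AC.additive_eqI[OF g(1)[OF u] h(1)[OF u] _ s])
  fix x c assume "x \<in> carrier vA" "c \<in> carrier vC"
  thus "g (pAC x c) u = h (pAC x c) u"
    by (intro CA.additive_eqI[OF g(2) h(2) _ u]) (simp_all add: p)
qed

lemma contract_lmul: "s \<in> carrier tAC \<Longrightarrow> u \<in> carrier tCA \<Longrightarrow> a \<in> carrier A \<Longrightarrow>
    contract (lmul a s) u = lact LR a (contract s u)"
  by (rule contract_induct[of "\<lambda>s u. contract (lmul a s) u" AA "\<lambda>s u. lact LR a (contract s u)"])
     (auto intro: additive_comp[OF lmul_additive contract1] contract2 additive_comp[OF contract1 lact_LR]
        additive_comp[OF contract2 lact_LR] simp: lmul_module A.smult_mult_right)

lemma contract_rmul: "s \<in> carrier tAC \<Longrightarrow> u \<in> carrier tCA \<Longrightarrow> a \<in> carrier A \<Longrightarrow>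
    contract s (rmul u a) = ract LR (contract s u) a"
  by (rule contract_induct[of "\<lambda>s u. contract s (rmul u a)" AA "\<lambda>s u. ract LR (contract s u) a"])
     (auto intro: additive_comp[OF rmul_additive contract2] contract1 additive_comp[OF contract1 ract_LR]
        additive_comp[OF contract2 ract_LR] simp: rmul_module)

lemma contract_scalar: "s \<in> carrier tAC \<Longrightarrow> u \<in> carrier tCA \<Longrightarrow>
    contract (lact tAC k s) u = contract s (lact tCA k u)"
proof (rule contract_induct[of "\<lambda>s u. contract (lact tAC k s) u" AA "\<lambda>s u. contract s (lact tCA k u)"])
  note l = CA.lact_tensor[OF cspaceD(1)[OF cC], of k]
  show "(\<lambda>s. contract (lact tAC k s) u) \<in> additive_maps tAC AA" if "u \<in> carrier tCA" for u
    by (rule additive_comp[OF lact_AC_additive contract1[OF that]])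
  show "contract (lact tAC k s) \<in> additive_maps tCA AA" if "s \<in> carrier tAC" for s
    using that cspaceD(6)[OF cAC] by (intro contract2) simp
  show "(\<lambda>s. contract s (lact tCA k u)) \<in> additive_maps tAC AA" if "u \<in> carrier tCA" for u
    using that cspaceD(6)[OF cCA] by (intro contract1) simp
  show "(\<lambda>u. contract s (lact tCA k u)) \<in> additive_maps tCA AA" if "s \<in> carrier tAC" for s
    using l by (intro additive_comp[OF _ contract2[OF that]]) simp
  show "contract (lact tAC k (pAC x c)) (pCA c' y) = contract (pAC x c) (lact tCA k (pCA c' y))"
    if "x \<in> carrier A" "c \<in> carrier C" "c' \<in> carrier C" "y \<in> carrier A" for x c c' y
    using that l by (simp add: \<gamma>_add smult_rules mult.commute)
qed

text \<open>The retraction \<open>a \<otimes> a' \<mapsto> \<Sum> a\<^sub>0 \<gamma>(a\<^sub>1, a'\<^sub>(\<^sub>-\<^sub>1\<^sub>)) a'\<^sub>0\<close> onto the cotensor square.\<close>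

definition proj where "proj = tensor_lift AA (\<lambda>x y. contract (\<delta> x) (lcoact y))"

lemma proj_balanced: "balanced cplx vA vA AA (\<lambda>x y. contract (\<delta> x) (lcoact y))"
  by (rule balancedI)
     (simp_all add: coact_add lcoact_add additive_add[OF contract1] additive_add[OF contract2] coact_smult lcoact_smult contract_scalar)

lemma proj_additive: "proj \<in> additive_maps AA AA"
  and proj_pure: "x \<in> carrier A \<Longrightarrow> y \<in> carrier A \<Longrightarrow> proj (pAA x y) = contract (\<delta> x) (lcoact y)"
  unfolding proj_def using Av.VV.lift_additive[OF AA_abelian proj_balanced] Av.VV.lift_pure[OF AA_abelian proj_balanced] by simp_all

lemma proj_lact: "t \<in> carrier AA \<Longrightarrow> b \<in> B \<Longrightarrow> proj (lact LR b t) = lact LR b (proj t)"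
proof (induction rule: Av.VV.induct)
  case (add s t)
  thus ?case by (simp add: LR_left B_in additive_add[OF proj_additive] additive_closed[OF proj_additive])
qed (simp add: proj_pure B_in B_coact contract_lmul)

lemma proj_ract: "t \<in> carrier AA \<Longrightarrow> b \<in> B \<Longrightarrow> proj (ract LR t b) = ract LR (proj t) b"
proof (induction rule: Av.VV.induct)
  case (add s t)
  thus ?case by (simp add: LR_right B_in additive_add[OF proj_additive] additive_closed[OF proj_additive])
qed (simp add: proj_pure B_in left_coact_B contract_rmul)

text \<open>
  The map \<open>x \<otimes> c \<otimes> y \<mapsto> \<Sum> x\<^sub>0 \<gamma>(x\<^sub>1, c) \<otimes> y\<close>.  Composed with \<open>cotensor_r\<close> it is \<open>proj\<close>, and composed with
  \<open>cotensor_l\<close> it is the identity by the normalisation of \<open>\<gamma>\<close>.  So \<open>proj\<close> is the identity where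
  \<open>cotensor_l\<close> and \<open>cotensor_r\<close> agree.
\<close>

definition fold_left where "fold_left = tensor_lift AA (\<lambda>x u. contract (\<delta> x) u)"

lemma fold_left_balanced: "balanced cplx vA tCA AA (\<lambda>x u. contract (\<delta> x) u)"
  by (rule balancedI)
     (simp_all add: coact_add additive_add[OF contract1] additive_add[OF contract2] coact_smult contract_scalar)

lemma fold_left: "fold_left \<in> additive_maps TACA AA"
  "x \<in> carrier A \<Longrightarrow> u \<in> carrier tCA \<Longrightarrow> fold_left (pA_CA x u) = contract (\<delta> x) u"
  unfolding fold_left_def
  using A_CA.lift_additive[OF Av.VV_abelian fold_left_balanced] A_CA.lift_pure[OF Av.VV_abelian fold_left_balanced] by simp_all

lemma fold_left_cotensor_r: "t \<in> carrier AA \<Longrightarrow> fold_left (cotensor_r t) = proj t"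
proof (induction rule: Av.VV.induct)
  case (add s t)
  thus ?case by (simp add: additive_add[OF cotensor_r(1)] additive_closed[OF cotensor_r(1)] additive_add[OF fold_left(1)] additive_add[OF proj_additive])
qed (simp add: cotensor_r fold_left proj_pure)

definition eval_right where "eval_right y = tensor_lift A (\<lambda>x c. y c \<odot>\<^bsub>A\<^esub> x)"

lemma eval_right_balanced: "linear_form y \<Longrightarrow> balanced cplx vA vC A (\<lambda>x c. y c \<odot>\<^bsub>A\<^esub> x)"
  by (rule balancedI) (simp_all add: linear_form_add linear_form_smult smult_rules mult.commute)

lemma eval_right: "linear_form y \<Longrightarrow> eval_right y \<in> additive_maps tAC A"
  "linear_form y \<Longrightarrow> x \<in> carrier A \<Longrightarrow> c \<in> carrier C \<Longrightarrow> eval_right y (pAC x c) = y c \<odot>\<^bsub>A\<^esub> x"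
  unfolding eval_right_def
  using AC.lift_additive[OF A.is_abelian_group eval_right_balanced] AC.lift_pure[OF A.is_abelian_group eval_right_balanced] by simp_all

lemma eval_right_add:
  assumes "r \<in> carrier tAC" "c \<in> carrier C" "c' \<in> carrier C"
  shows "eval_right (\<lambda>u. \<gamma> u (c \<oplus>\<^bsub>C\<^esub> c')) r = eval_right (\<lambda>u. \<gamma> u c) r \<oplus>\<^bsub>A\<^esub> eval_right (\<lambda>u. \<gamma> u c') r"
  using assms
proof (induction rule: AC.induct)
  case (pure x d)
  thus ?case using \<gamma>_form by (simp add: eval_right \<gamma>_add smult_rules)
next
  case (add s t)
  thus ?case using \<gamma>_form(2)
    by (simp add: additive_add[OF eval_right(1)] additive_closed[OF eval_right(1)] A.a_ac)
qed

lemma eval_right_scalar: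
  assumes "r \<in> carrier tAC" "c \<in> carrier C"
  shows "eval_right (\<lambda>u. \<gamma> u c) (lact tAC k r) = eval_right (\<lambda>u. \<gamma> u (k \<odot>\<^bsub>C\<^esub> c)) r"
  using assms
proof (induction rule: AC.induct)
  case (pure x d)
  thus ?case using \<gamma>_form by (simp add: eval_right \<gamma>_add smult_rules mult.commute)
next
  case (add s t)
  thus ?case using \<gamma>_form(2) cspaceD(6)[OF cAC]
    by (simp add: additive_add[OF eval_right(1)] additive_add[OF lact_AC_additive])
qed

text \<open>The map \<open>(x \<otimes> c) \<otimes> d \<mapsto> \<gamma>(c, d) x\<close>.\<close>

definition eval2 where "eval2 = tensor_lift A (\<lambda>r c. eval_right (\<lambda>u. \<gamma> u c) r)"

lemma eval2_balanced: "balanced cplx tAC vC A (\<lambda>r c. eval_right (\<lambda>u. \<gamma> u c) r)"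
  using \<gamma>_form(2)
  by (intro balancedI) (simp_all add: additive_closed[OF eval_right(1)] additive_add[OF eval_right(1)] eval_right_add
      cspaceD(5)[OF cAC] eval_right_scalar)

lemma eval2: "eval2 \<in> additive_maps TACC A"
  "r \<in> carrier tAC \<Longrightarrow> c \<in> carrier C \<Longrightarrow> eval2 (pACC r c) = eval_right (\<lambda>u. \<gamma> u c) r"
  unfolding eval2_def
  using ACC.lift_additive[OF A.is_abelian_group eval2_balanced] ACC.lift_pure[OF A.is_abelian_group eval2_balanced] by simp_all

text \<open>This is the normalisation \<open>\<Sum> \<gamma>(c\<^sub>1, c\<^sub>2) = \<epsilon>(c)\<close>.\<close>

lemma eval2_comult_right: "r \<in> carrier tAC \<Longrightarrow> eval2 (comult_right r) = eval_right \<epsilon> r"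
proof (induction rule: AC.induct)
  case (pure x c)
  hence xc: "x \<in> carrier A" "c \<in> carrier C" by simp_all
  note lift = VV.lift_additive[OF abelian_group_cplx \<gamma>_balanced] VV.lift_pure[OF abelian_group_cplx \<gamma>_balanced]
  have "eval2 (tensor_unassoc cplx cplx vA vC vC (pure_tensor cplx vA (vC \<otimes>\<^sub>\<complex> vC) x s)) = tensor_lift cplx \<gamma> s \<odot>\<^bsub>A\<^esub> x"
    if "s \<in> carrier (vC \<otimes>\<^sub>\<complex> vC)" for s
    using that
  proof (induction rule: VV.induct)
    case (pure c c')
    thus ?case using xc \<gamma>_form(2) by (simp add: unassoc_ACC(2) eval2 eval_right lift)
  next
    case (add s t)
    thus ?case using xc
      by (simp add: A_CC.pure_add2[simplified] additive_add[OF unassoc_ACC(1)] additive_closed[OF unassoc_ACC(1)]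
          additive_add[OF eval2(1)] additive_add[OF lift(1)] smult_rules)
  qed
  thus ?case using xc by (simp add: comult_right_def \<gamma>_counit eval_right linear_form_counit)
next
  case (add s t)
  thus ?case using linear_form_counit
    by (simp add: additive_add[OF comult_right_additive] additive_closed[OF comult_right_additive] additive_add[OF eval2(1)] additive_add[OF eval_right(1)])
qed

lemma eval_counit: "x \<in> carrier A \<Longrightarrow> eval_right \<epsilon> (\<delta> x) = x"
  using A_comod by (simp add: right_comodule_def eval_right_def)

lemma fold_left_assoc:
  assumes "s \<in> carrier tAC" "y \<in> carrier A"
  shows "fold_left (tensor_assoc cplx cplx vA vC vA (pure_tensor cplx tAC vA s y)) = pAA (eval2 (coact_left s)) y"
  using assms
proof (induction rule: AC.induct)
  case (pure x c)
  hence xc: "x \<in> carrier A" "c \<in> carrier C" "y \<in> carrier A" by simp_all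
  have "contract r (pCA c y) = pAA (eval_right (\<lambda>u. \<gamma> u c) r) y" if "r \<in> carrier tAC" for r
    using that
  proof (induction rule: AC.induct)
    case (pure x c)
    thus ?case using xc \<gamma>_form(2) by (simp add: eval_right)
  next
    case (add s t)
    thus ?case using xc \<gamma>_form(2)
      by (simp add: additive_add[OF contract1] additive_add[OF eval_right(1)] additive_closed[OF eval_right(1)]
          Av.VV.pure_add1[simplified])
  qed
  thus ?case using xc by (simp add: assoc_ACA(2) fold_left eval2)
next
  case (add s t)
  thus ?case
    by (simp add: AC_A.pure_add1[simplified] additive_add[OF assoc_ACA(1)] additive_closed[OF assoc_ACA(1)]
       additive_add[OF fold_left(1)] additive_add[OF coact_left_additive] additive_closed[OF coact_left_additive] additive_add[OF eval2(1)]
       additive_closed[OF eval2(1)] Av.VV.pure_add1[simplified])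
qed

lemma fold_left_cotensor_l: "t \<in> carrier AA \<Longrightarrow> fold_left (cotensor_l t) = t"
proof (induction rule: Av.VV.induct)
  case (pure x y)
  hence "eval2 (coact_left (\<delta> x)) = x" by (simp add: comult_right_coact[symmetric] eval2_comult_right eval_counit)
  thus ?case using pure by (simp add: cotensor_l fold_left_assoc)
next
  case (add s t)
  thus ?case by (simp add: additive_add[OF cotensor_l(1)] additive_closed[OF cotensor_l(1)] additive_add[OF fold_left(1)])
qed

lemma proj_id: "t \<in> cotens \<Longrightarrow> proj t = t"
  using fold_left_cotensor_r[of t] fold_left_cotensor_l[of t] by (simp add: cotens_iff)

text \<open>
  The same contraction with one more factor at the right, \<open>(\<A> \<otimes> \<C>) \<otimes> (\<C> \<otimes> (\<C> \<otimes> \<A>)) \<rightarrow> \<A> \<otimes> \<C> \<otimes> \<A>\<close>.  The values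
  of \<open>cotensor_l\<close> and \<open>cotensor_r\<close> on a contracted tensor are both of this form.
\<close>

definition contract3 where
  "contract3 = bilift TACA (\<lambda>x c c' u. pA_CA (\<gamma> c c' \<odot>\<^bsub>A\<^esub> x) u)"

lemma contract3_balanced:
  "c' \<in> carrier C \<Longrightarrow> u \<in> carrier tCA \<Longrightarrow> balanced cplx vA vC TACA (\<lambda>x c. pA_CA (\<gamma> c c' \<odot>\<^bsub>A\<^esub> x) u)"
  "x \<in> carrier A \<Longrightarrow> c \<in> carrier C \<Longrightarrow> balanced cplx vC tCA TACA (\<lambda>c' u. pA_CA (\<gamma> c c' \<odot>\<^bsub>A\<^esub> x) u)"
  by (intro balancedI; simp add: \<gamma>_add smult_rules A_CA.pure_add1[simplified] A_CA.pure_add2[simplified]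
        A_CA.pure_balanced[simplified, symmetric] mult.commute)+

lemma contract3:
  "w \<in> carrier TCCA \<Longrightarrow> (\<lambda>s. contract3 s w) \<in> additive_maps tAC TACA"
  "s \<in> carrier tAC \<Longrightarrow> contract3 s \<in> additive_maps TCCA TACA"
  "x \<in> carrier A \<Longrightarrow> c \<in> carrier C \<Longrightarrow> c' \<in> carrier C \<Longrightarrow> u \<in> carrier tCA \<Longrightarrow>
     contract3 (pAC x c) (pure_tensor cplx vC tCA c' u) = pA_CA (\<gamma> c c' \<odot>\<^bsub>A\<^esub> x) u"
  unfolding contract3_def
  using bilift[OF AC.tensor_product_axioms C_CA.tensor_product_axioms ACA_abelian, of "\<lambda>x c c' u. pA_CA (\<gamma> c c' \<odot>\<^bsub>A\<^esub> x) u"]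
    contract3_balanced by simp_all

lemma cotensor_r_contract:
  assumes "s \<in> carrier tAC" "u \<in> carrier tCA"
  shows "cotensor_r (contract s u) = contract3 s (id_lcoact u)"
  using _ _ _ _ _ assms
  by (rule contract_induct[of "\<lambda>s u. cotensor_r (contract s u)" TACA "\<lambda>s u. contract3 s (id_lcoact u)"])
     (auto intro: additive_comp[OF contract1 cotensor_r(1)] additive_comp[OF contract2 cotensor_r(1)] additive_comp[OF id_lcoact(1) contract3(2)]
        contract3(1) additive_closed[OF id_lcoact(1)] simp: cotensor_r id_lcoact contract3)

lemma assoc_scalar:
  assumes "q \<in> carrier tAC" "y \<in> carrier A"
  shows "tensor_assoc cplx cplx vA vC vA (pure_tensor cplx tAC vA (lact tAC k q) y) =
     lact TACA k (tensor_assoc cplx cplx vA vC vA (pure_tensor cplx tAC vA q y))"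
  using assms
proof (induction rule: AC.induct)
  case (pure x c)
  thus ?case using A_CA.lact_tensor(2)[OF cspaceD(1)[OF cA], of k] by (simp add: assoc_ACA(2))
next
  case (add s t)
  note cs = cspace_tensor[OF cA cCA]
  show ?case using add cspaceD(6)[OF cAC]
    by (simp add: cspaceD(7)[OF cAC] cspaceD(7)[OF cs] AC_A.pure_add1[simplified] additive_add[OF assoc_ACA(1)]
        additive_closed[OF assoc_ACA(1)])
qed

lemma cotensor_l_scalar: "t \<in> carrier AA \<Longrightarrow> cotensor_l (lact AA k t) = lact TACA k (cotensor_l t)"
proof (induction rule: Av.VV.induct)
  case (pure x y)
  thus ?case using Av.VV.lact_tensor(2)[OF cspaceD(1)[OF cA], of k]
    by (simp add: cotensor_l(2) coact_smult assoc_scalar)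
next
  case (add s t)
  thus ?case using cspaceD(6)[OF cAA]
    by (simp add: cspaceD(7)[OF cAA] additive_add[OF cotensor_l(1)] additive_closed[OF cotensor_l(1)] cspaceD(7)[OF cspace_tensor[OF cA cCA]])
qed

lemma slice_tensor_balanced:
  assumes "y \<in> carrier A" "c' \<in> carrier C"
  shows "balanced cplx tAC vC TACA
     (\<lambda>q d. lact TACA (\<gamma> d c') (tensor_assoc cplx cplx vA vC vA (pure_tensor cplx tAC vA q y)))"
proof -
  note cs = cspace_tensor[OF cA cCA]
  note sc = assoc_scalar[OF _ assms(1)]
  show ?thesis
    using assms
    by (intro balancedI)
       (simp_all add: cspaceD(6-9)[OF cs] additive_closed[OF assoc_ACA(1)] AC_A.pure_add1[simplified]
         additive_add[OF assoc_ACA(1)] \<gamma>_add cspaceD(5)[OF cAC] sc flip: cspaceD(9)[OF cs],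
        simp add: cspaceD(9)[OF cs, symmetric] additive_closed[OF assoc_ACA(1)] mult.commute)
qed

text \<open>For \<open>u = c' \<otimes> y\<close> this is \<open>\<Sum> x\<^sub>0 \<otimes> x\<^sub>1 \<gamma>(x\<^sub>2, c') \<otimes> y = \<Sum> x\<^sub>0 \<otimes> \<gamma>(x\<^sub>1, c'\<^sub>1) c'\<^sub>2 \<otimes> y\<close>, the invariance of \<open>\<gamma>\<close>.\<close>

lemma cotensor_l_contract:
  assumes x: "x \<in> carrier A" and u: "u \<in> carrier tCA"
  shows "cotensor_l (contract (\<delta> x) u) = contract3 (\<delta> x) (tensor_assoc cplx cplx vC vC vA (comult_id u))"
  using u
proof (induction rule: CA.induct)
  case (pure c' y)
  hence cy: "c' \<in> carrier C" "y \<in> carrier A" by simp_all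
  note cs = cspace_tensor[OF cA cCA]
  \<comment> \<open>The map \<open>q \<otimes> d \<mapsto> \<gamma>(d, c') (q \<otimes> y)\<close>; both sides of the equation factor through it.\<close>
  define T where "T = tensor_lift TACA
     (\<lambda>q d. lact TACA (\<gamma> d c') (tensor_assoc cplx cplx vA vC vA (pure_tensor cplx tAC vA q y)))"
  note bal = slice_tensor_balanced[OF cy(2,1)]
  have T: "T \<in> additive_maps TACC TACA"
    unfolding T_def by (rule ACC.lift_additive[OF ACA_abelian bal])
  have Tp: "T (pACC q d) = lact TACA (\<gamma> d c') (tensor_assoc cplx cplx vA vC vA (pure_tensor cplx tAC vA q y))"
    if "q \<in> carrier tAC" "d \<in> carrier C" for q d
    unfolding T_def using that by (simp add: ACC.lift_pure[OF ACA_abelian bal])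
  have lact_ACA: "lact TACA k (pA_CA x u) = pA_CA (k \<odot>\<^bsub>A\<^esub> x) u" if "x \<in> carrier A" "u \<in> carrier tCA" for k x u
    using A_CA.lact_tensor(2)[OF cspaceD(1)[OF cA], of k] that by simp
  have 1: "cotensor_l (contract r (pCA c' y)) = T (coact_left r)" if "r \<in> carrier tAC" for r
    using that
  proof (induction rule: AC.induct)
    case (pure x c)
    have "cotensor_l (pAA (\<gamma> c c' \<odot>\<^bsub>A\<^esub> x) y) = cotensor_l (lact AA (\<gamma> c c') (pAA x y))"
      using pure cy Av.VV.lact_tensor(2)[OF cspaceD(1)[OF cA]] by simp
    thus ?case using pure cy by (simp add: cotensor_l_scalar cotensor_l(2) Tp)
  next
    case (add s t)
    thus ?case using cy
      by (simp add: additive_add[OF contract1] additive_add[OF cotensor_l(1)] additive_add[OF coact_left_additive]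
          additive_closed[OF coact_left_additive] additive_add[OF T])
  qed
  have 2: "T (comult_right r) = contract3 r (tensor_assoc cplx cplx vC vC vA (pure_tensor cplx (vC \<otimes>\<^sub>\<complex> vC) vA (\<Delta> c') y))"
    if "r \<in> carrier tAC" for r
    using that
  proof (induction rule: AC.induct)
    case (pure x c)
    hence xc: "x \<in> carrier A" "c \<in> carrier C" by simp_all
    have "T (tensor_unassoc cplx cplx vA vC vC (pure_tensor cplx vA (vC \<otimes>\<^sub>\<complex> vC) x s)) =
        pA_CA x (pCA (slice_right (\<lambda>u. \<gamma> u c') s) y)" if "s \<in> carrier (vC \<otimes>\<^sub>\<complex> vC)" for s
      using that
    proof (induction rule: VV.induct)
      case (pure c0 d)
      thus ?case using xc cy \<gamma>_form(2)
        by (simp add: unassoc_ACC(2) Tp assoc_ACA(2) lact_ACA)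
           (simp add: A_CA.pure_balanced[of x _ "pCA c0 y", simplified] CA.lact_tensor(2)[OF cspaceD(1)[OF cC], simplified])
    next
      case (add s t)
      thus ?case using xc cy \<gamma>_form(2)
        by (simp add: A_CC.pure_add2[simplified] additive_add[OF unassoc_ACC(1)] additive_closed[OF unassoc_ACC(1)]
            additive_add[OF T] slices_add CA.pure_add1[simplified] A_CA.pure_add2[simplified])
    qed
    hence l: "T (comult_right (pAC x c)) = pA_CA x (pCA (R (\<lambda>u. \<gamma> u c') c) y)" using xc by (simp add: comult_right_def)
    have "contract3 (pAC x c) (tensor_assoc cplx cplx vC vC vA (pure_tensor cplx (vC \<otimes>\<^sub>\<complex> vC) vA s y)) =
        pA_CA x (pCA (slice_left (\<gamma> c) s) y)" if "s \<in> carrier (vC \<otimes>\<^sub>\<complex> vC)" for s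
      using that
    proof (induction rule: VV.induct)
      case (pure c0 d)
      thus ?case using xc cy \<gamma>_form(1)
        by (simp add: assoc_CCA(2) contract3(3))
           (simp add: A_CA.pure_balanced[of x _ "pCA d y", simplified] CA.lact_tensor(2)[OF cspaceD(1)[OF cC], simplified])
    next
      case (add s t)
      thus ?case using xc cy \<gamma>_form(1)
        by (simp add: CC_A.pure_add1[simplified] additive_add[OF assoc_CCA(1)] additive_closed[OF assoc_CCA(1)]
            additive_add[OF contract3(2)] slices_add CA.pure_add1[simplified] A_CA.pure_add2[simplified])
    qed
    thus ?case using l xc cy by (simp add: \<gamma>_invariant)
  next
    case (add s t)
    thus ?case using cy
      by (simp add: additive_add[OF comult_right_additive] additive_closed[OF comult_right_additive] additive_add[OF T]
          additive_add[OF contract3(1)] additive_closed[OF assoc_CCA(1)])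
  qed
  show ?case using 1[of "\<delta> x"] 2[of "\<delta> x"] x cy by (simp add: comult_right_coact comult_id)
next
  case (add s t)
  thus ?case using x
    by (simp add: additive_add[OF contract2] additive_add[OF cotensor_l(1)] additive_add[OF comult_id(1)] additive_closed[OF comult_id(1)]
        additive_add[OF assoc_CCA(1)] additive_closed[OF assoc_CCA(1)] additive_add[OF contract3(2)])
qed

text \<open>
  By \<open>cotensor_l_contract\<close> and \<open>cotensor_r_contract\<close>, the two maps differ on \<open>proj (x \<otimes> y)\<close> only in that one
  comultiplies and the other coacts on the left coaction of \<open>y\<close>.
\<close>

lemma proj_in: "t \<in> carrier AA \<Longrightarrow> proj t \<in> cotens"
proof (induction rule: Av.VV.induct)
  case (pure x y)
  thus ?case using cotensor_l_contract[of x "lcoact y"] cotensor_r_contract[of "\<delta> x" "lcoact y"] left_coact_coassoc[of y]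
    by (simp add: cotens_iff proj_pure)
next
  case (add s t)
  interpret G: abelian_group AA by (rule Av.VV_abelian)
  show ?case using add
    by (simp add: cotens_iff additive_add[OF proj_additive] additive_add[OF cotensor_l(1)] additive_add[OF cotensor_r(1)] G.a_closed)
qed

end

section \<open>Faithful flatness\<close>

text \<open>
  Transport of a module along an injection \<open>j\<close> of its carrier.  The test modules of faithful flatness
  have elements of one fixed type, so the modules of interest are first copied into it.
\<close>

definition copy_module ::
  "('n \<Rightarrow> 't) \<Rightarrow> ('l, 'n, 'r) bimodule \<Rightarrow> ('l0 \<Rightarrow> 'n \<Rightarrow> 'n) \<Rightarrow> ('n \<Rightarrow> 'r0 \<Rightarrow> 'n) \<Rightarrow> ('l0, 't, 'r0) bimodule" where
  "copy_module j N l r =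
     (let k = inv_into (carrier N) j in
      \<lparr>carrier = j ` carrier N, monoid.mult = undefined, one = undefined, ring.zero = j \<zero>\<^bsub>N\<^esub>,
       add = (\<lambda>x y. j (k x \<oplus>\<^bsub>N\<^esub> k y)), lact = (\<lambda>a x. j (l a (k x))), ract = (\<lambda>x a. j (r (k x) a))\<rparr>)"

lemma copy_module_sel:
  assumes j: "inj_on j (carrier N)"
  shows "carrier (copy_module j N l r) = j ` carrier N" "\<zero>\<^bsub>copy_module j N l r\<^esub> = j \<zero>\<^bsub>N\<^esub>"
    "x \<in> carrier N \<Longrightarrow> y \<in> carrier N \<Longrightarrow> j x \<oplus>\<^bsub>copy_module j N l r\<^esub> j y = j (x \<oplus>\<^bsub>N\<^esub> y)"
    "x \<in> carrier N \<Longrightarrow> lact (copy_module j N l r) a (j x) = j (l a x)"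
    "x \<in> carrier N \<Longrightarrow> ract (copy_module j N l r) (j x) b = j (r x b)"
  using j by (simp_all add: copy_module_def Let_def)

lemma copy_module_abelian:
  assumes j: "inj_on j (carrier N)" and N: "abelian_group N"
  shows "abelian_group (copy_module j N l r)"
proof -
  interpret abelian_group N by fact
  note s = copy_module_sel[OF j, where l = l and r = r]
  show ?thesis
  proof (rule abelian_groupI)
    fix x assume "x \<in> carrier (copy_module j N l r)"
    then obtain u where u: "x = j u" "u \<in> carrier N" by (auto simp: s)
    show "\<exists>y\<in>carrier (copy_module j N l r). y \<oplus>\<^bsub>copy_module j N l r\<^esub> x = \<zero>\<^bsub>copy_module j N l r\<^esub>"
      using u by (intro bexI[of _ "j (\<ominus>\<^bsub>N\<^esub> u)"]) (simp_all add: s l_neg)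
  qed (auto simp: s a_ac)
qed

lemma copy_left_module:
  assumes j: "inj_on j (carrier N)" and N: "left_module R N"
  shows "left_module R (copy_module j N (lact N) r)"
  using left_moduleD[OF N] copy_module_abelian[OF j] abelian_group.axioms(1)[of N]
  by (auto simp: left_module_def copy_module_sel[OF j] abelian_monoid.a_closed)

lemma copy_right_module:
  assumes j: "inj_on j (carrier N)" and N: "right_module R N"
  shows "right_module R (copy_module j N l (ract N))"
  using right_moduleD[OF N] copy_module_abelian[OF j] abelian_group.axioms(1)[of N]
  by (auto simp: right_module_def copy_module_sel[OF j] abelian_monoid.a_closed)

lemma zero_left_module:
  assumes "left_module R N" shows "left_module R (N\<lparr>carrier := {\<zero>\<^bsub>N\<^esub>}\<rparr>)"
proof -
  note D = left_moduleD[OF assms]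
  interpret abelian_group N by (rule D)
  have z: "lact N r \<zero>\<^bsub>N\<^esub> = \<zero>\<^bsub>N\<^esub>" if "r \<in> carrier R" for r
    using that D(3,4) by (intro additive_zero[OF _ D(2) D(2)] additive_mapsI) simp_all
  have "abelian_group (N\<lparr>carrier := {\<zero>\<^bsub>N\<^esub>}\<rparr>)"
    by (rule abelian_groupI) auto
  thus ?thesis using D(1) z ring.ring_simprules(1)[OF D(1)] ring.ring_simprules(5,6)[OF D(1)]
    by (auto simp: left_module_def)
qed

lemma zero_right_module:
  assumes "right_module R N" shows "right_module R (N\<lparr>carrier := {\<zero>\<^bsub>N\<^esub>}\<rparr>)"
proof -
  note D = right_moduleD[OF assms]
  interpret abelian_group N by (rule D)
  have z: "ract N \<zero>\<^bsub>N\<^esub> r = \<zero>\<^bsub>N\<^esub>" if "r \<in> carrier R" for r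
    using that D(3,4) by (intro additive_zero[of "\<lambda>n. ract N n r", OF _ D(2) D(2)] additive_mapsI) simp_all
  have "abelian_group (N\<lparr>carrier := {\<zero>\<^bsub>N\<^esub>}\<rparr>)"
    by (rule abelian_groupI) auto
  thus ?thesis using D(1) z ring.ring_simprules(1)[OF D(1)] ring.ring_simprules(5,6)[OF D(1)]
    by (auto simp: right_module_def)
qed

text \<open>
  A faithfully flat module reflects bijectivity: \<open>v\<close> is injective if \<open>0 \<rightarrow> N2 \<rightarrow> N3\<close> is exact at \<open>N2\<close> and
  surjective if \<open>N2 \<rightarrow> N3 \<rightarrow> 0\<close> is exact at \<open>N3\<close>, and the zero module stays zero under the tensor product.
\<close>

lemma flat_right_reflects_bij_aux:
  fixes N2 N3 :: "('r, 't, unit) bimodule"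
  assumes ff: "faithfully_flat_right TYPE('t) R M"
    and N: "left_module R N2" "left_module R N3" and v: "v \<in> left_linear R N2 N3"
    and bij: "bij_betw (tensor_map R M N3 (\<lambda>m. m) v) (carrier (tensor R M N2)) (carrier (tensor R M N3))"
  shows "bij_betw v (carrier N2) (carrier N3)"
proof -
  have M: "right_module R M" using ff by (simp add: faithfully_flat_right_def)
  have ex: "exact_at N1 u N2 v N3"
    if "left_module R N1" "left_module R N2" "left_module R N3" "u \<in> left_linear R N1 N2" "v \<in> left_linear R N2 N3"
      "exact_at (tensor R M N1) (tensor_map R M N2 (\<lambda>m. m) u)
         (tensor R M N2) (tensor_map R M N3 (\<lambda>m. m) v) (tensor R M N3)"
    for N1 N2 N3 :: "('r, 't, unit) bimodule" and u v
  proof -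
    note ff' = ff[unfolded faithfully_flat_right_def, THEN conjunct2, THEN spec, THEN spec, THEN spec, THEN spec, THEN spec, THEN mp]
    show ?thesis by (rule iffD2[OF ff' that(6)]) (intro conjI that(1-5))
  qed
  interpret T2: tensor_product R M N2 using M N(1) by (rule tensor_productI)
  interpret T3: tensor_product R M N3 using M N(2) by (rule tensor_productI)
  let ?h = "tensor_map R M N3 (\<lambda>m. m) v"
  note h = T2.map_additive_pure[OF T3.tensor_product_axioms right_linear_id v]
  define Z where "Z = N2\<lparr>carrier := {\<zero>\<^bsub>N2\<^esub>}\<rparr>"
  have Z: "left_module R Z" unfolding Z_def by (rule zero_left_module[OF N(1)])
  have Zsel: "carrier Z = {\<zero>\<^bsub>N2\<^esub>}" "\<zero>\<^bsub>Z\<^esub> = \<zero>\<^bsub>N2\<^esub>" by (simp_all add: Z_def)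
  interpret TZ: tensor_product R M Z using M Z by (rule tensor_productI)
  interpret Tg: abelian_group "tensor R M Z" by (rule TZ.tensor_abelian_group)
  interpret T2g: abelian_group "tensor R M N2" by (rule T2.tensor_abelian_group)
  interpret T3g: abelian_group "tensor R M N3" by (rule T3.tensor_abelian_group)
  have tz: "t = \<zero>\<^bsub>tensor R M Z\<^esub>" if "t \<in> carrier (tensor R M Z)" for t
    using that
    by (induction rule: TZ.induct) (use TZ.pure_zero2 Zsel in auto)
  have u: "(\<lambda>x. x) \<in> left_linear R Z N2"
    by (auto simp: left_linear_def additive_maps_def hom_def Z_def)
  have w: "(\<lambda>x. \<zero>\<^bsub>Z\<^esub>) \<in> left_linear R N3 Z"
    using left_moduleD(3)[OF Z] Zsel
    by (auto simp: left_linear_def additive_maps_def hom_def Z_def)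
  note hu = TZ.map_additive_pure[OF T2.tensor_product_axioms right_linear_id u]
  note hw = T3.map_additive_pure[OF TZ.tensor_product_axioms right_linear_id w]
  have h0: "?h \<zero>\<^bsub>tensor R M N2\<^esub> = \<zero>\<^bsub>tensor R M N3\<^esub>"
    by (rule additive_zero[OF h(1) T2.tensor_abelian_group T3.tensor_abelian_group])
  have hinj: "?h t = \<zero>\<^bsub>tensor R M N3\<^esub> \<Longrightarrow> t \<in> carrier (tensor R M N2) \<Longrightarrow> t = \<zero>\<^bsub>tensor R M N2\<^esub>" for t
    using inj_onD[OF bij_betw_imp_inj_on[OF bij], of t "\<zero>\<^bsub>tensor R M N2\<^esub>"] h0 by simp
  have "tensor_map R M N2 (\<lambda>m. m) (\<lambda>x. x) ` carrier (tensor R M Z) = {\<zero>\<^bsub>tensor R M N2\<^esub>}"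
  proof -
    have "carrier (tensor R M Z) = {\<zero>\<^bsub>tensor R M Z\<^esub>}" using tz by auto
    thus ?thesis using additive_zero[OF hu(1) TZ.tensor_abelian_group T2.tensor_abelian_group] by simp
  qed
  moreover have "{t \<in> carrier (tensor R M N2). ?h t = \<zero>\<^bsub>tensor R M N3\<^esub>} = {\<zero>\<^bsub>tensor R M N2\<^esub>}"
  proof (rule subset_antisym, rule subsetI)
    fix t assume "t \<in> {t \<in> carrier (tensor R M N2). ?h t = \<zero>\<^bsub>tensor R M N3\<^esub>}"
    hence "t \<in> carrier (tensor R M N2)" "?h t = \<zero>\<^bsub>tensor R M N3\<^esub>" by simp_all
    thus "t \<in> {\<zero>\<^bsub>tensor R M N2\<^esub>}" by (intro iffD2[OF singleton_iff] hinj)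
  qed (simp add: h0)
  ultimately have "exact_at (tensor R M Z) (tensor_map R M N2 (\<lambda>m. m) (\<lambda>x. x))
           (tensor R M N2) ?h (tensor R M N3)"
    by (simp add: exact_at_def)
  hence "exact_at Z (\<lambda>x. x) N2 v N3" by (rule ex[OF Z N u v])
  hence "v x = \<zero>\<^bsub>N3\<^esub> \<Longrightarrow> x \<in> carrier N2 \<Longrightarrow> x = \<zero>\<^bsub>N2\<^esub>" for x
    by (auto simp: exact_at_def Zsel)
  hence inj: "inj_on v (carrier N2)"
    by (rule additive_inj_on[OF left_linear_additive[OF v] T2.Nab T3.Nab, rotated])
  have "?h ` carrier (tensor R M N2) = {t \<in> carrier (tensor R M N3).
      tensor_map R M Z (\<lambda>m. m) (\<lambda>x. \<zero>\<^bsub>Z\<^esub>) t = \<zero>\<^bsub>tensor R M Z\<^esub>}"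
    using bij_betw_imp_surj_on[OF bij] tz additive_closed[OF hw(1)] by auto
  hence "exact_at (tensor R M N2) ?h (tensor R M N3) (tensor_map R M Z (\<lambda>m. m) (\<lambda>x. \<zero>\<^bsub>Z\<^esub>)) (tensor R M Z)"
    by (simp add: exact_at_def)
  hence "exact_at N2 v N3 (\<lambda>x. \<zero>\<^bsub>Z\<^esub>) Z" by (rule ex[OF N Z v w])
  hence "v ` carrier N2 = carrier N3" by (auto simp: exact_at_def)
  with inj show ?thesis by (simp add: bij_betw_def)
qed

lemma flat_right_reflects_bij:
  fixes N2 :: "('r, 'n, 's) bimodule" and N3 :: "('r, 'p, 'q) bimodule"
    and j2 :: "'n \<Rightarrow> 't" and j3 :: "'p \<Rightarrow> 't"
  assumes ff: "faithfully_flat_right TYPE('t) R M"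
    and N: "left_module R N2" "left_module R N3" and v: "v \<in> left_linear R N2 N3"
    and j: "inj_on j2 (carrier N2)" "inj_on j3 (carrier N3)"
    and bij: "bij_betw (tensor_map R M N3 (\<lambda>m. m) v) (carrier (tensor R M N2)) (carrier (tensor R M N3))"
  shows "bij_betw v (carrier N2) (carrier N3)"
proof -
  have M: "right_module R M" using ff by (simp add: faithfully_flat_right_def)
  define N2' :: "('r, 't, unit) bimodule" where "N2' = copy_module j2 N2 (lact N2) (\<lambda>x _. x)"
  define N3' :: "('r, 't, unit) bimodule" where "N3' = copy_module j3 N3 (lact N3) (\<lambda>x _. x)"
  note s2 = copy_module_sel[OF j(1), where l = "lact N2" and r = "\<lambda>x (_ :: unit). x", folded N2'_def]
  note s3 = copy_module_sel[OF j(2), where l = "lact N3" and r = "\<lambda>x (_ :: unit). x", folded N3'_def]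
  define k2 where "k2 = inv_into (carrier N2) j2"
  define k3 where "k3 = inv_into (carrier N3) j3"
  have k2: "x \<in> carrier N2 \<Longrightarrow> k2 (j2 x) = x" for x using j(1) by (simp add: k2_def)
  have k3: "x \<in> carrier N3 \<Longrightarrow> k3 (j3 x) = x" for x using j(2) by (simp add: k3_def)
  have N': "left_module R N2'" "left_module R N3'"
    unfolding N2'_def N3'_def using N j by (auto intro: copy_left_module)
  note coact_left = left_moduleD[OF N(1)] and D3 = left_moduleD[OF N(2)]
  interpret N2: abelian_group N2 by (rule coact_left)
  interpret N3: abelian_group N3 by (rule D3)
  have l: "j2 \<in> left_linear R N2 N2'" "k2 \<in> left_linear R N2' N2" "j3 \<in> left_linear R N3 N3'" "k3 \<in> left_linear R N3' N3"
    by (auto simp: left_linear_def s2 s3 k2 k3 coact_left D3 intro!: additive_mapsI)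
  \<comment> \<open>The map \<open>v\<close> between the copies; its tensor product is conjugate to that of \<open>v\<close>.\<close>
  define v' where "v' = (\<lambda>x. j3 (v (k2 x)))"
  note vc = additive_closed[OF left_linear_additive[OF v]]
  have v'j: "v' (j2 x) = j3 (v x)" if "x \<in> carrier N2" for x using that by (simp add: v'_def k2)
  have v': "v' \<in> left_linear R N2' N3'"
    using vc by (auto simp: v'_def left_linear_def s2 s3 k2 coact_left additive_add[OF left_linear_additive[OF v]] left_linear_act[OF v]
        intro!: additive_mapsI)
  interpret T2: tensor_product R M N2 using M N(1) by (rule tensor_productI)
  interpret T3: tensor_product R M N3 using M N(2) by (rule tensor_productI)
  interpret T2': tensor_product R M N2' using M N'(1) by (rule tensor_productI)
  interpret T3': tensor_product R M N3' using M N'(2) by (rule tensor_productI)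
  note hv = T2.map_additive_pure[OF T3.tensor_product_axioms right_linear_id v]
  note hv' = T2'.map_additive_pure[OF T3'.tensor_product_axioms right_linear_id v']
  note hj2 = T2.map_additive_pure[OF T2'.tensor_product_axioms right_linear_id l(1)]
  note hk2 = T2'.map_additive_pure[OF T2.tensor_product_axioms right_linear_id l(2)]
  note hj3 = T3.map_additive_pure[OF T3'.tensor_product_axioms right_linear_id l(3)]
  note hk3 = T3'.map_additive_pure[OF T3.tensor_product_axioms right_linear_id l(4)]
  let ?h = "tensor_map R M N3 (\<lambda>m. m) v" and ?h' = "tensor_map R M N3' (\<lambda>m. m) v'"
  let ?J2 = "tensor_map R M N2' (\<lambda>m. m) j2" and ?K2 = "tensor_map R M N2 (\<lambda>m. m) k2"
  let ?J3 = "tensor_map R M N3' (\<lambda>m. m) j3" and ?K3 = "tensor_map R M N3 (\<lambda>m. m) k3"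
  have b2: "bij_betw ?K2 (carrier (tensor R M N2')) (carrier (tensor R M N2))"
  proof (rule bij_betw_byWitness[of _ ?J2])
    show "\<forall>a\<in>carrier (tensor R M N2'). ?J2 (?K2 a) = a"
    proof
      fix t assume t: "t \<in> carrier (tensor R M N2')"
      show "?J2 (?K2 t) = t"
        by (rule T2'.additive_eqI[OF additive_comp[OF hk2(1) hj2(1)] additive_id _ t]) (auto simp: s2 hk2(2) hj2(2) k2)
    qed
    show "\<forall>a\<in>carrier (tensor R M N2). ?K2 (?J2 a) = a"
    proof
      fix t assume t: "t \<in> carrier (tensor R M N2)"
      show "?K2 (?J2 t) = t"
        by (rule T2.additive_eqI[OF additive_comp[OF hj2(1) hk2(1)] additive_id _ t]) (auto simp: s2 hk2(2) hj2(2) k2)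
    qed
  qed (use additive_closed[OF hk2(1)] additive_closed[OF hj2(1)] in auto)
  have b3: "bij_betw ?J3 (carrier (tensor R M N3)) (carrier (tensor R M N3'))"
  proof (rule bij_betw_byWitness[of _ ?K3])
    show "\<forall>a\<in>carrier (tensor R M N3'). ?J3 (?K3 a) = a"
    proof
      fix t assume t: "t \<in> carrier (tensor R M N3')"
      show "?J3 (?K3 t) = t"
        by (rule T3'.additive_eqI[OF additive_comp[OF hk3(1) hj3(1)] additive_id _ t]) (auto simp: s3 hk3(2) hj3(2) k3)
    qed
    show "\<forall>a\<in>carrier (tensor R M N3). ?K3 (?J3 a) = a"
    proof
      fix t assume t: "t \<in> carrier (tensor R M N3)"
      show "?K3 (?J3 t) = t"
        by (rule T3.additive_eqI[OF additive_comp[OF hj3(1) hk3(1)] additive_id _ t]) (auto simp: s3 hk3(2) hj3(2) k3)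
    qed
  qed (use additive_closed[OF hk3(1)] additive_closed[OF hj3(1)] in auto)
  have "bij_betw ?h' (carrier (tensor R M N2')) (carrier (tensor R M N3'))"
  proof -
    have "bij_betw (?J3 \<circ> (?h \<circ> ?K2)) (carrier (tensor R M N2')) (carrier (tensor R M N3'))"
      by (rule bij_betw_trans[OF bij_betw_trans[OF b2 bij] b3])
    moreover have "(?J3 \<circ> (?h \<circ> ?K2)) t = ?h' t" if t: "t \<in> carrier (tensor R M N2')" for t
      unfolding comp_def
      by (rule T2'.additive_eqI[OF additive_comp[OF additive_comp[OF hk2(1) hv(1)] hj3(1)] hv'(1) _ t])
         (auto simp: s2 hk2(2) hj3(2) hv(2) hv'(2) k2 vc v'j)
    ultimately show ?thesis using bij_betw_cong[of "carrier (tensor R M N2')" "?J3 \<circ> (?h \<circ> ?K2)" ?h'] by simp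
  qed
  hence bv': "bij_betw v' (carrier N2') (carrier N3')"
    by (rule flat_right_reflects_bij_aux[OF ff N' v'])
  have "bij_betw j2 (carrier N2) (carrier N2')" using j by (simp add: bij_betw_def s2)
  moreover have "bij_betw k3 (carrier N3') (carrier N3)"
    unfolding s3 k3_def using j(2) by (simp add: bij_betw_inv_into bij_betw_imageI)
  ultimately have "bij_betw (k3 \<circ> (v' \<circ> j2)) (carrier N2) (carrier N3)"
    using bv' by (intro bij_betw_trans)
  moreover have "(k3 \<circ> (v' \<circ> j2)) x = v x" if "x \<in> carrier N2" for x
    using that vc by (simp add: v'_def k2 k3)
  ultimately show ?thesis using bij_betw_cong[of "carrier N2" "k3 \<circ> (v' \<circ> j2)" v] by simp
qed

lemma flat_left_reflects_bij_aux:
  fixes N2 N3 :: "(unit, 't, 'r) bimodule"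
  assumes ff: "faithfully_flat_left TYPE('t) R M"
    and N: "right_module R N2" "right_module R N3" and v: "v \<in> right_linear R N2 N3"
    and bij: "bij_betw (tensor_map R N3 M v (\<lambda>m. m)) (carrier (tensor R N2 M)) (carrier (tensor R N3 M))"
  shows "bij_betw v (carrier N2) (carrier N3)"
proof -
  have M: "left_module R M" using ff by (simp add: faithfully_flat_left_def)
  have ex: "exact_at N1 u N2 v N3"
    if "right_module R N1" "right_module R N2" "right_module R N3" "u \<in> right_linear R N1 N2" "v \<in> right_linear R N2 N3"
      "exact_at (tensor R N1 M) (tensor_map R N2 M u (\<lambda>m. m))
         (tensor R N2 M) (tensor_map R N3 M v (\<lambda>m. m)) (tensor R N3 M)"
    for N1 N2 N3 :: "(unit, 't, 'r) bimodule" and u v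
  proof -
    note ff' = ff[unfolded faithfully_flat_left_def, THEN conjunct2, THEN spec, THEN spec, THEN spec, THEN spec, THEN spec, THEN mp]
    show ?thesis by (rule iffD2[OF ff' that(6)]) (intro conjI that(1-5))
  qed
  interpret T2: tensor_product R N2 M using N(1) M by (rule tensor_productI)
  interpret T3: tensor_product R N3 M using N(2) M by (rule tensor_productI)
  let ?h = "tensor_map R N3 M v (\<lambda>m. m)"
  note h = T2.map_additive_pure[OF T3.tensor_product_axioms v left_linear_id]
  define Z where "Z = N2\<lparr>carrier := {\<zero>\<^bsub>N2\<^esub>}\<rparr>"
  have Z: "right_module R Z" unfolding Z_def by (rule zero_right_module[OF N(1)])
  have Zsel: "carrier Z = {\<zero>\<^bsub>N2\<^esub>}" "\<zero>\<^bsub>Z\<^esub> = \<zero>\<^bsub>N2\<^esub>" by (simp_all add: Z_def)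
  interpret TZ: tensor_product R Z M using Z M by (rule tensor_productI)
  interpret Tg: abelian_group "tensor R Z M" by (rule TZ.tensor_abelian_group)
  interpret T2g: abelian_group "tensor R N2 M" by (rule T2.tensor_abelian_group)
  interpret T3g: abelian_group "tensor R N3 M" by (rule T3.tensor_abelian_group)
  have tz: "t = \<zero>\<^bsub>tensor R Z M\<^esub>" if "t \<in> carrier (tensor R Z M)" for t
    using that
    by (induction rule: TZ.induct) (use TZ.pure_zero1 Zsel in auto)
  have u: "(\<lambda>x. x) \<in> right_linear R Z N2"
    by (auto simp: right_linear_def additive_maps_def hom_def Z_def)
  have w: "(\<lambda>x. \<zero>\<^bsub>Z\<^esub>) \<in> right_linear R N3 Z"
    using right_moduleD(3)[OF Z] Zsel
    by (auto simp: right_linear_def additive_maps_def hom_def Z_def)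
  note hu = TZ.map_additive_pure[OF T2.tensor_product_axioms u left_linear_id]
  note hw = T3.map_additive_pure[OF TZ.tensor_product_axioms w left_linear_id]
  have h0: "?h \<zero>\<^bsub>tensor R N2 M\<^esub> = \<zero>\<^bsub>tensor R N3 M\<^esub>"
    by (rule additive_zero[OF h(1) T2.tensor_abelian_group T3.tensor_abelian_group])
  have hinj: "?h t = \<zero>\<^bsub>tensor R N3 M\<^esub> \<Longrightarrow> t \<in> carrier (tensor R N2 M) \<Longrightarrow> t = \<zero>\<^bsub>tensor R N2 M\<^esub>" for t
    using inj_onD[OF bij_betw_imp_inj_on[OF bij], of t "\<zero>\<^bsub>tensor R N2 M\<^esub>"] h0 by simp
  have "tensor_map R N2 M (\<lambda>x. x) (\<lambda>m. m) ` carrier (tensor R Z M) = {\<zero>\<^bsub>tensor R N2 M\<^esub>}"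
  proof -
    have "carrier (tensor R Z M) = {\<zero>\<^bsub>tensor R Z M\<^esub>}" using tz by auto
    thus ?thesis using additive_zero[OF hu(1) TZ.tensor_abelian_group T2.tensor_abelian_group] by simp
  qed
  moreover have "{t \<in> carrier (tensor R N2 M). ?h t = \<zero>\<^bsub>tensor R N3 M\<^esub>} = {\<zero>\<^bsub>tensor R N2 M\<^esub>}"
  proof (rule subset_antisym, rule subsetI)
    fix t assume "t \<in> {t \<in> carrier (tensor R N2 M). ?h t = \<zero>\<^bsub>tensor R N3 M\<^esub>}"
    hence "t \<in> carrier (tensor R N2 M)" "?h t = \<zero>\<^bsub>tensor R N3 M\<^esub>" by simp_all
    thus "t \<in> {\<zero>\<^bsub>tensor R N2 M\<^esub>}" by (intro iffD2[OF singleton_iff] hinj)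
  qed (simp add: h0)
  ultimately have "exact_at (tensor R Z M) (tensor_map R N2 M (\<lambda>x. x) (\<lambda>m. m))
           (tensor R N2 M) ?h (tensor R N3 M)"
    by (simp add: exact_at_def)
  hence "exact_at Z (\<lambda>x. x) N2 v N3" by (rule ex[OF Z N u v])
  hence "v x = \<zero>\<^bsub>N3\<^esub> \<Longrightarrow> x \<in> carrier N2 \<Longrightarrow> x = \<zero>\<^bsub>N2\<^esub>" for x
    by (auto simp: exact_at_def Zsel)
  hence inj: "inj_on v (carrier N2)"
    by (rule additive_inj_on[OF right_linear_additive[OF v] T2.Mab T3.Mab, rotated])
  have "?h ` carrier (tensor R N2 M) = {t \<in> carrier (tensor R N3 M).
      tensor_map R Z M (\<lambda>x. \<zero>\<^bsub>Z\<^esub>) (\<lambda>m. m) t = \<zero>\<^bsub>tensor R Z M\<^esub>}"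
    using bij_betw_imp_surj_on[OF bij] tz additive_closed[OF hw(1)] by auto
  hence "exact_at (tensor R N2 M) ?h (tensor R N3 M) (tensor_map R Z M (\<lambda>x. \<zero>\<^bsub>Z\<^esub>) (\<lambda>m. m)) (tensor R Z M)"
    by (simp add: exact_at_def)
  hence "exact_at N2 v N3 (\<lambda>x. \<zero>\<^bsub>Z\<^esub>) Z" by (rule ex[OF N Z v w])
  hence "v ` carrier N2 = carrier N3" by (auto simp: exact_at_def)
  with inj show ?thesis by (simp add: bij_betw_def)
qed

lemma flat_left_reflects_bij:
  fixes N2 :: "('s, 'n, 'r) bimodule" and N3 :: "('q, 'p, 'r) bimodule"
    and j2 :: "'n \<Rightarrow> 't" and j3 :: "'p \<Rightarrow> 't"
  assumes ff: "faithfully_flat_left TYPE('t) R M"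
    and N: "right_module R N2" "right_module R N3" and v: "v \<in> right_linear R N2 N3"
    and j: "inj_on j2 (carrier N2)" "inj_on j3 (carrier N3)"
    and bij: "bij_betw (tensor_map R N3 M v (\<lambda>m. m)) (carrier (tensor R N2 M)) (carrier (tensor R N3 M))"
  shows "bij_betw v (carrier N2) (carrier N3)"
proof -
  have M: "left_module R M" using ff by (simp add: faithfully_flat_left_def)
  define N2' :: "(unit, 't, 'r) bimodule" where "N2' = copy_module j2 N2 (\<lambda>_ x. x) (ract N2)"
  define N3' :: "(unit, 't, 'r) bimodule" where "N3' = copy_module j3 N3 (\<lambda>_ x. x) (ract N3)"
  note s2 = copy_module_sel[OF j(1), where l = "\<lambda>(_ :: unit) x. x" and r = "ract N2", folded N2'_def]
  note s3 = copy_module_sel[OF j(2), where l = "\<lambda>(_ :: unit) x. x" and r = "ract N3", folded N3'_def]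
  define k2 where "k2 = inv_into (carrier N2) j2"
  define k3 where "k3 = inv_into (carrier N3) j3"
  have k2: "x \<in> carrier N2 \<Longrightarrow> k2 (j2 x) = x" for x using j(1) by (simp add: k2_def)
  have k3: "x \<in> carrier N3 \<Longrightarrow> k3 (j3 x) = x" for x using j(2) by (simp add: k3_def)
  have N': "right_module R N2'" "right_module R N3'"
    unfolding N2'_def N3'_def using N j by (auto intro: copy_right_module)
  note coact_left = right_moduleD[OF N(1)] and D3 = right_moduleD[OF N(2)]
  interpret N2: abelian_group N2 by (rule coact_left)
  interpret N3: abelian_group N3 by (rule D3)
  have l: "j2 \<in> right_linear R N2 N2'" "k2 \<in> right_linear R N2' N2" "j3 \<in> right_linear R N3 N3'" "k3 \<in> right_linear R N3' N3"
    by (auto simp: right_linear_def s2 s3 k2 k3 coact_left D3 intro!: additive_mapsI)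
  \<comment> \<open>The map \<open>v\<close> between the copies; its tensor product is conjugate to that of \<open>v\<close>.\<close>
  define v' where "v' = (\<lambda>x. j3 (v (k2 x)))"
  note vc = additive_closed[OF right_linear_additive[OF v]]
  have v'j: "v' (j2 x) = j3 (v x)" if "x \<in> carrier N2" for x using that by (simp add: v'_def k2)
  have v': "v' \<in> right_linear R N2' N3'"
    using vc by (auto simp: v'_def right_linear_def s2 s3 k2 coact_left additive_add[OF right_linear_additive[OF v]] right_linear_act[OF v]
        intro!: additive_mapsI)
  interpret T2: tensor_product R N2 M using N(1) M by (rule tensor_productI)
  interpret T3: tensor_product R N3 M using N(2) M by (rule tensor_productI)
  interpret T2': tensor_product R N2' M using N'(1) M by (rule tensor_productI)
  interpret T3': tensor_product R N3' M using N'(2) M by (rule tensor_productI)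
  note hv = T2.map_additive_pure[OF T3.tensor_product_axioms v left_linear_id]
  note hv' = T2'.map_additive_pure[OF T3'.tensor_product_axioms v' left_linear_id]
  note hj2 = T2.map_additive_pure[OF T2'.tensor_product_axioms l(1) left_linear_id]
  note hk2 = T2'.map_additive_pure[OF T2.tensor_product_axioms l(2) left_linear_id]
  note hj3 = T3.map_additive_pure[OF T3'.tensor_product_axioms l(3) left_linear_id]
  note hk3 = T3'.map_additive_pure[OF T3.tensor_product_axioms l(4) left_linear_id]
  let ?h = "tensor_map R N3 M v (\<lambda>m. m)" and ?h' = "tensor_map R N3' M v' (\<lambda>m. m)"
  let ?J2 = "tensor_map R N2' M j2 (\<lambda>m. m)" and ?K2 = "tensor_map R N2 M k2 (\<lambda>m. m)"
  let ?J3 = "tensor_map R N3' M j3 (\<lambda>m. m)" and ?K3 = "tensor_map R N3 M k3 (\<lambda>m. m)"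
  have b2: "bij_betw ?K2 (carrier (tensor R N2' M)) (carrier (tensor R N2 M))"
  proof (rule bij_betw_byWitness[of _ ?J2])
    show "\<forall>a\<in>carrier (tensor R N2' M). ?J2 (?K2 a) = a"
    proof
      fix t assume t: "t \<in> carrier (tensor R N2' M)"
      show "?J2 (?K2 t) = t"
        by (rule T2'.additive_eqI[OF additive_comp[OF hk2(1) hj2(1)] additive_id _ t]) (auto simp: s2 hk2(2) hj2(2) k2)
    qed
    show "\<forall>a\<in>carrier (tensor R N2 M). ?K2 (?J2 a) = a"
    proof
      fix t assume t: "t \<in> carrier (tensor R N2 M)"
      show "?K2 (?J2 t) = t"
        by (rule T2.additive_eqI[OF additive_comp[OF hj2(1) hk2(1)] additive_id _ t]) (auto simp: s2 hk2(2) hj2(2) k2)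
    qed
  qed (use additive_closed[OF hk2(1)] additive_closed[OF hj2(1)] in auto)
  have b3: "bij_betw ?J3 (carrier (tensor R N3 M)) (carrier (tensor R N3' M))"
  proof (rule bij_betw_byWitness[of _ ?K3])
    show "\<forall>a\<in>carrier (tensor R N3' M). ?J3 (?K3 a) = a"
    proof
      fix t assume t: "t \<in> carrier (tensor R N3' M)"
      show "?J3 (?K3 t) = t"
        by (rule T3'.additive_eqI[OF additive_comp[OF hk3(1) hj3(1)] additive_id _ t]) (auto simp: s3 hk3(2) hj3(2) k3)
    qed
    show "\<forall>a\<in>carrier (tensor R N3 M). ?K3 (?J3 a) = a"
    proof
      fix t assume t: "t \<in> carrier (tensor R N3 M)"
      show "?K3 (?J3 t) = t"
        by (rule T3.additive_eqI[OF additive_comp[OF hj3(1) hk3(1)] additive_id _ t]) (auto simp: s3 hk3(2) hj3(2) k3)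
    qed
  qed (use additive_closed[OF hk3(1)] additive_closed[OF hj3(1)] in auto)
  have "bij_betw ?h' (carrier (tensor R N2' M)) (carrier (tensor R N3' M))"
  proof -
    have "bij_betw (?J3 \<circ> (?h \<circ> ?K2)) (carrier (tensor R N2' M)) (carrier (tensor R N3' M))"
      by (rule bij_betw_trans[OF bij_betw_trans[OF b2 bij] b3])
    moreover have "(?J3 \<circ> (?h \<circ> ?K2)) t = ?h' t" if t: "t \<in> carrier (tensor R N2' M)" for t
      unfolding comp_def
      by (rule T2'.additive_eqI[OF additive_comp[OF additive_comp[OF hk2(1) hv(1)] hj3(1)] hv'(1) _ t])
         (auto simp: s2 hk2(2) hj3(2) hv(2) hv'(2) k2 vc v'j)
    ultimately show ?thesis using bij_betw_cong[of "carrier (tensor R N2' M)" "?J3 \<circ> (?h \<circ> ?K2)" ?h'] by simp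
  qed
  hence bv': "bij_betw v' (carrier N2') (carrier N3')"
    by (rule flat_left_reflects_bij_aux[OF ff N' v'])
  have "bij_betw j2 (carrier N2) (carrier N2')" using j by (simp add: bij_betw_def s2)
  moreover have "bij_betw k3 (carrier N3') (carrier N3)"
    unfolding s3 k3_def using j(2) by (simp add: bij_betw_inv_into bij_betw_imageI)
  ultimately have "bij_betw (k3 \<circ> (v' \<circ> j2)) (carrier N2) (carrier N3)"
    using bv' by (intro bij_betw_trans)
  moreover have "(k3 \<circ> (v' \<circ> j2)) x = v x" if "x \<in> carrier N2" for x
    using that vc by (simp add: v'_def k2 k3)
  ultimately show ?thesis using bij_betw_cong[of "carrier N2" "k3 \<circ> (v' \<circ> j2)" v] by simp
qed

section \<open>Colinear algebra maps\<close>

locale galois_morphism =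
  G: galois_cointegral C e A \<gamma> + G': galois_cointegral C e A' \<gamma>
  for C :: "'c coalgebra" and e :: 'c and A :: "('a, 'c) comodule" and A' :: "('b, 'c) comodule"
    and \<gamma> :: "'c \<Rightarrow> 'c \<Rightarrow> complex" +
  fixes f :: "'a \<Rightarrow> 'b"
  assumes f_hom: "f \<in> algebra_hom A A'" and f_colinear: "colinear C A A' f"
begin

lemma f_in [simp]: "a \<in> carrier A \<Longrightarrow> f a \<in> carrier A'"
  and f_add: "a \<in> carrier A \<Longrightarrow> b \<in> carrier A \<Longrightarrow> f (a \<oplus>\<^bsub>A\<^esub> b) = f a \<oplus>\<^bsub>A'\<^esub> f b"
  and f_mult: "a \<in> carrier A \<Longrightarrow> b \<in> carrier A \<Longrightarrow> f (a \<otimes>\<^bsub>A\<^esub> b) = f a \<otimes>\<^bsub>A'\<^esub> f b"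
  and f_one: "f \<one>\<^bsub>A\<^esub> = \<one>\<^bsub>A'\<^esub>"
  and f_smult: "a \<in> carrier A \<Longrightarrow> f (k \<odot>\<^bsub>A\<^esub> a) = k \<odot>\<^bsub>A'\<^esub> f a"
  using f_hom by (auto simp: algebra_hom_def ring_hom_def)

lemma f_linear: "f \<in> left_linear cplx G.vA G'.vA"
  by (auto simp: left_linear_def f_add f_smult intro!: additive_mapsI)

text \<open>The maps \<open>f \<otimes> id\<close> from \<open>\<A> \<otimes> \<C>\<close> to \<open>\<A>' \<otimes> \<C>\<close>, \<open>id \<otimes> f\<close> from \<open>\<C> \<otimes> \<A>\<close> to \<open>\<C> \<otimes> \<A>'\<close>, and \<open>f \<otimes> f\<close> over the complex numbers.\<close>

abbreviation "fC \<equiv> tensor_map cplx G'.vA G.vC f (\<lambda>c. c)"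
abbreviation "Cf \<equiv> tensor_map cplx G.vC G'.vA (\<lambda>c. c) f"
abbreviation "ff \<equiv> tensor_map cplx G'.vA G'.vA f f"

lemmas f_right_linear = clinear_right[OF f_linear G.cA G'.cA]

lemma fC_additive: "fC \<in> additive_maps G.tAC G'.tAC"
  and fC_pure [simp]: "a \<in> carrier A \<Longrightarrow> c \<in> carrier C \<Longrightarrow> fC (G.pAC a c) = G'.pAC (f a) c"
  using G.AC.map_additive_pure[OF G'.AC.tensor_product_axioms f_right_linear left_linear_id] by simp_all

lemma Cf_additive: "Cf \<in> additive_maps G.tCA G'.tCA"
  and Cf_pure [simp]: "c \<in> carrier C \<Longrightarrow> a \<in> carrier A \<Longrightarrow> Cf (G.pCA c a) = G'.pCA c (f a)"
  using G.CA.map_additive_pure[OF G'.CA.tensor_product_axioms right_linear_id f_linear] by simp_all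

lemma ff_additive: "ff \<in> additive_maps G.AA G'.AA"
  and ff_pure [simp]: "a \<in> carrier A \<Longrightarrow> b \<in> carrier A \<Longrightarrow> ff (G.pAA a b) = G'.pAA (f a) (f b)"
  using G.Av.VV.map_additive_pure[OF G'.Av.VV.tensor_product_axioms f_right_linear f_linear] by simp_all

lemma fC_in [simp]: "t \<in> carrier G.tAC \<Longrightarrow> fC t \<in> carrier G'.tAC"
  using additive_closed[OF fC_additive] .

lemma Cf_in [simp]: "t \<in> carrier G.tCA \<Longrightarrow> Cf t \<in> carrier G'.tCA"
  using additive_closed[OF Cf_additive] .

lemma coact_f: "a \<in> carrier A \<Longrightarrow> coact A' (f a) = fC (coact A a)"
  using f_colinear by (simp add: colinear_def)

lemma fC_lmul: "t \<in> carrier G.tAC \<Longrightarrow> x \<in> carrier A \<Longrightarrow> fC (G.lmul x t) = G'.lmul (f x) (fC t)"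
proof (induction rule: G.AC.induct)
  case (add s t)
  thus ?case by (simp add: G.lmul_module G'.lmul_module additive_add[OF fC_additive])
qed (simp add: f_mult)

text \<open>By \<open>B_I\<close> it suffices that \<open>\<delta>(f b) = (f \<otimes> id)(b \<otimes> e)\<close>, which is colinearity.\<close>

lemma f_B: "b \<in> G.B \<Longrightarrow> f b \<in> G'.B"
  by (rule G'.B_I) (simp_all add: G.B_in coact_f G.B_coact_one)

lemma f_B_in [simp]: "b \<in> G.B \<Longrightarrow> f b \<in> carrier A'"
  using G.B_in by simp

lemma f_restrict: "f \<in> algebra_hom G.BA G'.BA"
  using f_B G.B_in by (auto simp: algebra_hom_def ring_hom_def f_add f_mult f_one f_smult)

text \<open>The map \<open>f \<otimes> f\<close> from \<open>\<A> \<otimes>\<^sub>\<B> \<A>\<close> to the tensor product \<open>\<A>' \<otimes> \<A>'\<close> over \<open>\<B>'\<close>.\<close>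

definition fB where "fB = tensor_lift G'.AtA (\<lambda>x y. G'.tB (f x) (f y))"

lemma fB_balanced: "balanced G.BA (regular A) (regular A) G'.AtA (\<lambda>x y. G'.tB (f x) (f y))"
  using G'.TB.pure_balanced
  by (intro balancedI) (simp_all add: f_add f_mult G.B_in f_B G'.TB.pure_add1[simplified] G'.TB.pure_add2[simplified])

lemma fB_additive: "fB \<in> additive_maps G.AtA G'.AtA"
  and fB_pure [simp]: "x \<in> carrier A \<Longrightarrow> y \<in> carrier A \<Longrightarrow> fB (G.tB x y) = G'.tB (f x) (f y)"
  unfolding fB_def
  using G.TB.lift_additive[OF G'.TB.tensor_abelian_group fB_balanced] G.TB.lift_pure[OF G'.TB.tensor_abelian_group fB_balanced]
  by simp_all

lemma fB_in [simp]: "s \<in> carrier G.AtA \<Longrightarrow> fB s \<in> carrier G'.AtA"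
  using additive_closed[OF fB_additive] .

lemma fB_ract: "s \<in> carrier G.AtA \<Longrightarrow> a \<in> carrier A \<Longrightarrow> fB (ract G.AtA s a) = ract G'.AtA (fB s) (f a)"
proof (induction rule: G.TB.induct)
  case (add s t)
  thus ?case by (simp add: G.TB_right G'.TB_right additive_add[OF fB_additive])
qed (simp add: f_mult)

lemma can_fB: "s \<in> carrier G.AtA \<Longrightarrow> G'.cn (fB s) = fC (G.cn s)"
proof (induction rule: G.TB.induct)
  case (add s t)
  thus ?case
    by (simp add: additive_add[OF fB_additive] additive_add[OF G.can_additive] additive_add[OF G'.can_additive] additive_add[OF fC_additive])
qed (simp add: coact_f fC_lmul)

text \<open>The canonical maps intertwine \<open>fB\<close> and \<open>fC\<close>, and \<open>fB\<close> respects right multiplication.\<close>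

lemma ract_AC_fC: "t \<in> carrier G.tAC \<Longrightarrow> a \<in> carrier A \<Longrightarrow> G'.ract_AC (f a) (fC t) = fC (G.ract_AC a t)"
proof -
  assume t: "t \<in> carrier G.tAC" and a: "a \<in> carrier A"
  have s: "fB (G.can_inv t) \<in> carrier G'.AtA" using t by simp
  have "G'.ract_AC (f a) (fC t) = G'.ract_AC (f a) (G'.cn (fB (G.can_inv t)))" using t by (simp add: can_fB del: G'.ract_AC_can)
  also have "\<dots> = G'.cn (fB (ract G.AtA (G.can_inv t) a))" using t a by (simp add: G'.ract_AC_can[OF s] fB_ract)
  also have "\<dots> = fC (G.ract_AC a t)" using t a by (simp add: can_fB G.TB_right G.ract_AC_def)
  finally show ?thesis .
qed

lemma entwining_Cf: "s \<in> carrier G.tCA \<Longrightarrow> G'.\<psi> (Cf s) = fC (G.\<psi> s)"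
proof (induction rule: G.CA.induct)
  case (pure c a)
  have "G'.pAC \<one>\<^bsub>A'\<^esub> c = fC (G.pAC \<one>\<^bsub>A\<^esub> c)" using pure by (simp add: f_one)
  thus ?case using pure by (simp add: ract_AC_fC del: fC_pure)
next
  case (add s t)
  thus ?case
    by (simp add: additive_add[OF Cf_additive] additive_add[OF G.entwining_additive] additive_add[OF G'.entwining_additive]
        additive_add[OF fC_additive])
qed

text \<open>A right colinear algebra map is left colinear, since it commutes with the entwinings.\<close>

lemma left_coact_f: "a \<in> carrier A \<Longrightarrow> G'.lcoact (f a) = Cf (G.lcoact a)"
proof -
  assume a: "a \<in> carrier A"
  have "G'.\<psi> (Cf (G.lcoact a)) = G'.pAC (f a) e" using a by (simp add: entwining_Cf)
  thus ?thesis using G'.psi_inv_entwining[of "Cf (G.lcoact a)"] a by (simp add: G'.left_coact_alt)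
qed

lemma contract_fC_Cf:
  assumes "s \<in> carrier G.tAC" "u \<in> carrier G.tCA"
  shows "G'.contract (fC s) (Cf u) = ff (G.contract s u)"
  using _ _ _ _ _ assms
  by (rule G.contract_induct[of "\<lambda>s u. G'.contract (fC s) (Cf u)" G'.AA "\<lambda>s u. ff (G.contract s u)"])
     (auto intro: additive_comp[OF fC_additive G'.contract1] additive_comp[OF Cf_additive G'.contract2]
        additive_comp[OF G.contract1 ff_additive] additive_comp[OF G.contract2 ff_additive] simp: f_smult)

lemma proj_ff: "t \<in> carrier G.AA \<Longrightarrow> G'.proj (ff t) = ff (G.proj t)"
proof (induction rule: G.Av.VV.induct)
  case (pure x y)
  thus ?case by (simp add: G.proj_pure G'.proj_pure coact_f left_coact_f contract_fC_Cf)
next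
  case (add s t)
  thus ?case
    by (simp add: additive_add[OF ff_additive] additive_closed[OF ff_additive] additive_add[OF G.proj_additive]
        additive_closed[OF G.proj_additive] additive_add[OF G'.proj_additive])
qed

lemma ff_in: "t \<in> carrier G.AA \<Longrightarrow> ff t \<in> carrier G'.AA"
  using additive_closed[OF ff_additive] .

lemma ff_cotens: "t \<in> G.cotens \<Longrightarrow> ff t \<in> G'.cotens"
  using proj_ff[of t] G.proj_id[of t] G'.proj_in[of "ff t"] ff_in[of t] by (simp add: G.cotens_iff)

lemma ff_lact: "t \<in> carrier G.AA \<Longrightarrow> a \<in> carrier A \<Longrightarrow> ff (lact G.LR a t) = lact G'.LR (f a) (ff t)"
proof (induction rule: G.Av.VV.induct)
  case (add s t)
  thus ?case by (simp add: G.LR_left G'.LR_left additive_add[OF ff_additive] ff_in)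
qed (simp add: f_mult)

lemma ff_ract: "t \<in> carrier G.AA \<Longrightarrow> a \<in> carrier A \<Longrightarrow> ff (ract G.LR t a) = ract G'.LR (ff t) (f a)"
proof (induction rule: G.Av.VV.induct)
  case (add s t)
  thus ?case by (simp add: G.LR_right G'.LR_right additive_add[OF ff_additive] ff_in)
qed (simp add: f_mult)

subsection \<open>\<open>\<B>' \<otimes>\<^sub>\<B> \<A> \<cong> \<A>'\<close>\<close>

abbreviation "BR \<equiv> restrict_right f G'.BA"
abbreviation "BL \<equiv> restrict_left f G'.BA"

lemma restrict_sel [simp]:
  "carrier BR = G'.B" "\<zero>\<^bsub>BR\<^esub> = \<zero>\<^bsub>A'\<^esub>" "add BR = add A'" "lact BR = monoid.mult A'" "ract BR = (\<lambda>x b. x \<otimes>\<^bsub>A'\<^esub> f b)"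
  "carrier BL = G'.B" "\<zero>\<^bsub>BL\<^esub> = \<zero>\<^bsub>A'\<^esub>" "add BL = add A'" "ract BL = monoid.mult A'" "lact BL = (\<lambda>b x. f b \<otimes>\<^bsub>A'\<^esub> x)"
  by (simp_all add: restrict_right_def restrict_left_def)

lemma restrict_abelian: "abelian_group BR" "abelian_group BL"
  by (rule abelian_group_cong[OF _ _ _ ring.is_abelian_group[OF G'.ring_B]]; simp)+

lemma bimod_BR: "bimod G'.BA G.BA BR"
  using restrict_abelian G'.ring_B G.ring_B f_B G.B_in G'.B_in
  unfolding bimod_def left_module_def right_module_def
  by (auto simp: G'.mult_B G'.add_B G'.A.l_distr G'.A.r_distr G'.A.m_assoc f_add f_mult f_one)

lemma bimod_BL: "bimod G.BA G'.BA BL"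
  using restrict_abelian G'.ring_B G.ring_B f_B G.B_in G'.B_in
  unfolding bimod_def left_module_def right_module_def
  by (auto simp: G'.mult_B G'.add_B G'.A.l_distr G'.A.r_distr G'.A.m_assoc f_add f_mult f_one)

sublocale NL: tensor_product G.BA BR "regular A"
  using bimodD(2)[OF bimod_BR] bimodD(1)[OF G.bimod_BA] by (rule tensor_productI)

abbreviation "NL \<equiv> tensor G.BA BR (regular A)"
abbreviation "pNL \<equiv> pure_tensor G.BA BR (regular A)"

lemma NL_bimod: "bimod G'.BA G.BA NL"
  by (rule NL.bimod_tensor[OF bimod_BR G.bimod_BB])

lemmas NL_pure [simp] = NL.pure_in[simplified]

lemma NL_lact: "b \<in> G'.B \<Longrightarrow> lact NL b \<in> additive_maps NL NL"
  "b \<in> G'.B \<Longrightarrow> x \<in> G'.B \<Longrightarrow> a \<in> carrier A \<Longrightarrow> lact NL b (pNL x a) = pNL (b \<otimes>\<^bsub>A'\<^esub> x) a"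
  using NL.lact_tensor[OF bimod_BR, of b] by simp_all

text \<open>The map \<open>b \<otimes> a \<mapsto> b f(a)\<close> from \<open>\<B>' \<otimes>\<^sub>\<B> \<A>\<close> to \<open>\<A>'\<close>.\<close>

definition \<phi>L where "\<phi>L = tensor_lift (regular A') (\<lambda>x a. x \<otimes>\<^bsub>A'\<^esub> f a)"

lemma \<phi>L_balanced: "balanced G.BA BR (regular A) (regular A') (\<lambda>x a. x \<otimes>\<^bsub>A'\<^esub> f a)"
  by (rule balancedI) (simp_all add: G'.B_in G.B_in G'.A.l_distr G'.A.r_distr G'.A.m_assoc f_add f_mult)

lemma regular_abelian: "abelian_group (regular A')"
  using G'.TB.Mab .

lemma \<phi>L: "\<phi>L \<in> left_linear G'.BA NL (regular A')"
  "x \<in> G'.B \<Longrightarrow> a \<in> carrier A \<Longrightarrow> \<phi>L (pNL x a) = x \<otimes>\<^bsub>A'\<^esub> f a"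
proof -
  show "\<phi>L \<in> left_linear G'.BA NL (regular A')"
    unfolding \<phi>L_def
    by (rule NL.lift_left_linear[OF bimod_BR bimodD(1)[OF G'.bimod_BA] \<phi>L_balanced])
       (simp add: G'.B_in G'.A.m_assoc)
  show "x \<in> G'.B \<Longrightarrow> a \<in> carrier A \<Longrightarrow> \<phi>L (pNL x a) = x \<otimes>\<^bsub>A'\<^esub> f a"
    unfolding \<phi>L_def using NL.lift_pure[OF regular_abelian \<phi>L_balanced] by simp
qed

sublocale TL: tensor_product G'.BA "regular A'" NL
  using bimodD(2)[OF G'.bimod_AB] bimodD(1)[OF NL_bimod] by (rule tensor_productI)

abbreviation "TL \<equiv> tensor G'.BA (regular A') NL"
abbreviation "pTL \<equiv> pure_tensor G'.BA (regular A') NL"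

lemma TL_lact: "a \<in> carrier A' \<Longrightarrow> lact TL a \<in> additive_maps TL TL"
  "a \<in> carrier A' \<Longrightarrow> x \<in> carrier A' \<Longrightarrow> n \<in> carrier NL \<Longrightarrow> lact TL a (pTL x n) = pTL (a \<otimes>\<^bsub>A'\<^esub> x) n"
  using TL.lact_tensor[OF G'.bimod_AB, of a] by simp_all

lemmas TL_left = left_moduleD(3-7)[OF TL.left_module_tensor[OF G'.bimod_AB]]
lemmas TL_pure [simp] = TL.pure_in[simplified]

text \<open>The map to be proved bijective: \<open>\<phi>L\<close> after application of \<open>\<A>' \<otimes> -\<close> over \<open>\<B>'\<close>.\<close>

definition gL where "gL = tensor_map G'.BA (regular A') (regular A') (\<lambda>m. m) \<phi>L"

lemma gL: "gL \<in> additive_maps TL G'.AtA"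
  "a \<in> carrier A' \<Longrightarrow> n \<in> carrier NL \<Longrightarrow> gL (pTL a n) = G'.tB a (\<phi>L n)"
  unfolding gL_def
  using TL.map_additive_pure[OF G'.TB.tensor_product_axioms right_linear_id \<phi>L(1)] by simp_all

text \<open>The map \<open>x \<otimes> y \<mapsto> f(x) \<otimes> (1 \<otimes> y)\<close> from \<open>\<A> \<otimes>\<^sub>\<B> \<A>\<close> to the source of \<open>gL\<close>.\<close>

definition \<kappa>L where "\<kappa>L = tensor_lift TL (\<lambda>x y. pTL (f x) (pNL \<one>\<^bsub>A'\<^esub> y))"

lemma \<kappa>L_balanced: "balanced G.BA (regular A) (regular A) TL (\<lambda>x y. pTL (f x) (pNL \<one>\<^bsub>A'\<^esub> y))"
proof (rule balancedI)
  fix x b y assume "x \<in> carrier (regular A)" "b \<in> carrier G.BA" "y \<in> carrier (regular A)"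
  hence xby: "x \<in> carrier A" "b \<in> G.B" "y \<in> carrier A" by simp_all
  have "pTL (f x \<otimes>\<^bsub>A'\<^esub> f b) (pNL \<one>\<^bsub>A'\<^esub> y) = pTL (f x) (lact NL (f b) (pNL \<one>\<^bsub>A'\<^esub> y))"
    using xby TL.pure_balanced[of "f x" "f b" "pNL \<one>\<^bsub>A'\<^esub> y"] by (simp add: f_B G'.one_B)
  also have "lact NL (f b) (pNL \<one>\<^bsub>A'\<^esub> y) = pNL \<one>\<^bsub>A'\<^esub> (b \<otimes>\<^bsub>A\<^esub> y)"
    using xby NL.pure_balanced[of "\<one>\<^bsub>A'\<^esub>" b y] by (simp add: NL_lact f_B G'.one_B)
  finally show "pTL (f (ract (regular A) x b)) (pNL \<one>\<^bsub>A'\<^esub> y) = pTL (f x) (pNL \<one>\<^bsub>A'\<^esub> (lact (regular A) b y))"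
    using xby by (simp add: f_mult G.B_in)
qed (simp_all add: f_add G'.one_B TL.pure_add1[simplified] TL.pure_add2[simplified] NL.pure_add2[simplified])

lemma \<kappa>L: "\<kappa>L \<in> additive_maps G.AtA TL"
  "x \<in> carrier A \<Longrightarrow> y \<in> carrier A \<Longrightarrow> \<kappa>L (G.tB x y) = pTL (f x) (pNL \<one>\<^bsub>A'\<^esub> y)"
  unfolding \<kappa>L_def
  using G.TB.lift_additive[OF TL.tensor_abelian_group \<kappa>L_balanced] G.TB.lift_pure[OF TL.tensor_abelian_group \<kappa>L_balanced] by simp_all

lemma \<kappa>L_in [simp]: "s \<in> carrier G.AtA \<Longrightarrow> \<kappa>L s \<in> carrier TL"
  using additive_closed[OF \<kappa>L(1)] .

lemma \<kappa>L_lact: "s \<in> carrier G.AtA \<Longrightarrow> x \<in> carrier A \<Longrightarrow> \<kappa>L (lact G.AtA x s) = lact TL (f x) (\<kappa>L s)"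
proof (induction rule: G.TB.induct)
  case (add s t)
  thus ?case by (simp add: G.TB_left TL_left additive_add[OF \<kappa>L(1)])
qed (simp add: \<kappa>L TL_lact f_mult G'.one_B)

text \<open>
  The inverse of \<open>can' \<circ> gL\<close>: it is left \<open>\<A>'\<close>-linear, and its value at \<open>1 \<otimes> c\<close> is the image of
  \<open>can\<^sup>-\<^sup>1(1 \<otimes> c)\<close> for the canonical map of the first extension.
\<close>

definition JL where "JL = tensor_lift TL (\<lambda>a c. lact TL a (\<kappa>L (G.can_inv (G.pAC \<one>\<^bsub>A\<^esub> c))))"

lemma JL_balanced: "balanced cplx G'.vA G.vC TL (\<lambda>a c. lact TL a (\<kappa>L (G.can_inv (G.pAC \<one>\<^bsub>A\<^esub> c))))"
proof (rule balancedI)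
  fix a k c assume "a \<in> carrier G'.vA" "c \<in> carrier G.vC"
  hence ac: "a \<in> carrier A'" "c \<in> carrier C" by simp_all
  have "\<kappa>L (G.can_inv (G.pAC \<one>\<^bsub>A\<^esub> (k \<odot>\<^bsub>C\<^esub> c))) = lact TL (f (k \<odot>\<^bsub>A\<^esub> \<one>\<^bsub>A\<^esub>)) (\<kappa>L (G.can_inv (G.pAC \<one>\<^bsub>A\<^esub> c)))"
    unfolding G.pAC_scalar[OF ac(2)] using ac(2)
    by (subst G.can_inv_lmul) (simp_all add: \<kappa>L_lact)
  thus "lact TL (ract G'.vA a k) (\<kappa>L (G.can_inv (G.pAC \<one>\<^bsub>A\<^esub> c))) = lact TL a (\<kappa>L (G.can_inv (G.pAC \<one>\<^bsub>A\<^esub> (lact G.vC k c))))"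
    using ac by (simp add: TL_left(4)[symmetric] f_smult f_one G'.A.smult_mult_right)
qed (simp_all add: TL_left G.AC.pure_add2[simplified] additive_add[OF G.can_inv_additive] additive_add[OF \<kappa>L(1)])

lemma JL: "JL \<in> additive_maps G'.tAC TL"
  "a \<in> carrier A' \<Longrightarrow> c \<in> carrier C \<Longrightarrow> JL (G'.pAC a c) = lact TL a (\<kappa>L (G.can_inv (G.pAC \<one>\<^bsub>A\<^esub> c)))"
  unfolding JL_def
  using G'.AC.lift_additive[OF TL.tensor_abelian_group JL_balanced] G'.AC.lift_pure[OF TL.tensor_abelian_group JL_balanced] by simp_all

lemma JL_in [simp]: "t \<in> carrier G'.tAC \<Longrightarrow> JL t \<in> carrier TL"
  using additive_closed[OF JL(1)] .

lemma JL_lmul: "t \<in> carrier G'.tAC \<Longrightarrow> a \<in> carrier A' \<Longrightarrow> JL (G'.lmul a t) = lact TL a (JL t)"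
proof (induction rule: G'.AC.induct)
  case (add s t)
  thus ?case by (simp add: G'.lmul_module TL_left additive_add[OF JL(1)])
qed (simp add: JL TL_left)

text \<open>
  As \<open>\<delta>(a) = can(1 \<otimes> a)\<close>, this determines \<open>JL\<close> on the elements \<open>\<delta>(f a)\<close>, from which the canonical map of
  \<open>\<A>'\<close> is built.
\<close>

lemma JL_fC: "t \<in> carrier G.tAC \<Longrightarrow> JL (fC t) = \<kappa>L (G.can_inv t)"
proof (induction rule: G.AC.induct)
  case (pure x c)
  have "G.can_inv (G.pAC x c) = lact G.AtA x (G.can_inv (G.pAC \<one>\<^bsub>A\<^esub> c))"
    using G.can_inv_lmul[of "G.pAC \<one>\<^bsub>A\<^esub> c" x] pure by simp
  thus ?case using pure by (simp add: JL \<kappa>L_lact)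
next
  case (add s t)
  thus ?case by (simp add: additive_add[OF fC_additive] additive_add[OF JL(1)] additive_add[OF G.can_inv_additive] additive_add[OF \<kappa>L(1)])
qed

lemma JL_can_gL: "w \<in> carrier TL \<Longrightarrow> JL (G'.cn (gL w)) = w"
proof (induction rule: TL.induct)
  case (pure a' n)
  hence a': "a' \<in> carrier A'" by simp
  have "JL (G'.cn (gL (pTL a' n))) = pTL a' n" if "n \<in> carrier NL" for n
    using that
  proof (induction rule: NL.induct)
    case (pure b a)
    hence ba: "b \<in> G'.B" "b \<in> carrier A'" "a \<in> carrier A" by (simp_all add: G'.B_in)
    have ci: "G.can_inv (coact A a) = G.tB \<one>\<^bsub>A\<^esub> a"
      using G.can_inv_can[of "G.tB \<one>\<^bsub>A\<^esub> a"] ba by (simp add: G.lmul_module)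
    have "JL (G'.cn (gL (pTL a' (pNL b a)))) = lact TL a' (lact TL b (JL (fC (coact A a))))"
      using a' ba by (simp add: gL \<phi>L G'.B_coact JL_lmul coact_f G'.lmul_module)
    also have "\<dots> = pTL (a' \<otimes>\<^bsub>A'\<^esub> b) (pNL \<one>\<^bsub>A'\<^esub> a)"
      using a' ba by (simp add: JL_fC ci \<kappa>L TL_lact f_one G'.one_B)
    also have "\<dots> = pTL a' (pNL b a)"
      using a' ba TL.pure_balanced[of a' b "pNL \<one>\<^bsub>A'\<^esub> a"] by (simp add: NL_lact G'.one_B)
    finally show ?case .
  next
    case (add s t)
    thus ?case using a' additive_closed[OF gL(1)]
      by (simp add: TL.pure_add2[simplified] additive_add[OF gL(1)] additive_add[OF G'.can_additive] additive_add[OF JL(1)])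
  qed
  thus ?case using pure by simp
next
  case (add s t)
  thus ?case using additive_closed[OF gL(1)]
    by (simp add: additive_add[OF gL(1)] additive_add[OF G'.can_additive] additive_add[OF JL(1)])
qed

lemma gL_lact: "w \<in> carrier TL \<Longrightarrow> a \<in> carrier A' \<Longrightarrow> gL (lact TL a w) = lact G'.AtA a (gL w)"
proof (induction rule: TL.induct)
  case (pure x n)
  thus ?case using additive_closed[OF left_linear_additive[OF \<phi>L(1)]] by (simp add: TL_lact gL)
next
  case (add s t)
  thus ?case using additive_closed[OF gL(1)] by (simp add: TL_left G'.TB_left additive_add[OF gL(1)])
qed

lemma can_gL_\<kappa>L: "s \<in> carrier G.AtA \<Longrightarrow> G'.cn (gL (\<kappa>L s)) = fC (G.cn s)"
proof (induction rule: G.TB.induct)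
  case (add s t)
  thus ?case using additive_closed[OF gL(1)]
    by (simp add: additive_add[OF gL(1)] additive_add[OF \<kappa>L(1)] additive_add[OF G'.can_additive] additive_add[OF fC_additive]
        additive_add[OF G.can_additive])
qed (simp add: \<kappa>L gL \<phi>L G'.one_B fC_lmul coact_f)

lemma can_gL_JL: "t \<in> carrier G'.tAC \<Longrightarrow> G'.cn (gL (JL t)) = t"
proof (induction rule: G'.AC.induct)
  case (pure a c)
  thus ?case using additive_closed[OF gL(1)]
    by (simp add: JL gL_lact G'.can_lact can_gL_\<kappa>L f_one)
next
  case (add s t)
  thus ?case using additive_closed[OF gL(1)]
    by (simp add: additive_add[OF gL(1)] additive_add[OF JL(1)] additive_add[OF G'.can_additive])
qed

lemma gL_bij: "bij_betw gL (carrier TL) (carrier G'.AtA)"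
proof (rule bij_betw_byWitness[of _ "\<lambda>z. JL (G'.cn z)"])
  show "\<forall>w\<in>carrier TL. JL (G'.cn (gL w)) = w" by (simp add: JL_can_gL)
  show "\<forall>z\<in>carrier G'.AtA. gL (JL (G'.cn z)) = z"
  proof
    fix z assume z: "z \<in> carrier G'.AtA"
    have "G'.cn (gL (JL (G'.cn z))) = G'.cn z" using z by (simp add: can_gL_JL)
    thus "gL (JL (G'.cn z)) = z"
      using G'.can_inv_can[of "gL (JL (G'.cn z))"] G'.can_inv_can[OF z] z additive_closed[OF gL(1)] by simp
  qed
qed (use additive_closed[OF gL(1)] in auto)

lemma \<phi>L_bij:
  assumes "faithfully_flat_right TYPE(('b, 'a) tens) G'.BA (regular A')"
  shows "bij_betw \<phi>L (carrier NL) (carrier A')"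
proof -
  \<comment> \<open>The elements of \<open>\<B>' \<otimes>\<^sub>\<B> \<A>\<close> are themselves of the type of the test modules; those of \<open>\<A>'\<close> are copied into it by this injection, whose second component is arbitrary.\<close>
  have "inj (\<lambda>x :: 'b. {frag_of (x, undefined :: 'a)})"
    by (auto simp: inj_def dest!: arg_cong[where f = Poly_Mapping.keys])
  hence "inj_on (\<lambda>x :: 'b. {frag_of (x, undefined :: 'a)}) (carrier (regular A'))" by (rule inj_on_subset) simp
  from flat_right_reflects_bij[OF assms bimodD(1)[OF NL_bimod] bimodD(1)[OF G'.bimod_BA] \<phi>L(1) inj_on_id2 this gL_bij[unfolded gL_def]]
  show ?thesis by simp
qed

subsection \<open>\<open>\<A> \<otimes>\<^sub>\<B> \<B>' \<cong> \<A>'\<close>\<close>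

sublocale NR: tensor_product G.BA "regular A" BL
  using bimodD(2)[OF G.bimod_AB] bimodD(1)[OF bimod_BL] by (rule tensor_productI)

abbreviation "NR \<equiv> tensor G.BA (regular A) BL"
abbreviation "pNR \<equiv> pure_tensor G.BA (regular A) BL"

lemma NR_bimod: "bimod G.BA G'.BA NR"
  by (rule NR.bimod_tensor[OF G.bimod_BB bimod_BL])

lemmas NR_pure [simp] = NR.pure_in[simplified]

lemma NR_ract: "b \<in> G'.B \<Longrightarrow> (\<lambda>t. ract NR t b) \<in> additive_maps NR NR"
  "b \<in> G'.B \<Longrightarrow> x \<in> G'.B \<Longrightarrow> a \<in> carrier A \<Longrightarrow> ract NR (pNR a x) b = pNR a (x \<otimes>\<^bsub>A'\<^esub> b)"
  using NR.ract_tensor[OF bimod_BL, of b] by simp_all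

text \<open>
  The mirror image of the preceding construction, with the map \<open>a \<otimes> b \<mapsto> f(a) b\<close> and with \<open>\<psi>\<^sup>-\<^sup>1 \<circ> can\<close> in place
  of the canonical map.
\<close>

definition \<phi>R where "\<phi>R = tensor_lift (regular A') (\<lambda>a x. f a \<otimes>\<^bsub>A'\<^esub> x)"

lemma \<phi>R_balanced: "balanced G.BA (regular A) BL (regular A') (\<lambda>a x. f a \<otimes>\<^bsub>A'\<^esub> x)"
  by (rule balancedI) (simp_all add: G'.B_in G.B_in G'.A.l_distr G'.A.r_distr G'.A.m_assoc f_add f_mult)

lemma \<phi>R: "\<phi>R \<in> right_linear G'.BA NR (regular A')"
  "x \<in> G'.B \<Longrightarrow> a \<in> carrier A \<Longrightarrow> \<phi>R (pNR a x) = f a \<otimes>\<^bsub>A'\<^esub> x"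
proof -
  show "\<phi>R \<in> right_linear G'.BA NR (regular A')"
    unfolding \<phi>R_def
    by (rule NR.lift_right_linear[OF bimod_BL bimodD(2)[OF G'.bimod_AB] \<phi>R_balanced])
       (simp add: G'.B_in G'.A.m_assoc)
  show "x \<in> G'.B \<Longrightarrow> a \<in> carrier A \<Longrightarrow> \<phi>R (pNR a x) = f a \<otimes>\<^bsub>A'\<^esub> x"
    unfolding \<phi>R_def using NR.lift_pure[OF regular_abelian \<phi>R_balanced] by simp
qed

sublocale TR: tensor_product G'.BA NR "regular A'"
  using bimodD(2)[OF NR_bimod] bimodD(1)[OF G'.bimod_BA] by (rule tensor_productI)

abbreviation "TR \<equiv> tensor G'.BA NR (regular A')"
abbreviation "pTR \<equiv> pure_tensor G'.BA NR (regular A')"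

lemma TR_ract: "a \<in> carrier A' \<Longrightarrow> (\<lambda>t. ract TR t a) \<in> additive_maps TR TR"
  "a \<in> carrier A' \<Longrightarrow> x \<in> carrier A' \<Longrightarrow> n \<in> carrier NR \<Longrightarrow> ract TR (pTR n x) a = pTR n (x \<otimes>\<^bsub>A'\<^esub> a)"
  using TR.ract_tensor[OF G'.bimod_BA, of a] by simp_all

lemmas TR_right = right_moduleD(3-7)[OF TR.right_module_tensor[OF G'.bimod_BA]]
lemmas TR_pure [simp] = TR.pure_in[simplified]

definition gR where "gR = tensor_map G'.BA (regular A') (regular A') \<phi>R (\<lambda>m. m)"

lemma gR: "gR \<in> additive_maps TR G'.AtA"
  "a \<in> carrier A' \<Longrightarrow> n \<in> carrier NR \<Longrightarrow> gR (pTR n a) = G'.tB (\<phi>R n) a"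
  unfolding gR_def
  using TR.map_additive_pure[OF G'.TB.tensor_product_axioms \<phi>R(1) left_linear_id] by simp_all

lemma gR_in [simp]: "w \<in> carrier TR \<Longrightarrow> gR w \<in> carrier G'.AtA"
  using additive_closed[OF gR(1)] .

definition \<kappa>R where "\<kappa>R = tensor_lift TR (\<lambda>x y. pTR (pNR x \<one>\<^bsub>A'\<^esub>) (f y))"

lemma \<kappa>R_balanced: "balanced G.BA (regular A) (regular A) TR (\<lambda>x y. pTR (pNR x \<one>\<^bsub>A'\<^esub>) (f y))"
proof (rule balancedI)
  fix x b y assume "x \<in> carrier (regular A)" "b \<in> carrier G.BA" "y \<in> carrier (regular A)"
  hence xby: "x \<in> carrier A" "b \<in> G.B" "y \<in> carrier A" by simp_all
  have "pTR (pNR x \<one>\<^bsub>A'\<^esub>) (f b \<otimes>\<^bsub>A'\<^esub> f y) = pTR (ract NR (pNR x \<one>\<^bsub>A'\<^esub>) (f b)) (f y)"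
    using xby TR.pure_balanced[of "pNR x \<one>\<^bsub>A'\<^esub>" "f b" "f y"] by (simp add: f_B G'.one_B)
  also have "ract NR (pNR x \<one>\<^bsub>A'\<^esub>) (f b) = pNR (x \<otimes>\<^bsub>A\<^esub> b) \<one>\<^bsub>A'\<^esub>"
    using xby NR.pure_balanced[of x b "\<one>\<^bsub>A'\<^esub>"] by (simp add: NR_ract f_B G'.one_B)
  finally show "pTR (pNR (ract (regular A) x b) \<one>\<^bsub>A'\<^esub>) (f y) = pTR (pNR x \<one>\<^bsub>A'\<^esub>) (f (lact (regular A) b y))"
    using xby by (simp add: f_mult G.B_in)
qed (simp_all add: f_add G'.one_B TR.pure_add1[simplified] TR.pure_add2[simplified] NR.pure_add1[simplified])

lemma \<kappa>R: "\<kappa>R \<in> additive_maps G.AtA TR"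
  "x \<in> carrier A \<Longrightarrow> y \<in> carrier A \<Longrightarrow> \<kappa>R (G.tB x y) = pTR (pNR x \<one>\<^bsub>A'\<^esub>) (f y)"
  unfolding \<kappa>R_def
  using G.TB.lift_additive[OF TR.tensor_abelian_group \<kappa>R_balanced] G.TB.lift_pure[OF TR.tensor_abelian_group \<kappa>R_balanced] by simp_all

lemma \<kappa>R_in [simp]: "s \<in> carrier G.AtA \<Longrightarrow> \<kappa>R s \<in> carrier TR"
  using additive_closed[OF \<kappa>R(1)] .

lemma \<kappa>R_ract: "s \<in> carrier G.AtA \<Longrightarrow> x \<in> carrier A \<Longrightarrow> \<kappa>R (ract G.AtA s x) = ract TR (\<kappa>R s) (f x)"
proof (induction rule: G.TB.induct)
  case (add s t)
  thus ?case by (simp add: G.TB_right TR_right additive_add[OF \<kappa>R(1)])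
qed (simp add: \<kappa>R TR_ract f_mult G'.one_B)

text \<open>The inverse of the left canonical map \<open>\<psi>\<^sup>-\<^sup>1 \<circ> can\<close> of the first extension.\<close>

definition left_can_inv where "left_can_inv u = G.can_inv (G.\<psi> u)"

lemma left_can_inv_additive: "left_can_inv \<in> additive_maps G.tCA G.AtA"
  unfolding left_can_inv_def[abs_def] by (rule additive_comp[OF G.entwining_additive G.can_inv_additive])

lemma left_can_inv_in [simp]: "u \<in> carrier G.tCA \<Longrightarrow> left_can_inv u \<in> carrier G.AtA"
  using additive_closed[OF left_can_inv_additive] .

lemma left_can_inv_rmul: "u \<in> carrier G.tCA \<Longrightarrow> a \<in> carrier A \<Longrightarrow> left_can_inv (G.rmul u a) = ract G.AtA (left_can_inv u) a"
  by (simp add: left_can_inv_def G.entwining_rmul G.ract_AC_def G.TB_right)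

lemma left_can_inv_left_coact: "a \<in> carrier A \<Longrightarrow> left_can_inv (G.lcoact a) = G.tB a \<one>\<^bsub>A\<^esub>"
  using G.psi_inv_can[of a "\<one>\<^bsub>A\<^esub>"] G.entwining_psi_inv[of "G.cn (G.tB a \<one>\<^bsub>A\<^esub>)"] G.can_inv_can[of "G.tB a \<one>\<^bsub>A\<^esub>"]
  by (simp add: left_can_inv_def G.rmul_module del: G.can_pure)

text \<open>
  The inverse of the left canonical map of \<open>\<A>'\<close> composed with \<open>gR\<close>, obtained by right \<open>\<A>'\<close>-linearity from
  its values at \<open>c \<otimes> 1\<close>.
\<close>

definition JR where "JR = tensor_lift TR (\<lambda>c a. ract TR (\<kappa>R (left_can_inv (G.pCA c \<one>\<^bsub>A\<^esub>))) a)"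

lemma JR_balanced: "balanced cplx G.vC G'.vA TR (\<lambda>c a. ract TR (\<kappa>R (left_can_inv (G.pCA c \<one>\<^bsub>A\<^esub>))) a)"
proof (rule balancedI)
  fix c k a assume "c \<in> carrier G.vC" "a \<in> carrier G'.vA"
  hence ac: "a \<in> carrier A'" "c \<in> carrier C" by simp_all
  have "G.pCA (k \<odot>\<^bsub>C\<^esub> c) \<one>\<^bsub>A\<^esub> = G.rmul (G.pCA c \<one>\<^bsub>A\<^esub>) (k \<odot>\<^bsub>A\<^esub> \<one>\<^bsub>A\<^esub>)"
    using ac G.CA.pure_balanced[of c k "\<one>\<^bsub>A\<^esub>"] by simp
  hence "\<kappa>R (left_can_inv (G.pCA (k \<odot>\<^bsub>C\<^esub> c) \<one>\<^bsub>A\<^esub>)) = ract TR (\<kappa>R (left_can_inv (G.pCA c \<one>\<^bsub>A\<^esub>))) (f (k \<odot>\<^bsub>A\<^esub> \<one>\<^bsub>A\<^esub>))"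
    using ac by (simp add: left_can_inv_rmul \<kappa>R_ract del: G.rmul_pure)
  thus "ract TR (\<kappa>R (left_can_inv (G.pCA (ract G.vC c k) \<one>\<^bsub>A\<^esub>))) a = ract TR (\<kappa>R (left_can_inv (G.pCA c \<one>\<^bsub>A\<^esub>))) (lact G'.vA k a)"
    using ac by (simp add: TR_right(4)[symmetric] f_smult f_one G'.A.smult_mult_left)
qed (simp_all add: TR_right G.CA.pure_add1[simplified] additive_add[OF left_can_inv_additive] additive_add[OF \<kappa>R(1)])

lemma JR: "JR \<in> additive_maps G'.tCA TR"
  "a \<in> carrier A' \<Longrightarrow> c \<in> carrier C \<Longrightarrow> JR (G'.pCA c a) = ract TR (\<kappa>R (left_can_inv (G.pCA c \<one>\<^bsub>A\<^esub>))) a"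
  unfolding JR_def
  using G'.CA.lift_additive[OF TR.tensor_abelian_group JR_balanced] G'.CA.lift_pure[OF TR.tensor_abelian_group JR_balanced] by simp_all

lemma JR_in [simp]: "t \<in> carrier G'.tCA \<Longrightarrow> JR t \<in> carrier TR"
  using additive_closed[OF JR(1)] .

lemma JR_rmul: "t \<in> carrier G'.tCA \<Longrightarrow> a \<in> carrier A' \<Longrightarrow> JR (G'.rmul t a) = ract TR (JR t) a"
proof (induction rule: G'.CA.induct)
  case (add s t)
  thus ?case by (simp add: G'.rmul_module TR_right additive_add[OF JR(1)])
qed (simp add: JR TR_right)

lemma JR_Cf: "u \<in> carrier G.tCA \<Longrightarrow> JR (Cf u) = \<kappa>R (left_can_inv u)"
proof (induction rule: G.CA.induct)
  case (pure c x)
  have "left_can_inv (G.pCA c x) = ract G.AtA (left_can_inv (G.pCA c \<one>\<^bsub>A\<^esub>)) x"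
    using left_can_inv_rmul[of "G.pCA c \<one>\<^bsub>A\<^esub>" x] pure by simp
  thus ?case using pure by (simp add: JR \<kappa>R_ract)
next
  case (add s t)
  thus ?case by (simp add: additive_add[OF Cf_additive] additive_add[OF JR(1)] additive_add[OF left_can_inv_additive] additive_add[OF \<kappa>R(1)])
qed

definition left_can where "left_can s = G'.psi_inv (G'.cn s)"

lemma left_can_additive: "left_can \<in> additive_maps G'.AtA G'.tCA"
  unfolding left_can_def[abs_def] by (rule additive_comp[OF G'.can_additive G'.psi_inv_additive])

lemma left_can_in [simp]: "s \<in> carrier G'.AtA \<Longrightarrow> left_can s \<in> carrier G'.tCA"
  using additive_closed[OF left_can_additive] .

lemma left_can_pure: "x \<in> carrier A' \<Longrightarrow> y \<in> carrier A' \<Longrightarrow> left_can (G'.tB x y) = G'.rmul (G'.lcoact x) y"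
  unfolding left_can_def by (rule G'.psi_inv_can)

lemma left_can_inj: "s \<in> carrier G'.AtA \<Longrightarrow> s' \<in> carrier G'.AtA \<Longrightarrow> left_can s = left_can s' \<Longrightarrow> s = s'"
  unfolding left_can_def by (metis G'.can_in G'.can_inv_can G'.entwining_psi_inv)

lemma left_can_ract: "s \<in> carrier G'.AtA \<Longrightarrow> a \<in> carrier A' \<Longrightarrow> left_can (ract G'.AtA s a) = G'.rmul (left_can s) a"
proof (induction rule: G'.TB.induct)
  case (add s t)
  thus ?case by (simp add: G'.TB_right additive_add[OF left_can_additive] G'.rmul_module)
qed (simp add: left_can_pure G'.rmul_module)

lemma JR_left_can_gR: "w \<in> carrier TR \<Longrightarrow> JR (left_can (gR w)) = w"
proof (induction rule: TR.induct)
  case (pure n a')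
  hence a': "a' \<in> carrier A'" by simp
  have "JR (left_can (gR (pTR n a'))) = pTR n a'" if "n \<in> carrier NR" for n
    using that
  proof (induction rule: NR.induct)
    case (pure a b)
    hence ba: "b \<in> G'.B" "b \<in> carrier A'" "a \<in> carrier A" by (simp_all add: G'.B_in)
    have "JR (left_can (gR (pTR (pNR a b) a'))) = ract TR (ract TR (JR (Cf (G.lcoact a))) b) a'"
      using a' ba by (simp add: gR \<phi>R left_can_pure G'.left_coact_B JR_rmul left_coact_f G'.rmul_module)
    also have "\<dots> = pTR (pNR a \<one>\<^bsub>A'\<^esub>) (b \<otimes>\<^bsub>A'\<^esub> a')"
      using a' ba by (simp add: JR_Cf left_can_inv_left_coact \<kappa>R TR_ract f_one G'.one_B)
    also have "\<dots> = pTR (pNR a b) a'"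
      using a' ba TR.pure_balanced[of "pNR a \<one>\<^bsub>A'\<^esub>" b a'] by (simp add: NR_ract G'.one_B)
    finally show ?case .
  next
    case (add s t)
    thus ?case using a'
      by (simp add: TR.pure_add1[simplified] additive_add[OF gR(1)] additive_add[OF left_can_additive] additive_add[OF JR(1)])
  qed
  thus ?case using pure by simp
next
  case (add s t)
  thus ?case
    by (simp add: additive_add[OF gR(1)] additive_add[OF left_can_additive] additive_add[OF JR(1)])
qed

lemma gR_ract: "w \<in> carrier TR \<Longrightarrow> a \<in> carrier A' \<Longrightarrow> gR (ract TR w a) = ract G'.AtA (gR w) a"
proof (induction rule: TR.induct)
  case (pure n x)
  thus ?case using additive_closed[OF right_linear_additive[OF \<phi>R(1)]] by (simp add: TR_ract gR)
next
  case (add s t)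
  thus ?case by (simp add: TR_right G'.TB_right additive_add[OF gR(1)])
qed

lemma left_can_gR_\<kappa>R: "u \<in> carrier G.tCA \<Longrightarrow> left_can (gR (\<kappa>R (left_can_inv u))) = Cf u"
proof -
  assume u: "u \<in> carrier G.tCA"
  have "gR (\<kappa>R s) = fB s" if "s \<in> carrier G.AtA" for s
    using that
    by (induction rule: G.TB.induct)
       (simp_all add: \<kappa>R gR \<phi>R G'.one_B additive_add[OF gR(1)] additive_add[OF \<kappa>R(1)] additive_add[OF fB_additive])
  hence "left_can (gR (\<kappa>R (left_can_inv u))) = G'.psi_inv (fC (G.\<psi> u))" using u by (simp add: left_can_def can_fB) (simp add: left_can_inv_def)
  also have "\<dots> = Cf u" using u by (simp add: entwining_Cf[symmetric])
  finally show ?thesis .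
qed

lemma left_can_gR_JR: "t \<in> carrier G'.tCA \<Longrightarrow> left_can (gR (JR t)) = t"
proof (induction rule: G'.CA.induct)
  case (pure c a)
  thus ?case by (simp add: JR gR_ract left_can_ract left_can_gR_\<kappa>R f_one)
next
  case (add s t)
  thus ?case by (simp add: additive_add[OF gR(1)] additive_add[OF JR(1)] additive_add[OF left_can_additive])
qed

lemma gR_bij: "bij_betw gR (carrier TR) (carrier G'.AtA)"
proof (rule bij_betw_byWitness[of _ "\<lambda>z. JR (left_can z)"])
  show "\<forall>w\<in>carrier TR. JR (left_can (gR w)) = w" by (simp add: JR_left_can_gR)
  show "\<forall>z\<in>carrier G'.AtA. gR (JR (left_can z)) = z"
  proof
    fix z assume z: "z \<in> carrier G'.AtA"
    show "gR (JR (left_can z)) = z" by (rule left_can_inj) (use z in \<open>simp_all add: left_can_gR_JR\<close>)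
  qed
qed auto

lemma \<phi>R_bij:
  assumes "faithfully_flat_left TYPE(('a, 'b) tens) G'.BA (regular A')"
  shows "bij_betw \<phi>R (carrier NR) (carrier A')"
proof -
  have "inj (\<lambda>x :: 'b. {frag_of (undefined :: 'a, x)})"
    by (auto simp: inj_def dest!: arg_cong[where f = Poly_Mapping.keys])
  hence "inj_on (\<lambda>x :: 'b. {frag_of (undefined :: 'a, x)}) (carrier (regular A'))" by (rule inj_on_subset) simp
  from flat_left_reflects_bij[OF assms bimodD(2)[OF NR_bimod] bimodD(2)[OF G'.bimod_AB] \<phi>R(1) inj_on_id2 this gR_bij[unfolded gR_def]]
  show ?thesis by simp
qed

end

context galois_cointegral
begin

abbreviation "CS \<equiv> cotensor_square C e A"

lemma CS_sel [simp]:
  "carrier CS = cotens" "\<zero>\<^bsub>CS\<^esub> = \<zero>\<^bsub>AA\<^esub>" "add CS = add AA" "lact CS = lact LR" "ract CS = ract LR"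
  by (simp_all add: cotensor_square_def)

lemma cotens_AA: "t \<in> cotens \<Longrightarrow> t \<in> carrier AA"
  by (simp add: cotens_iff)

text \<open>The cotensor square is stable under \<open>\<B>\<close>, as the image of the \<open>\<B>\<close>-bilinear map \<open>proj\<close>.\<close>

lemma cotens_lact: "t \<in> cotens \<Longrightarrow> b \<in> B \<Longrightarrow> lact LR b t \<in> cotens"
  using proj_in[of "lact LR b t"] by (simp add: proj_lact cotens_AA proj_id LR_left(1) B_in)

lemma cotens_ract: "t \<in> cotens \<Longrightarrow> b \<in> B \<Longrightarrow> ract LR t b \<in> cotens"
  using proj_in[of "ract LR t b"] by (simp add: proj_ract cotens_AA proj_id LR_right(1) B_in)

lemma CS_abelian: "abelian_group CS"
proof -
  interpret G: abelian_group AA by (rule Av.VV_abelian)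
  interpret H: abelian_group TACA by (rule ACA_abelian)
  show ?thesis
  proof (rule abelian_groupI)
    fix x assume "x \<in> carrier CS"
    hence x: "x \<in> carrier AA" "cotensor_l x = cotensor_r x" by (simp_all add: cotens_iff)
    have "\<ominus>\<^bsub>AA\<^esub> x \<in> cotens"
      using x additive_minus[OF cotensor_l(1) Av.VV_abelian ACA_abelian x(1)] additive_minus[OF cotensor_r(1) Av.VV_abelian ACA_abelian x(1)]
      by (simp add: cotens_iff)
    thus "\<exists>y\<in>carrier CS. y \<oplus>\<^bsub>CS\<^esub> x = \<zero>\<^bsub>CS\<^esub>" using x by (intro bexI[of _ "\<ominus>\<^bsub>AA\<^esub> x"]) (simp_all add: G.l_neg)
  qed (simp_all add: cotens_iff additive_add[OF cotensor_l(1)] additive_add[OF cotensor_r(1)] G.a_ac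
        additive_zero[OF cotensor_l(1) Av.VV_abelian ACA_abelian] additive_zero[OF cotensor_r(1) Av.VV_abelian ACA_abelian])
qed

lemma CS_bimod: "bimod BA BA CS"
  unfolding bimod_def left_module_def right_module_def
  using ring_B CS_abelian
  by (simp add: cotens_lact cotens_ract cotens_AA B_in LR_left LR_right LR_comm)

text \<open>The tensor product \<open>\<A> \<otimes> \<A>\<close> is over the complex numbers, so the two outer actions of a scalar agree.\<close>

lemma LR_scalar: "t \<in> carrier AA \<Longrightarrow> lact LR (k \<odot>\<^bsub>A\<^esub> \<one>\<^bsub>A\<^esub>) t = ract LR t (k \<odot>\<^bsub>A\<^esub> \<one>\<^bsub>A\<^esub>)"
proof (induction rule: Av.VV.induct)
  case (pure x y)
  thus ?case using Av.VV.pure_balanced[of x k y] by (simp add: A.smult_mult_left A.smult_mult_right)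
next
  case (add s t)
  thus ?case by (simp add: LR_left LR_right)
qed

end

context galois_morphism
begin

section \<open>The isomorphism\<close>

abbreviation "BCL \<equiv> base_change_left C e A A' f"
abbreviation "BC \<equiv> base_change C e A A' f"
abbreviation "pBCL \<equiv> pure_tensor G.BA BR G.CS"
abbreviation "pBC \<equiv> pure_tensor G.BA BCL BL"

sublocale BCL: tensor_product G.BA BR G.CS
  using bimodD(2)[OF bimod_BR] bimodD(1)[OF G.CS_bimod] by (rule tensor_productI)

lemma BCL_bimod: "bimod G'.BA G.BA BCL"
  unfolding base_change_left_def by (rule BCL.bimod_tensor[OF bimod_BR G.CS_bimod])

sublocale BC: tensor_product G.BA BCL BL
  using bimodD(2)[OF BCL_bimod] bimodD(1)[OF bimod_BL] by (rule tensor_productI)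

lemmas BCL_facts = BCL.pure_in BCL.pure_add1 BCL.pure_add2 BCL.pure_balanced
  BCL.lact_tensor(2)[OF bimod_BR] BCL.ract_tensor(2)[OF G.CS_bimod]
lemmas BCL_simps = BCL_facts[folded base_change_left_def, simplified]
lemmas BC_facts = BC.pure_in BC.pure_add1 BC.pure_add2 BC.pure_balanced
  BC.lact_tensor(2)[OF BCL_bimod] BC.ract_tensor(2)[OF bimod_BL]
lemmas BC_simps = BC_facts[folded base_change_def, simplified]
lemmas BCL_induct = BCL.induct[folded base_change_left_def, simplified, consumes 1, case_names pure add]
lemmas BC_induct = BC.induct[folded base_change_def, simplified, consumes 1, case_names pure add]

lemma BC_abelian: "abelian_group BC"
  using BC.tensor_abelian_group by (simp add: base_change_def)

text \<open>The isomorphism \<open>(x \<otimes> t) \<otimes> y \<mapsto> x (f \<otimes> f)(t) y\<close> is built in two steps along the iterated tensor product.\<close>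

definition h1 where "h1 = tensor_lift G'.CS (\<lambda>x t. lact G'.LR x (ff t))"

lemma ff_cotens_AA: "t \<in> G.cotens \<Longrightarrow> ff t \<in> carrier G'.AA"
  by (rule ff_in[OF G.cotens_AA])

lemma h1_balanced: "balanced G.BA BR G.CS G'.CS (\<lambda>x t. lact G'.LR x (ff t))"
  by (rule balancedI)
     (simp_all add: G'.cotens_lact ff_cotens G'.LR_left G'.B_in ff_cotens_AA G.cotens_AA additive_add[OF ff_additive] f_B ff_lact G.B_in)

lemma h1: "h1 \<in> additive_maps BCL G'.CS"
  "x \<in> G'.B \<Longrightarrow> t \<in> G.cotens \<Longrightarrow> h1 (pBCL x t) = lact G'.LR x (ff t)"
  unfolding h1_def base_change_left_def
  using BCL.lift_additive[OF G'.CS_abelian h1_balanced] BCL.lift_pure[OF G'.CS_abelian h1_balanced] by simp_all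

lemma h1_in: "w \<in> carrier BCL \<Longrightarrow> h1 w \<in> G'.cotens"
  using additive_closed[OF h1(1)] by simp

lemma h1_in_AA: "w \<in> carrier BCL \<Longrightarrow> h1 w \<in> carrier G'.AA"
  by (rule G'.cotens_AA[OF h1_in])

lemma h1_add: "w \<in> carrier BCL \<Longrightarrow> w' \<in> carrier BCL \<Longrightarrow> h1 (w \<oplus>\<^bsub>BCL\<^esub> w') = h1 w \<oplus>\<^bsub>G'.AA\<^esub> h1 w'"
  using additive_add[OF h1(1)] by simp

lemmas BCL_left = left_moduleD(3-7)[OF bimodD(1)[OF BCL_bimod], simplified]
lemmas BCL_right = right_moduleD(3-7)[OF bimodD(2)[OF BCL_bimod], simplified]

lemma h1_lact: "w \<in> carrier BCL \<Longrightarrow> b \<in> G'.B \<Longrightarrow> h1 (lact BCL b w) = lact G'.LR b (h1 w)"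
proof (induction rule: BCL_induct)
  case (pure x t)
  thus ?case by (simp add: BCL_simps h1 G'.mult_B G'.LR_left G'.B_in ff_cotens_AA)
next
  case (add s t)
  thus ?case by (simp add: BCL_left h1_add G'.LR_left G'.B_in h1_in_AA)
qed

lemma h1_ract: "w \<in> carrier BCL \<Longrightarrow> b \<in> G.B \<Longrightarrow> h1 (ract BCL w b) = ract G'.LR (h1 w) (f b)"
proof (induction rule: BCL_induct)
  case (pure x t)
  thus ?case by (simp add: BCL_simps h1 G.cotens_ract ff_ract G.cotens_AA G.B_in G'.LR_comm G'.B_in ff_cotens_AA)
next
  case (add s t)
  thus ?case by (simp add: BCL_right h1_add G'.LR_right G.B_in h1_in_AA)
qed

definition h where "h = tensor_lift G'.CS (\<lambda>w y. ract G'.LR (h1 w) y)"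

lemma h_balanced: "balanced G.BA BCL BL G'.CS (\<lambda>w y. ract G'.LR (h1 w) y)"
  by (rule balancedI) (simp_all add: G'.cotens_ract h1_in h1_add G'.LR_right h1_in_AA G'.B_in h1_ract)

lemma h: "h \<in> additive_maps BC G'.CS"
  "w \<in> carrier BCL \<Longrightarrow> y \<in> G'.B \<Longrightarrow> h (pBC w y) = ract G'.LR (h1 w) y"
  unfolding h_def base_change_def
  using BC.lift_additive[OF G'.CS_abelian h_balanced] BC.lift_pure[OF G'.CS_abelian h_balanced] by simp_all

lemma h_left_linear: "h \<in> left_linear G'.BA BC G'.CS"
  unfolding h_def base_change_def
  by (rule BC.lift_left_linear[OF BCL_bimod bimodD(1)[OF G'.CS_bimod] h_balanced])
     (simp add: h1_lact G'.LR_comm G'.B_in h1_in_AA)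

lemma h_right_linear: "h \<in> right_linear G'.BA BC G'.CS"
  unfolding h_def base_change_def
  by (rule BC.lift_right_linear[OF bimod_BL bimodD(2)[OF G'.CS_bimod] h_balanced])
     (simp add: G'.LR_right G'.B_in h1_in_AA)

text \<open>
  The map \<open>(b \<otimes> a, a' \<otimes> b') \<mapsto> b \<otimes> proj(a \<otimes> a') \<otimes> b'\<close> on pairs from \<open>\<B>' \<otimes>\<^sub>\<B> \<A>\<close> and \<open>\<A> \<otimes>\<^sub>\<B> \<B>'\<close>.  It is balanced over \<open>\<B>\<close>
  because \<open>proj\<close> is \<open>\<B>\<close>-bilinear.
\<close>

definition glue where
  "glue = bilift BC (\<lambda>b a a' b'. pBC (pBCL b (G.proj (G.pAA a a'))) b')"

lemma proj_cotens [simp]: "a \<in> carrier A \<Longrightarrow> a' \<in> carrier A \<Longrightarrow> G.proj (G.pAA a a') \<in> G.cotens"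
  by (rule G.proj_in) simp

lemma proj_pure_B:
  "a \<in> carrier A \<Longrightarrow> a' \<in> carrier A \<Longrightarrow> b \<in> G.B \<Longrightarrow> G.proj (G.pAA (b \<otimes>\<^bsub>A\<^esub> a) a') = lact G.LR b (G.proj (G.pAA a a'))"
  "a \<in> carrier A \<Longrightarrow> a' \<in> carrier A \<Longrightarrow> b \<in> G.B \<Longrightarrow> G.proj (G.pAA a (a' \<otimes>\<^bsub>A\<^esub> b)) = ract G.LR (G.proj (G.pAA a a')) b"
  using G.proj_lact[of "G.pAA a a'" b] G.proj_ract[of "G.pAA a a'" b] by (simp_all add: G.B_in)

lemma glue_balanced:
  "a' \<in> carrier A \<Longrightarrow> b' \<in> G'.B \<Longrightarrow> balanced G.BA BR (regular A) BC (\<lambda>b a. pBC (pBCL b (G.proj (G.pAA a a'))) b')"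
  "b \<in> G'.B \<Longrightarrow> a \<in> carrier A \<Longrightarrow> balanced G.BA (regular A) BL BC (\<lambda>a' b'. pBC (pBCL b (G.proj (G.pAA a a'))) b')"
  by (intro balancedI; simp add: BC_simps BCL_simps G.Av.VV.pure_add1[simplified] G.Av.VV.pure_add2[simplified]
      additive_add[OF G.proj_additive] proj_pure_B)+
     (simp add: BC_simps(4)[symmetric] BCL_simps)

lemma glue: "v \<in> carrier NR \<Longrightarrow> (\<lambda>u. glue u v) \<in> additive_maps NL BC"
  "u \<in> carrier NL \<Longrightarrow> glue u \<in> additive_maps NR BC"
  "b \<in> G'.B \<Longrightarrow> a \<in> carrier A \<Longrightarrow> a' \<in> carrier A \<Longrightarrow> b' \<in> G'.B \<Longrightarrow>
     glue (pNL b a) (pNR a' b') = pBC (pBCL b (G.proj (G.pAA a a'))) b'"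
  unfolding glue_def
  using bilift[OF NL.tensor_product_axioms NR.tensor_product_axioms BC_abelian, of "\<lambda>b a a' b'. pBC (pBCL b (G.proj (G.pAA a a'))) b'"]
    glue_balanced by simp_all

lemma glue_in: "u \<in> carrier NL \<Longrightarrow> v \<in> carrier NR \<Longrightarrow> glue u v \<in> carrier BC"
  using additive_closed[OF glue(2)] .

lemma glue_eqI:
  assumes g: "\<And>v. v \<in> carrier NR \<Longrightarrow> (\<lambda>u. g1 u v) \<in> additive_maps NL H" "\<And>u. u \<in> carrier NL \<Longrightarrow> g1 u \<in> additive_maps NR H"
    "\<And>v. v \<in> carrier NR \<Longrightarrow> (\<lambda>u. g2 u v) \<in> additive_maps NL H" "\<And>u. u \<in> carrier NL \<Longrightarrow> g2 u \<in> additive_maps NR H"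
    and p: "\<And>b a a' b'. b \<in> G'.B \<Longrightarrow> a \<in> carrier A \<Longrightarrow> a' \<in> carrier A \<Longrightarrow> b' \<in> G'.B \<Longrightarrow>
      g1 (pNL b a) (pNR a' b') = g2 (pNL b a) (pNR a' b')"
    and u: "u \<in> carrier NL" and v: "v \<in> carrier NR"
  shows "g1 u v = g2 u v"
proof (rule NL.additive_eqI[OF g(1)[OF v] g(3)[OF v] _ u])
  fix b a assume "b \<in> carrier BR" "a \<in> carrier (regular A)"
  thus "g1 (pNL b a) v = g2 (pNL b a) v"
    by (intro NR.additive_eqI[OF g(2) g(4) _ v]) (simp_all add: p)
qed

lemmas NL_left = left_moduleD(3-7)[OF bimodD(1)[OF NL_bimod], simplified]
lemmas NR_right = right_moduleD(3-7)[OF bimodD(2)[OF NR_bimod], simplified]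

text \<open>
  Scalars pass through the middle, via \<open>\<B>\<close> on both sides of the cotensor square.  With this, \<open>glue\<close> is
  defined on the tensor product over the complex numbers.
\<close>

lemma glue_scalar:
  assumes u: "u \<in> carrier NL" and v: "v \<in> carrier NR"
  shows "glue (lact NL (k \<odot>\<^bsub>A'\<^esub> \<one>\<^bsub>A'\<^esub>) u) v = glue u (ract NR v (k \<odot>\<^bsub>A'\<^esub> \<one>\<^bsub>A'\<^esub>))"
proof (rule glue_eqI[of "\<lambda>u v. glue (lact NL (k \<odot>\<^bsub>A'\<^esub> \<one>\<^bsub>A'\<^esub>) u) v" BC "\<lambda>u v. glue u (ract NR v (k \<odot>\<^bsub>A'\<^esub> \<one>\<^bsub>A'\<^esub>))"])
  note k = G'.scalar_B[of k]
  show "(\<lambda>u. glue (lact NL (k \<odot>\<^bsub>A'\<^esub> \<one>\<^bsub>A'\<^esub>) u) v) \<in> additive_maps NL BC" if "v \<in> carrier NR" for v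
    by (rule additive_comp[OF NL_lact(1)[OF k] glue(1)[OF that]])
  show "glue (lact NL (k \<odot>\<^bsub>A'\<^esub> \<one>\<^bsub>A'\<^esub>) u) \<in> additive_maps NR BC" if "u \<in> carrier NL" for u
    by (rule glue(2)[OF NL_left(1)[OF k that]])
  show "(\<lambda>u. glue u (ract NR v (k \<odot>\<^bsub>A'\<^esub> \<one>\<^bsub>A'\<^esub>))) \<in> additive_maps NL BC" if "v \<in> carrier NR" for v
    by (rule glue(1)[OF NR_right(1)[OF k that]])
  show "(\<lambda>v. glue u (ract NR v (k \<odot>\<^bsub>A'\<^esub> \<one>\<^bsub>A'\<^esub>))) \<in> additive_maps NR BC" if "u \<in> carrier NL" for u
    by (rule additive_comp[OF NR_ract(1)[OF k] glue(2)[OF that]])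
  fix b a a' b' assume b: "b \<in> G'.B" and a: "a \<in> carrier A" "a' \<in> carrier A" and b': "b' \<in> G'.B"
  let ?t = "G.proj (G.pAA a a')" and ?k = "k \<odot>\<^bsub>A\<^esub> \<one>\<^bsub>A\<^esub>" and ?k' = "k \<odot>\<^bsub>A'\<^esub> \<one>\<^bsub>A'\<^esub>"
  have fk: "f ?k = ?k'" by (simp add: f_smult f_one)
  have t: "?t \<in> G.cotens" using a by simp
  have "pBCL (?k' \<otimes>\<^bsub>A'\<^esub> b) ?t = pBCL (b \<otimes>\<^bsub>A'\<^esub> f ?k) ?t"
    using b G'.B_in[OF b] by (simp add: fk G'.A.smult_mult_left G'.A.smult_mult_right)
  also have "\<dots> = pBCL b (lact G.LR ?k ?t)" using b t G.scalar_B by (simp add: BCL_simps(4))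
  also have "lact G.LR ?k ?t = ract G.LR ?t ?k" using t by (intro G.LR_scalar G.cotens_AA)
  also have "pBCL b (ract G.LR ?t ?k) = ract BCL (pBCL b ?t) ?k" using b t G.scalar_B by (simp add: BCL_simps)
  finally have 1: "pBCL (?k' \<otimes>\<^bsub>A'\<^esub> b) ?t = ract BCL (pBCL b ?t) ?k" .
  have "pBC (ract BCL (pBCL b ?t) ?k) b' = pBC (pBCL b ?t) (f ?k \<otimes>\<^bsub>A'\<^esub> b')"
    using b b' t G.scalar_B by (simp add: BC_simps(4) BCL_simps(1))
  also have "f ?k \<otimes>\<^bsub>A'\<^esub> b' = b' \<otimes>\<^bsub>A'\<^esub> ?k'"
    using G'.B_in[OF b'] by (simp add: fk G'.A.smult_mult_left G'.A.smult_mult_right)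
  finally show "glue (lact NL ?k' (pNL b a)) (pNR a' b') = glue (pNL b a) (ract NR (pNR a' b') ?k')"
    using 1 a b b' k by (simp add: NL_lact NR_ract glue G'.mult_B)
qed (fact u v)+

text \<open>Both sides are \<open>b (f \<otimes> f)(proj(a \<otimes> a')) b'\<close> on generators, by naturality and \<open>\<B>'\<close>-bilinearity of \<open>proj\<close>.\<close>

lemma h_glue:
  assumes u: "u \<in> carrier NL" and v: "v \<in> carrier NR"
  shows "h (glue u v) = G'.proj (G'.pAA (\<phi>L u) (\<phi>R v))"
proof (rule glue_eqI[of "\<lambda>u v. h (glue u v)" G'.AA "\<lambda>u v. G'.proj (G'.pAA (\<phi>L u) (\<phi>R v))"])
  have hA: "h \<in> additive_maps BC G'.AA"
    using additive_closed[OF h(1)] additive_add[OF h(1)] G'.cotens_AA by (intro additive_mapsI) simp_all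
  note l = left_linear_additive[OF \<phi>L(1)] right_linear_additive[OF \<phi>R(1)]
  note lc = additive_closed[OF l(1)] additive_closed[OF l(2)]
  show "(\<lambda>u. h (glue u v)) \<in> additive_maps NL G'.AA" if "v \<in> carrier NR" for v
    by (rule additive_comp[OF glue(1)[OF that] hA])
  show "(\<lambda>v. h (glue u v)) \<in> additive_maps NR G'.AA" if "u \<in> carrier NL" for u
    by (rule additive_comp[OF glue(2)[OF that] hA])
  show "(\<lambda>u. G'.proj (G'.pAA (\<phi>L u) (\<phi>R v))) \<in> additive_maps NL G'.AA" if "v \<in> carrier NR" for v
    using that lc by (intro additive_comp[OF _ G'.proj_additive] additive_mapsI)
      (simp_all add: additive_add[OF l(1)] G'.Av.VV.pure_add1[simplified])
  show "(\<lambda>v. G'.proj (G'.pAA (\<phi>L u) (\<phi>R v))) \<in> additive_maps NR G'.AA" if "u \<in> carrier NL" for u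
    using that lc by (intro additive_comp[OF _ G'.proj_additive] additive_mapsI)
      (simp_all add: additive_add[OF l(2)] G'.Av.VV.pure_add2[simplified])
  fix b a a' b' assume b: "b \<in> G'.B" and a: "a \<in> carrier A" "a' \<in> carrier A" and b': "b' \<in> G'.B"
  have "G'.proj (G'.pAA (b \<otimes>\<^bsub>A'\<^esub> f a) (f a' \<otimes>\<^bsub>A'\<^esub> b')) = ract G'.LR (lact G'.LR b (G'.proj (ff (G.pAA a a')))) b'"
    using a b b' G'.proj_lact[of "ff (G.pAA a a')" b] G'.proj_ract[of "lact G'.LR b (ff (G.pAA a a'))" b']
    by (simp add: G'.B_in)
  also have "\<dots> = h (pBC (pBCL b (G.proj (G.pAA a a'))) b')"
    using a b b' by (simp add: proj_ff h h1 BCL_simps del: ff_pure)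
  finally show "h (glue (pNL b a) (pNR a' b')) = G'.proj (G'.pAA (\<phi>L (pNL b a)) (\<phi>R (pNR a' b')))"
    using a b b' by (simp add: glue \<phi>L \<phi>R)
qed (fact u v)+

context
  assumes bL: "bij_betw \<phi>L (carrier NL) (carrier A')" and bR: "bij_betw \<phi>R (carrier NR) (carrier A')"
begin

definition iL where "iL = inv_into (carrier NL) \<phi>L"
definition iR where "iR = inv_into (carrier NR) \<phi>R"

lemma iL: "iL \<in> additive_maps A' NL" "x \<in> carrier A' \<Longrightarrow> \<phi>L (iL x) = x" "u \<in> carrier NL \<Longrightarrow> iL (\<phi>L u) = u"
proof -
  have "inv_into (carrier NL) \<phi>L \<in> additive_maps (regular A') NL"
    using bL by (intro inv_into_additive[OF left_linear_additive[OF \<phi>L(1)] _ NL.tensor_abelian_group]) simp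
  thus "iL \<in> additive_maps A' NL"
    unfolding iL_def using additive_maps_cong[of "regular A'" A' NL NL] by simp
qed (use bij_betw_inv_into_right[OF bL] bij_betw_inv_into_left[OF bL] in \<open>simp_all add: iL_def\<close>)

lemma iR: "iR \<in> additive_maps A' NR" "x \<in> carrier A' \<Longrightarrow> \<phi>R (iR x) = x" "u \<in> carrier NR \<Longrightarrow> iR (\<phi>R u) = u"
proof -
  have "inv_into (carrier NR) \<phi>R \<in> additive_maps (regular A') NR"
    using bR by (intro inv_into_additive[OF right_linear_additive[OF \<phi>R(1)] _ NR.tensor_abelian_group]) simp
  thus "iR \<in> additive_maps A' NR"
    unfolding iR_def using additive_maps_cong[of "regular A'" A' NR NR] by simp
qed (use bij_betw_inv_into_right[OF bR] bij_betw_inv_into_left[OF bR] in \<open>simp_all add: iR_def\<close>)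

lemmas iL_in = additive_closed[OF iL(1)] and iR_in = additive_closed[OF iR(1)]

lemma iL_scalar: "x \<in> carrier A' \<Longrightarrow> iL (k \<odot>\<^bsub>A'\<^esub> x) = lact NL (k \<odot>\<^bsub>A'\<^esub> \<one>\<^bsub>A'\<^esub>) (iL x)"
  using left_linear_act[OF \<phi>L(1), of "k \<odot>\<^bsub>A'\<^esub> \<one>\<^bsub>A'\<^esub>" "iL x"] iL(3)[of "lact NL (k \<odot>\<^bsub>A'\<^esub> \<one>\<^bsub>A'\<^esub>) (iL x)"]
  by (simp add: G'.scalar_B iL_in iL(2) NL_left(1) G'.A.smult_mult_left)

lemma iR_scalar: "x \<in> carrier A' \<Longrightarrow> iR (k \<odot>\<^bsub>A'\<^esub> x) = ract NR (iR x) (k \<odot>\<^bsub>A'\<^esub> \<one>\<^bsub>A'\<^esub>)"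
  using right_linear_act[OF \<phi>R(1), of "k \<odot>\<^bsub>A'\<^esub> \<one>\<^bsub>A'\<^esub>" "iR x"] iR(3)[of "ract NR (iR x) (k \<odot>\<^bsub>A'\<^esub> \<one>\<^bsub>A'\<^esub>)"]
  by (simp add: G'.scalar_B iR_in iR(2) NR_right(1) G'.A.smult_mult_right)

text \<open>
  A left inverse of \<open>h\<close>, defined on all of \<open>\<A>' \<otimes> \<A>'\<close>: write the two factors as sums of elements \<open>b f(a)\<close> and \<open>f(a') b'\<close>, then
  apply \<open>glue\<close>.
\<close>

definition hinv where "hinv = tensor_lift BC (\<lambda>x y. glue (iL x) (iR y))"

lemma hinv_balanced: "balanced cplx G'.vA G'.vA BC (\<lambda>x y. glue (iL x) (iR y))"
  by (rule balancedI)
     (simp_all add: glue_in iL_in iR_in additive_add[OF iL(1)] additive_add[OF iR(1)] additive_add[OF glue(1)] additive_add[OF glue(2)]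
       iL_scalar iR_scalar glue_scalar)

lemma hinv: "hinv \<in> additive_maps G'.AA BC"
  "x \<in> carrier A' \<Longrightarrow> y \<in> carrier A' \<Longrightarrow> hinv (G'.pAA x y) = glue (iL x) (iR y)"
  unfolding hinv_def
  using G'.Av.VV.lift_additive[OF BC_abelian hinv_balanced] G'.Av.VV.lift_pure[OF BC_abelian hinv_balanced] by simp_all

lemma h_hinv: "t \<in> carrier G'.AA \<Longrightarrow> h (hinv t) = G'.proj t"
proof (induction rule: G'.Av.VV.induct)
  case (pure x y)
  thus ?case by (simp add: hinv h_glue iL iR iL_in iR_in)
next
  case (add s t)
  thus ?case using additive_closed[OF hinv(1)] additive_add[OF h(1)]
    by (simp add: additive_add[OF hinv(1)] additive_add[OF G'.proj_additive])
qed

lemma hinv_act: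
  assumes "t \<in> carrier G.AA" "b \<in> G'.B" "b' \<in> G'.B"
  shows "hinv (ract G'.LR (lact G'.LR b (ff t)) b') = pBC (pBCL b (G.proj t)) b'"
  using assms
proof (induction rule: G.Av.VV.induct)
  case (pure a a')
  have "iL (b \<otimes>\<^bsub>A'\<^esub> f a) = pNL b a" "iR (f a' \<otimes>\<^bsub>A'\<^esub> b') = pNR a' b'"
    using pure iL(3)[of "pNL b a"] iR(3)[of "pNR a' b'"] by (simp_all add: \<phi>L \<phi>R)
  thus ?case using pure by (simp add: G'.B_in hinv glue)
next
  case (add s t)
  thus ?case using additive_closed[OF G.proj_additive] G.proj_in
    by (simp add: additive_add[OF ff_additive] ff_in G'.LR_left G'.LR_right G'.B_in additive_add[OF hinv(1)]
        additive_add[OF G.proj_additive] BCL_simps BC_simps)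
qed

text \<open>On generators this is \<open>hinv_act\<close> together with the fact that \<open>proj\<close> fixes the cotensor square.\<close>

lemma hinv_h: "w \<in> carrier BC \<Longrightarrow> hinv (h w) = w"
proof (induction rule: BC_induct)
  case (pure w y)
  hence y: "y \<in> G'.B" by simp
  have "hinv (h (pBC w y)) = pBC w y" if "w \<in> carrier BCL" for w
    using that
  proof (induction rule: BCL_induct)
    case (pure x t)
    thus ?case using y hinv_act[of t x y] by (simp add: h h1 BCL_simps G.cotens_AA G.proj_id)
  next
    case (add s t)
    thus ?case using y additive_closed[OF h(1)] G'.cotens_AA
      by (simp add: BC_simps additive_add[OF h(1), simplified] additive_add[OF hinv(1)])
  qed
  thus ?case using pure by simp
next
  case (add s t)
  thus ?case using additive_closed[OF h(1)] G'.cotens_AA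
    by (simp add: additive_add[OF h(1), simplified] additive_add[OF hinv(1)])
qed

text \<open>Since \<open>h \<circ> hinv\<close> is the projection, \<open>hinv\<close> is inverse to \<open>h\<close> on the cotensor square.\<close>

lemma h_iso: "h \<in> bimodule_iso G'.BA G'.BA BC G'.CS"
proof -
  have "bij_betw h (carrier BC) G'.cotens"
  proof (rule bij_betw_byWitness[of _ hinv])
    show "\<forall>w\<in>carrier BC. hinv (h w) = w" by (simp add: hinv_h)
    show "\<forall>t\<in>G'.cotens. h (hinv t) = t" by (simp add: h_hinv G'.cotens_AA G'.proj_id)
    show "h ` carrier BC \<subseteq> G'.cotens" using additive_closed[OF h(1)] by auto
    show "hinv ` G'.cotens \<subseteq> carrier BC" using additive_closed[OF hinv(1)] G'.cotens_AA by auto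
  qed
  thus ?thesis using h_left_linear h_right_linear by (simp add: bimodule_iso_def)
qed

lemma h_pure: "x \<in> G'.B \<Longrightarrow> t \<in> G.cotens \<Longrightarrow> y \<in> G'.B \<Longrightarrow>
    h (base_change_pure C e A A' f x t y) = lact G'.LR x (ract G'.LR (ff t) y)"
  by (simp add: base_change_pure_def h h1 BCL_simps G'.LR_comm G'.B_in ff_cotens_AA)

end
end

theorem theorem1p5:
  fixes C :: "'c coalgebra" and e :: 'c
    and A :: "('a, 'c) comodule" and A' :: "('b, 'c) comodule"
    and f :: "'a \<Rightarrow> 'b"
  assumes "is_coalgebra C" and "group_like C e"
    and "coaugmented_Galois_extension C e A" and "bijective_entwining C A"
    and "coaugmented_Galois_extension C e A'" and "bijective_entwining C A'"
    and "faithfully_flat_left TYPE(('a, 'b) tens) (coinv_algebra C A') (regular A')"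
    and "faithfully_flat_right TYPE(('b, 'a) tens) (coinv_algebra C A') (regular A')"
    and "cosemisimple C"
    and "f \<in> algebra_hom A A'" and "colinear C A A' f"
  shows "f \<in> algebra_hom (coinv_algebra C A) (coinv_algebra C A') \<and>
    (\<exists>h \<in> bimodule_iso (coinv_algebra C A') (coinv_algebra C A')
            (base_change C e A A' f) (cotensor_square C e A').
       \<forall>x \<in> coinvariants C A'. \<forall>t \<in> carrier (cotensor_square C e A). \<forall>y \<in> coinvariants C A'.
         h (base_change_pure C e A A' f x t y) =
           lact (cotensor_square C e A') x
             (ract (cotensor_square C e A') (tensor_map cplx (vect A') (vect A') f f t) y))"
proof -
  interpret complex_coalgebra C by (rule complex_coalgebra.intro) fact
  obtain \<gamma> where \<gamma>: "cointegral \<gamma>" using cointegral_exists[OF assms(9)] by auto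
  interpret galois_morphism C e A A' \<gamma> f
    by unfold_locales (use assms \<gamma> in auto)
  have b: "bij_betw \<phi>L (carrier NL) (carrier A')" "bij_betw \<phi>R (carrier NR) (carrier A')"
    by (rule \<phi>L_bij[OF assms(8)], rule \<phi>R_bij[OF assms(7)])
  show ?thesis
    using f_restrict h_iso[OF b] h_pure[OF b] by (intro conjI bexI[of _ h]) simp_all
qed

end
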